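(* Let $s>0$, let $1\le p\le\infty$, and let $u=u(v,z,\rho)$ be any solution on $N\times(0,\infty)$ of the equation $$\Big(-\mathcal{L}+\partial_\rho^2+\frac{1-2s}{\rho}\partial_\rho+\frac14\rho^2\Delta_z\Big)u(v,z,\rho)=0 .$$ Then $u$ satisfies the uniform estimates $$\int_N|u(v,z,\rho)|^p\,dv\,dz\le C,\qquad \rho>0,$$ with $C$ independent of $\rho$ (for $p=\infty$: $\|u(\cdot,\cdot,\rho)\|_{L^\infty(N)}\le C$ for all $\rho>0$), if and only if: - in the case $1<p\le\infty$: $u(\cdot,\rho)=c\,\rho^{2s}f\ast\varphi_{s,\rho}$ for some $f\in L^p(N)$; - in the case $p=1$: $u(\cdot,\rho)=c\,\rho^{2s}\mu\ast\varphi_{s,\rho}$ for some complex Borel measure $\mu$ on $N$. Here $c$ is a constant. Moreover, there is a constant $c'$ such that, when $1<p<\infty$, $u(\cdot,\rho)\to c'f$ in $L^p(N)$ as $\rho\to0$, and, when $p=1$, $u(\cdot,\rho)\to c'\mu$ weakly as $\rho\to0$.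
   Context: $N$ is an $H$-type group: a simply connected step two nilpotent Lie group whose Lie algebra $\mathfrak n=\mathfrak v\oplus\mathfrak z$ (orthogonal direct sum of Euclidean spaces, $\dim\mathfrak v=2n$, $\dim\mathfrak z=m$) has $\mathfrak z$ central, $[\mathfrak v,\mathfrak v]\subset\mathfrak z$, and for every unit vector $v\in\mathfrak v$ the map $\mathrm{ad}(v)$ is a surjective isometry from the orthogonal complement (in $\mathfrak v$) of $\ker \mathrm{ad}(v)$ onto $\mathfrak z$. Elements of $N$ are written $(v,z)$, with product $(v,z)(v',z')=(v+v',z+z'+\frac12[v,v'])$ and Haar measure $dv\,dz$ (Lebesgue measure). $X_1,\dots,X_{2n}$ and $Z_1,\dots,Z_m$ are the left-invariant vector fields corresponding to orthonormal bases of $\mathfrak v$ and $\mathfrak z$. The sublaplacian is $\mathcal L=-\sum_{j=1}^{2n}X_j^2$ and $\Delta_z=\sum_{k=1}^mZ_k^2$. Convolution: $f\ast g(x)=\int_Nf(xy^{-1})g(y)\,dy$. The kernel is $$\varphi_{s,\rho}(v,z)=\big((\rho^2+|v|^2)^2+16|z|^2\big)^{-\frac{n+m+s}{2}}.$$ *)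

theory Defs
  imports "HOL-Analysis.Analysis"
begin

section \<open>H-type groups\<close>

text \<open>
  The Lie algebra is the orthogonal direct sum \<open>'v \<times> 'z\<close> of two Euclidean spaces. As \<open>'z\<close> is
  central and brackets take values in \<open>'z\<close>, the Lie bracket is determined by its restriction
  \<open>'v \<Rightarrow> 'v \<Rightarrow> 'z\<close> (the Jacobi identity is then automatic). For \<open>v\<close> in the first summand,
  the complement in \<open>'v\<close> of the kernel of \<open>ad v\<close> on the whole Lie algebra is the complement of the
  kernel of \<open>bracket v\<close>.
\<close>

definition H_type :: "('v::euclidean_space \<Rightarrow> 'v \<Rightarrow> 'z::euclidean_space) \<Rightarrow> bool" where
  "H_type bracket \<longleftrightarrow>
     bilinear bracket \<and> (\<forall>v. bracket v v = 0) \<and>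
     (\<forall>v. norm v = 1 \<longrightarrow>
        (let K = orthogonal_comp {w. bracket v w = 0}
         in bracket v ` K = UNIV \<and> (\<forall>w\<in>K. norm (bracket v w) = norm w)))"

definition gmult ::
  "('v::real_vector \<Rightarrow> 'v \<Rightarrow> 'z::real_vector) \<Rightarrow> 'v \<times> 'z \<Rightarrow> 'v \<times> 'z \<Rightarrow> 'v \<times> 'z" where
  "gmult bracket x y =
     (fst x + fst y, snd x + snd y + (1 / 2) *\<^sub>R bracket (fst x) (fst y))"

text \<open>As \<open>bracket v v = 0\<close>, the inverse of \<open>x\<close> is \<open>- x\<close>.\<close>

definition ginv :: "'v::real_vector \<times> 'z::real_vector \<Rightarrow> 'v \<times> 'z" where
  "ginv x = - x"

section \<open>Invariant vector fields and the equation\<close>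

text \<open>In these (exponential) coordinates the one-parameter group generated by \<open>X\<close> is \<open>t *\<^sub>R X\<close>.\<close>

definition left_inv_field ::
  "('v::real_vector \<Rightarrow> 'v \<Rightarrow> 'z::real_vector) \<Rightarrow> 'v \<times> 'z \<Rightarrow>
     ('v \<times> 'z \<Rightarrow> complex) \<Rightarrow> 'v \<times> 'z \<Rightarrow> complex" where
  "left_inv_field bracket X f x =
     vector_derivative (\<lambda>t. f (gmult bracket x (t *\<^sub>R X))) (at 0)"

definition sublaplacian ::
  "('v::euclidean_space \<Rightarrow> 'v \<Rightarrow> 'z::euclidean_space) \<Rightarrow>
     ('v \<times> 'z \<Rightarrow> complex) \<Rightarrow> 'v \<times> 'z \<Rightarrow> complex" where
  "sublaplacian bracket f x =
     - (\<Sum>e\<in>Basis. left_inv_field bracket (e, 0) (left_inv_field bracket (e, 0) f) x)"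

definition Delta_z ::
  "('v::euclidean_space \<Rightarrow> 'v \<Rightarrow> 'z::euclidean_space) \<Rightarrow>
     ('v \<times> 'z \<Rightarrow> complex) \<Rightarrow> 'v \<times> 'z \<Rightarrow> complex" where
  "Delta_z bracket f x =
     (\<Sum>e\<in>Basis. left_inv_field bracket (0, e) (left_inv_field bracket (0, e) f) x)"

definition C2_on :: "'a::real_normed_vector set \<Rightarrow> ('a \<Rightarrow> 'b::real_normed_vector) \<Rightarrow> bool" where
  "C2_on S f \<longleftrightarrow>
     (\<exists>(f' :: 'a \<Rightarrow> 'a \<Rightarrow>\<^sub>L 'b) (f'' :: 'a \<Rightarrow> 'a \<Rightarrow>\<^sub>L 'a \<Rightarrow>\<^sub>L 'b).
        (\<forall>x\<in>S. (f has_derivative blinfun_apply (f' x)) (at x)) \<and>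
        (\<forall>x\<in>S. (f' has_derivative blinfun_apply (f'' x)) (at x)) \<and>
        continuous_on S f'')"

text \<open>
  Classical solutions on \<open>N \<times> (0,\<infinity>)\<close>. For \<open>\<rho> > 0\<close> the operator is elliptic with smooth coefficients,
  so requiring \<open>C\<^sup>2\<close> is equivalent to requiring smoothness. The values of \<open>u\<close> for \<open>\<rho> \<le> 0\<close> are
  irrelevant.
\<close>

definition is_solution ::
  "('v::euclidean_space \<Rightarrow> 'v \<Rightarrow> 'z::euclidean_space) \<Rightarrow> real \<Rightarrow>
     (('v \<times> 'z) \<times> real \<Rightarrow> complex) \<Rightarrow> bool" where
  "is_solution bracket s u \<longleftrightarrow>
     C2_on (UNIV \<times> {0<..}) u \<and>
     (\<forall>x. \<forall>\<rho>>0.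
        - sublaplacian bracket (\<lambda>y. u (y, \<rho>)) x
        + vector_derivative (\<lambda>r. vector_derivative (\<lambda>q. u (x, q)) (at r)) (at \<rho>)
        + ((1 - 2 * s) / \<rho>) *\<^sub>R vector_derivative (\<lambda>r. u (x, r)) (at \<rho>)
        + (1 / 4 * \<rho>\<^sup>2) *\<^sub>R Delta_z bracket (\<lambda>y. u (y, \<rho>)) x = 0)"

definition phi ::
  "nat \<Rightarrow> nat \<Rightarrow> real \<Rightarrow> real \<Rightarrow> 'v::euclidean_space \<times> 'z::euclidean_space \<Rightarrow> complex" where
  "phi n m s \<rho> x =
     complex_of_real
       (((\<rho>\<^sup>2 + (norm (fst x))\<^sup>2)\<^sup>2 + 16 * (norm (snd x))\<^sup>2) powr (- ((n + m + s) / 2)))"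

section \<open>Lebesgue spaces and complex measures\<close>

text \<open>
  For finite \<open>p\<close> the bound is on the integral of \<open>\<bar>f\<bar>\<^sup>p\<close> (no \<open>p\<close>-th root is taken), for \<open>p = \<infinity>\<close> it is on
  the essential supremum. Haar measure is \<open>lborel\<close>.
\<close>

definition Lp_bound :: "ennreal \<Rightarrow> ('a::euclidean_space \<Rightarrow> complex) \<Rightarrow> real \<Rightarrow> bool" where
  "Lp_bound p f C \<longleftrightarrow>
     (if p = \<infinity> then AE x in lborel. norm (f x) \<le> C
      else (\<integral>\<^sup>+x. ennreal (norm (f x) powr enn2real p) \<partial>lborel) \<le> ennreal C)"

definition Lp_space :: "ennreal \<Rightarrow> ('a::euclidean_space \<Rightarrow> complex) set" where
  "Lp_space p = {f \<in> borel_measurable borel. \<exists>C. Lp_bound p f C}"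

definition gconv ::
  "('v::euclidean_space \<Rightarrow> 'v \<Rightarrow> 'z::euclidean_space) \<Rightarrow> ('v \<times> 'z \<Rightarrow> complex) \<Rightarrow>
     ('v \<times> 'z \<Rightarrow> complex) \<Rightarrow> 'v \<times> 'z \<Rightarrow> complex" where
  "gconv bracket f g x = (LINT y|lborel. f (gmult bracket x (ginv y)) * g y)"

definition complex_borel_measure :: "('a::topological_space set \<Rightarrow> complex) \<Rightarrow> bool" where
  "complex_borel_measure \<mu> \<longleftrightarrow>
     (\<forall>A :: nat \<Rightarrow> 'a set. range A \<subseteq> sets borel \<longrightarrow> disjoint_family A \<longrightarrow>
        (\<lambda>i. \<mu> (A i)) sums \<mu> (\<Union>i. A i))"

text \<open>
  Positive part \<open>\<nu>\<^sup>+(A) = sup {\<nu>(B) | B \<subseteq> A}\<close> in the Jordan decomposition of a real measure \<open>\<nu>\<close>; negative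
  values of \<open>\<nu>\<close> are truncated to \<open>0 = \<nu>({})\<close> by \<open>ennreal\<close>. The negative part is the positive part
  of \<open>- \<nu>\<close>.
\<close>

definition positive_part :: "('a::topological_space set \<Rightarrow> real) \<Rightarrow> 'a measure" where
  "positive_part \<nu> =
     measure_of UNIV (sets borel) (\<lambda>A. SUP B\<in>{B \<in> sets borel. B \<subseteq> A}. ennreal (\<nu> B))"

definition cm_integral ::
  "('a::topological_space set \<Rightarrow> complex) \<Rightarrow> ('a \<Rightarrow> complex) \<Rightarrow> complex" where
  "cm_integral \<mu> g =
     (LINT x|positive_part (\<lambda>A. Re (\<mu> A)). g x) - (LINT x|positive_part (\<lambda>A. - Re (\<mu> A)). g x)
     + \<i> * ((LINT x|positive_part (\<lambda>A. Im (\<mu> A)). g x)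
            - (LINT x|positive_part (\<lambda>A. - Im (\<mu> A)). g x))"

text \<open>
  For \<open>\<mu> = f dx\<close> this is \<open>gconv f g\<close>, by the substitution \<open>y \<mapsto> y\<inverse> x\<close>, which preserves Haar measure.
\<close>

definition gconv_measure ::
  "('v::euclidean_space \<Rightarrow> 'v \<Rightarrow> 'z::euclidean_space) \<Rightarrow> (('v \<times> 'z) set \<Rightarrow> complex) \<Rightarrow>
     ('v \<times> 'z \<Rightarrow> complex) \<Rightarrow> 'v \<times> 'z \<Rightarrow> complex" where
  "gconv_measure bracket \<mu> g x = cm_integral \<mu> (\<lambda>y. g (gmult bracket (ginv y) x))"

end

theory Submission
  imports Defs "HOL-Probability.Probability"
begin

text \<open>
  Put \<open>K \<rho> = \<rho>\<^sup>2\<^sup>s \<phi>\<^sub>s\<^sub>,\<^sub>\<rho>\<close>. These functions have constant integral \<open>A\<close>, concentrate at the identity as \<open>\<rho> \<rightarrow> 0\<close>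
  and solve the equation; this gives the estimates and the limits for convolutions.

  Conversely, the equation satisfies a maximum principle, by comparison with a supersolution that tends to
  infinity. If \<open>u\<close> satisfies the estimates, then along some filter \<open>\<rho> \<rightarrow> 0\<close> it converges weakly to a
  function \<open>f\<close> if \<open>p > 1\<close> (uniform integrability) and vaguely to a measure if \<open>p = 1\<close>. For continuous
  \<open>h\<close> with compact support, the left convolution \<open>h \<star> u\<close> is again a solution, and it converges locally
  uniformly to \<open>h \<star> f\<close>. The maximum principle gives \<open>A (h \<star> u) = (h \<star> f) \<star> K \<rho>\<close>, and letting \<open>h\<close>
  vary, \<open>A u = f \<star> K \<rho>\<close>.
\<close>

section \<open>The group and its Haar measure\<close>

text \<open>Estimates on the slices give neither pointwise bounds nor boundary values, so the
  maximum principle cannot be applied to \<open>u\<close> itself. Left convolution commutes with the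
  left-invariant fields and moves the dependence on \<open>x\<close> into \<open>h\<close>; hence
  the smoothed solution is bounded and equicontinuous in \<open>x\<close> uniformly in
  \<open>\<rho>\<close>, and weak limits become locally uniform. For \<open>p > 1\<close> weak
  limits are taken in the finite measure with density \<open>K 1\<close>: there the bounds for all
  such \<open>p\<close>, \<open>p = \<infinity>\<close> included, become uniform integrability, no
  duality of Lebesgue spaces enters, and the bound on \<open>f\<close> is recovered afterwards. For
  \<open>p = 1\<close> mass may concentrate on null sets or escape to infinity, which leaves only a
  vague limit. That \<open>\<phi>\<close> gives solutions rests on two identities for
  \<open>G\<close>: the second-order part of the operator applied to it, and its squared gradient.
  Both use the H-type condition.\<close>

locale htype =
  fixes bracket :: "'v::euclidean_space \<Rightarrow> 'v \<Rightarrow> 'z::euclidean_space"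
    and n m :: nat and s :: real
  assumes H_type: "H_type bracket" and dim_v: "DIM('v) = 2 * n" and dim_z: "DIM('z) = m"
    and s_pos: "s > 0"
begin

section \<open>The bracket and its adjoint\<close>

lemma bounded_bilinear_bracket: "bounded_bilinear bracket"
  using H_type unfolding H_type_def bilinear_conv_bounded_bilinear by (rule conjunct1)

sublocale br: bounded_bilinear bracket
  by (rule bounded_bilinear_bracket)

lemma bracket_self [simp]: "bracket v v = 0"
  using H_type by (simp add: H_type_def)

lemma bracket_antisym: "bracket w v = - bracket v w"
proof -
  have "bracket (v + w) (v + w) = 0" by simp
  then show ?thesis
    unfolding br.add_left br.add_right by (simp add: eq_neg_iff_add_eq_0 add.commute)
qed

text \<open>The vector \<open>w\<close> is Kaplan's \<open>J_z v\<close>. For a unit vector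
  \<open>v\<close> it is the preimage of \<open>z\<close> under \<open>bracket v\<close> in the
  complement \<open>K\<close> of the kernel: polarisation turns the isometry on \<open>K\<close>
  into preservation of inner products, and the kernel contributes nothing because \<open>w\<close>
  is orthogonal to it. The general case follows by homogeneity in \<open>v\<close>.\<close>

lemma bracket_adjoint:
  obtains w where "norm w = norm z * norm v" "\<And>x. z \<bullet> bracket v x = w \<bullet> x"
proof -
  have unit: "\<exists>w. norm w = norm z \<and> (\<forall>x. z \<bullet> bracket v x = w \<bullet> x)" if v: "norm v = 1" for v
  proof -
    define K where "K = orthogonal_comp {w. bracket v w = 0}"
    have onto: "bracket v ` K = UNIV" and iso: "\<And>w. w \<in> K \<Longrightarrow> norm (bracket v w) = norm w"
      using H_type v by (auto simp: H_type_def Let_def K_def)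
    have K: "subspace K"
      unfolding K_def by (rule subspace_orthogonal_comp)
    have ker: "subspace {w. bracket v w = 0}"
      by (auto simp: subspace_def br.add_right br.scaleR_right br.zero_right)
    obtain w where w: "w \<in> K" "bracket v w = z"
      using onto by (metis UNIV_I imageE)
    have "z \<bullet> bracket v x = w \<bullet> x" for x
    proof -
      obtain y k where y: "y \<in> span {w. bracket v w = 0}"
        and k: "\<And>w. w \<in> span {w. bracket v w = 0} \<Longrightarrow> orthogonal k w" and x: "x = y + k"
        using orthogonal_subspace_decomp_exists by blast
      have y0: "bracket v y = 0"
        using y ker by (metis (mono_tags, lifting) mem_Collect_eq span_eq_iff)
      have kK: "k \<in> K"
        using k by (auto simp: K_def orthogonal_comp_def span_base orthogonal_commute)
      have "z \<bullet> bracket v x = bracket v w \<bullet> bracket v k"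
        by (simp add: x br.add_right y0 w)
      also have "\<dots> = w \<bullet> k"
        using iso[OF w(1)] iso[OF kK] iso[OF subspace_add[OF K w(1) kK]]
        by (simp add: dot_norm br.add_right)
      also have "\<dots> = w \<bullet> x"
        using w(1) y0 by (auto simp: x inner_add_right K_def orthogonal_comp_def orthogonal_def inner_commute)
      finally show ?thesis .
    qed
    moreover have "norm w = norm z"
      using iso[OF w(1)] w(2) by simp
    ultimately show ?thesis by blast
  qed
  show ?thesis
  proof (cases "v = 0")
    case True
    then show ?thesis
      by (intro that[of 0]) (auto simp: br.zero_left)
  next
    case False
    then have "norm (v /\<^sub>R norm v) = 1" by simp
    from unit[OF this] obtain w where w: "norm w = norm z" "\<And>x. z \<bullet> bracket (v /\<^sub>R norm v) x = w \<bullet> x"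
      by blast
    show ?thesis
    proof (rule that[of "norm v *\<^sub>R w"])
      show "norm (norm v *\<^sub>R w) = norm z * norm v"
        using w(1) by simp
      show "z \<bullet> bracket v x = norm v *\<^sub>R w \<bullet> x" for x
        using w(2)[of x] False by (simp add: br.scaleR_left field_simps)
    qed
  qed
qed

text \<open>Parseval's identity for the vector \<open>w\<close> of
  \<open>bracket_adjoint\<close>.\<close>

lemma sum_inner_bracket_power2:
  "(\<Sum>e\<in>Basis. (z \<bullet> bracket v e)\<^sup>2) = (norm z)\<^sup>2 * (norm v)\<^sup>2"
proof -
  obtain w where w: "norm w = norm z * norm v" "\<And>x. z \<bullet> bracket v x = w \<bullet> x"
    using bracket_adjoint[of z v] by blast
  have "(\<Sum>e\<in>Basis. (w \<bullet> e)\<^sup>2) = w \<bullet> w"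
    by (subst euclidean_inner) (simp add: power2_eq_square)
  then show ?thesis
    by (simp add: w dot_square_norm power_mult_distrib)
qed

text \<open>The adjoint vector is orthogonal to \<open>v\<close>, since
  \<open>z \<bullet> bracket v v = 0\<close>. This removes the mixed term from the squared gradient
  of \<open>G\<close> in \<open>sum_G1\<close>.\<close>

lemma sum_inner_mult_inner_bracket: "(\<Sum>e\<in>Basis. (v \<bullet> e) * (z \<bullet> bracket v e)) = 0"
proof -
  obtain w where w: "\<And>x. z \<bullet> bracket v x = w \<bullet> x"
    using bracket_adjoint[of z v] by blast
  have "(\<Sum>e\<in>Basis. (v \<bullet> e) * (w \<bullet> e)) = w \<bullet> v"
    by (subst (3) euclidean_inner) (simp add: mult.commute)
  then show ?thesis
    using w[of v] by (simp add: w)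
qed

text \<open>Each of the \<open>m\<close> basis vectors of the centre contributes
  \<open>(norm v)\<^sup>2\<close>.\<close>

lemma sum_norm_bracket_power2: "(\<Sum>e\<in>Basis. (norm (bracket v e))\<^sup>2) = m * (norm v)\<^sup>2"
proof -
  have "(\<Sum>e\<in>Basis. (norm (bracket v e))\<^sup>2) = (\<Sum>e\<in>Basis. \<Sum>k\<in>Basis. (k \<bullet> bracket v e)\<^sup>2)"
    by (intro sum.cong refl, subst power2_norm_eq_inner, subst euclidean_inner)
       (simp add: power2_eq_square inner_commute)
  also have "\<dots> = (\<Sum>k\<in>Basis. \<Sum>e\<in>Basis. (k \<bullet> bracket v e)\<^sup>2)"
    by (rule sum.swap)
  also have "\<dots> = m * (norm v)\<^sup>2"
    by (simp add: sum_inner_bracket_power2 dim_z)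
  finally show ?thesis .
qed

text \<open>The adjoint vector for \<open>z = bracket v w\<close>, paired with \<open>w\<close> in
  the Cauchy-Schwarz inequality.\<close>

lemma norm_bracket_le: "norm (bracket v w) \<le> norm v * norm w"
proof (cases "bracket v w = 0")
  case False
  obtain u where u: "norm u = norm (bracket v w) * norm v" "\<And>x. bracket v w \<bullet> bracket v x = u \<bullet> x"
    using bracket_adjoint[of "bracket v w" v] by blast
  have "(norm (bracket v w))\<^sup>2 \<le> norm u * norm w"
    by (metis u(2) dot_square_norm norm_cauchy_schwarz)
  then show ?thesis
    using False u(1) by (simp add: power2_eq_square)
qed simp

section \<open>The group law\<close>

abbreviation mult (infixl "\<odot>" 70) where "x \<odot> y \<equiv> gmult bracket x y"

lemma mult_eq: "x \<odot> y = (fst x + fst y, snd x + snd y + (1 / 2) *\<^sub>R bracket (fst x) (fst y))"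
  by (simp add: gmult_def)

lemma mult_assoc: "(x \<odot> y) \<odot> z = x \<odot> (y \<odot> z)"
  by (simp add: mult_eq br.add_left br.add_right algebra_simps)

lemma mult_minus_left [simp]: "- x \<odot> x = 0" and mult_minus_right [simp]: "x \<odot> - x = 0"
  by (simp_all add: mult_eq br.minus_left br.minus_right zero_prod_def)

lemma mult_zero_left [simp]: "0 \<odot> x = x" and mult_zero_right [simp]: "x \<odot> 0 = x"
  by (simp_all add: mult_eq br.zero_left br.zero_right)

lemma mult_minus_cancel [simp]:
  "- x \<odot> (x \<odot> y) = y" "x \<odot> (- x \<odot> y) = y" "(y \<odot> x) \<odot> - x = y" "(y \<odot> - x) \<odot> x = y"
  by (simp_all flip: mult_assoc) (simp_all add: mult_assoc)

lemma minus_mult: "- (x \<odot> y) = - y \<odot> - x"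
  using bracket_antisym[of "fst x" "fst y"] by (simp add: mult_eq br.minus_left br.minus_right)

lemma continuous_on_mult [continuous_intros]:
  "continuous_on S f \<Longrightarrow> continuous_on S g \<Longrightarrow> continuous_on S (\<lambda>x. f x \<odot> g x)"
  unfolding mult_eq by (intro continuous_intros br.continuous_on)

lemma borel_measurable_mult [measurable]:
  "(\<lambda>x. a \<odot> x) \<in> borel_measurable borel" "(\<lambda>x. x \<odot> a) \<in> borel_measurable borel"
  by (intro borel_measurable_continuous_onI continuous_intros)+

end

text \<open>Left and right translations of the group both have this shape, because the bracket is
  central. For fixed first coordinate the map translates the second one, so Fubini's theorem shows
  that Lebesgue measure is a Haar measure on both sides.\<close>

lemma lborel_distr_shear:
  fixes L :: "'a::euclidean_space \<Rightarrow> 'b::euclidean_space" and a :: 'a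
  assumes L: "continuous_on UNIV L"
  shows "distr lborel borel (\<lambda>x. (a + fst x, L (fst x) + snd x)) = lborel" (is "distr _ _ ?T = _")
proof (rule measure_eqI)
  have T: "?T \<in> borel_measurable borel"
    by (intro borel_measurable_continuous_onI continuous_intros continuous_on_compose2[OF L]) auto
  fix A :: "('a \<times> 'b) set" assume "A \<in> sets (distr lborel borel ?T)"
  then have A: "A \<in> sets borel" by simp
  have [measurable]: "indicator A \<in> borel_measurable (lborel \<Otimes>\<^sub>M lborel)"
    using A by (simp add: lborel_prod)
  have [measurable]: "(\<lambda>x. indicator A (?T x)) \<in> borel_measurable (lborel \<Otimes>\<^sub>M lborel)"
    unfolding lborel_prod using T A by measurable
  have "emeasure (distr lborel borel ?T) A = (\<integral>\<^sup>+x. indicator A (?T x) \<partial>lborel)"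
    using A T by (subst nn_integral_indicator[symmetric]) (auto simp: nn_integral_distr simp del: nn_integral_indicator)
  also have "\<dots> = (\<integral>\<^sup>+x. indicator A (?T x) \<partial>(lborel \<Otimes>\<^sub>M lborel))"
    by (simp add: lborel_prod)
  also have "\<dots> = (\<integral>\<^sup>+x. \<integral>\<^sup>+y. indicator A (?T (x, y)) \<partial>lborel \<partial>lborel)"
    by (subst lborel.nn_integral_fst) auto
  also have "\<dots> = (\<integral>\<^sup>+x. \<integral>\<^sup>+y. indicator A (a + x, y) \<partial>(distr lborel borel ((+) (L x))) \<partial>lborel)"
    by (subst nn_integral_distr) (auto intro!: nn_integral_cong)
  also have "\<dots> = (\<integral>\<^sup>+x. \<integral>\<^sup>+y. indicator A (a + x, y) \<partial>lborel \<partial>lborel)"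
    by (simp add: lborel_distr_plus)
  also have "\<dots> = (\<integral>\<^sup>+x. \<integral>\<^sup>+y. indicator A (x, y) \<partial>lborel \<partial>(distr lborel borel ((+) a)))"
    by (subst nn_integral_distr) auto
  also have "\<dots> = (\<integral>\<^sup>+x. indicator A x \<partial>(lborel \<Otimes>\<^sub>M lborel))"
    by (simp add: lborel_distr_plus lborel.nn_integral_fst)
  finally show "emeasure (distr lborel borel ?T) A = emeasure lborel A"
    using A by (simp add: lborel_prod)
qed simp

lemma lborel_distr_minus: "distr lborel borel uminus = (lborel :: 'a::euclidean_space measure)"
proof -
  have "(\<lambda>x::'a. 0 + (-1) *\<^sub>R x) = uminus"
    by auto
  with lborel_affine[of "-1" "0::'a"] show ?thesis
    by (simp only: density_1 abs_minus abs_one power_one ennreal_1)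
qed

context htype
begin

lemma lborel_distr_mult_left: "distr lborel borel (\<lambda>x. a \<odot> x) = lborel"
proof -
  have "continuous_on UNIV (\<lambda>v. snd a + (1 / 2) *\<^sub>R bracket (fst a) v)"
    by (intro continuous_intros br.continuous_on)
  from lborel_distr_shear[OF this, of "fst a"] show ?thesis
    by (simp add: mult_eq ac_simps)
qed

lemma lborel_distr_mult_right: "distr lborel borel (\<lambda>x. x \<odot> a) = lborel"
proof -
  have "continuous_on UNIV (\<lambda>v. snd a + (1 / 2) *\<^sub>R bracket v (fst a))"
    by (intro continuous_intros br.continuous_on)
  from lborel_distr_shear[OF this, of "fst a"] show ?thesis
    by (simp add: mult_eq ac_simps)
qed

lemma nn_integral_mult_left:
  "f \<in> borel_measurable borel \<Longrightarrow> (\<integral>\<^sup>+x. f (a \<odot> x) \<partial>lborel) = (\<integral>\<^sup>+x. f x \<partial>lborel)"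
  by (subst (2) lborel_distr_mult_left[of a, symmetric]) (simp add: nn_integral_distr)

lemma nn_integral_mult_right:
  "f \<in> borel_measurable borel \<Longrightarrow> (\<integral>\<^sup>+x. f (x \<odot> a) \<partial>lborel) = (\<integral>\<^sup>+x. f x \<partial>lborel)"
  by (subst (2) lborel_distr_mult_right[of a, symmetric]) (simp add: nn_integral_distr)

lemma nn_integral_minus:
  fixes f :: "'v \<times> 'z \<Rightarrow> ennreal"
  shows "f \<in> borel_measurable borel \<Longrightarrow> (\<integral>\<^sup>+x. f (- x) \<partial>lborel) = (\<integral>\<^sup>+x. f x \<partial>lborel)"
  by (subst (2) lborel_distr_minus[symmetric]) (simp add: nn_integral_distr)

lemma integral_mult_right:
  fixes f :: "'v \<times> 'z \<Rightarrow> 'b::{banach,second_countable_topology}"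
  assumes "f \<in> borel_measurable borel"
  shows "(LINT x|lborel. f (x \<odot> a)) = (LINT x|lborel. f x)"
  using assms by (subst (2) lborel_distr_mult_right[of a, symmetric]) (simp add: integral_distr)

lemma integral_mult_left:
  fixes f :: "'v \<times> 'z \<Rightarrow> 'b::{banach,second_countable_topology}"
  assumes "f \<in> borel_measurable borel"
  shows "(LINT x|lborel. f (a \<odot> x)) = (LINT x|lborel. f x)"
  using assms by (subst (2) lborel_distr_mult_left[of a, symmetric]) (simp add: integral_distr)

lemma integral_minus_arg:
  fixes f :: "'v \<times> 'z \<Rightarrow> 'b::{banach,second_countable_topology}"
  assumes "f \<in> borel_measurable borel"
  shows "(LINT x|lborel. f (- x)) = (LINT x|lborel. f x)"
  using assms by (subst (2) lborel_distr_minus[symmetric]) (simp add: integral_distr)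

section \<open>Dilations\<close>

definition dil :: "real \<Rightarrow> 'v \<times> 'z \<Rightarrow> 'v \<times> 'z" where
  "dil r x = (r *\<^sub>R fst x, r\<^sup>2 *\<^sub>R snd x)"

lemma continuous_on_dil [continuous_intros]:
  "continuous_on S f \<Longrightarrow> continuous_on S g \<Longrightarrow> continuous_on S (\<lambda>x. dil (f x) (g x))"
  unfolding dil_def by (intro continuous_intros)

lemma borel_measurable_dil [measurable]: "dil r \<in> borel_measurable borel"
  by (intro borel_measurable_continuous_onI continuous_intros)

text \<open>The Jacobian of \<open>dil r\<close> is \<open>r\<close> to the homogeneous dimension:
  each of the \<open>2 * n\<close> directions of the first layer contributes \<open>r\<close>, each
  of the \<open>m\<close> central ones \<open>r\<^sup>2\<close>.\<close>

lemma density_distr_dil: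
  assumes "r > 0"
  shows "density (distr lborel borel (dil r)) (\<lambda>_. ennreal (r ^ (2 * n + 2 * m))) = lborel"
proof -
  define c where "c j = (if snd j = 0 then r else r\<^sup>2)" for j :: "'v \<times> 'z"
  have T: "(\<lambda>x. 0 + (\<Sum>j\<in>Basis. (c j * (x \<bullet> j)) *\<^sub>R j)) = dil r"
  proof
    fix x :: "'v \<times> 'z"
    have "(\<Sum>j\<in>Basis. (c j * (x \<bullet> j)) *\<^sub>R j)
        = (\<Sum>j\<in>Basis. (r * (fst x \<bullet> j)) *\<^sub>R (j, 0)) + (\<Sum>j\<in>Basis. (r\<^sup>2 * (snd x \<bullet> j)) *\<^sub>R (0, j))"
      unfolding sum_Basis_prod_eq by (simp add: c_def inner_prod_def nonzero_Basis cong: sum.cong)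
    also have "\<dots> = (r *\<^sub>R (\<Sum>j\<in>Basis. (fst x \<bullet> j) *\<^sub>R j), r\<^sup>2 *\<^sub>R (\<Sum>j\<in>Basis. (snd x \<bullet> j) *\<^sub>R j))"
      by (simp add: sum_prod scaleR_sum_right prod_eq_iff fst_sum snd_sum)
    finally show "0 + (\<Sum>j\<in>Basis. (c j * (x \<bullet> j)) *\<^sub>R j) = dil r x"
      by (simp add: dil_def euclidean_representation)
  qed
  have "(\<Prod>j\<in>Basis. \<bar>c j\<bar>) = (\<Prod>j\<in>(Basis::'v set). r) * (\<Prod>j\<in>(Basis::'z set). r\<^sup>2)"
    unfolding Basis_prod_def using assms
    by (subst prod.union_disjoint)
       (auto simp: prod.reindex inj_on_def c_def nonzero_Basis intro!: arg_cong2[where f="(*)"] prod.cong)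
  also have "\<dots> = r ^ (2 * n + 2 * m)"
    by (simp add: dim_v dim_z power_add power_mult)
  finally show ?thesis
    using lborel_affine_euclidean[of c 0] T assms by (simp add: c_def)
qed

lemma nn_integral_dil:
  assumes "r > 0" "f \<in> borel_measurable borel"
  shows "(\<integral>\<^sup>+x. ennreal (r ^ (2 * n + 2 * m)) * f (dil r x) \<partial>lborel) = (\<integral>\<^sup>+x. f x \<partial>lborel)"
  using assms by (subst (2) density_distr_dil[of r, symmetric]) (simp_all add: nn_integral_density nn_integral_distr)

end

section \<open>The kernel\<close>

lemma power_powr: "x > 0 \<Longrightarrow> (x ^ k) powr a = x powr (k * a)" for x :: real
  by (metis powr_powr powr_realpow)

context htype
begin

definition G :: "real \<Rightarrow> 'v \<times> 'z \<Rightarrow> real" where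
  "G \<rho> x = (\<rho>\<^sup>2 + (norm (fst x))\<^sup>2)\<^sup>2 + 16 * (norm (snd x))\<^sup>2"

definition kap :: real where "kap = (n + m + s) / 2"

text \<open>The power of \<open>\<rho>\<close> makes the integral of \<open>K \<rho>\<close> independent of \<open>\<rho>\<close>.\<close>

definition K :: "real \<Rightarrow> 'v \<times> 'z \<Rightarrow> real" where
  "K \<rho> x = \<rho> powr (2 * s) * G \<rho> x powr (- kap)"

lemma kap_pos: "kap > 0"
  using s_pos by (simp add: kap_def add_nonneg_pos)

lemma phi_eq: "phi n m s \<rho> x = complex_of_real (G \<rho> x powr (- kap))"
  by (simp add: phi_def G_def kap_def)

lemma G_ge: "\<rho> ^ 4 \<le> G \<rho> x"
proof -
  have "(\<rho>\<^sup>2)\<^sup>2 \<le> (\<rho>\<^sup>2 + (norm (fst x))\<^sup>2)\<^sup>2"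
    by (intro power_mono) auto
  then show ?thesis
    unfolding G_def power_mult[symmetric] by simp (smt (verit) zero_le_power2)
qed

lemma G_pos: "\<rho> > 0 \<Longrightarrow> G \<rho> x > 0"
  using G_ge[of \<rho> x] by (smt (verit) zero_less_power)

lemma K_pos: "\<rho> > 0 \<Longrightarrow> K \<rho> x > 0"
  using G_pos[of \<rho> x] by (simp add: K_def)

lemma K_nonneg [simp]: "K \<rho> x \<ge> 0"
  by (simp add: K_def)

lemma G_minus [simp]: "G \<rho> (- x) = G \<rho> x" and K_minus [simp]: "K \<rho> (- x) = K \<rho> x"
  by (simp_all add: G_def K_def)

lemma continuous_on_G [continuous_intros]:
  "continuous_on S f \<Longrightarrow> continuous_on S g \<Longrightarrow> continuous_on S (\<lambda>x. G (f x) (g x))"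
  unfolding G_def by (intro continuous_intros)

lemma continuous_on_K [continuous_intros]:
  assumes "continuous_on S f" "continuous_on S g" "\<And>x. x \<in> S \<Longrightarrow> f x > 0"
  shows "continuous_on S (\<lambda>x. K (f x) (g x))"
  unfolding K_def using assms(3) G_pos
  by (intro continuous_intros assms(1,2)) (auto dest!: assms(3) simp: less_imp_neq[symmetric] G_pos order.strict_implies_not_eq)

lemma borel_measurable_G [measurable]: "G \<rho> \<in> borel_measurable borel"
  by (intro borel_measurable_continuous_onI continuous_intros)

lemma borel_measurable_K [measurable]: "K \<rho> \<in> borel_measurable borel"
  unfolding K_def by measurable

lemma G_dil: "G (\<rho> * r) (dil r x) = r ^ 4 * G \<rho> x"
  by (simp add: G_def dil_def power_mult_distrib) algebra

lemma K_le:
  assumes "\<rho> > 0" shows "K \<rho> x \<le> \<rho> powr (2 * s) * \<rho> powr (- 4 * kap)"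
proof -
  have "G \<rho> x powr (- kap) \<le> (\<rho> ^ 4) powr (- kap)"
    using G_ge[of \<rho> x] assms kap_pos by (intro powr_mono2') auto
  also have "(\<rho> ^ 4) powr (- kap) = \<rho> powr (- 4 * kap)"
    using assms by (simp add: power_powr)
  finally show ?thesis
    by (simp add: K_def mult_left_mono)
qed

text \<open>The exponents \<open>2 * n + 2 * m\<close> of the Jacobian, \<open>2 * s\<close> of the
  prefactor and \<open>- 4 * kap\<close> from \<open>G_dil\<close> add up to zero.\<close>

lemma K_scale:
  assumes "r > 0"
  shows "r ^ (2 * n + 2 * m) * K r (dil r x) = K 1 x"
proof -
  have "G r (dil r x) = r ^ 4 * G 1 x"
    using G_dil[of 1 r x] by simp
  then have "K r (dil r x) = r powr (2 * s) * (r ^ 4) powr (- kap) * G 1 x powr (- kap)"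
    using assms by (simp add: K_def powr_mult)
  also have "(r ^ 4) powr (- kap) = r powr (- 4 * kap)"
    using assms by (simp add: power_powr)
  finally have "r ^ (2 * n + 2 * m) * K r (dil r x)
      = (r powr real (2 * n + 2 * m) * r powr (2 * s) * r powr (- 4 * kap)) * G 1 x powr (- kap)"
    using assms by (simp only: powr_realpow mult.assoc)
  also have "r powr real (2 * n + 2 * m) * r powr (2 * s) * r powr (- 4 * kap) = 1"
    using assms by (simp add: kap_def flip: powr_add) (simp add: field_simps)
  finally show ?thesis by (simp add: K_def)
qed

text \<open>\<open>B k\<close> is the image of \<open>B 0\<close> under \<open>dil (2 ^ k)\<close>,
  so its volume grows like \<open>2 ^ (k * (2 * n + 2 * m))\<close>, while the kernel outside
  \<open>B (k - 1)\<close> is at most a multiple of \<open>16 powr (- kap * k)\<close>. The products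
  form a geometric series of ratio \<open>2 powr (-2 * s)\<close>, which converges because
  \<open>s > 0\<close>.\<close>

lemma nn_integral_K_finite: "(\<integral>\<^sup>+x. ennreal (K 1 x) \<partial>lborel) < \<infinity>"
proof -
  define B where "B k = {x. G 0 x \<le> 16 ^ k}" for k :: nat
  have [measurable]: "B k \<in> sets borel" for k
    unfolding B_def by measurable
  have B0: "emeasure lborel (B 0) < \<infinity>"
  proof (intro emeasure_bounded_finite)
    have "norm x \<le> 2" if "x \<in> B 0" for x
    proof -
      have "((norm (fst x))\<^sup>2)\<^sup>2 + 16 * (norm (snd x))\<^sup>2 \<le> 1"
        using that by (simp add: B_def G_def)
      then have "((norm (fst x))\<^sup>2)\<^sup>2 \<le> 1\<^sup>2" "(norm (snd x))\<^sup>2 \<le> 1\<^sup>2"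
        using zero_le_power2[of "norm (snd x)"] zero_le_power2[of "(norm (fst x))\<^sup>2"]
        unfolding power_one by linarith+
      then have "(norm (fst x))\<^sup>2 \<le> 1" "norm (snd x) \<le> 1"
        using power2_le_imp_le[of "(norm (fst x))\<^sup>2" 1] power2_le_imp_le[of "norm (snd x)" 1] by simp_all
      then have "norm (fst x) \<le> 1" "norm (snd x) \<le> 1"
        by (auto simp: abs_square_le_1)
      then show ?thesis
        using norm_Pair_le[of "fst x" "snd x"] by simp
    qed
    then show "bounded (B 0)"
      unfolding bounded_iff by blast
  qed
  have Bk: "emeasure lborel (B k) = ennreal (2 ^ (k * (2 * n + 2 * m))) * emeasure lborel (B 0)" for k
  proof -
    have "dil (2 ^ k) x \<in> B k \<longleftrightarrow> x \<in> B 0" for x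
      using G_dil[of 0 "2 ^ k" x] by (simp add: B_def power_mult[symmetric] mult.commute[of k] power_mult)
    then have "indicator (B k) (dil (2 ^ k) x) = (indicator (B 0) x :: ennreal)" for x
      by (simp add: indicator_def)
    then have "(\<integral>\<^sup>+x. ennreal ((2 ^ k) ^ (2 * n + 2 * m)) * indicator (B 0) x \<partial>lborel) = emeasure lborel (B k)"
      using nn_integral_dil[of "2 ^ k" "indicator (B k)"] by simp
    then show ?thesis
      by (simp add: nn_integral_cmult power_mult)
  qed
  have term_le: "F k \<le> (\<Sum>k. F k)" for F :: "nat \<Rightarrow> ennreal" and k
    using sum_le_suminf[OF summableI, of "{k}" F] by simp
  \<comment> \<open>Each point is charged to the first \<open>B k\<close> that contains it. Being
    outside \<open>B (k - 1)\<close> only gives \<open>16 ^ (k - 1) \<le> G 0 x\<close>, and the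
    factor \<open>16 powr kap\<close> pays for the shift by one.\<close>
  have bd: "ennreal (K 1 x) \<le> (\<Sum>k. ennreal (16 powr kap * (16 ^ k) powr (- kap)) * indicator (B k) x)" for x
  proof -
    have ex: "\<exists>k. x \<in> B k"
      using real_arch_pow[of 16 "G 0 x"] by (auto simp: B_def intro: less_imp_le)
    define k where "k = (LEAST k. x \<in> B k)"
    have xk: "x \<in> B k"
      unfolding k_def using ex by (rule LeastI_ex)
    have "K 1 x \<le> 16 powr kap * (16 ^ k) powr (- kap)"
    proof (cases k)
      case 0
      then show ?thesis
        using K_le[of 1 x] kap_pos ge_one_powr_ge_zero[of 16 kap] by simp
    next
      case (Suc j)
      then have "x \<notin> B j"
        using not_less_Least[of j "\<lambda>k. x \<in> B k"] by (simp add: k_def[symmetric])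
      then have "16 ^ j \<le> G 0 x"
        by (simp add: B_def)
      also have "G 0 x \<le> G 1 x"
        unfolding G_def by (intro add_right_mono power_mono) auto
      finally have "G 1 x powr (- kap) \<le> (16 ^ j) powr (- kap)"
        using kap_pos by (intro powr_mono2') auto
      also have "\<dots> = 16 powr kap * (16 ^ k) powr (- kap)"
        by (simp add: Suc powr_mult powr_minus)
      finally show ?thesis by (simp add: K_def)
    qed
    then have "ennreal (K 1 x) \<le> ennreal (16 powr kap * (16 ^ k) powr (- kap)) * indicator (B k) x"
      using xk by (simp add: ennreal_leI)
    also have "\<dots> \<le> (\<Sum>k. ennreal (16 powr kap * (16 ^ k) powr (- kap)) * indicator (B k) x)"
      by (rule term_le)
    finally show ?thesis .
  qed
  \<comment> \<open>\<open>4 * kap = 2 * n + 2 * m + 2 * s\<close>, so the exponent of the volume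
    cancels and \<open>-2 * s\<close> remains.\<close>
  have eq: "16 powr kap * (16 ^ k) powr (- kap) * 2 ^ (k * (2 * n + 2 * m)) = 16 powr kap * (2 powr (-2 * s)) ^ k" for k
  proof -
    have "(16 ^ k :: real) powr (- kap) * 2 ^ (k * (2 * n + 2 * m))
        = 2 powr (4 * k * (- kap)) * 2 powr (k * (2 * n + 2 * m))"
      using power_powr[of 16 k "- kap"] powr_realpow[of 2 "k * (2 * n + 2 * m)"] power_powr[of 2 4 "k * - kap"]
      by (simp add: mult.assoc)
    also have "\<dots> = 2 powr (-2 * s * k)"
      by (simp add: kap_def flip: powr_add) (simp add: field_simps)
    finally show ?thesis
      by (simp add: powr_power mult.commute mult.left_commute)
  qed
  have eq': "ennreal (16 powr kap * (16 ^ k) powr (- kap)) * ennreal (2 ^ (k * (2 * n + 2 * m)))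
      = ennreal (16 powr kap * (2 powr (-2 * s)) ^ k)" for k
    by (subst ennreal_mult'[symmetric]) (simp, simp only: eq)
  define a where "a k = ennreal (16 powr kap * (2 powr (-2 * s)) ^ k)" for k
  have term_eq: "ennreal (16 powr kap * (16 ^ k) powr (- kap)) * emeasure lborel (B k) = a k * emeasure lborel (B 0)" for k
    by (subst Bk) (simp only: mult.assoc[symmetric] eq' a_def)
  have "norm (2 powr (-2 * s)) < 1"
    using s_pos powr_less_cancel_iff[of 2 "-2 * s" 0] by simp
  then have "summable (\<lambda>k. 16 powr kap * (2 powr (-2 * s)) ^ k)"
    by (intro summable_mult summable_geometric)
  then have suma: "suminf a < \<infinity>"
    unfolding a_def by (subst suminf_ennreal2) auto
  have "(\<integral>\<^sup>+x. ennreal (K 1 x) \<partial>lborel)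
      \<le> (\<integral>\<^sup>+x. (\<Sum>k. ennreal (16 powr kap * (16 ^ k) powr (- kap)) * indicator (B k) x) \<partial>lborel)"
    by (intro nn_integral_mono bd)
  also have "\<dots> = (\<Sum>k. ennreal (16 powr kap * (16 ^ k) powr (- kap)) * emeasure lborel (B k))"
    by (subst nn_integral_suminf) (auto simp: nn_integral_cmult)
  also have "\<dots> = (\<Sum>k. a k * emeasure lborel (B 0))"
    by (simp only: term_eq)
  also have "\<dots> = suminf a * emeasure lborel (B 0)"
    by (rule ennreal_suminf_multc)
  also have "\<dots> < \<infinity>"
    using B0 suma by (simp add: ennreal_mult_less_top)
  finally show ?thesis .
qed

text \<open>All kernels are images of this one finite measure under dilations, see
  \<open>distr_KM_dil\<close>. The dependence on \<open>\<rho>\<close> thereby moves into the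
  integrand, which still makes sense at \<open>\<rho> = 0\<close>. The same measure is the weight in
  which weak limits are taken for \<open>p > 1\<close>.\<close>

definition KM :: "('v \<times> 'z) measure" where "KM = density lborel (\<lambda>x. ennreal (K 1 x))"

lemma sets_KM [simp, measurable_cong]: "sets KM = sets borel" and space_KM [simp]: "space KM = UNIV"
  by (simp_all add: KM_def)

sublocale KM: finite_measure KM
  by (rule finite_measureI)
     (use nn_integral_K_finite in \<open>simp add: KM_def emeasure_density top.not_eq_extremum\<close>)

definition A where "A = measure KM UNIV"

lemma A_pos: "A > 0"
proof -
  have "emeasure KM UNIV \<noteq> 0"
  proof
    assume "emeasure KM UNIV = 0"
    then have "AE x in lborel. ennreal (K 1 x) = 0"
      by (simp add: KM_def emeasure_density nn_integral_0_iff_AE)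
    then have "AE x in (lborel :: ('v \<times> 'z) measure). False"
      by eventually_elim (metis K_pos ennreal_eq_0_iff leD zero_less_one)
    then show False by (auto simp: AE_iff_null null_sets_def)
  qed
  then show ?thesis
    by (simp add: A_def KM.emeasure_eq_measure zero_less_measure_iff)
qed

lemma distr_KM_dil:
  assumes "\<rho> > 0"
  shows "distr KM borel (dil \<rho>) = density lborel (\<lambda>x. ennreal (K \<rho> x))"
proof (rule measure_eqI)
  fix B assume "B \<in> sets (distr KM borel (dil \<rho>))"
  then have B [measurable]: "B \<in> sets borel" by simp
  have "emeasure (distr KM borel (dil \<rho>)) B = (\<integral>\<^sup>+x. indicator B (dil \<rho> x) \<partial>KM)"
    by (subst nn_integral_indicator[symmetric]) (auto simp: nn_integral_distr simp del: nn_integral_indicator)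
  also have "\<dots> = (\<integral>\<^sup>+x. ennreal (K 1 x) * indicator B (dil \<rho> x) \<partial>lborel)"
    by (simp add: KM_def nn_integral_density)
  also have "\<dots> = (\<integral>\<^sup>+x. ennreal (\<rho> ^ (2 * n + 2 * m)) * (ennreal (K \<rho> (dil \<rho> x)) * indicator B (dil \<rho> x)) \<partial>lborel)"
    using assms by (intro nn_integral_cong) (simp add: K_scale[OF assms, symmetric] ennreal_mult' mult.assoc)
  also have "\<dots> = (\<integral>\<^sup>+x. ennreal (K \<rho> x) * indicator B x \<partial>lborel)"
    using assms nn_integral_dil[of \<rho> "\<lambda>x. ennreal (K \<rho> x) * indicator B x"] by simp
  finally show "emeasure (distr KM borel (dil \<rho>)) B = emeasure (density lborel (\<lambda>x. ennreal (K \<rho> x))) B"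
    by (simp add: emeasure_density)
qed simp

lemma nn_integral_K:
  assumes "\<rho> > 0" and [measurable]: "f \<in> borel_measurable borel"
  shows "(\<integral>\<^sup>+x. ennreal (K \<rho> x) * f x \<partial>lborel) = (\<integral>\<^sup>+x. f (dil \<rho> x) \<partial>KM)"
  using assms(1) by (simp add: nn_integral_density flip: nn_integral_distr[of "dil \<rho>" KM borel] add: distr_KM_dil)

lemma nn_integral_K_1: "\<rho> > 0 \<Longrightarrow> (\<integral>\<^sup>+x. ennreal (K \<rho> x) \<partial>lborel) = ennreal A"
  using nn_integral_K[of \<rho> "\<lambda>_. 1"] by (simp add: A_def KM.emeasure_eq_measure)

lemma integral_K:
  fixes f :: "'v \<times> 'z \<Rightarrow> 'b::{banach,second_countable_topology}"
  assumes "\<rho> > 0" and [measurable]: "f \<in> borel_measurable borel"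
  shows "(LINT x|lborel. K \<rho> x *\<^sub>R f x) = (LINT x|KM. f (dil \<rho> x))"
    and "integrable lborel (\<lambda>x. K \<rho> x *\<^sub>R f x) \<longleftrightarrow> integrable KM (\<lambda>x. f (dil \<rho> x))"
  using assms(1)
  by (simp_all add: integral_density integrable_density flip: integral_distr[of "dil \<rho>" KM borel]
     integrable_distr_eq[of "dil \<rho>" KM borel] add: distr_KM_dil)

text \<open>A Harnack-type comparison for fixed \<open>\<rho> > 0\<close>. With
  \<open>r = \<rho>\<^sup>2 + (norm v)\<^sup>2\<close>, the terms that the translation adds are of
  order at most two in \<open>r\<close>, and \<open>\<rho>\<^sup>2 \<le> r\<close> lets lower powers
  of \<open>r\<close> be absorbed in \<open>r\<^sup>2\<close>.\<close>

lemma G_mult_le: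
  assumes "\<rho> > 0" "R \<ge> 0"
  obtains C where "C > 0" "\<And>a x. norm a \<le> R \<Longrightarrow> G \<rho> (a \<odot> x) \<le> C * G \<rho> x"
proof
  \<comment> \<open>The square bounds the change of the first layer. The two terms with
    \<open>48 = 16 * 3\<close> and the final \<open>3\<close> come from squaring the three summands
    \<open>R\<close>, \<open>norm z\<close> and \<open>R * norm v\<close> that bound the central
    component.\<close>
  let ?C = "(2 + 2 * R\<^sup>2 / \<rho>\<^sup>2)\<^sup>2 + 48 * R\<^sup>2 / \<rho> ^ 4 + 48 * R\<^sup>2 / \<rho>\<^sup>2 + 3"
  show "?C > 0"
    using assms by (intro add_nonneg_pos add_nonneg_nonneg) auto
  fix a x :: "'v \<times> 'z" assume a: "norm a \<le> R"
  obtain a1 a2 v z where ax: "a = (a1, a2)" "x = (v, z)" by fastforce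
  have a12: "norm a1 \<le> R" "norm a2 \<le> R"
    using a norm_fst_le[of a1 a2] norm_snd_le[of a2 a1] by (auto simp: ax)
  define r where "r = \<rho>\<^sup>2 + (norm v)\<^sup>2"
  have r: "\<rho>\<^sup>2 \<le> r" "(norm v)\<^sup>2 \<le> r" "0 < r"
    using assms by (auto simp: r_def add_pos_nonneg)
  have rho1: "1 \<le> r / \<rho>\<^sup>2" using r assms by simp
  have rho2: "1 \<le> r\<^sup>2 / \<rho> ^ 4"
    using power_mono[OF rho1, of 2] by (simp add: power_divide flip: power_mult)
  have v2: "(norm v)\<^sup>2 \<le> r\<^sup>2 / \<rho>\<^sup>2"
  proof -
    have "(norm v)\<^sup>2 \<le> r * 1" using r by simp
    also have "\<dots> \<le> r * (r / \<rho>\<^sup>2)" using r rho1 by (intro mult_left_mono) auto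
    finally show ?thesis by (simp add: power2_eq_square)
  qed
  have "(norm (a1 + v))\<^sup>2 \<le> (norm a1 + norm v)\<^sup>2"
    by (intro power_mono norm_triangle_ineq) auto
  also have "\<dots> \<le> 2 * (norm a1)\<^sup>2 + 2 * (norm v)\<^sup>2"
    by (smt (verit) sum_squares_bound power2_sum)
  also have "\<dots> \<le> 2 * R\<^sup>2 + 2 * (norm v)\<^sup>2"
    using a12 by (simp add: power_mono)
  finally have "\<rho>\<^sup>2 + (norm (a1 + v))\<^sup>2 \<le> 2 * r + 2 * R\<^sup>2 * 1"
    unfolding r_def by (smt (verit) zero_le_power2)
  also have "\<dots> \<le> 2 * r + 2 * R\<^sup>2 * (r / \<rho>\<^sup>2)"
    using rho1 by (intro add_left_mono mult_left_mono) auto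
  also have "\<dots> = (2 + 2 * R\<^sup>2 / \<rho>\<^sup>2) * r"
    by (simp add: field_simps)
  finally have 1: "(\<rho>\<^sup>2 + (norm (a1 + v))\<^sup>2)\<^sup>2 \<le> (2 + 2 * R\<^sup>2 / \<rho>\<^sup>2)\<^sup>2 * r\<^sup>2"
    by (metis power_mono power_mult_distrib add_nonneg_nonneg zero_le_power2)
  have "norm (a2 + z + (1 / 2) *\<^sub>R bracket a1 v) \<le> R + norm z + R * norm v"
  proof -
    have "norm (bracket a1 v) \<le> R * norm v"
      using norm_bracket_le[of a1 v] a12 by (meson mult_right_mono norm_ge_zero order_trans)
    moreover have "0 \<le> R * norm v" using assms by simp
    ultimately have "norm ((1 / 2) *\<^sub>R bracket a1 v) \<le> R * norm v"
      by simp
    then show ?thesis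
      using a12 norm_triangle_ineq[of "a2 + z" "(1 / 2) *\<^sub>R bracket a1 v"] norm_triangle_ineq[of a2 z] by linarith
  qed
  then have "(norm (a2 + z + (1 / 2) *\<^sub>R bracket a1 v))\<^sup>2 \<le> (R + norm z + R * norm v)\<^sup>2"
    by (intro power_mono) auto
  also have "\<dots> \<le> 3 * (R\<^sup>2 + (norm z)\<^sup>2 + (R * norm v)\<^sup>2)"
  proof -
    have "0 \<le> (R - norm z)\<^sup>2 + (R - R * norm v)\<^sup>2 + (norm z - R * norm v)\<^sup>2" by simp
    then show ?thesis by (simp add: power2_eq_square algebra_simps)
  qed
  also have "\<dots> \<le> 3 * (R\<^sup>2 * (r\<^sup>2 / \<rho> ^ 4) + (norm z)\<^sup>2 + R\<^sup>2 * (r\<^sup>2 / \<rho>\<^sup>2))"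
    using mult_left_mono[OF rho2, of "R\<^sup>2"] mult_left_mono[OF v2, of "R\<^sup>2"] by (simp add: power_mult_distrib)
  finally have "16 * (norm (a2 + z + (1 / 2) *\<^sub>R bracket a1 v))\<^sup>2
     \<le> 16 * (3 * (R\<^sup>2 * (r\<^sup>2 / \<rho> ^ 4) + (norm z)\<^sup>2 + R\<^sup>2 * (r\<^sup>2 / \<rho>\<^sup>2)))"
    by simp
  then have 2: "16 * (norm (a2 + z + (1 / 2) *\<^sub>R bracket a1 v))\<^sup>2
     \<le> (48 * R\<^sup>2 / \<rho> ^ 4 + 48 * R\<^sup>2 / \<rho>\<^sup>2) * r\<^sup>2 + 3 * (16 * (norm z)\<^sup>2)"
    by (simp add: algebra_simps)
  have "G \<rho> (a \<odot> x) \<le> ((2 + 2 * R\<^sup>2 / \<rho>\<^sup>2)\<^sup>2 + (48 * R\<^sup>2 / \<rho> ^ 4 + 48 * R\<^sup>2 / \<rho>\<^sup>2)) * r\<^sup>2 + 3 * (16 * (norm z)\<^sup>2)"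
    using 1 2 by (simp add: G_def mult_eq ax ring_distribs)
  also have "\<dots> \<le> ?C * r\<^sup>2 + ?C * (16 * (norm z)\<^sup>2)"
    by (rule add_mono; rule mult_right_mono) auto
  also have "\<dots> = ?C * G \<rho> x"
    by (simp add: G_def ax r_def algebra_simps)
  finally show "G \<rho> (a \<odot> x) \<le> ?C * G \<rho> x" .
qed

text \<open>Translates of the kernel by bounded elements have one multiple of the kernel as a
  majorant, which dominated convergence and Fubini's theorem use below. As \<open>K\<close> contains
  a negative power of \<open>G\<close>, the comparison of \<open>G\<close> is applied to the inverse
  translation.\<close>

lemma K_mult_le:
  assumes "\<rho> > 0" "R \<ge> 0"
  obtains C where "C > 0" "\<And>a x. norm a \<le> R \<Longrightarrow> K \<rho> (a \<odot> x) \<le> C * K \<rho> x"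
proof -
  obtain C where C: "C > 0" "\<And>a x. norm a \<le> R \<Longrightarrow> G \<rho> (a \<odot> x) \<le> C * G \<rho> x"
    using G_mult_le[OF assms] by blast
  show ?thesis
  proof
    show "C powr kap > 0" using C by simp
    fix a x :: "'v \<times> 'z" assume "norm a \<le> R"
    then have "G \<rho> x \<le> C * G \<rho> (a \<odot> x)"
      using C(2)[of "- a" "a \<odot> x"] by simp
    then have "(C * G \<rho> (a \<odot> x)) powr (- kap) \<le> G \<rho> x powr (- kap)"
      using G_pos[OF assms(1)] kap_pos by (intro powr_mono2') auto
    then have "C powr (- kap) * G \<rho> (a \<odot> x) powr (- kap) \<le> G \<rho> x powr (- kap)"
      using C(1) by (simp add: powr_mult)
    then have "C powr kap * (C powr (- kap) * G \<rho> (a \<odot> x) powr (- kap)) \<le> C powr kap * G \<rho> x powr (- kap)"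
      by (intro mult_left_mono) auto
    also have "C powr kap * (C powr (- kap) * G \<rho> (a \<odot> x) powr (- kap)) = G \<rho> (a \<odot> x) powr (- kap)"
      using C(1) by (simp flip: mult.assoc powr_add)
    finally have "G \<rho> (a \<odot> x) powr (- kap) \<le> C powr kap * G \<rho> x powr (- kap)" .
    then show "K \<rho> (a \<odot> x) \<le> C powr kap * K \<rho> x"
      unfolding K_def by (metis mult.left_commute mult_left_mono powr_ge_zero)
  qed
qed

end

section \<open>The equation and the maximum principle\<close>

text \<open>The second derivative is taken at \<open>0\<close> only. If it were positive,
  \<open>f'\<close> would be positive just to the right of \<open>0\<close>, and by the mean value
  theorem \<open>f\<close> would exceed \<open>f 0\<close> there.\<close>

lemma second_derivative_test:
  fixes f f' :: "real \<Rightarrow> real"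
  assumes d: "d > 0" and f: "\<And>t. \<bar>t\<bar> < d \<Longrightarrow> (f has_real_derivative f' t) (at t)"
    and f': "(f' has_real_derivative l) (at 0)" and max: "\<And>t. \<bar>t\<bar> < d \<Longrightarrow> f t \<le> f 0"
  shows "f' 0 = 0" "l \<le> 0"
proof -
  show 0: "f' 0 = 0"
    using d max by (intro DERIV_local_max[OF f[of 0], of d]) auto
  show "l \<le> 0"
  proof (rule ccontr)
    assume "\<not> l \<le> 0"
    then obtain e where e: "e > 0" "\<And>h. 0 < h \<Longrightarrow> h < e \<Longrightarrow> f' 0 < f' (0 + h)"
      using DERIV_pos_inc_right[OF f'] by force
    define t where "t = min d e / 2"
    have t: "0 < t" "t < d" "t < e" using d e by (auto simp: t_def)
    have "\<exists>z>0. z < t \<and> f t - f 0 = (t - 0) * f' z"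
      using t by (intro MVT2 f) auto
    then obtain z where z: "0 < z" "z < t" "f t - f 0 = t * f' z" by auto
    have "f' z > 0" using e(2)[of z] z t 0 by simp
    then have "f t > f 0" using z t by (smt (verit) mult_pos_pos)
    then show False using max[of t] t by simp
  qed
qed

section \<open>Derivatives along fields with straight integral curves\<close>

definition Om :: "('a \<times> real) set" where "Om = {p. 0 < snd p}"

lemma open_Om: "open (Om :: ('a::topological_space \<times> real) set)"
  unfolding Om_def by (intro open_Collect_less continuous_intros)

definition ddir :: "('a::real_normed_vector \<times> real \<Rightarrow> 'a \<times> real) \<Rightarrow> ('a \<times> real \<Rightarrow> real) \<Rightarrow> ('a \<times> real \<Rightarrow> real) \<Rightarrow> bool" where
  "ddir E f f' \<longleftrightarrow> (\<forall>p\<in>Om. ((\<lambda>t. f (p + t *\<^sub>R E p)) has_real_derivative f' p) (at 0))"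

text \<open>The integral curves of such a field are straight lines; for the fields below this is due
  to \<open>bracket e e = 0\<close>. Two successive derivatives along \<open>E\<close> are then
  derivatives of a single function of \<open>t\<close>.\<close>

definition line_field :: "('a::real_normed_vector \<times> real \<Rightarrow> 'a \<times> real) \<Rightarrow> bool" where
  "line_field E \<longleftrightarrow> continuous_on UNIV E \<and> (\<forall>p t. E (p + t *\<^sub>R E p) = E p)"

lemma ddir_shift:
  assumes "line_field E" "ddir E f f'" "p + t *\<^sub>R E p \<in> Om"
  shows "((\<lambda>t. f (p + t *\<^sub>R E p)) has_real_derivative f' (p + t *\<^sub>R E p)) (at t)"
proof -
  have "((\<lambda>r. f ((p + t *\<^sub>R E p) + r *\<^sub>R E p)) has_real_derivative f' (p + t *\<^sub>R E p)) (at 0)"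
    using assms unfolding ddir_def line_field_def by metis
  then have "((\<lambda>r. f (p + (r + t) *\<^sub>R E p)) has_real_derivative f' (p + t *\<^sub>R E p)) (at 0)"
    by (simp add: scaleR_left_distrib ac_simps)
  then show ?thesis
    using DERIV_shift[of "\<lambda>t. f (p + t *\<^sub>R E p)" _ 0 t] by simp
qed

context htype
begin

definition XF :: "'v \<Rightarrow> ('v \<times> 'z) \<times> real \<Rightarrow> ('v \<times> 'z) \<times> real" where
  "XF e p = ((e, (1 / 2) *\<^sub>R bracket (fst (fst p)) e), 0)"

definition ZF :: "'z \<Rightarrow> ('v \<times> 'z) \<times> real \<Rightarrow> ('v \<times> 'z) \<times> real" where
  "ZF e p = ((0, e), 0)"

definition RF :: "('v \<times> 'z) \<times> real \<Rightarrow> ('v \<times> 'z) \<times> real" where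
  "RF p = ((0, 0), 1)"

definition fields :: "(('v \<times> 'z) \<times> real \<Rightarrow> ('v \<times> 'z) \<times> real) set" where
  "fields = XF ` Basis \<union> {RF} \<union> ZF ` Basis"

lemma line_field: "E \<in> fields \<Longrightarrow> line_field E"
  unfolding fields_def line_field_def XF_def[abs_def] ZF_def[abs_def] RF_def[abs_def]
  by (auto intro!: continuous_intros br.continuous_on simp: br.add_left br.scaleR_left)

lemma fields_continuous: "E \<in> fields \<Longrightarrow> continuous_on S E"
  using line_field unfolding line_field_def by (blast intro: continuous_on_subset)

lemma fields_const: "E \<in> fields \<Longrightarrow> E (p + t *\<^sub>R E p) = E p"
  using line_field unfolding line_field_def by blast

text \<open>
  Derivatives are only taken along the fields: the maximum principle needs no others, and their
  existence and continuity pass to left convolutions.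
\<close>

definition jet ::
  "(('v \<times> 'z) \<times> real \<Rightarrow> real) \<Rightarrow> ((('v \<times> 'z) \<times> real \<Rightarrow> ('v \<times> 'z) \<times> real) \<Rightarrow> ('v \<times> 'z) \<times> real \<Rightarrow> real) \<Rightarrow>
   ((('v \<times> 'z) \<times> real \<Rightarrow> ('v \<times> 'z) \<times> real) \<Rightarrow> ('v \<times> 'z) \<times> real \<Rightarrow> real) \<Rightarrow> bool" where
  "jet f D1 D2 \<longleftrightarrow> continuous_on Om f \<and>
    (\<forall>E\<in>fields. continuous_on Om (D1 E) \<and> continuous_on Om (D2 E) \<and> ddir E f (D1 E) \<and> ddir E (D1 E) (D2 E))"

definition Lop where
  "Lop D1 D2 p = (\<Sum>e\<in>Basis. D2 (XF e) p) + D2 RF p + (1 - 2 * s) / snd p * D1 RF p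
     + (snd p)\<^sup>2 / 4 * (\<Sum>e\<in>Basis. D2 (ZF e) p)"

definition sol :: "(('v \<times> 'z) \<times> real \<Rightarrow> real) \<Rightarrow> bool" where
  "sol f \<longleftrightarrow> (\<exists>D1 D2. jet f D1 D2 \<and> (\<forall>p\<in>Om. Lop D1 D2 p = 0))"

lemma jet_lincomb:
  assumes "jet f D1 D2" "jet g E1 E2"
  shows "jet (\<lambda>p. a * f p + b * g p) (\<lambda>E p. a * D1 E p + b * E1 E p) (\<lambda>E p. a * D2 E p + b * E2 E p)"
  using assms unfolding jet_def ddir_def
  by (auto intro!: continuous_intros derivative_eq_intros)

lemma Lop_lincomb:
  "Lop (\<lambda>E p. a * D1 E p + b * E1 E p) (\<lambda>E p. a * D2 E p + b * E2 E p) p = a * Lop D1 D2 p + b * Lop E1 E2 p"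
  by (simp add: Lop_def sum.distrib algebra_simps flip: sum_distrib_left)

lemma sol_lincomb: "sol f \<Longrightarrow> sol g \<Longrightarrow> sol (\<lambda>p. a * f p + b * g p)"
  unfolding sol_def by (elim exE conjE, intro exI conjI, rule jet_lincomb, assumption+) (simp add: Lop_lincomb)

lemma jet_mult:
  assumes "jet f D1 D2" "jet g E1 E2"
  shows "jet (\<lambda>p. f p * g p) (\<lambda>E p. D1 E p * g p + f p * E1 E p)
      (\<lambda>E p. D2 E p * g p + 2 * (D1 E p * E1 E p) + f p * E2 E p)"
  using assms unfolding jet_def ddir_def
  by (auto intro!: continuous_intros derivative_eq_intros)

lemma jet_powr:
  assumes "jet f D1 D2" and pos: "\<And>p. p \<in> Om \<Longrightarrow> f p > 0"
  shows "jet (\<lambda>p. f p powr a) (\<lambda>E p. a * f p powr (a - 1) * D1 E p)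
      (\<lambda>E p. a * (a - 1) * f p powr (a - 2) * (D1 E p)\<^sup>2 + a * f p powr (a - 1) * D2 E p)"
proof -
  have [simp]: "f p \<noteq> 0" if "p \<in> Om" for p using pos[OF that] by simp
  have 1: "((\<lambda>t. f (p + t *\<^sub>R E p) powr b) has_real_derivative b * f p powr (b - 1) * D1 E p) (at 0)"
    if "p \<in> Om" "E \<in> fields" for p E b
  proof -
    have "((\<lambda>t. f (p + t *\<^sub>R E p)) has_real_derivative D1 E p) (at 0)"
      using that assms(1) unfolding jet_def ddir_def by blast
    from DERIV_fun_powr[OF this] pos[OF that(1)] show ?thesis by simp
  qed
  show ?thesis
    using assms(1) unfolding jet_def ddir_def
    by (auto intro!: continuous_intros derivative_eq_intros 1 pos simp: power2_eq_square)
qed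

lemma jet_rho: "jet snd (\<lambda>E p. snd (E p)) (\<lambda>E p. 0)"
  unfolding jet_def ddir_def
proof (intro conjI ballI)
  fix E p assume E: "E \<in> fields" and p: "p \<in> (Om :: (('v \<times> 'z) \<times> real) set)"
  show "((\<lambda>t. snd (p + t *\<^sub>R E p)) has_real_derivative snd (E p)) (at 0)"
    by (auto intro!: derivative_eq_intros)
qed (auto intro!: continuous_intros fields_continuous simp: fields_const)

definition G1 where
  "G1 E p = 4 * ((snd p)\<^sup>2 + (norm (fst (fst p)))\<^sup>2) * (fst (fst p) \<bullet> fst (fst (E p)) + snd p * snd (E p))
    + 32 * (snd (fst p) \<bullet> snd (fst (E p)))"

definition G2 where
  "G2 E p = 8 * (fst (fst p) \<bullet> fst (fst (E p)) + snd p * snd (E p))\<^sup>2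
    + 4 * ((snd p)\<^sup>2 + (norm (fst (fst p)))\<^sup>2) * ((norm (fst (fst (E p))))\<^sup>2 + (snd (E p))\<^sup>2)
    + 32 * (norm (snd (fst (E p))))\<^sup>2"

lemma jet_G: "jet (\<lambda>p. G (snd p) (fst p)) G1 G2"
proof -
  have d1: "((\<lambda>t. G (snd (p + t *\<^sub>R e)) (fst (p + t *\<^sub>R e))) has_real_derivative G1 (\<lambda>_. e) p) (at 0)" for p e
    unfolding G_def G1_def power2_norm_eq_inner fst_add snd_add fst_scaleR snd_scaleR
    by (auto intro!: derivative_eq_intros simp: inner_commute algebra_simps)
  have d2: "((\<lambda>t. G1 (\<lambda>_. e) (p + t *\<^sub>R e)) has_real_derivative G2 (\<lambda>_. e) p) (at 0)" for p e
    unfolding G2_def G1_def power2_norm_eq_inner fst_add snd_add fst_scaleR snd_scaleR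
    by (auto intro!: derivative_eq_intros simp: inner_commute power2_eq_square algebra_simps)
  have g: "G1 E p = G1 (\<lambda>_. E p) p" "G2 E p = G2 (\<lambda>_. E p) p"
    "G1 E (p + t *\<^sub>R E p) = G1 (\<lambda>_. E p) (p + t *\<^sub>R E p)" if "E \<in> fields"
      for E :: "('v \<times> 'z) \<times> real \<Rightarrow> ('v \<times> 'z) \<times> real" and p t
    using fields_const[OF that] by (simp_all add: G1_def G2_def)
  show ?thesis
    unfolding jet_def ddir_def
  proof (intro conjI ballI)
    fix E assume E: "E \<in> fields"
    show "continuous_on Om (G1 E)" "continuous_on Om (G2 E)"
      unfolding G1_def G2_def by (intro continuous_intros fields_continuous[OF E])+
    fix p :: "('v \<times> 'z) \<times> real"
    show "((\<lambda>t. G (snd (p + t *\<^sub>R E p)) (fst (p + t *\<^sub>R E p))) has_real_derivative G1 E p) (at 0)"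
      using d1[of p "E p"] g[OF E] by simp
    show "((\<lambda>t. G1 E (p + t *\<^sub>R E p)) has_real_derivative G2 E p) (at 0)"
      using d2[of "E p" p] g[OF E] by simp
  qed (intro continuous_intros)
qed

text \<open>The bracket contributes \<open>8 * m * (norm v)\<^sup>2\<close> through
  \<open>sum_norm_bracket_power2\<close>, the central fields \<open>8 * m * \<rho>\<^sup>2\<close>.
  The coefficient \<open>\<rho>\<^sup>2 / 4\<close> in the equation is exactly what joins the two to
  a multiple of \<open>\<rho>\<^sup>2 + (norm v)\<^sup>2\<close>.\<close>

lemma sum_G2:
  "(\<Sum>e\<in>Basis. G2 (XF e) p) + G2 RF p + (snd p)\<^sup>2 / 4 * (\<Sum>e\<in>Basis. G2 (ZF e) p)
     = (12 + 8 * n + 8 * m) * ((snd p)\<^sup>2 + (norm (fst (fst p)))\<^sup>2)"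
proof -
  obtain v z \<rho> where p: "p = ((v, z), \<rho>)" by (metis surj_pair)
  have "(\<Sum>e\<in>Basis. G2 (XF e) p) = 8 * (\<Sum>e\<in>Basis. (v \<bullet> e)\<^sup>2) + (\<Sum>e\<in>(Basis::'v set). 4 * (\<rho>\<^sup>2 + (norm v)\<^sup>2))
      + 8 * (\<Sum>e\<in>Basis. (norm (bracket v e))\<^sup>2)"
    by (simp add: G2_def XF_def p sum.distrib sum_distrib_left power_divide)
  also have "(\<Sum>e\<in>Basis. (v \<bullet> e)\<^sup>2) = (norm v)\<^sup>2"
    by (simp add: power2_norm_eq_inner) (subst euclidean_inner, simp add: power2_eq_square)
  finally show ?thesis
    by (simp add: sum_norm_bracket_power2 G2_def RF_def ZF_def p dim_z dim_v algebra_simps)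
qed

text \<open>The squared gradient of \<open>G\<close> with respect to the operator. The mixed term
  vanishes by \<open>sum_inner_mult_inner_bracket\<close>. Divisibility of the rest by
  \<open>G\<close> is what lets the derivatives of a power of \<open>G\<close> collapse to a single
  power in \<open>jet_Q\<close>.\<close>

lemma sum_G1:
  "(\<Sum>e\<in>Basis. (G1 (XF e) p)\<^sup>2) + (G1 RF p)\<^sup>2 + (snd p)\<^sup>2 / 4 * (\<Sum>e\<in>Basis. (G1 (ZF e) p)\<^sup>2)
     = 16 * ((snd p)\<^sup>2 + (norm (fst (fst p)))\<^sup>2) * G (snd p) (fst p)"
proof -
  obtain v z \<rho> where p: "p = ((v, z), \<rho>)" by (metis surj_pair)
  define R where "R = \<rho>\<^sup>2 + (norm v)\<^sup>2"
  have nrm: "(\<Sum>e\<in>Basis. (x \<bullet> e)\<^sup>2) = (norm x)\<^sup>2" for x :: "'c::euclidean_space"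
    by (simp add: power2_norm_eq_inner) (subst euclidean_inner, simp add: power2_eq_square)
  have "(G1 (XF e) p)\<^sup>2 = 16 * R\<^sup>2 * (v \<bullet> e)\<^sup>2 + 128 * R * ((v \<bullet> e) * (z \<bullet> bracket v e)) + 256 * (z \<bullet> bracket v e)\<^sup>2" for e
  proof -
    have "G1 (XF e) p = 4 * R * (v \<bullet> e) + 16 * (z \<bullet> bracket v e)"
      by (simp add: G1_def XF_def p R_def)
    then show ?thesis
      by (simp add: power2_eq_square algebra_simps)
  qed
  then have 1: "(\<Sum>e\<in>Basis. (G1 (XF e) p)\<^sup>2) = 16 * R\<^sup>2 * (norm v)\<^sup>2 + 256 * ((norm z)\<^sup>2 * (norm v)\<^sup>2)"
    by (simp add: sum.distrib sum_inner_bracket_power2 sum_inner_mult_inner_bracket nrm flip: sum_distrib_left)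
  have 2: "(\<Sum>e\<in>Basis. (G1 (ZF e) p)\<^sup>2) = 1024 * (norm z)\<^sup>2"
    by (simp add: G1_def ZF_def p nrm power_mult_distrib flip: sum_distrib_left)
  have 3: "G1 RF p = 4 * R * \<rho>"
    by (simp add: G1_def RF_def p R_def)
  show ?thesis
    unfolding 1 2 3 by (simp add: G_def p R_def[symmetric]) (simp add: R_def power2_eq_square algebra_simps)
qed

definition Q :: "real \<Rightarrow> real \<Rightarrow> ('v \<times> 'z) \<times> real \<Rightarrow> real" where
  "Q a b p = snd p powr a * G (snd p) (fst p) powr b"

text \<open>This ansatz contains both the kernel and the two pieces of the barrier. The squared
  gradient comes with \<open>G powr (b - 2)\<close>, and \<open>sum_G1\<close> raises this to
  \<open>b - 1\<close>, the power in the other terms; hence only two terms survive. The first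
  vanishes when its last factor does, the second when \<open>a\<close> is \<open>0\<close> or
  \<open>2 * s\<close>.\<close>

lemma jet_Q:
  obtains D1 D2 where "jet (Q a b) D1 D2"
    "\<And>p. p \<in> Om \<Longrightarrow> Lop D1 D2 p =
       snd p powr a * b * G (snd p) (fst p) powr (b - 1) * ((snd p)\<^sup>2 + (norm (fst (fst p)))\<^sup>2) *
         (8 * n + 8 * m - 8 * s + 16 * b + 8 * a)
       + a * (a - 2 * s) * snd p powr (a - 2) * G (snd p) (fst p) powr b"
proof -
  have pos: "0 < G (snd p) (fst p)" "0 < snd p" if "p \<in> Om" for p :: "('v \<times> 'z) \<times> real"
    using that G_pos by (auto simp: Om_def)
  note j = jet_mult[OF jet_powr[OF jet_rho pos(2), of a] jet_powr[OF jet_G pos(1), of b]]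
  define D1 where "D1 = (\<lambda>E p. a * snd p powr (a - 1) * snd (E p) * G (snd p) (fst p) powr b +
      snd p powr a * (b * G (snd p) (fst p) powr (b - 1) * G1 E p))"
  define D2 where "D2 = (\<lambda>E p. (a * (a - 1) * snd p powr (a - 2) * (snd (E p))\<^sup>2 + a * snd p powr (a - 1) * 0) *
      G (snd p) (fst p) powr b +
      2 * (a * snd p powr (a - 1) * snd (E p) * (b * G (snd p) (fst p) powr (b - 1) * G1 E p)) +
      snd p powr a *
      (b * (b - 1) * G (snd p) (fst p) powr (b - 2) * (G1 E p)\<^sup>2 + b * G (snd p) (fst p) powr (b - 1) * G2 E p))"
  show ?thesis
  proof (rule that[of D1 D2])
    show "jet (Q a b) D1 D2"
      unfolding D1_def D2_def Q_def[abs_def] by (rule j)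
    fix p :: "('v \<times> 'z) \<times> real" assume p: "p \<in> Om"
    define r g R where "r = snd p" and "g = G (snd p) (fst p)" and "R = (snd p)\<^sup>2 + (norm (fst (fst p)))\<^sup>2"
    have rg: "r > 0" "g > 0" using pos[OF p] by (auto simp: r_def g_def)
    have G1R: "G1 RF p = 4 * R * r"
      by (simp add: G1_def RF_def R_def r_def)
    \<comment> \<open>With all powers written through the exponents \<open>a - 2\<close> and
      \<open>b - 2\<close>, the remaining identity is polynomial.\<close>
    have pr1: "x powr (c - 1) = x powr (c - 2) * x" if "x > 0" for x c :: real
      using that powr_add[of x "c - 2" 1] by simp
    have pr2: "x powr c = x powr (c - 2) * x\<^sup>2" if "x > 0" for x c :: real
      using that powr_add[of x "c - 2" 2] by simp
    note pr = pr1[OF rg(1), of a] pr2[OF rg(1), of a] pr1[OF rg(2), of b] pr2[OF rg(2), of b]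
    define q P where "q = g powr (b - 2)" and "P = r powr (a - 2)"
    note pr = pr[folded q_def P_def]
    define SX1 SX2 SZ1 SZ2 where "SX1 = (\<Sum>e\<in>Basis. (G1 (XF e) p)\<^sup>2)" and "SX2 = (\<Sum>e\<in>Basis. G2 (XF e) p)"
      and "SZ1 = (\<Sum>e\<in>Basis. (G1 (ZF e) p)\<^sup>2)" and "SZ2 = (\<Sum>e\<in>Basis. G2 (ZF e) p)"
    have DX: "D2 (XF e) p = r powr a * (b * (b - 1) * q * (G1 (XF e) p)\<^sup>2 + b * g powr (b - 1) * G2 (XF e) p)" for e
      by (simp add: D2_def r_def g_def q_def XF_def)
    have DZ: "D2 (ZF e) p = r powr a * (b * (b - 1) * q * (G1 (ZF e) p)\<^sup>2 + b * g powr (b - 1) * G2 (ZF e) p)" for e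
      by (simp add: D2_def r_def g_def q_def ZF_def)
    have DR2: "D2 RF p = a * (a - 1) * P * g powr b + 2 * (a * r powr (a - 1) * (b * g powr (b - 1) * G1 RF p))
        + r powr a * (b * (b - 1) * q * (G1 RF p)\<^sup>2 + b * g powr (b - 1) * G2 RF p)"
      by (simp add: D2_def r_def g_def q_def P_def RF_def)
    have DR1: "D1 RF p = a * r powr (a - 1) * g powr b + r powr a * (b * g powr (b - 1) * G1 RF p)"
      by (simp add: D1_def r_def g_def q_def P_def RF_def)
    have U1: "SX1 + (4 * R * r)\<^sup>2 + r\<^sup>2 / 4 * SZ1 = 16 * R * g"
      unfolding SX1_def SZ1_def R_def g_def r_def G1R[unfolded R_def r_def, symmetric] by (rule sum_G1)
    have U2: "SX2 + G2 RF p + r\<^sup>2 / 4 * SZ2 = (12 + 8 * n + 8 * m) * R"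
      unfolding SX2_def SZ2_def R_def g_def r_def by (rule sum_G2)
    \<comment> \<open>The two identities eliminate the sums over the horizontal fields; the sums
      over the central fields then cancel.\<close>
    have SX: "SX1 = 16 * R * g - (4 * R * r)\<^sup>2 - r\<^sup>2 / 4 * SZ1"
      "SX2 = (12 + 8 * n + 8 * m) * R - G2 RF p - r\<^sup>2 / 4 * SZ2"
      using U1 U2 by linarith+
    have L: "Lop D1 D2 p = r powr a * (b * (b - 1) * q * SX1 + b * g powr (b - 1) * SX2) + D2 RF p
        + (1 - 2 * s) / r * D1 RF p + r\<^sup>2 / 4 * (r powr a * (b * (b - 1) * q * SZ1 + b * g powr (b - 1) * SZ2))"
      unfolding Lop_def DX DZ r_def[symmetric] SX1_def SX2_def SZ1_def SZ2_def sum_distrib_left[symmetric] sum.distrib ..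
    have f1: "(1 - 2 * s) / r * (a * (P * r) * (q * g\<^sup>2) + P * r\<^sup>2 * (b * (q * g) * (4 * R * r)))
        = (1 - 2 * s) * (a * P * (q * g\<^sup>2) + P * r\<^sup>2 * b * (q * g) * 4 * R)"
      using rg by (simp add: field_simps power2_eq_square)
    show "Lop D1 D2 p =
       snd p powr a * b * G (snd p) (fst p) powr (b - 1) * ((snd p)\<^sup>2 + (norm (fst (fst p)))\<^sup>2) *
         (8 * n + 8 * m - 8 * s + 16 * b + 8 * a)
       + a * (a - 2 * s) * snd p powr (a - 2) * G (snd p) (fst p) powr b"
      unfolding g_def[symmetric] R_def[symmetric]
      unfolding r_def[symmetric] L DR2 DR1 pr G1R f1 P_def[symmetric] SX by (simp add: field_simps power2_eq_square)
  qed
qed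

text \<open>The exponents \<open>a = 2 * s\<close> and \<open>b = - kap\<close> annihilate both
  coefficients in \<open>jet_Q\<close>.\<close>

lemma sol_K: "sol (\<lambda>p. K (snd p) (fst p))"
proof -
  obtain D1 D2 where D: "jet (Q (2 * s) (- kap)) D1 D2"
    "\<And>p. p \<in> Om \<Longrightarrow> Lop D1 D2 p =
       snd p powr (2 * s) * (- kap) * G (snd p) (fst p) powr (- kap - 1) * ((snd p)\<^sup>2 + (norm (fst (fst p)))\<^sup>2) *
         (8 * n + 8 * m - 8 * s + 16 * (- kap) + 8 * (2 * s))
       + 2 * s * (2 * s - 2 * s) * snd p powr (2 * s - 2) * G (snd p) (fst p) powr (- kap)"
    using jet_Q by blast
  have "jet (\<lambda>p. K (snd p) (fst p)) D1 D2"
    using D(1) unfolding K_def Q_def[abs_def] by simp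
  moreover have "Lop D1 D2 p = 0" if "p \<in> Om" for p
    unfolding D(2)[OF that] by (simp add: kap_def field_simps)
  ultimately show ?thesis unfolding sol_def by blast
qed

end

lemma line_in_open:
  fixes p :: "'a::real_normed_vector"
  assumes "open S" "p \<in> S"
  obtains d where "d > 0" "\<And>t. \<bar>t\<bar> \<le> d \<Longrightarrow> p + t *\<^sub>R e \<in> S"
proof -
  have "open ((\<lambda>t. p + t *\<^sub>R e) -` S)"
    by (intro open_vimage assms continuous_intros)
  moreover have "0 \<in> (\<lambda>t. p + t *\<^sub>R e) -` S" using assms by simp
  ultimately obtain d where "d > 0" "cball 0 d \<subseteq> (\<lambda>t. p + t *\<^sub>R e) -` S"
    by (meson open_contains_cball)
  then show ?thesis by (intro that[of d]) (auto simp: subset_iff dist_norm)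
qed

context htype
begin

section \<open>The barrier and the maximum principle\<close>

lemma G_coercive:
  assumes "\<rho> > 0" "G \<rho> x \<le> T" "T \<ge> 1"
  shows "\<rho> \<le> T" "norm x \<le> 2 * T"
proof -
  have pw: "y \<le> T" if "y ^ k \<le> T" "0 \<le> y" "k > 0" for y and k :: nat
  proof (rule ccontr)
    assume "\<not> y \<le> T"
    then have "y > 1" "y > T" using assms by auto
    then have "y ^ 1 \<le> y ^ k" using that by (intro power_increasing) auto
    then show False using \<open>y > T\<close> that by simp
  qed
  have "\<rho> ^ 4 \<le> T" using G_ge[of \<rho> x] assms by simp
  then show "\<rho> \<le> T" using pw[of \<rho> 4] assms by simp
  have "((norm (fst x))\<^sup>2)\<^sup>2 \<le> (\<rho>\<^sup>2 + (norm (fst x))\<^sup>2)\<^sup>2" by (intro power_mono) auto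
  then have *: "norm (fst x) ^ 4 \<le> (\<rho>\<^sup>2 + (norm (fst x))\<^sup>2)\<^sup>2" by simp
  have "norm (fst x) ^ 4 \<le> T"
    using assms(2)[unfolded G_def] * zero_le_power2[of "norm (snd x)"] by linarith
  moreover have "(norm (snd x))\<^sup>2 \<le> T"
    using assms(2)[unfolded G_def] zero_le_power2[of "norm (snd x)"] zero_le_power2[of "\<rho>\<^sup>2 + (norm (fst x))\<^sup>2"]
    by linarith
  ultimately have "norm (fst x) \<le> T" "norm (snd x) \<le> T"
    using pw[of "norm (fst x)" 4] pw[of "norm (snd x)" 2] by auto
  then show "norm x \<le> 2 * T"
    using norm_Pair_le[of "fst x" "snd x"] by simp
qed

text \<open>
  The barrier is \<open>G\<^sup>\<beta> + k \<rho>\<^sup>b\<close> with \<open>4 \<beta> = b < 2 s\<close>. The operator maps \<open>\<rho>\<^sup>b\<close> to a negative multiple of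
  \<open>\<rho>\<^sup>b\<^sup>-\<^sup>2\<close>, which dominates the image of \<open>G\<^sup>\<beta>\<close> because \<open>G \<ge> \<rho>\<^sup>4\<close>.
\<close>

lemma barrier:
  obtains B D1 D2 where "jet B D1 D2" "\<And>p. p \<in> Om \<Longrightarrow> B p \<ge> 0" "\<And>p. p \<in> Om \<Longrightarrow> Lop D1 D2 p < 0"
    "\<And>M. \<exists>R. \<forall>p\<in>Om. B p \<le> M \<longrightarrow> norm (fst p) \<le> R \<and> snd p \<le> R"
proof -
  \<comment> \<open>\<open>b < 2 * s\<close> makes the image of \<open>\<rho> powr b\<close>
    negative; \<open>b \<le> 1\<close> keeps \<open>\<beta> - 1/2\<close> negative, so that
    \<open>G\<close> may be replaced by \<open>\<rho> ^ 4\<close> in the estimate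
    \<open>gR\<close>.\<close>
  define b where "b = min s 1"
  have b: "0 < b" "b < 2 * s" "b \<le> 1" using s_pos by (auto simp: b_def)
  define \<beta> where "\<beta> = b / 4"
  obtain D1 D2 where D: "jet (Q 0 \<beta>) D1 D2"
    "\<And>p. p \<in> Om \<Longrightarrow> Lop D1 D2 p =
       snd p powr 0 * \<beta> * G (snd p) (fst p) powr (\<beta> - 1) * ((snd p)\<^sup>2 + (norm (fst (fst p)))\<^sup>2) *
         (8 * n + 8 * m - 8 * s + 16 * \<beta> + 8 * 0)
       + 0 * (0 - 2 * s) * snd p powr (0 - 2) * G (snd p) (fst p) powr \<beta>"
    using jet_Q[of 0 \<beta>] by blast
  obtain E1 E2 where E: "jet (Q b 0) E1 E2"
    "\<And>p. p \<in> Om \<Longrightarrow> Lop E1 E2 p =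
       snd p powr b * 0 * G (snd p) (fst p) powr (0 - 1) * ((snd p)\<^sup>2 + (norm (fst (fst p)))\<^sup>2) *
         (8 * n + 8 * m - 8 * s + 16 * 0 + 8 * b)
       + b * (b - 2 * s) * snd p powr (b - 2) * G (snd p) (fst p) powr 0"
    using jet_Q[of b 0] by blast
  define c where "c = \<beta> * \<bar>8 * n + 8 * m - 8 * s + 16 * \<beta>\<bar>"
  \<comment> \<open>\<open>c\<close> bounds the coefficient in the image of
    \<open>Q 0 \<beta>\<close>. The factor \<open>k\<close> makes the image of the second piece
    equal to \<open>- (c + 1)\<close> times \<open>\<rho> powr (b - 2)\<close>; the extra unit makes
    the sum strictly negative.\<close>
  define k where "k = (c + 1) / (b * (2 * s - b))"
  have c: "c \<ge> 0" using b by (simp add: c_def \<beta>_def)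
  have k: "k > 0" "k * (b * (b - 2 * s)) = - (c + 1)"
    using b c by (auto simp: k_def field_simps)
  let ?B = "\<lambda>p. 1 * Q 0 \<beta> p + k * Q b 0 p"
  have j: "jet ?B (\<lambda>E p. 1 * D1 E p + k * E1 E p) (\<lambda>E p. 1 * D2 E p + k * E2 E p)"
    by (rule jet_lincomb[OF D(1) E(1)])
  show ?thesis
  proof (rule that[OF j])
    fix p :: "('v \<times> 'z) \<times> real" assume p: "p \<in> Om"
    show "?B p \<ge> 0" using k by (simp add: Q_def)
    define r g where "r = snd p" and "g = G r (fst p)"
    have rg: "r > 0" "g > 0" using p G_pos by (auto simp: Om_def r_def g_def)
    define R where "R = r\<^sup>2 + (norm (fst (fst p)))\<^sup>2"
    have R: "R \<ge> 0" by (simp add: R_def)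
    have "R\<^sup>2 \<le> g" by (simp add: R_def g_def G_def)
    then have Rg: "R \<le> g powr (1/2)"
      using R rg by (simp add: powr_half_sqrt real_le_rsqrt)
    have "g powr (\<beta> - 1) * R \<le> g powr (\<beta> - 1) * g powr (1/2)"
      using Rg by (intro mult_left_mono) auto
    also have "\<dots> = g powr (\<beta> - 1/2)"
      by (simp flip: powr_add)
    also have "\<dots> \<le> (r ^ 4) powr (\<beta> - 1/2)"
      using rg G_ge[of r "fst p"] b by (intro powr_mono2') (auto simp: g_def \<beta>_def)
    also have "\<dots> = r powr (b - 2)"
      using rg by (simp add: power_powr \<beta>_def algebra_simps)
    finally have gR: "g powr (\<beta> - 1) * R \<le> r powr (b - 2)" .
    have "Lop D1 D2 p = (g powr (\<beta> - 1) * R) * (\<beta> * (8 * n + 8 * m - 8 * s + 16 * \<beta>))"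
      using rg unfolding D(2)[OF p] by (simp add: r_def g_def R_def)
    also have "\<dots> \<le> (g powr (\<beta> - 1) * R) * c"
      using R b by (intro mult_left_mono) (auto simp: c_def \<beta>_def intro!: mult_left_mono divide_right_mono)
    also have "\<dots> \<le> r powr (b - 2) * c"
      using gR c by (intro mult_right_mono)
    finally have 1: "Lop D1 D2 p \<le> r powr (b - 2) * c" .
    have "k * Lop E1 E2 p = (k * (b * (b - 2 * s))) * r powr (b - 2)"
      using rg unfolding E(2)[OF p] by (simp add: r_def g_def)
    then have 2: "k * Lop E1 E2 p = - (c + 1) * r powr (b - 2)"
      by (simp only: k)
    have "r powr (b - 2) > 0" using rg by simp
    moreover have "Lop D1 D2 p + k * Lop E1 E2 p \<le> - (r powr (b - 2))"
      using 1 2 by (simp add: algebra_simps)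
    ultimately have "Lop D1 D2 p + k * Lop E1 E2 p < 0"
      by linarith
    then show "Lop (\<lambda>E p. 1 * D1 E p + k * E1 E p) (\<lambda>E p. 1 * D2 E p + k * E2 E p) p < 0"
      unfolding Lop_lincomb by simp
  next
    fix M
    define T where "T = max 1 (\<bar>M\<bar> powr (1 / \<beta>))"
    show "\<exists>R. \<forall>p\<in>Om. ?B p \<le> M \<longrightarrow> norm (fst p) \<le> R \<and> snd p \<le> R"
    proof (intro exI[of _ "2 * T"] ballI impI)
      fix p :: "('v \<times> 'z) \<times> real" assume p: "p \<in> Om" "?B p \<le> M"
      have r: "snd p > 0" using p by (simp add: Om_def)
      define g where "g = G (snd p) (fst p)"
      have g: "g > 0" using G_pos r by (simp add: g_def)
      have "0 \<le> k * Q b 0 p" using k by (simp add: Q_def)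
      then have "g powr \<beta> \<le> \<bar>M\<bar>" using p(2) r by (simp add: Q_def g_def)
      then have "(g powr \<beta>) powr (1 / \<beta>) \<le> \<bar>M\<bar> powr (1 / \<beta>)"
        using b by (intro powr_mono2) (auto simp: \<beta>_def)
      then have "g \<le> T"
        using g b by (simp add: powr_powr \<beta>_def T_def)
      moreover have "T \<ge> 1" by (simp add: T_def)
      ultimately show "norm (fst p) \<le> 2 * T \<and> snd p \<le> 2 * T"
        using G_coercive[OF r, of "fst p" T] by (simp add: g_def)
    qed
  qed
qed

text \<open>At an interior maximum of \<open>w - \<epsilon> * B\<close> the operator would be
  nonpositive by the second derivative test along each field, yet it equals
  \<open>- \<epsilon>\<close> times the negative image of \<open>B\<close>. Where
  \<open>\<epsilon> * B > M\<close> the difference is negative, so \<open>w\<close> has to be small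
  only on a ball whose radius depends on \<open>M / \<epsilon>\<close>, and only for some
  arbitrarily small \<open>\<rho>\<close>. \<open>B\<close> and \<open>R\<close> are chosen before
  \<open>w\<close> because \<open>w\<close> and \<open>\<epsilon>\<close> vary later at a fixed
  point.\<close>

lemma max_principle:
  "\<exists>(B :: ('v \<times> 'z) \<times> real \<Rightarrow> real) (R :: real \<Rightarrow> real). \<forall>w M \<epsilon>. \<forall>p\<in>Om. sol w \<longrightarrow> (\<forall>p\<in>Om. w p \<le> M) \<longrightarrow> \<epsilon> > 0 \<longrightarrow>
     (\<forall>\<eta>>0. \<exists>\<rho>. 0 < \<rho> \<and> \<rho> < \<eta> \<and> (\<forall>x. norm x \<le> R (M / \<epsilon>) \<longrightarrow> w (x, \<rho>) \<le> \<epsilon>)) \<longrightarrow>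
     w p \<le> \<epsilon> * B p + \<epsilon>"
proof -
  obtain B D1 D2 where B: "jet B D1 D2" "\<And>p. p \<in> Om \<Longrightarrow> B p \<ge> 0" "\<And>p. p \<in> Om \<Longrightarrow> Lop D1 D2 p < 0"
    "\<And>M. \<exists>R. \<forall>p\<in>Om. B p \<le> M \<longrightarrow> norm (fst p) \<le> R \<and> snd p \<le> R"
    using barrier by blast
  obtain R where R: "\<And>M p. p \<in> Om \<Longrightarrow> B p \<le> M \<Longrightarrow> norm (fst p) \<le> R M \<and> snd p \<le> R M"
    using B(4) by metis
  show ?thesis
  proof (intro exI[of _ B] exI[of _ R] allI ballI impI)
    fix w M and \<epsilon> :: real and p0 :: "('v \<times> 'z) \<times> real"
    assume "sol w" and "\<forall>p\<in>Om. w p \<le> M" and \<epsilon>: "\<epsilon> > 0" and p0: "p0 \<in> Om"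
      and "\<forall>\<eta>>0. \<exists>\<rho>. 0 < \<rho> \<and> \<rho> < \<eta> \<and> (\<forall>x. norm x \<le> R (M / \<epsilon>) \<longrightarrow> w (x, \<rho>) \<le> \<epsilon>)"
    then have M: "\<And>p. p \<in> Om \<Longrightarrow> w p \<le> M"
      and small: "\<And>\<eta>. \<eta> > 0 \<Longrightarrow> \<exists>\<rho>. 0 < \<rho> \<and> \<rho> < \<eta> \<and> (\<forall>x. norm x \<le> R (M / \<epsilon>) \<longrightarrow> w (x, \<rho>) \<le> \<epsilon>)"
      by auto
    from \<open>sol w\<close> obtain W1 W2 where W: "jet w W1 W2" "\<And>p. p \<in> Om \<Longrightarrow> Lop W1 W2 p = 0"
      by (auto simp: sol_def)
    define q where "q p = 1 * w p + (- \<epsilon>) * B p" for p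
    have jq: "jet q (\<lambda>E p. 1 * W1 E p + (- \<epsilon>) * D1 E p) (\<lambda>E p. 1 * W2 E p + (- \<epsilon>) * D2 E p)" (is "jet q ?Q1 ?Q2")
      unfolding q_def[abs_def] by (rule jet_lincomb[OF W(1) B(1)])
    show "w p0 \<le> \<epsilon> * B p0 + \<epsilon>"
    proof (rule ccontr)
      assume "\<not> ?thesis"
      then have q0: "q p0 > \<epsilon>" by (simp add: q_def)
      have "0 < snd p0" using p0 by (simp add: Om_def)
      from small[OF this] obtain \<rho> where \<rho>: "0 < \<rho>" "\<rho> < snd p0" "\<And>x. norm x \<le> R (M / \<epsilon>) \<Longrightarrow> w (x, \<rho>) \<le> \<epsilon>"
        by blast
      \<comment> \<open>Above height \<open>\<rho>\<close> and outside this box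
        \<open>q \<le> 0\<close>, and on the bottom face \<open>q \<le> \<epsilon>\<close>. A value
        above \<open>\<epsilon>\<close> thus forces an interior maximum.\<close>
      define C where "C = cball (0 :: 'v \<times> 'z) (R (M / \<epsilon>)) \<times> {\<rho>..R (M / \<epsilon>)}"
      have C: "compact C" unfolding C_def by (intro compact_Times compact_cball compact_Icc)
      have COm: "C \<subseteq> Om" using \<rho> by (auto simp: C_def Om_def)
      have out: "p \<in> C" if "q p > 0" "snd p \<ge> \<rho>" for p
      proof -
        have p: "p \<in> Om" using that \<rho> by (simp add: Om_def)
        have "\<epsilon> * B p \<le> M" using M[OF p] that by (simp add: q_def)
        then have "B p \<le> M / \<epsilon>" using \<epsilon> by (simp add: field_simps)
        from R[OF p this] show ?thesis using that by (cases p) (auto simp: C_def)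
      qed
      have p0C: "p0 \<in> C" using out[of p0] q0 \<epsilon> \<rho> by simp
      have "continuous_on C q"
        using jq COm by (auto simp: jet_def intro: continuous_on_subset)
      then obtain p1 where p1: "p1 \<in> C" "\<And>p. p \<in> C \<Longrightarrow> q p \<le> q p1"
        using continuous_attains_sup[OF C, of q] p0C by blast
      have q1: "q p1 > \<epsilon>" using p1(2)[OF p0C] q0 by simp
      have p1Om: "p1 \<in> Om" using p1 COm by blast
      have max: "q p \<le> q p1" if "snd p > \<rho>" for p
        using out[of p] p1(2)[of p] q1 \<epsilon> that by (cases "q p > 0") auto
      have "snd p1 \<noteq> \<rho>"
      proof
        assume a: "snd p1 = \<rho>"
        then have "w p1 \<le> \<epsilon>" using \<rho>(3)[of "fst p1"] p1(1) by (cases p1) (auto simp: C_def)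
        moreover have "0 \<le> \<epsilon> * B p1" using B(2)[OF p1Om] \<epsilon> by simp
        ultimately show False using q1 by (simp add: q_def)
      qed
      then have snd1: "snd p1 > \<rho>" using p1(1) by (auto simp: C_def)
      have S: "open {p :: ('v \<times> 'z) \<times> real. \<rho> < snd p}"
        by (intro open_Collect_less continuous_intros)
      have der: "?Q1 E p1 = 0 \<and> ?Q2 E p1 \<le> 0" if E: "E \<in> fields" for E
      proof -
        obtain d where d: "d > 0" "\<And>t. \<bar>t\<bar> \<le> d \<Longrightarrow> p1 + t *\<^sub>R E p1 \<in> {p. \<rho> < snd p}"
          using line_in_open[OF S, of p1 "E p1"] snd1 by blast
        have inOm: "p1 + t *\<^sub>R E p1 \<in> Om" if "\<bar>t\<bar> < d" for t
          using d(2)[of t] that \<rho> by (auto simp: Om_def)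
        have dd: "ddir E q (?Q1 E)" "ddir E (?Q1 E) (?Q2 E)"
          using jq E unfolding jet_def by blast+
        have 1: "((\<lambda>t. q (p1 + t *\<^sub>R E p1)) has_real_derivative ?Q1 E (p1 + t *\<^sub>R E p1)) (at t)" if "\<bar>t\<bar> < d" for t
          by (rule ddir_shift[OF line_field[OF E] dd(1) inOm[OF that]])
        have 2: "((\<lambda>t. ?Q1 E (p1 + t *\<^sub>R E p1)) has_real_derivative ?Q2 E p1) (at 0)"
          using dd(2) p1Om unfolding ddir_def by blast
        have 3: "q (p1 + t *\<^sub>R E p1) \<le> q (p1 + 0 *\<^sub>R E p1)" if "\<bar>t\<bar> < d" for t
          using max[of "p1 + t *\<^sub>R E p1"] d(2)[of t] that by simp
        show ?thesis
          using second_derivative_test[OF d(1) 1 2 3] by simp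
      qed
      have "Lop ?Q1 ?Q2 p1 \<le> 0"
      proof -
        have "(\<Sum>e\<in>Basis. ?Q2 (XF e) p1) \<le> 0" "(\<Sum>e\<in>Basis. ?Q2 (ZF e) p1) \<le> 0"
          by (intro sum_nonpos; use der in \<open>auto simp: fields_def\<close>)+
        moreover have "?Q1 RF p1 = 0" "?Q2 RF p1 \<le> 0"
          using der[of RF] by (auto simp: fields_def)
        ultimately show ?thesis
          unfolding Lop_def by (smt (verit) mult_eq_0_iff mult_nonneg_nonpos divide_nonneg_nonneg zero_le_power2)
      qed
      moreover have "Lop ?Q1 ?Q2 p1 > 0"
        unfolding Lop_lincomb using W(2)[OF p1Om] B(3)[OF p1Om] \<epsilon> by (simp add: mult_pos_neg)
      ultimately show False by simp
    qed
  qed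
qed

section \<open>Left convolution of solutions\<close>

definition cint :: "'v \<times> 'z \<Rightarrow> 'v \<times> 'z \<Rightarrow> ('v \<times> 'z \<Rightarrow> real) \<Rightarrow> (('v \<times> 'z) \<times> real \<Rightarrow> real) \<Rightarrow> ('v \<times> 'z) \<times> real \<Rightarrow> real" where
  "cint a b h f p = integral (cbox a b) (\<lambda>y. h y * f (- y \<odot> fst p, snd p))"

text \<open>A left translation maps the line of \<open>E\<close> through \<open>p\<close> to the
  line of \<open>E\<close> through the translated point. Derivatives along the fields can therefore
  be taken under the integral in \<open>cint\<close>.\<close>

lemma fields_left_invariant:
  assumes "E \<in> fields"
  shows "(- y \<odot> fst (p + t *\<^sub>R E p), snd (p + t *\<^sub>R E p)) = (- y \<odot> fst p, snd p) + t *\<^sub>R E (- y \<odot> fst p, snd p)"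
  using assms
  by (auto simp: fields_def XF_def ZF_def RF_def mult_eq br.add_right br.add_left br.diff_left br.minus_left br.scaleR_right
      br.zero_right algebra_simps)

context
  fixes a b :: "'v \<times> 'z" and h :: "'v \<times> 'z \<Rightarrow> real"
  assumes h: "continuous_on (cbox a b) h"
begin

lemma continuous_on_cint_integrand:
  assumes "continuous_on Om f"
  shows "continuous_on (Om \<times> cbox a b) (\<lambda>(p, y). h y * f (- y \<odot> fst p, snd p))"
  unfolding split_def
  by (intro continuous_intros continuous_on_compose2[OF assms] continuous_on_compose2[OF h]) (auto simp: Om_def)

lemma has_integral_cint:
  assumes "continuous_on Om f" "p \<in> Om"
  shows "((\<lambda>y. h y * f (- y \<odot> fst p, snd p)) has_integral cint a b h f p) (cbox a b)"
proof -
  have "continuous_on (cbox a b) (\<lambda>y. h y * f (- y \<odot> fst p, snd p))"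
    using assms(2) by (intro continuous_intros continuous_on_compose2[OF assms(1)] h) (auto simp: Om_def)
  then show ?thesis
    unfolding cint_def by (intro integrable_integral integrable_continuous)
qed

lemma continuous_on_cint:
  assumes "continuous_on Om f" shows "continuous_on Om (cint a b h f)"
  unfolding cint_def by (rule integral_continuous_on_param[OF continuous_on_cint_integrand[OF assms]])

text \<open>The Leibniz rule for gauge integrals over a box, for the sake of which
  \<open>cint\<close> integrates over \<open>cbox a b\<close>.\<close>

lemma ddir_cint:
  assumes E: "E \<in> fields" and f: "continuous_on Om f" "continuous_on Om f'" "ddir E f f'"
  shows "ddir E (cint a b h f) (cint a b h f')"
  unfolding ddir_def
proof
  fix p :: "('v \<times> 'z) \<times> real" assume p: "p \<in> Om"
  obtain d where d: "d > 0" "\<And>t. \<bar>t\<bar> \<le> d \<Longrightarrow> p + t *\<^sub>R E p \<in> Om"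
    using line_in_open[OF open_Om p] by blast
  have "((\<lambda>t. integral (cbox a b) (\<lambda>y. h y * f (- y \<odot> fst (p + t *\<^sub>R E p), snd (p + t *\<^sub>R E p)))) has_vector_derivative
      integral (cbox a b) (\<lambda>y. h y * f' (- y \<odot> fst (p + 0 *\<^sub>R E p), snd (p + 0 *\<^sub>R E p)))) (at 0 within {-d..d})"
  proof (rule leibniz_rule_vector_derivative)
    fix t y assume t: "t \<in> {-d..d}" and y: "y \<in> cbox a b"
    have Om: "p + t *\<^sub>R E p \<in> Om" using d t by auto
    then have "(- y \<odot> fst p, snd p) + t *\<^sub>R E (- y \<odot> fst p, snd p) \<in> Om"
      by (simp add: fields_left_invariant[OF E, symmetric] Om_def)
    from ddir_shift[OF line_field[OF E] f(3) this]
    have "((\<lambda>t. f (- y \<odot> fst (p + t *\<^sub>R E p), snd (p + t *\<^sub>R E p))) has_real_derivative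
        f' (- y \<odot> fst (p + t *\<^sub>R E p), snd (p + t *\<^sub>R E p))) (at t)"
      by (simp only: fields_left_invariant[OF E])
    then show "((\<lambda>t. h y * f (- y \<odot> fst (p + t *\<^sub>R E p), snd (p + t *\<^sub>R E p))) has_vector_derivative
        h y * f' (- y \<odot> fst (p + t *\<^sub>R E p), snd (p + t *\<^sub>R E p))) (at t within {-d..d})"
      by (intro has_real_derivative_iff_has_vector_derivative[THEN iffD1] has_field_derivative_at_within[OF DERIV_cmult])
  next
    fix t assume "t \<in> {-d..d}"
    then have "p + t *\<^sub>R E p \<in> Om" using d by auto
    from has_integral_cint[OF f(1) this]
    show "(\<lambda>y. h y * f (- y \<odot> fst (p + t *\<^sub>R E p), snd (p + t *\<^sub>R E p))) integrable_on cbox a b" by blast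
  next
    have c1: "continuous_on ({-d..d} \<times> cbox a b) (\<lambda>x. (p + fst x *\<^sub>R E p, snd x))"
      by (intro continuous_intros)
    have c2: "(\<lambda>x. (p + fst x *\<^sub>R E p, snd x)) ` ({-d..d} \<times> cbox a b) \<subseteq> Om \<times> cbox a b"
      using d by auto
    from continuous_on_compose2[OF continuous_on_cint_integrand[OF f(2)] c1 c2]
    show "continuous_on ({-d..d} \<times> cbox a b) (\<lambda>(t, y). h y * f' (- y \<odot> fst (p + t *\<^sub>R E p), snd (p + t *\<^sub>R E p)))"
      by (simp add: split_def)
  qed (use d in auto)
  then have "((\<lambda>t. cint a b h f (p + t *\<^sub>R E p)) has_vector_derivative cint a b h f' p) (at 0 within {-d..d})"
    by (simp add: cint_def)
  then show "((\<lambda>t. cint a b h f (p + t *\<^sub>R E p)) has_real_derivative cint a b h f' p) (at 0)"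
    using d by (simp add: has_real_derivative_iff_has_vector_derivative at_within_Icc_at)
qed

text \<open>The coefficients of the operator depend on \<open>\<rho>\<close> alone, which left
  translation does not change, so the operator passes under the integral by linearity.\<close>

lemma sol_cint:
  assumes "sol v" shows "sol (cint a b h v)"
proof -
  obtain D1 D2 where D: "jet v D1 D2" "\<And>p. p \<in> Om \<Longrightarrow> Lop D1 D2 p = 0"
    using assms by (auto simp: sol_def)
  have cont: "continuous_on Om v" "E \<in> fields \<Longrightarrow> continuous_on Om (D1 E)" "E \<in> fields \<Longrightarrow> continuous_on Om (D2 E)"
    "E \<in> fields \<Longrightarrow> ddir E v (D1 E)" "E \<in> fields \<Longrightarrow> ddir E (D1 E) (D2 E)" for E
    using D(1) by (auto simp: jet_def)
  have j: "jet (cint a b h v) (\<lambda>E. cint a b h (D1 E)) (\<lambda>E. cint a b h (D2 E))"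
    unfolding jet_def using cont by (auto intro!: continuous_on_cint ddir_cint)
  moreover have "Lop (\<lambda>E. cint a b h (D1 E)) (\<lambda>E. cint a b h (D2 E)) p = 0" if p: "p \<in> Om" for p
  proof -
    have F: "XF e \<in> fields" "ZF e' \<in> fields" "RF \<in> fields" if "e \<in> Basis" "e' \<in> Basis" for e e'
      using that by (auto simp: fields_def)
    have F: "e \<in> Basis \<Longrightarrow> XF e \<in> fields" "e' \<in> Basis \<Longrightarrow> ZF e' \<in> fields" "RF \<in> fields" for e e'
      by (auto simp: fields_def)
    have "((\<lambda>y. (\<Sum>e\<in>Basis. h y * D2 (XF e) (- y \<odot> fst p, snd p)) + h y * D2 RF (- y \<odot> fst p, snd p)
        + (1 - 2 * s) / snd p * (h y * D1 RF (- y \<odot> fst p, snd p))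
        + (snd p)\<^sup>2 / 4 * (\<Sum>e\<in>Basis. h y * D2 (ZF e) (- y \<odot> fst p, snd p))) has_integral
        Lop (\<lambda>E. cint a b h (D1 E)) (\<lambda>E. cint a b h (D2 E)) p) (cbox a b)"
      unfolding Lop_def
      by (intro has_integral_add has_integral_mult_right has_integral_sum has_integral_cint cont F p finite_Basis)
    moreover have "(\<Sum>e\<in>Basis. h y * D2 (XF e) (- y \<odot> fst p, snd p)) + h y * D2 RF (- y \<odot> fst p, snd p)
        + (1 - 2 * s) / snd p * (h y * D1 RF (- y \<odot> fst p, snd p))
        + (snd p)\<^sup>2 / 4 * (\<Sum>e\<in>Basis. h y * D2 (ZF e) (- y \<odot> fst p, snd p)) = 0" for y
    proof -
      have "(- y \<odot> fst p, snd p) \<in> Om" using p by (simp add: Om_def)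
      from D(2)[OF this] have "h y * Lop D1 D2 (- y \<odot> fst p, snd p) = 0" by simp
      then show ?thesis
        by (simp add: Lop_def sum_distrib_left algebra_simps)
    qed
    ultimately have "((\<lambda>y. 0) has_integral Lop (\<lambda>E. cint a b h (D1 E)) (\<lambda>E. cint a b h (D2 E)) p) (cbox a b)"
      by simp
    then show ?thesis by (metis has_integral_0 has_integral_unique)
  qed
  ultimately show ?thesis unfolding sol_def by blast
qed

end

end

section \<open>Poisson integrals and uniqueness\<close>

text \<open>A finite net and three errors \<open>\<epsilon> / 3\<close>: along a filter, pointwise
  convergence is uniform on finite sets, and equicontinuity spreads it from the net to
  \<open>X\<close>. The maximum principle asks for such uniformity on balls.\<close>

lemma equicontinuous_imp_uniform:
  fixes f :: "'b \<Rightarrow> 'a::metric_space \<Rightarrow> real"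
  assumes X: "compact X" and F: "F \<noteq> bot" and P: "eventually P F"
    and eq: "\<And>\<epsilon>. \<epsilon> > 0 \<Longrightarrow> \<exists>\<delta>>0. \<forall>\<rho> x x'. P \<rho> \<longrightarrow> x \<in> X \<longrightarrow> x' \<in> X \<longrightarrow> dist x x' < \<delta> \<longrightarrow> \<bar>f \<rho> x - f \<rho> x'\<bar> \<le> \<epsilon>"
    and lim: "\<And>x. x \<in> X \<Longrightarrow> ((\<lambda>\<rho>. f \<rho> x) \<longlongrightarrow> g x) F"
  shows "continuous_on X g" "\<epsilon> > 0 \<Longrightarrow> eventually (\<lambda>\<rho>. \<forall>x\<in>X. \<bar>f \<rho> x - g x\<bar> \<le> \<epsilon>) F"
proof -
  have eqg: "\<exists>\<delta>>0. \<forall>\<rho> x x'. P \<rho> \<longrightarrow> x \<in> X \<longrightarrow> x' \<in> X \<longrightarrow> dist x x' < \<delta> \<longrightarrow>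
      \<bar>f \<rho> x - f \<rho> x'\<bar> \<le> \<epsilon> \<and> \<bar>g x - g x'\<bar> \<le> \<epsilon>" if \<epsilon>: "\<epsilon> > 0" for \<epsilon>
  proof -
    obtain \<delta> where \<delta>: "\<delta> > 0" "\<And>\<rho> x x'. P \<rho> \<Longrightarrow> x \<in> X \<Longrightarrow> x' \<in> X \<Longrightarrow> dist x x' < \<delta> \<Longrightarrow> \<bar>f \<rho> x - f \<rho> x'\<bar> \<le> \<epsilon>"
      using eq[OF \<epsilon>] by blast
    have "\<bar>g x - g x'\<bar> \<le> \<epsilon>" if x: "x \<in> X" "x' \<in> X" "dist x x' < \<delta>" for x x'
    proof (rule tendsto_upperbound[OF _ _ F])
      show "((\<lambda>\<rho>. \<bar>f \<rho> x - f \<rho> x'\<bar>) \<longlongrightarrow> \<bar>g x - g x'\<bar>) F"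
        by (intro tendsto_intros lim x)
      show "\<forall>\<^sub>F \<rho> in F. \<bar>f \<rho> x - f \<rho> x'\<bar> \<le> \<epsilon>"
        using P by eventually_elim (intro \<delta>(2) x)
    qed
    then show ?thesis using \<delta> by blast
  qed
  obtain \<rho>0 where P0: "P \<rho>0" using P F eventually_happens' by blast
  show "continuous_on X g"
    unfolding continuous_on_iff
  proof (intro ballI allI impI)
    fix x \<epsilon> assume x: "x \<in> X" and "0 < (\<epsilon> :: real)"
    then have "\<epsilon> / 2 > 0" by simp
    from eqg[OF this] obtain \<delta> where \<delta>: "\<delta> > 0" "\<And>x x'. x \<in> X \<Longrightarrow> x' \<in> X \<Longrightarrow> dist x x' < \<delta> \<Longrightarrow> \<bar>g x - g x'\<bar> \<le> \<epsilon> / 2"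
      using P0 by blast
    have "dist (g x') (g x) < \<epsilon>" if "x' \<in> X" "dist x' x < \<delta>" for x'
      using \<delta>(2)[OF that(1) x that(2)] \<open>0 < \<epsilon>\<close> by (simp add: dist_real_def)
    then show "\<exists>d>0. \<forall>x'\<in>X. dist x' x < d \<longrightarrow> dist (g x') (g x) < \<epsilon>" using \<delta>(1) by blast
  qed
  assume \<epsilon>: "\<epsilon> > 0"
  then have "\<epsilon> / 3 > 0" by simp
  from eqg[OF this] obtain \<delta> where \<delta>: "\<delta> > 0" and \<delta>f: "\<And>\<rho> x x'. P \<rho> \<Longrightarrow> x \<in> X \<Longrightarrow> x' \<in> X \<Longrightarrow> dist x x' < \<delta> \<Longrightarrow> \<bar>f \<rho> x - f \<rho> x'\<bar> \<le> \<epsilon> / 3"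
     and \<delta>g: "\<And>x x'. x \<in> X \<Longrightarrow> x' \<in> X \<Longrightarrow> dist x x' < \<delta> \<Longrightarrow> \<bar>g x - g x'\<bar> \<le> \<epsilon> / 3"
    using P0 by blast
  obtain k where k: "finite k" "k \<subseteq> X" "X \<subseteq> (\<Union>x\<in>k. ball x \<delta>)"
  proof (rule compactE_image[OF X, of X "\<lambda>x. ball x \<delta>"])
    show "X \<subseteq> (\<Union>x\<in>X. ball x \<delta>)" using \<delta> by auto
  qed auto
  have "eventually (\<lambda>\<rho>. \<forall>x\<in>k. \<bar>f \<rho> x - g x\<bar> < \<epsilon> / 3) F"
  proof (intro eventually_ball_finite k ballI)
    fix x assume "x \<in> k"
    then have "x \<in> X" using k by blast
    from tendstoD[OF lim[OF this], of "\<epsilon> / 3"] \<epsilon> show "\<forall>\<^sub>F \<rho> in F. \<bar>f \<rho> x - g x\<bar> < \<epsilon> / 3"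
      by (simp add: dist_real_def)
  qed
  then show "eventually (\<lambda>\<rho>. \<forall>x\<in>X. \<bar>f \<rho> x - g x\<bar> \<le> \<epsilon>) F"
    using P
  proof eventually_elim
    case (elim \<rho>)
    show ?case
    proof
      fix x assume x: "x \<in> X"
      then obtain y where y: "y \<in> k" "dist y x < \<delta>" using k(3) by auto
      then have "y \<in> X" using k by blast
      have "\<bar>f \<rho> y - g y\<bar> < \<epsilon> / 3" using elim y by blast
      with \<delta>f[OF elim(2) \<open>y \<in> X\<close> x y(2)] \<delta>g[OF \<open>y \<in> X\<close> x y(2)]
      show "\<bar>f \<rho> x - g x\<bar> \<le> \<epsilon>" by arith
    qed
  qed
qed

section \<open>Continuous functions with compact support\<close>

definition Cc :: "('a::real_normed_vector \<Rightarrow> real) set" where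
  "Cc = {h. continuous_on UNIV h \<and> (\<exists>R. \<forall>x. norm x > R \<longrightarrow> h x = 0)}"

lemma Cc_continuous: "h \<in> Cc \<Longrightarrow> continuous_on S h"
  by (auto simp: Cc_def intro: continuous_on_subset)

lemma Cc_support:
  assumes "h \<in> Cc"
  obtains R where "R \<ge> 0" "\<And>x. h x \<noteq> 0 \<Longrightarrow> norm x \<le> R"
proof -
  obtain R where R: "\<And>x. norm x > R \<Longrightarrow> h x = 0" using assms by (auto simp: Cc_def)
  show ?thesis
  proof (rule that[of "max 0 R"])
    fix x assume "h x \<noteq> 0"
    then show "norm x \<le> max 0 R" using R[of x] by (cases "norm x > R") auto
  qed simp
qed

lemma Cc_bounded:
  fixes h :: "'a::euclidean_space \<Rightarrow> real"
  assumes "h \<in> Cc"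
  obtains M where "M \<ge> 0" "\<And>x. \<bar>h x\<bar> \<le> M"
proof -
  obtain R where R: "\<And>x. h x \<noteq> 0 \<Longrightarrow> norm x \<le> R" using Cc_support[OF assms] by blast
  have "bounded (h ` cball 0 R)"
    by (intro compact_imp_bounded compact_continuous_image Cc_continuous assms compact_cball)
  then obtain M where "\<forall>x\<in>cball 0 R. \<bar>h x\<bar> \<le> M" unfolding bounded_iff by auto
  then have M: "\<And>x. norm x \<le> R \<Longrightarrow> \<bar>h x\<bar> \<le> M" by simp
  show ?thesis
  proof (rule that[of "max 0 M"])
    fix x show "\<bar>h x\<bar> \<le> max 0 M"
      using R[of x] M[of x] by (cases "h x = 0") auto
  qed simp
qed

text \<open>The box depends on \<open>h\<close> alone and serves every continuous \<open>g\<close>;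
  a left convolution thus agrees with one \<open>cint\<close> at all points at once.\<close>

lemma Cc_integral_cbox:
  fixes h f :: "'a::euclidean_space \<Rightarrow> real"
  assumes h: "h \<in> Cc" and f: "continuous_on UNIV f"
  obtains a b where "integrable lborel (\<lambda>x. h x * f x)"
    "\<And>g. continuous_on UNIV g \<Longrightarrow> (LINT x|lborel. h x * g x) = integral (cbox a b) (\<lambda>x. h x * g x)"
proof -
  obtain R where R: "\<And>x. h x \<noteq> 0 \<Longrightarrow> norm x \<le> R" using Cc_support[OF h] by blast
  obtain a where "cball 0 R \<subseteq> cbox (-a) (a::'a)"
    using bounded_subset_cbox_symmetric[of "cball (0::'a) R"] by auto
  then have z: "x \<notin> cbox (-a) a \<Longrightarrow> h x = 0" for x using R[of x] by (meson mem_cball_0 subsetD)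
  have int: "integrable lborel (\<lambda>x. h x * g x)" if "continuous_on UNIV g" for g
  proof -
    have "integrable lborel (\<lambda>x. indicator (cbox (-a) a) x *\<^sub>R (h x * g x))"
      by (intro borel_integrable_compact compact_cbox continuous_intros Cc_continuous h continuous_on_subset[OF that]) auto
    moreover have "(\<lambda>x. indicator (cbox (-a) a) x *\<^sub>R (h x * g x)) = (\<lambda>x. h x * g x)"
      using z by (auto simp: indicator_def fun_eq_iff)
    ultimately show ?thesis by simp
  qed
  show ?thesis
  proof (rule that[OF int[OF f]])
    fix g :: "'a \<Rightarrow> real" assume g: "continuous_on UNIV g"
    have "(LINT x|lborel. h x * g x) = integral UNIV (\<lambda>x. h x * g x)"
      by (rule integral_lborel[OF int[OF g], symmetric])
    also have "\<dots> = integral UNIV (\<lambda>x. if x \<in> cbox (-a) a then h x * g x else 0)"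
      using z by (intro arg_cong[where f="integral UNIV"]) (auto simp: fun_eq_iff)
    also have "\<dots> = integral (cbox (-a) a) (\<lambda>x. h x * g x)"
      by (rule integral_restrict_UNIV)
    finally show "(LINT x|lborel. h x * g x) = integral (cbox (-a) a) (\<lambda>x. h x * g x)" .
  qed
qed

lemma Cc_integrable:
  fixes h f :: "'a::euclidean_space \<Rightarrow> real"
  assumes "h \<in> Cc" "continuous_on UNIV f" shows "integrable lborel (\<lambda>x. h x * f x)"
  using Cc_integral_cbox[OF assms] by blast

definition cutoff :: "nat \<Rightarrow> 'a::real_normed_vector \<Rightarrow> real" where
  "cutoff j x = max 0 (min 1 (real j + 1 - norm x))"

lemma cutoff: "0 \<le> cutoff j x" "cutoff j x \<le> 1" "norm x \<le> real j \<Longrightarrow> cutoff j x = 1"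
  "norm x > real j + 1 \<Longrightarrow> cutoff j x = 0" "continuous_on S (cutoff j)"
  unfolding cutoff_def by (auto intro!: continuous_intros)

lemma cutoff_Cc: "continuous_on UNIV f \<Longrightarrow> (\<lambda>x. f x * cutoff j x) \<in> Cc"
  by (auto simp: Cc_def cutoff intro!: continuous_intros exI[of _ "real j + 1"])

text \<open>Testing with \<open>D\<close> times a cutoff makes the integral of a nonnegative
  continuous function vanish. That function is zero almost everywhere, hence everywhere, since a
  nonempty open set is not negligible.\<close>

lemma continuous_zero_if_orthogonal:
  fixes D :: "'a::euclidean_space \<Rightarrow> real"
  assumes D: "continuous_on UNIV D" and 0: "\<And>h. h \<in> Cc \<Longrightarrow> (LINT x|lborel. h x * D x) = 0"
  shows "D x = 0"
proof -
  obtain j :: nat where j: "norm x \<le> real j" using real_arch_simple by blast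
  have h: "(\<lambda>x. D x * cutoff j x) \<in> Cc" by (rule cutoff_Cc[OF D])
  have i: "integrable lborel (\<lambda>x. D x * cutoff j x * D x)" by (rule Cc_integrable[OF h D])
  have nn: "0 \<le> D x * cutoff j x * D x" for x
    using mult_nonneg_nonneg[OF cutoff(1)[of j x] zero_le_square[of "D x"]] by (simp add: ac_simps)
  have "AE x in lborel. D x * cutoff j x * D x = 0"
    using integral_nonneg_eq_0_iff_AE[OF i] 0[OF h] nn by simp
  moreover have op: "open {x. D x * cutoff j x * D x \<noteq> 0}"
    by (intro open_Collect_neq continuous_intros D cutoff(5))
  moreover from this have "{x. D x * cutoff j x * D x \<noteq> 0} \<in> sets lborel" by simp
  ultimately have "{x. D x * cutoff j x * D x \<noteq> 0} \<in> null_sets lborel"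
    by (subst (asm) AE_iff_null) auto
  then have "negligible {x. D x * cutoff j x * D x \<noteq> 0}"
    by (simp add: negligible_iff_null_sets null_sets_completionI)
  then have "{x. D x * cutoff j x * D x \<noteq> 0} = {}"
    using open_not_negligible op by blast
  then have "D x * cutoff j x * D x = 0" by blast
  then show ?thesis using cutoff(3)[OF j] by simp
qed

context htype
begin

section \<open>Poisson integrals of bounded functions\<close>

lemma norm_mult_le: "norm (x \<odot> y) \<le> norm x + norm y + norm x * norm y"
proof -
  have "norm (bracket (fst x) (fst y)) \<le> norm (fst x) * norm (fst y)" by (rule norm_bracket_le)
  also have "\<dots> \<le> norm x * norm y" by (intro mult_mono norm_fst_le[of "fst x" "snd x", simplified] norm_fst_le[of "fst y" "snd y", simplified]) auto
  finally have b: "norm (0 :: 'v, (1 / 2) *\<^sub>R bracket (fst x) (fst y)) \<le> norm x * norm y"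
    by (simp add: norm_Pair) (smt (verit) norm_ge_zero)
  have "x \<odot> y = x + y + (0, (1 / 2) *\<^sub>R bracket (fst x) (fst y))"
    by (simp add: mult_eq prod_eq_iff)
  then show ?thesis
    using b norm_triangle_ineq[of "x + y" "(0, (1 / 2) *\<^sub>R bracket (fst x) (fst y))"] norm_triangle_ineq[of x y] by simp
qed

text \<open>The substitution exchanges the two forms of a convolution; it is an inversion followed
  by a left translation.\<close>

lemma integral_reflect:
  fixes f :: "'v \<times> 'z \<Rightarrow> 'b::{banach,second_countable_topology}"
  assumes [measurable]: "f \<in> borel_measurable borel"
  shows "(LINT y|lborel. f (x \<odot> - y)) = (LINT y|lborel. f y)"
  using integral_mult_left[of f x] integral_minus_arg[of "\<lambda>y. f (x \<odot> y)"] by simp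

lemma nn_integral_reflect:
  assumes [measurable]: "f \<in> borel_measurable borel"
  shows "(\<integral>\<^sup>+y. f (x \<odot> - y) \<partial>lborel) = (\<integral>\<^sup>+y. f y \<partial>lborel)"
  using nn_integral_mult_left[of f x] nn_integral_minus[of "\<lambda>y. f (x \<odot> y)"] by simp

lemma integrable_reflect:
  fixes f :: "'v \<times> 'z \<Rightarrow> 'b::{banach,second_countable_topology}"
  assumes [measurable]: "f \<in> borel_measurable borel"
  shows "integrable lborel (\<lambda>y. f (x \<odot> - y)) \<longleftrightarrow> integrable lborel f"
proof -
  have [measurable]: "(\<lambda>y. x \<odot> - y) \<in> borel_measurable borel"
    by (intro borel_measurable_continuous_onI continuous_intros)
  show ?thesis
    unfolding integrable_iff_bounded
    using nn_integral_reflect[of "\<lambda>y. ennreal (norm (f y))" x] by simp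
qed

lemma reflect_mult [simp]: "- (x \<odot> - y) \<odot> x = y"
  by (simp add: minus_mult)

text \<open>The convolution of a bounded function with \<open>K \<rho>\<close>; at \<open>\<rho> = 0\<close> it is \<open>A * g x\<close>.\<close>

definition Pois :: "('v \<times> 'z \<Rightarrow> 'b::{banach,second_countable_topology}) \<Rightarrow> ('v \<times> 'z) \<times> real \<Rightarrow> 'b" where
  "Pois g p = (LINT y|KM. g (fst p \<odot> - dil (snd p) y))"

lemma dil_zero [simp]: "dil 0 y = 0"
  by (simp add: dil_def zero_prod_def)

lemma Pois_zero: "Pois g (x, 0) = A *\<^sub>R g x"
  by (simp add: Pois_def A_def)

text \<open>Having \<open>x\<close> in the kernel suits the equation and Fubini's theorem; having it
  in \<open>g\<close>, against a fixed measure, suits limits in \<open>\<rho>\<close>.\<close>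

lemma Pois_eq:
  fixes g :: "'v \<times> 'z \<Rightarrow> 'b::{banach,second_countable_topology}"
  assumes \<rho>: "\<rho> > 0" and [measurable]: "g \<in> borel_measurable borel"
  shows "(LINT w|lborel. K \<rho> (- w \<odot> x) *\<^sub>R g w) = Pois g (x, \<rho>)"
    and "integrable lborel (\<lambda>w. K \<rho> (- w \<odot> x) *\<^sub>R g w) \<longleftrightarrow> integrable KM (\<lambda>y. g (x \<odot> - dil \<rho> y))"
proof -
  have [measurable]: "(\<lambda>w. - w \<odot> x) \<in> borel_measurable borel" "(\<lambda>w. x \<odot> - w) \<in> borel_measurable borel"
    by (intro borel_measurable_continuous_onI continuous_intros)+
  have "(LINT w|lborel. K \<rho> (- w \<odot> x) *\<^sub>R g w) = (LINT y|lborel. K \<rho> y *\<^sub>R g (x \<odot> - y))"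
    by (subst integral_reflect[of _ x, symmetric]) auto
  also have "\<dots> = Pois g (x, \<rho>)"
    using integral_K(1)[OF \<rho>, of "\<lambda>y. g (x \<odot> - y)"] by (simp add: Pois_def)
  finally show "(LINT w|lborel. K \<rho> (- w \<odot> x) *\<^sub>R g w) = Pois g (x, \<rho>)" .
  have "integrable lborel (\<lambda>w. K \<rho> (- w \<odot> x) *\<^sub>R g w) \<longleftrightarrow> integrable lborel (\<lambda>y. K \<rho> y *\<^sub>R g (x \<odot> - y))"
    by (subst integrable_reflect[of _ x, symmetric]) auto
  then show "integrable lborel (\<lambda>w. K \<rho> (- w \<odot> x) *\<^sub>R g w) \<longleftrightarrow> integrable KM (\<lambda>y. g (x \<odot> - dil \<rho> y))"
    using integral_K(2)[OF \<rho>, of "\<lambda>y. g (x \<odot> - y)"] by simp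
qed

lemma integrable_KM_bounded:
  fixes g :: "'v \<times> 'z \<Rightarrow> 'b::{banach,second_countable_topology}"
  assumes [measurable]: "g \<in> borel_measurable borel" and "\<And>x. norm (g x) \<le> M"
  shows "integrable KM (\<lambda>y. g (x \<odot> - dil \<rho> y))"
  using assms(2) by (intro KM.integrable_const_bound[of _ M]) auto

lemma norm_Pois_le:
  fixes g :: "'v \<times> 'z \<Rightarrow> 'b::{banach,second_countable_topology}"
  assumes [measurable]: "g \<in> borel_measurable borel" and "\<And>x. norm (g x) \<le> M"
  shows "norm (Pois g p) \<le> A * M"
proof -
  have "norm (Pois g p) \<le> (LINT y|KM. norm (g (fst p \<odot> - dil (snd p) y)))"
    unfolding Pois_def by (rule integral_norm_bound)
  also have "\<dots> \<le> (LINT y|KM. M)"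
    using assms(2) by (intro integral_mono integrable_norm integrable_KM_bounded[OF assms]) auto
  finally show ?thesis by (simp add: A_def)
qed

text \<open>The domain includes \<open>\<rho> = 0\<close>, where \<open>Pois g\<close> is
  \<open>A\<close> times \<open>g\<close>; the boundary behaviour in \<open>Pois_uniform\<close> is
  then uniform continuity on a compact set.\<close>

lemma continuous_on_Pois:
  fixes g :: "'v \<times> 'z \<Rightarrow> 'b::{banach,second_countable_topology}"
  assumes g: "continuous_on UNIV g" and M: "\<And>x. norm (g x) \<le> M"
  shows "continuous_on UNIV (Pois g)"
  unfolding continuous_on_sequentially
proof (intro allI ballI impI, elim conjE)
  fix p and P :: "nat \<Rightarrow> ('v \<times> 'z) \<times> real" assume P: "P \<longlonglongrightarrow> p"
  have [measurable]: "g \<in> borel_measurable borel" by (rule borel_measurable_continuous_onI[OF g])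
  have "(\<lambda>n. LINT y|KM. g (fst (P n) \<odot> - dil (snd (P n)) y)) \<longlonglongrightarrow> (LINT y|KM. g (fst p \<odot> - dil (snd p) y))"
  proof (rule integral_dominated_convergence[where w="\<lambda>_. M"])
    show "AE y in KM. (\<lambda>n. g (fst (P n) \<odot> - dil (snd (P n)) y)) \<longlonglongrightarrow> g (fst p \<odot> - dil (snd p) y)"
    proof (rule AE_I2)
      fix y
      have "continuous_on UNIV (\<lambda>p. g (fst p \<odot> - dil (snd p) y))"
        by (intro continuous_intros continuous_on_compose2[OF g]) auto
      then have "isCont (\<lambda>p. g (fst p \<odot> - dil (snd p) y)) p"
        using continuous_on_eq_continuous_at[OF open_UNIV] by blast
      then show "(\<lambda>n. g (fst (P n) \<odot> - dil (snd (P n)) y)) \<longlonglongrightarrow> g (fst p \<odot> - dil (snd p) y)"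
        using P by (rule isCont_tendsto_compose)
    qed
  qed (use M in auto)
  then show "(Pois g \<circ> P) \<longlonglongrightarrow> Pois g p" by (simp add: Pois_def o_def)
qed

lemma Pois_uniform:
  fixes g :: "'v \<times> 'z \<Rightarrow> real"
  assumes g: "continuous_on UNIV g" and M: "\<And>x. norm (g x) \<le> M" and \<epsilon>: "\<epsilon> > 0"
  obtains \<eta> where "\<eta> > 0" "\<And>x \<rho>. norm x \<le> R \<Longrightarrow> 0 < \<rho> \<Longrightarrow> \<rho> < \<eta> \<Longrightarrow> \<bar>Pois g (x, \<rho>) - A * g x\<bar> \<le> \<epsilon>"
proof -
  have "uniformly_continuous_on (cball 0 R \<times> {0..1}) (Pois g)"
    by (intro compact_uniformly_continuous compact_Times compact_cball compact_Icc
        continuous_on_subset[OF continuous_on_Pois[OF g M]]) auto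
  then obtain d where d: "d > 0" "\<And>p q. p \<in> cball 0 R \<times> {0..1} \<Longrightarrow> q \<in> cball 0 R \<times> {0..1} \<Longrightarrow> dist q p < d \<Longrightarrow> dist (Pois g q) (Pois g p) < \<epsilon>"
    using \<epsilon> unfolding uniformly_continuous_on_def by metis
  show ?thesis
  proof (rule that[of "min 1 d"])
    fix x :: "'v \<times> 'z" and \<rho> assume "norm x \<le> R" "0 < \<rho>" "\<rho> < min 1 d"
    then show "\<bar>Pois g (x, \<rho>) - A * g x\<bar> \<le> \<epsilon>"
      using d(2)[of "(x, 0)" "(x, \<rho>)"] by (simp add: dist_Pair_Pair dist_real_def Pois_zero)
  qed (use d in auto)
qed


section \<open>Smoothed solutions\<close>

lemma sol_continuous:
  "sol u \<Longrightarrow> continuous_on Om u"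
  by (auto simp: sol_def jet_def)

lemma sol_continuous_slice:
  assumes "sol u" "\<rho> > 0" "continuous_on S f"
  shows "continuous_on S (\<lambda>y. u (f y, \<rho>))"
  using assms by (intro continuous_on_compose2[OF sol_continuous[OF assms(1)]] continuous_intros)
    (auto simp: Om_def)

lemma Cc_translate:
  assumes h: "h \<in> Cc" and R: "\<And>x. h x \<noteq> 0 \<Longrightarrow> norm x \<le> R" "R \<ge> 0" and T: "norm x \<le> T"
  shows "(\<lambda>y. h (x \<odot> - y)) \<in> Cc"
    and "h (x \<odot> - y) \<noteq> 0 \<Longrightarrow> norm y \<le> R + T + R * T"
proof -
  have bd: "norm y \<le> R + T + R * T" if "h (x \<odot> - y) \<noteq> 0" for y
  proof -
    have "norm y = norm (- (x \<odot> - y) \<odot> x)" by simp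
    also have "\<dots> \<le> norm (x \<odot> - y) + norm x + norm (x \<odot> - y) * norm x"
      using norm_mult_le[of "- (x \<odot> - y)" x] by simp
    also have "\<dots> \<le> R + T + R * T"
      using R(1)[OF that] R(2) T by (intro add_mono mult_mono) auto
    finally show ?thesis .
  qed
  then show "h (x \<odot> - y) \<noteq> 0 \<Longrightarrow> norm y \<le> R + T + R * T" .
  show "(\<lambda>y. h (x \<odot> - y)) \<in> Cc"
    unfolding Cc_def
    using bd by (auto intro!: continuous_on_compose2[OF Cc_continuous[OF h]] continuous_intros exI[of _ "R + T + R * T"])
      (smt (verit))
qed

lemma Cc_convolution_eq:
  assumes "h \<in> Cc" "sol u" "\<rho> > 0"
  shows "(LINT w|lborel. h w * u (- w \<odot> x, \<rho>)) = (LINT y|lborel. h (x \<odot> - y) * u (y, \<rho>))"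
proof -
  have "(\<lambda>w. h w * u (- w \<odot> x, \<rho>)) \<in> borel_measurable borel"
    by (intro borel_measurable_continuous_onI continuous_intros sol_continuous_slice assms Cc_continuous)
  from integral_reflect[OF this, of x] show ?thesis by simp
qed

text \<open>The consequence of the \<open>L\<^sup>p\<close> estimates that all exponents \<open>p\<close> share.\<close>

definition loc_bounded :: "real \<Rightarrow> (('v \<times> 'z) \<times> real \<Rightarrow> real) \<Rightarrow> bool" where
  "loc_bounded C u \<longleftrightarrow> C \<ge> 0 \<and> (\<forall>\<rho>>0. \<forall>S\<in>sets borel.
     (\<integral>\<^sup>+x. ennreal \<bar>u (x, \<rho>)\<bar> * indicator S x \<partial>lborel) \<le> ennreal C * (1 + emeasure lborel S))"

text \<open>The estimates on \<open>u\<close> enter \<open>smoothed_eq_Pois\<close> through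
  integrals of this kind: against \<open>h\<close>, for boundedness, and against differences of
  translates of \<open>h\<close>, for equicontinuity.\<close>

lemma loc_boundedD:
  assumes u: "loc_bounded C u" "\<rho> > 0" and "sol u" and S: "S \<in> sets borel" "emeasure lborel S < \<infinity>"
    and k: "\<And>y. \<bar>k y\<bar> \<le> \<epsilon> * indicator S y" "\<epsilon> \<ge> 0"
  shows "\<bar>LINT y|lborel. k y * u (y, \<rho>)\<bar> \<le> \<epsilon> * (C * (1 + measure lborel S))"
proof -
  have [measurable]: "(\<lambda>y. u (y, \<rho>)) \<in> borel_measurable borel"
    by (intro borel_measurable_continuous_onI sol_continuous_slice assms continuous_intros)
  have "ennreal \<bar>LINT y|lborel. k y * u (y, \<rho>)\<bar> \<le> (\<integral>\<^sup>+y. ennreal (norm (k y * u (y, \<rho>))) \<partial>lborel)"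
    using integral_norm_bound_ennreal[of lborel "\<lambda>y. k y * u (y, \<rho>)"]
    by (cases "integrable lborel (\<lambda>y. k y * u (y, \<rho>))") (auto simp: not_integrable_integral_eq)
  also have "\<dots> \<le> (\<integral>\<^sup>+y. ennreal \<epsilon> * (ennreal \<bar>u (y, \<rho>)\<bar> * indicator S y) \<partial>lborel)"
  proof (intro nn_integral_mono)
    fix y
    have "norm (k y * u (y, \<rho>)) \<le> \<epsilon> * indicator S y * \<bar>u (y, \<rho>)\<bar>"
      by (simp add: abs_mult k mult_right_mono)
    also have "ennreal \<dots> = ennreal \<epsilon> * (ennreal \<bar>u (y, \<rho>)\<bar> * indicator S y)"
      using k(2) by (auto simp: indicator_def ennreal_mult')
    finally show "ennreal (norm (k y * u (y, \<rho>))) \<le> ennreal \<epsilon> * (ennreal \<bar>u (y, \<rho>)\<bar> * indicator S y)"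
      by (simp add: ennreal_leI)
  qed
  also have "\<dots> \<le> ennreal \<epsilon> * (\<integral>\<^sup>+y. ennreal \<bar>u (y, \<rho>)\<bar> * indicator S y \<partial>lborel)"
    using S(1) by (subst nn_integral_cmult) auto
  also have "\<dots> \<le> ennreal \<epsilon> * (ennreal C * (1 + emeasure lborel S))"
    using u S(1) by (intro mult_left_mono) (auto simp: loc_bounded_def)
  also have "\<dots> = ennreal (\<epsilon> * (C * (1 + measure lborel S)))"
    using S u(1) k(2) by (simp add: loc_bounded_def emeasure_eq_ennreal_measure ennreal_mult ennreal_plus[symmetric] ennreal_1[symmetric]
       del: ennreal_1 ennreal_plus)
  finally show ?thesis
    using u(1) k(2) by (subst (asm) ennreal_le_iff) (auto simp: loc_bounded_def)
qed

text \<open>The maximum principle identifies the smoothed solution with the Poisson integral of its boundary values.\<close>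

lemma smoothed_eq_Pois:
  assumes u: "sol u" "loc_bounded C u" and F: "F \<noteq> bot" "F \<le> at_right (0::real)" and h: "h \<in> Cc"
    and lim: "\<And>x. ((\<lambda>\<rho>. LINT w|lborel. h w * u (- w \<odot> x, \<rho>)) \<longlongrightarrow> g x) F"
    and \<rho>: "\<rho> > 0"
  shows "continuous_on UNIV g" "\<exists>M. \<forall>x. \<bar>g x\<bar> \<le> M" "A * (LINT w|lborel. h w * u (- w \<odot> x, \<rho>)) = Pois g (x, \<rho>)"
proof -
  define H where "H p = (LINT w|lborel. h w * u (- w \<odot> fst p, snd p))" for p
  obtain R where R: "\<And>x. h x \<noteq> 0 \<Longrightarrow> norm x \<le> R" "R \<ge> 0" using Cc_support[OF h] by blast
  obtain Mh where Mh: "Mh \<ge> 0" "\<And>x. \<bar>h x\<bar> \<le> Mh" using Cc_bounded[OF h] by blast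
  have C0: "C \<ge> 0" using u(2) by (simp add: loc_bounded_def)
  have Pos: "eventually (\<lambda>\<rho>. 0 < \<rho>) F"
    using F(2) eventually_at_right_less[of "0::real"] by (auto simp: le_filter_def)
  have H_eq: "H (x, \<rho>) = (LINT y|lborel. h (x \<odot> - y) * u (y, \<rho>))" if "\<rho> > 0" for x \<rho>
    using Cc_convolution_eq[OF h u(1) that] by (simp add: H_def)
  have fin: "emeasure lborel (cball (0::'v \<times> 'z) r) < \<infinity>" for r
    by (rule emeasure_bounded_finite) simp
  obtain a b where ab: "\<And>f. continuous_on UNIV f \<Longrightarrow> (LINT x|lborel. h x * f x) = integral (cbox a b) (\<lambda>x. h x * f x)"
    by (rule Cc_integral_cbox[OF h continuous_on_const]) (rule that)
  have H_cint: "H p = cint a b h u p" if "p \<in> Om" for p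
  proof -
    have "continuous_on UNIV (\<lambda>w. u (- w \<odot> fst p, snd p))"
      using that by (intro sol_continuous_slice u continuous_intros) (auto simp: Om_def)
    from ab[OF this] show ?thesis by (simp add: H_def cint_def)
  qed
  define M1 where "M1 = Mh * (C * (1 + measure lborel (cball (0::'v \<times> 'z) R)))"
  \<comment> \<open>The support of \<open>h (x \<odot> - y)\<close> in \<open>y\<close> lies in the
    preimage of a fixed ball under a measure preserving map, so the bound is the same for all
    \<open>x\<close>.\<close>
  have H_bd: "\<bar>H (x, \<rho>)\<bar> \<le> M1" if \<rho>: "\<rho> > 0" for x \<rho>
  proof -
    define S where "S = (\<lambda>y. x \<odot> - y) -` cball 0 R"
    have [measurable]: "(\<lambda>y. x \<odot> - y) \<in> borel_measurable borel"
      by (intro borel_measurable_continuous_onI continuous_intros)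
    have S: "S \<in> sets borel" unfolding S_def using measurable_sets_borel[of "\<lambda>y. x \<odot> - y"] by auto
    have ind: "indicator (cball 0 R) (x \<odot> - y) = (indicator S y :: ennreal)" for y
      by (simp add: S_def indicator_def)
    have "emeasure lborel S = (\<integral>\<^sup>+y. indicator (cball 0 R) (x \<odot> - y) \<partial>lborel)"
      using S by (simp only: ind nn_integral_indicator sets_lborel)
    also have "\<dots> = emeasure lborel (cball (0::'v \<times> 'z) R)"
      by (subst nn_integral_reflect) (auto intro!: borel_measurable_indicator)
    finally have eS: "emeasure lborel S = emeasure lborel (cball (0::'v \<times> 'z) R)" .
    have "\<bar>LINT y|lborel. h (x \<odot> - y) * u (y, \<rho>)\<bar> \<le> Mh * (C * (1 + measure lborel S))"
    proof (rule loc_boundedD[OF u(2) \<rho> u(1) S])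
      show "emeasure lborel S < \<infinity>" using eS fin by simp
      show "\<bar>h (x \<odot> - y)\<bar> \<le> Mh * indicator S y" for y
        using Mh R(1)[of "x \<odot> - y"] by (auto simp: indicator_def S_def)
    qed (rule Mh)
    then show ?thesis
      using H_eq[OF \<rho>] eS by (simp add: M1_def measure_def)
  qed
  \<comment> \<open>In \<open>H_eq\<close> the point \<open>x\<close> enters through
    \<open>h\<close> only. Uniform continuity of \<open>h\<close> and the bound on the slices of
    \<open>u\<close> over a fixed ball give a \<open>\<delta>\<close> that does not depend on
    \<open>\<rho>\<close>.\<close>
  have equi: "\<exists>\<delta>>0. \<forall>\<rho> x x'. 0 < \<rho> \<longrightarrow> x \<in> cball 0 T \<longrightarrow> x' \<in> cball 0 T \<longrightarrow> dist x x' < \<delta> \<longrightarrow> \<bar>H (x, \<rho>) - H (x', \<rho>)\<bar> \<le> \<epsilon>"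
    if \<epsilon>: "\<epsilon> > 0" for \<epsilon> T
  proof -
    define T' where "T' = R + T + R * T"
    define c where "c = C * (1 + measure lborel (cball (0::'v \<times> 'z) T'))"
    have c: "c \<ge> 0" using C0 by (simp add: c_def)
    have "uniformly_continuous_on (cball 0 T \<times> cball 0 T') (\<lambda>(x, y). h (x \<odot> - y))"
      unfolding split_def
      by (intro compact_uniformly_continuous compact_Times compact_cball continuous_on_compose2[OF Cc_continuous[OF h, of UNIV]]
          continuous_intros) auto
    moreover have "\<epsilon> / (c + 1) > 0" using \<epsilon> c by simp
    ultimately obtain d where d: "d > 0" "\<And>p q. p \<in> cball 0 T \<times> cball 0 T' \<Longrightarrow> q \<in> cball 0 T \<times> cball 0 T' \<Longrightarrow> dist q p < d \<Longrightarrow>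
        dist ((\<lambda>(x, y). h (x \<odot> - y)) q) ((\<lambda>(x, y). h (x \<odot> - y)) p) < \<epsilon> / (c + 1)"
      unfolding uniformly_continuous_on_def by metis
    have "\<bar>H (x, \<rho>) - H (x', \<rho>)\<bar> \<le> \<epsilon>" if \<rho>: "0 < \<rho>" and x: "norm x \<le> T" "norm x' \<le> T" "dist x x' < d" for \<rho> x x'
    proof -
      have cont: "continuous_on UNIV (\<lambda>y. u (y, \<rho>))"
        by (intro sol_continuous_slice u \<rho> continuous_intros)
      have k: "\<bar>h (x \<odot> - y) - h (x' \<odot> - y)\<bar> \<le> \<epsilon> / (c + 1) * indicator (cball 0 T') y" for y
      proof (cases "norm y \<le> T'")
        case True
        then show ?thesis
          using d(2)[of "(x', y)" "(x, y)"] x by (simp add: dist_Pair_Pair dist_real_def)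
      next
        case False
        then have "h (x \<odot> - y) = 0" "h (x' \<odot> - y) = 0"
          using Cc_translate(2)[OF h R x(1), of y] Cc_translate(2)[OF h R x(2), of y] by (auto simp: T'_def)
        then show ?thesis using False by simp
      qed
      have "H (x, \<rho>) - H (x', \<rho>) = (LINT y|lborel. h (x \<odot> - y) * u (y, \<rho>) - h (x' \<odot> - y) * u (y, \<rho>))"
        unfolding H_eq[OF \<rho>]
        by (intro Bochner_Integration.integral_diff[symmetric] Cc_integrable[OF _ cont] Cc_translate(1)[OF h R order_refl])
      also have "\<dots> = (LINT y|lborel. (h (x \<odot> - y) - h (x' \<odot> - y)) * u (y, \<rho>))"
        by (simp add: algebra_simps)
      finally have "\<bar>H (x, \<rho>) - H (x', \<rho>)\<bar> \<le> \<epsilon> / (c + 1) * c"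
        using loc_boundedD[OF u(2) \<rho> u(1) _ fin k] \<epsilon> c by (simp add: c_def)
      also have "\<dots> \<le> \<epsilon>" using \<epsilon> c by (simp add: field_simps)
      finally show ?thesis .
    qed
    then show ?thesis using d(1) by (intro exI[of _ d]) auto
  qed
  have lim': "((\<lambda>\<rho>. H (x, \<rho>)) \<longlongrightarrow> g x) F" for x
    using lim[of x] by (simp add: H_def)
  note unif = equicontinuous_imp_uniform[OF compact_cball F(1) Pos equi lim']
  have unif2: "\<forall>\<^sub>F \<rho> in F. \<forall>x\<in>cball 0 T. \<bar>H (x, \<rho>) - g x\<bar> \<le> \<epsilon>" if "\<epsilon> > 0" for \<epsilon> T
    by (rule unif(2)) (use that in auto)
  show g: "continuous_on UNIV g"
    unfolding continuous_on_eq_continuous_at[OF open_UNIV]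
  proof
    fix x :: "'v \<times> 'z"
    have "continuous_on (ball 0 (norm x + 1)) g"
      using unif(1)[of "norm x + 1"] by (rule continuous_on_subset) auto
    then show "isCont g x" by (rule continuous_on_interior) auto
  qed
  have gM: "\<bar>g x\<bar> \<le> M1" for x
  proof (rule tendsto_upperbound[OF _ _ F(1)])
    show "((\<lambda>\<rho>. \<bar>H (x, \<rho>)\<bar>) \<longlongrightarrow> \<bar>g x\<bar>) F" by (intro tendsto_intros lim')
    show "\<forall>\<^sub>F \<rho> in F. \<bar>H (x, \<rho>)\<bar> \<le> M1" using Pos by eventually_elim (rule H_bd)
  qed
  then show "\<exists>M. \<forall>x. \<bar>g x\<bar> \<le> M" by blast
  have M1: "M1 \<ge> 0" using gM[of 0] by linarith
  have gm [measurable]: "g \<in> borel_measurable borel" by (rule borel_measurable_continuous_onI[OF g])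
  \<comment> \<open>\<open>g\<close> is bounded and continuous but may lack compact support, whereas
    \<open>sol_cint\<close> yields solutions from compactly supported boundary values. Hence the
    comparison is made with \<open>gj j\<close>, which agrees with \<open>g\<close> on the ball of
    radius \<open>j\<close>.\<close>
  define gj where "gj j x = g x * cutoff j x" for j x
  have gjc: "continuous_on UNIV (gj j)" for j
    unfolding gj_def by (intro continuous_intros g cutoff)
  have [measurable]: "gj j \<in> borel_measurable borel" for j
    by (rule borel_measurable_continuous_onI[OF gjc])
  have gjM: "norm (gj j x) \<le> M1" for j x
    using mult_mono[OF gM[of x] cutoff(2)[of j x] M1] cutoff(1)[of j x] by (simp add: gj_def abs_mult)
  have sol_P: "\<exists>v. sol v \<and> (\<forall>p\<in>Om. v p = Pois (gj j) p)" for j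
  proof -
    have "gj j \<in> Cc" using cutoff_Cc[OF g] by (simp add: gj_def[abs_def])
    then obtain a b where ab: "\<And>f. continuous_on UNIV f \<Longrightarrow> (LINT x|lborel. gj j x * f x) = integral (cbox a b) (\<lambda>x. gj j x * f x)"
      by (rule Cc_integral_cbox[OF _ continuous_on_const]) (rule that)
    have "sol (cint a b (gj j) (\<lambda>p. K (snd p) (fst p)))"
      by (intro sol_cint sol_K continuous_on_subset[OF gjc]) auto
    moreover have "cint a b (gj j) (\<lambda>p. K (snd p) (fst p)) p = Pois (gj j) p" if "p \<in> Om" for p
    proof -
      have p: "snd p > 0" using that by (simp add: Om_def)
      have "continuous_on UNIV (\<lambda>w. K (snd p) (- w \<odot> fst p))"
        using p by (intro continuous_intros) auto
      from ab[OF this] Pois_eq(1)[OF p, of "gj j" "fst p"] show ?thesis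
        by (simp add: cint_def mult.commute)
    qed
    ultimately show ?thesis by blast
  qed
  obtain B :: "('v \<times> 'z) \<times> real \<Rightarrow> real" and Rf where mp: "\<forall>w M \<epsilon>. \<forall>p\<in>Om. sol w \<longrightarrow> (\<forall>p\<in>Om. w p \<le> M) \<longrightarrow> \<epsilon> > 0 \<longrightarrow>
     (\<forall>\<eta>>0. \<exists>\<rho>. 0 < \<rho> \<and> \<rho> < \<eta> \<and> (\<forall>x. norm x \<le> Rf (M / \<epsilon>) \<longrightarrow> w (x, \<rho>) \<le> \<epsilon>)) \<longrightarrow>
     w p \<le> \<epsilon> * B p + \<epsilon>"
    using max_principle by (elim exE) (rule that)
  \<comment> \<open>The bound does not depend on \<open>j\<close>, so \<open>j\<close> may be chosen
    after the radius \<open>Rf (M / \<epsilon>)\<close>.\<close>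
  define M where "M = A * M1 + A * M1"
  \<comment> \<open>\<open>\<sigma>\<close> gives both inequalities. On the ball of radius
    \<open>Rf (M / \<epsilon>)\<close> the functions \<open>gj j\<close> and \<open>g\<close>
    coincide, and for suitable small \<open>\<rho>\<close> both \<open>A * H\<close> and the Poisson
    integral are within \<open>\<epsilon> / 2\<close> of \<open>A * g\<close> there.\<close>
  have key: "\<sigma> * (A * H p - Pois (gj j) p) \<le> \<epsilon> * B p + \<epsilon>"
    if \<sigma>: "\<sigma> \<in> {1, -1}" and \<epsilon>: "\<epsilon> > 0" and j: "Rf (M / \<epsilon>) \<le> real j" and p: "p \<in> Om" for \<sigma> \<epsilon> j p
  proof -
    obtain v where v: "sol v" "\<And>p. p \<in> Om \<Longrightarrow> v p = Pois (gj j) p" using sol_P by blast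
    define w where "w p = \<sigma> * A * cint a b h u p + - \<sigma> * v p" for p
    have weq: "w p = \<sigma> * (A * H p - Pois (gj j) p)" if "p \<in> Om" for p
      using that by (simp add: w_def H_cint v algebra_simps)
    have "w p \<le> \<epsilon> * B p + \<epsilon>"
    proof (rule mp[rule_format, OF p _ _ \<epsilon>])
      show "sol w" unfolding w_def[abs_def]
        by (intro sol_lincomb sol_cint u v Cc_continuous h)
      fix q :: "('v \<times> 'z) \<times> real" assume q: "q \<in> Om"
      have "\<bar>H q\<bar> \<le> M1" using H_bd[of "snd q" "fst q"] q by (simp add: Om_def)
      then have "\<bar>A * H q\<bar> \<le> A * M1" using A_pos by (simp add: abs_mult)
      moreover have "\<bar>Pois (gj j) q\<bar> \<le> A * M1" using norm_Pois_le[of "gj j" M1 q] gjM by simp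
      ultimately have "\<bar>A * H q - Pois (gj j) q\<bar> \<le> M" unfolding M_def by linarith
      then show "w q \<le> M" using weq[OF q] \<sigma> by (auto simp: abs_le_iff)
    next
      fix \<eta> :: real assume \<eta>: "\<eta> > 0"
      define \<epsilon>' where "\<epsilon>' = \<epsilon> / (2 * A)"
      have \<epsilon>': "\<epsilon>' > 0" "A * \<epsilon>' = \<epsilon> / 2" using A_pos \<epsilon> by (auto simp: \<epsilon>'_def)
      obtain \<eta>' where \<eta>': "\<eta>' > 0" "\<And>x \<rho>. norm x \<le> Rf (M / \<epsilon>) \<Longrightarrow> 0 < \<rho> \<Longrightarrow> \<rho> < \<eta>' \<Longrightarrow> \<bar>Pois (gj j) (x, \<rho>) - A * gj j x\<bar> \<le> \<epsilon> / 2"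
        using Pois_uniform[OF gjc gjM, of "\<epsilon> / 2"] \<epsilon> by (metis half_gt_zero)
      have "\<forall>\<^sub>F \<rho> in F. \<rho> < min \<eta> \<eta>'"
        using F(2) \<eta> \<eta>' by (auto simp: le_filter_def eventually_at_right_field intro!: exI[of _ "min \<eta> \<eta>'"])
      then have "\<forall>\<^sub>F \<rho> in F. 0 < \<rho> \<and> \<rho> < min \<eta> \<eta>' \<and> (\<forall>x\<in>cball 0 (Rf (M / \<epsilon>)). \<bar>H (x, \<rho>) - g x\<bar> \<le> \<epsilon>')"
        using Pos unif2[OF \<epsilon>'(1), of "Rf (M / \<epsilon>)"] by eventually_elim auto
      then obtain \<rho> where \<rho>: "0 < \<rho>" "\<rho> < \<eta>" "\<rho> < \<eta>'" "\<And>x. norm x \<le> Rf (M / \<epsilon>) \<Longrightarrow> \<bar>H (x, \<rho>) - g x\<bar> \<le> \<epsilon>'"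
        using F(1) by (auto dest!: eventually_happens')
      have "w (x, \<rho>) \<le> \<epsilon>" if x: "norm x \<le> Rf (M / \<epsilon>)" for x
      proof -
        have "gj j x = g x" using x j by (simp add: gj_def cutoff)
        then have 1: "\<bar>Pois (gj j) (x, \<rho>) - A * g x\<bar> \<le> \<epsilon> / 2" using \<eta>'(2)[OF x] \<rho> by simp
        have "A * \<bar>H (x, \<rho>) - g x\<bar> \<le> A * \<epsilon>'" using \<rho>(4)[OF x] A_pos by simp
        then have 2: "\<bar>A * H (x, \<rho>) - A * g x\<bar> \<le> \<epsilon> / 2"
          using A_pos by (simp add: \<epsilon>'(2) abs_mult flip: right_diff_distrib)
        have "(x, \<rho>) \<in> Om" using \<rho> by (simp add: Om_def)
        from weq[OF this] have "w (x, \<rho>) = \<sigma> * (A * H (x, \<rho>) - Pois (gj j) (x, \<rho>))" .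
        moreover have "\<bar>A * H (x, \<rho>) - Pois (gj j) (x, \<rho>)\<bar> \<le> \<epsilon>" using 1 2 by linarith
        ultimately show ?thesis using \<sigma> by (auto simp: abs_le_iff)
      qed
      then show "\<exists>\<rho>. 0 < \<rho> \<and> \<rho> < \<eta> \<and> (\<forall>x. norm x \<le> Rf (M / \<epsilon>) \<longrightarrow> w (x, \<rho>) \<le> \<epsilon>)"
        using \<rho> by blast
    qed
    then show ?thesis using weq[OF p] by simp
  qed
  have Plim: "(\<lambda>j. Pois (gj j) p) \<longlonglongrightarrow> Pois g p" for p
    unfolding Pois_def
  proof (rule integral_dominated_convergence[where w="\<lambda>_. M1"])
    show "AE y in KM. (\<lambda>j. gj j (fst p \<odot> - dil (snd p) y)) \<longlonglongrightarrow> g (fst p \<odot> - dil (snd p) y)"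
    proof (rule AE_I2)
      fix y
      define x where "x = fst p \<odot> - dil (snd p) y"
      obtain N :: nat where N: "norm x \<le> real N" using real_arch_simple by blast
      have "gj j x = g x" if "j \<ge> N" for j
        using N that by (simp add: gj_def cutoff)
      then show "(\<lambda>j. gj j x) \<longlonglongrightarrow> g x"
        by (intro tendsto_eventually) (auto simp: eventually_sequentially)
    qed
  qed (use gjM in auto)
  \<comment> \<open>First \<open>j\<close> tends to infinity for fixed \<open>\<epsilon>\<close>,
    then \<open>\<epsilon>\<close> tends to \<open>0\<close> at the fixed point \<open>p\<close>,
    where \<open>B p\<close> is a constant.\<close>
  have fin2: "\<sigma> * (A * H p - Pois g p) \<le> 0" if \<sigma>: "\<sigma> \<in> {1, -1}" and p: "p \<in> Om" for \<sigma> p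
  proof -
    have le: "\<sigma> * (A * H p - Pois g p) \<le> \<epsilon> * B p + \<epsilon>" if \<epsilon>: "\<epsilon> > 0" for \<epsilon>
    proof (rule LIMSEQ_le_const2)
      show "(\<lambda>j. \<sigma> * (A * H p - Pois (gj j) p)) \<longlonglongrightarrow> \<sigma> * (A * H p - Pois g p)"
        by (intro tendsto_intros Plim)
      obtain N :: nat where "Rf (M / \<epsilon>) \<le> real N" using real_arch_simple by blast
      then show "\<exists>N. \<forall>j\<ge>N. \<sigma> * (A * H p - Pois (gj j) p) \<le> \<epsilon> * B p + \<epsilon>"
        by (intro exI[of _ N] allI impI key[OF \<sigma> \<epsilon> _ p]) auto
    qed
    have "((\<lambda>\<epsilon>. \<epsilon> * B p + \<epsilon>) \<longlongrightarrow> 0 * B p + 0) (at_right 0)"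
      by (intro tendsto_intros)
    then have "\<sigma> * (A * H p - Pois g p) \<le> 0 * B p + 0"
      by (rule tendsto_lowerbound) (auto simp: eventually_at_right_field intro!: exI[of _ 1] le)
    then show ?thesis by simp
  qed
  have "(x, \<rho>) \<in> Om" using \<rho> by (simp add: Om_def)
  from fin2[OF _ this, of 1] fin2[OF _ this, of "-1"] have "A * H (x, \<rho>) = Pois g (x, \<rho>)" by simp
  then show "A * (LINT w|lborel. h w * u (- w \<odot> x, \<rho>)) = Pois g (x, \<rho>)" by (simp add: H_def)
qed


text \<open>Boundary measures whose Poisson integral converges. The class contains the finite
  measures, for \<open>p = 1\<close>, and the measures whose density is nonnegative and integrable
  with respect to \<open>KM\<close>, for \<open>p > 1\<close>.\<close>

definition admissible :: "('v \<times> 'z) measure \<Rightarrow> bool" where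
  "admissible \<nu> \<longleftrightarrow> sets \<nu> = sets borel \<and> sigma_finite_measure \<nu> \<and> (\<forall>\<rho>>0. integrable \<nu> (K \<rho>))"

context
  fixes \<nu> and \<rho> :: real
  assumes \<nu>: "admissible \<nu>" and \<rho>: "\<rho> > 0"
begin

lemma sets_nu: "sets \<nu> = sets borel"
  using \<nu> by (simp add: admissible_def)

lemma measurable_nu: "f \<in> borel_measurable borel \<Longrightarrow> f \<in> borel_measurable \<nu>"
  using measurable_cong_sets[OF sets_nu] by blast

lemma measurable_lborel_nu:
  fixes f :: "('v \<times> 'z) \<times> ('v \<times> 'z) \<Rightarrow> 'b::topological_space"
  shows "continuous_on UNIV f \<Longrightarrow> f \<in> borel_measurable (lborel \<Otimes>\<^sub>M \<nu>)"
proof -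
  have "sets (lborel \<Otimes>\<^sub>M \<nu>) = sets ((borel :: ('v \<times> 'z) measure) \<Otimes>\<^sub>M (borel :: ('v \<times> 'z) measure))"
    by (intro sets_pair_measure_cong sets_nu sets_lborel)
  also have "\<dots> = sets borel" by (simp only: borel_prod)
  finally show "continuous_on UNIV f \<Longrightarrow> f \<in> borel_measurable (lborel \<Otimes>\<^sub>M \<nu>)"
    using measurable_cong_sets borel_measurable_continuous_onI by blast
qed

lemma nn_integral_K_nu: "(\<integral>\<^sup>+y. ennreal (K \<rho> y) \<partial>\<nu>) < \<infinity>"
proof -
  have "integrable \<nu> (K \<rho>)" using \<nu> \<rho> by (simp add: admissible_def)
  then show ?thesis
    unfolding integrable_iff_bounded by simp
qed

lemma integrable_K_translate: "integrable \<nu> (\<lambda>y. K \<rho> (w \<odot> y))"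
proof -
  obtain C where C: "C > 0" "\<And>a x. norm a \<le> norm w \<Longrightarrow> K \<rho> (a \<odot> x) \<le> C * K \<rho> x"
    using K_mult_le[OF \<rho>, of "norm w"] by auto
  have "integrable \<nu> (\<lambda>y. C * K \<rho> y)"
    using \<nu> \<rho> by (simp add: admissible_def)
  then show ?thesis
    by (rule Bochner_Integration.integrable_bound) (use C in \<open>auto intro!: measurable_nu\<close>)
qed

text \<open>A convergent sequence is bounded, so by \<open>K_mult_le\<close> one multiple of
  \<open>K \<rho>\<close> dominates all the translates.\<close>

lemma continuous_on_K_nu: "continuous_on UNIV (\<lambda>w. LINT y|\<nu>. K \<rho> (w \<odot> y))"
  unfolding continuous_on_sequentially
proof (intro allI ballI impI, elim conjE)
  fix w and W :: "nat \<Rightarrow> 'v \<times> 'z" assume W: "W \<longlonglongrightarrow> w"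
  then have "bounded (range W)" by (rule convergent_imp_bounded)
  then obtain r where r: "\<And>n. norm (W n) \<le> r" by (auto simp: bounded_iff)
  then have "r \<ge> 0" by (meson norm_ge_zero order_trans)
  then obtain C where C: "C > 0" "\<And>a x. norm a \<le> r \<Longrightarrow> K \<rho> (a \<odot> x) \<le> C * K \<rho> x"
    using K_mult_le[OF \<rho>] by blast
  have "(\<lambda>n. LINT y|\<nu>. K \<rho> (W n \<odot> y)) \<longlonglongrightarrow> (LINT y|\<nu>. K \<rho> (w \<odot> y))"
  proof (rule integral_dominated_convergence[where w="\<lambda>y. C * K \<rho> y"])
    show "integrable \<nu> (\<lambda>y. C * K \<rho> y)"
      using \<nu> \<rho> by (simp add: admissible_def)
    show "AE y in \<nu>. (\<lambda>n. K \<rho> (W n \<odot> y)) \<longlonglongrightarrow> K \<rho> (w \<odot> y)"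
    proof (rule AE_I2)
      fix y
      have "continuous_on UNIV (\<lambda>w. K \<rho> (w \<odot> y))" using \<rho> by (intro continuous_intros) auto
      then have "isCont (\<lambda>w. K \<rho> (w \<odot> y)) w"
        using continuous_on_eq_continuous_at[OF open_UNIV] by blast
      then show "(\<lambda>n. K \<rho> (W n \<odot> y)) \<longlonglongrightarrow> K \<rho> (w \<odot> y)" using W by (rule isCont_tendsto_compose)
    qed
  qed (use C r in \<open>auto intro!: measurable_nu\<close>)
  then show "((\<lambda>w. LINT y|\<nu>. K \<rho> (w \<odot> y)) \<circ> W) \<longlonglongrightarrow> (LINT y|\<nu>. K \<rho> (w \<odot> y))"
    by (simp add: o_def)
qed

text \<open>The substitution \<open>w \<mapsto> w \<odot> y\<close> turns the left integrand into
  \<open>K \<rho> (w \<odot> y) * h w\<close>, and Fubini's theorem exchanges the integrals. For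
  absolute convergence, \<open>h\<close> confines \<open>w\<close> to a ball, on which
  \<open>K_mult_le\<close> bounds the translated kernel by \<open>C * K \<rho> y\<close>.\<close>

lemma Fubini_K:
  assumes h: "h \<in> Cc"
  shows "integrable lborel (\<lambda>w. K \<rho> w * (LINT y|\<nu>. h (w \<odot> - y)))" (is ?i)
    and "(LINT w|lborel. K \<rho> w * (LINT y|\<nu>. h (w \<odot> - y))) = (LINT w|lborel. h w * (LINT y|\<nu>. K \<rho> (w \<odot> y)))" (is ?e)
proof -
  obtain R where R: "\<And>x. h x \<noteq> 0 \<Longrightarrow> norm x \<le> R" "R \<ge> 0" using Cc_support[OF h] by blast
  obtain Mh where Mh: "Mh \<ge> 0" "\<And>x. \<bar>h x\<bar> \<le> Mh" using Cc_bounded[OF h] by blast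
  obtain C where C: "C > 0" "\<And>a x. norm a \<le> R \<Longrightarrow> K \<rho> (a \<odot> x) \<le> C * K \<rho> x"
    using K_mult_le[OF \<rho> R(2)] by blast
  interpret nu: sigma_finite_measure \<nu> using \<nu> by (simp add: admissible_def)
  interpret pair: pair_sigma_finite lborel \<nu> ..
  have hc: "continuous_on UNIV h" by (rule Cc_continuous[OF h])
  have [measurable]: "h \<in> borel_measurable borel" by (rule borel_measurable_continuous_onI[OF hc])
  let ?f1 = "\<lambda>p. K \<rho> (fst p) * h (fst p \<odot> - snd p)" and ?f2 = "\<lambda>p. K \<rho> (fst p \<odot> snd p) * h (fst p)"
  have c: "continuous_on UNIV ?f1" "continuous_on UNIV ?f2"
    using \<rho> by (auto intro!: continuous_intros continuous_on_compose2[OF hc])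
  have inner: "(\<integral>\<^sup>+w. ennreal (norm (?f2 (w, y))) \<partial>lborel) \<le> ennreal (C * Mh * measure lborel (cball (0::'v \<times> 'z) R)) * ennreal (K \<rho> y)" for y
  proof -
    have fin: "emeasure lborel (cball (0::'v \<times> 'z) R) < \<infinity>" by (rule emeasure_bounded_finite) simp
    have "(\<integral>\<^sup>+w. ennreal (norm (?f2 (w, y))) \<partial>lborel) \<le> (\<integral>\<^sup>+w. ennreal (C * K \<rho> y * Mh) * indicator (cball (0::'v \<times> 'z) R) w \<partial>lborel)"
    proof (intro nn_integral_mono)
      fix w
      have "norm (?f2 (w, y)) \<le> C * K \<rho> y * Mh * indicator (cball 0 R) w"
      proof (cases "norm w \<le> R")
        case True
        then show ?thesis
          using mult_mono[OF C(2)[OF True, of y] Mh(2)[of w]] C(1) by (simp add: abs_mult)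
      next
        case False
        then have "h w = 0" using R(1) by blast
        then show ?thesis using C(1) Mh(1) by simp
      qed
      then show "ennreal (norm (?f2 (w, y))) \<le> ennreal (C * K \<rho> y * Mh) * indicator (cball 0 R) w"
        by (auto simp: indicator_def ennreal_leI split: if_splits)
    qed
    also have "\<dots> = ennreal (C * K \<rho> y * Mh) * emeasure lborel (cball (0::'v \<times> 'z) R)"
      by (rule nn_integral_cmult_indicator) simp
    also have "\<dots> = ennreal (C * Mh * measure lborel (cball (0::'v \<times> 'z) R)) * ennreal (K \<rho> y)"
      using fin C Mh by (simp add: emeasure_eq_ennreal_measure mult_ac flip: ennreal_mult)
    finally show ?thesis .
  qed
  have inner1: "(\<integral>\<^sup>+w. ennreal (norm (?f1 (w, y))) \<partial>lborel) = (\<integral>\<^sup>+w. ennreal (norm (?f2 (w, y))) \<partial>lborel)" for y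
  proof -
    have [measurable]: "(\<lambda>w. w \<odot> - y) \<in> borel_measurable borel"
      by (intro borel_measurable_continuous_onI continuous_intros)
    show ?thesis
      by (subst nn_integral_mult_right[of _ y, symmetric]) auto
  qed
  have int: "integrable (lborel \<Otimes>\<^sub>M \<nu>) f"
    if f: "continuous_on UNIV f" "\<And>y. (\<integral>\<^sup>+w. ennreal (norm (f (w, y))) \<partial>lborel) \<le> ennreal (C * Mh * measure lborel (cball (0::'v \<times> 'z) R)) * ennreal (K \<rho> y)"
    for f :: "('v \<times> 'z) \<times> ('v \<times> 'z) \<Rightarrow> real"
  proof (rule integrableI_bounded)
    show [measurable]: "f \<in> borel_measurable (lborel \<Otimes>\<^sub>M \<nu>)" by (rule measurable_lborel_nu[OF f(1)])
    have "(\<integral>\<^sup>+p. ennreal (norm (f p)) \<partial>(lborel \<Otimes>\<^sub>M \<nu>)) = (\<integral>\<^sup>+y. (\<integral>\<^sup>+w. ennreal (norm (f (w, y))) \<partial>lborel) \<partial>\<nu>)"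
      by (rule pair.nn_integral_snd[symmetric]) measurable
    also have "\<dots> \<le> (\<integral>\<^sup>+y. ennreal (C * Mh * measure lborel (cball (0::'v \<times> 'z) R)) * ennreal (K \<rho> y) \<partial>\<nu>)"
      by (intro nn_integral_mono f(2))
    also have "\<dots> = ennreal (C * Mh * measure lborel (cball (0::'v \<times> 'z) R)) * (\<integral>\<^sup>+y. ennreal (K \<rho> y) \<partial>\<nu>)"
      by (intro nn_integral_cmult measurable_nu) measurable
    also have "\<dots> < \<infinity>" using nn_integral_K_nu by (simp add: ennreal_mult_less_top)
    finally show "(\<integral>\<^sup>+p. ennreal (norm (f p)) \<partial>(lborel \<Otimes>\<^sub>M \<nu>)) < \<infinity>" .
  qed
  have i1: "integrable (lborel \<Otimes>\<^sub>M \<nu>) (\<lambda>(w, y). K \<rho> w * h (w \<odot> - y))"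
    using int[OF c(1)] inner inner1 by (simp add: split_def)
  have i2: "integrable (lborel \<Otimes>\<^sub>M \<nu>) (\<lambda>(w, y). K \<rho> (w \<odot> y) * h w)"
    using int[OF c(2)] inner by (simp add: split_def)
  have "integrable lborel (\<lambda>w. LINT y|\<nu>. K \<rho> w * h (w \<odot> - y))"
    using pair.integrable_fst[OF i1] by simp
  then show ?i by simp
  have "(LINT w|lborel. K \<rho> w * (LINT y|\<nu>. h (w \<odot> - y))) = (LINT w|lborel. LINT y|\<nu>. K \<rho> w * h (w \<odot> - y))"
    by simp
  also have "\<dots> = (LINT y|\<nu>. LINT w|lborel. K \<rho> w * h (w \<odot> - y))"
    by (rule pair.Fubini_integral[OF i1, symmetric])
  also have "\<dots> = (LINT y|\<nu>. LINT w|lborel. K \<rho> (w \<odot> y) * h w)"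
  proof (rule Bochner_Integration.integral_cong[OF refl])
    fix y
    have [measurable]: "(\<lambda>w. w \<odot> - y) \<in> borel_measurable borel"
      by (intro borel_measurable_continuous_onI continuous_intros)
    show "(LINT w|lborel. K \<rho> w * h (w \<odot> - y)) = (LINT w|lborel. K \<rho> (w \<odot> y) * h w)"
      by (subst integral_mult_right[of _ y, symmetric]) auto
  qed
  also have "\<dots> = (LINT w|lborel. LINT y|\<nu>. K \<rho> (w \<odot> y) * h w)"
    by (rule pair.Fubini_integral[OF i2])
  finally show ?e by (simp add: mult.commute)
qed

end

text \<open>\<open>smoothed_eq_Pois\<close> is applied at the group identity for every
  \<open>h\<close>, which together with \<open>Fubini_K\<close> says that \<open>D\<close> is
  orthogonal to \<open>Cc\<close>. Two positive measures allow the boundary value to be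
  signed.\<close>

lemma uniqueness:
  assumes u: "sol u" "loc_bounded C u" and F: "F \<noteq> bot" "F \<le> at_right (0::real)"
    and \<nu>: "admissible \<nu>1" "admissible \<nu>2"
    and lim: "\<And>h. h \<in> Cc \<Longrightarrow> ((\<lambda>\<rho>. LINT x|lborel. h x * u (x, \<rho>)) \<longlongrightarrow> (LINT x|\<nu>1. h x) - (LINT x|\<nu>2. h x)) F"
    and \<rho>: "\<rho> > 0"
  shows "A * u (x, \<rho>) = (LINT y|\<nu>1. K \<rho> (- y \<odot> x)) - (LINT y|\<nu>2. K \<rho> (- y \<odot> x))"
proof -
  define D where "D w = A * u (- w, \<rho>) - ((LINT y|\<nu>1. K \<rho> (w \<odot> y)) - (LINT y|\<nu>2. K \<rho> (w \<odot> y)))" for w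
  have uc: "continuous_on UNIV (\<lambda>w. u (- w, \<rho>))"
    by (intro sol_continuous_slice u \<rho> continuous_intros)
  note Vc = continuous_on_K_nu[OF \<nu>(1) \<rho>] continuous_on_K_nu[OF \<nu>(2) \<rho>]
  have "D w = 0" for w
  proof (rule continuous_zero_if_orthogonal[of D])
    show "continuous_on UNIV D"
      unfolding D_def by (intro continuous_intros uc Vc)
    fix h :: "'v \<times> 'z \<Rightarrow> real" assume h: "h \<in> Cc"
    obtain R where R: "\<And>x. h x \<noteq> 0 \<Longrightarrow> norm x \<le> R" "R \<ge> 0" using Cc_support[OF h] by blast
    have Pos: "eventually (\<lambda>\<rho>. 0 < \<rho>) F"
      using F(2) eventually_at_right_less[of "0::real"] by (auto simp: le_filter_def)
    define g where "g x = (LINT y|\<nu>1. h (x \<odot> - y)) - (LINT y|\<nu>2. h (x \<odot> - y))" for x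
    have lim': "((\<lambda>\<rho>. LINT w|lborel. h w * u (- w \<odot> x, \<rho>)) \<longlongrightarrow> g x) F" for x
    proof (rule Lim_transform_eventually[OF lim[OF Cc_translate(1)[OF h R order_refl, of x], folded g_def]])
      show "\<forall>\<^sub>F \<rho> in F. (LINT y|lborel. h (x \<odot> - y) * u (y, \<rho>)) = (LINT w|lborel. h w * u (- w \<odot> x, \<rho>))"
        using Pos by eventually_elim (rule Cc_convolution_eq[OF h u(1), symmetric])
    qed
    note sm = smoothed_eq_Pois[OF u F h lim' \<rho>]
    have gm [measurable]: "g \<in> borel_measurable borel" by (rule borel_measurable_continuous_onI[OF sm(1)])
    have "A * (LINT w|lborel. h w * u (- w, \<rho>)) = (LINT w|lborel. K \<rho> w * g w)"
      using sm(3)[of 0] Pois_eq(1)[OF \<rho> gm, of 0] by simp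
    also have "\<dots> = (LINT w|lborel. K \<rho> w * (LINT y|\<nu>1. h (w \<odot> - y)) - K \<rho> w * (LINT y|\<nu>2. h (w \<odot> - y)))"
      by (simp add: g_def right_diff_distrib)
    also have "\<dots> = (LINT w|lborel. h w * (LINT y|\<nu>1. K \<rho> (w \<odot> y))) - (LINT w|lborel. h w * (LINT y|\<nu>2. K \<rho> (w \<odot> y)))"
      using Fubini_K[OF \<nu>(1) \<rho> h] Fubini_K[OF \<nu>(2) \<rho> h] by simp
    finally have e: "A * (LINT w|lborel. h w * u (- w, \<rho>)) =
      (LINT w|lborel. h w * (LINT y|\<nu>1. K \<rho> (w \<odot> y))) - (LINT w|lborel. h w * (LINT y|\<nu>2. K \<rho> (w \<odot> y)))" .
    have "(LINT w|lborel. h w * D w) = (LINT w|lborel. A * (h w * u (- w, \<rho>)) -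
       (h w * (LINT y|\<nu>1. K \<rho> (w \<odot> y)) - h w * (LINT y|\<nu>2. K \<rho> (w \<odot> y))))"
      by (simp add: D_def algebra_simps)
    also have "\<dots> = A * (LINT w|lborel. h w * u (- w, \<rho>)) -
      ((LINT w|lborel. h w * (LINT y|\<nu>1. K \<rho> (w \<odot> y))) - (LINT w|lborel. h w * (LINT y|\<nu>2. K \<rho> (w \<odot> y))))"
      using Cc_integrable[OF h uc] Cc_integrable[OF h Vc(1)] Cc_integrable[OF h Vc(2)] by simp
    finally show "(LINT w|lborel. h w * D w) = 0" using e by simp
  qed
  from this[of "- x"] have "A * u (x, \<rho>) = (LINT y|\<nu>1. K \<rho> (- x \<odot> y)) - (LINT y|\<nu>2. K \<rho> (- x \<odot> y))"
    by (simp add: D_def)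
  moreover have "K \<rho> (- x \<odot> y) = K \<rho> (- y \<odot> x)" for y
    using K_minus[of \<rho> "- y \<odot> x"] by (simp add: minus_mult)
  ultimately show ?thesis by simp
qed

end

section \<open>Weak compactness\<close>

text \<open>By Tychonoff's theorem the family \<open>\<Phi>\<close> has a cluster point in a product
  of intervals; \<open>F\<close> is the infimum of \<open>F0\<close> and the preimage of its
  neighbourhood filter. A filter is used because the index \<open>h\<close> will range over all
  measurable sets, and an uncountable product of intervals need not be sequentially compact.\<close>

lemma filter_limit:
  fixes \<Phi> :: "'b \<Rightarrow> 'h \<Rightarrow> real"
  assumes F0: "F0 \<noteq> bot" and ex: "eventually (\<lambda>\<rho>. \<forall>h. \<bar>\<Phi> \<rho> h\<bar> \<le> C h) F0"
  obtains F l where "F \<noteq> bot" "F \<le> F0" "\<And>h. ((\<lambda>\<rho>. \<Phi> \<rho> h) \<longlongrightarrow> l h) F"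
proof -
  define S where "S = (\<Pi>\<^sub>E h\<in>UNIV. {- C h..C h})"
  have "compactin (product_topology (\<lambda>_. euclideanreal) UNIV) S"
    unfolding S_def by (subst compactin_PiE) (auto simp: compact_Icc)
  then have S: "compact S"
    by (simp only: euclidean_product_topology compactin_euclidean_iff)
  have "eventually (\<lambda>f. f \<in> S) (filtermap \<Phi> F0)"
    unfolding eventually_filtermap using ex by eventually_elim (auto simp: S_def abs_le_iff minus_le_iff)
  moreover have "filtermap \<Phi> F0 \<noteq> bot" using F0 by (simp add: filtermap_bot_iff)
  ultimately obtain x where x: "inf (nhds x) (filtermap \<Phi> F0) \<noteq> bot"
    using S unfolding compact_filter by blast
  define F where "F = inf F0 (filtercomap \<Phi> (nhds x))"
  have "F \<noteq> bot"
  proof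
    assume "F = bot"
    then have "eventually (\<lambda>_. False) F" by simp
    then obtain P Q where PQ: "eventually P F0" "eventually Q (filtercomap \<Phi> (nhds x))" "\<And>\<rho>. P \<rho> \<Longrightarrow> Q \<rho> \<Longrightarrow> False"
      unfolding F_def eventually_inf by auto
    then obtain R where R: "eventually R (nhds x)" "\<And>\<rho>. R (\<Phi> \<rho>) \<Longrightarrow> Q \<rho>"
      unfolding eventually_filtercomap by blast
    have "eventually (\<lambda>f. \<not> R f) (filtermap \<Phi> F0)"
      unfolding eventually_filtermap using PQ(1) by eventually_elim (use PQ R in blast)
    with R(1) have "eventually (\<lambda>_. False) (inf (nhds x) (filtermap \<Phi> F0))"
      unfolding eventually_inf by blast
    then show False using x by (simp add: eventually_False)
  qed
  moreover have "F \<le> F0" by (simp add: F_def)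
  moreover have "((\<lambda>\<rho>. \<Phi> \<rho> h) \<longlongrightarrow> x h) F" for h
  proof -
    have "filtermap \<Phi> F \<le> filtermap \<Phi> (filtercomap \<Phi> (nhds x))"
      unfolding F_def by (intro filtermap_mono) simp
    also have "\<dots> \<le> nhds x" by (rule filtermap_filtercomap)
    finally have "(\<Phi> \<longlongrightarrow> x) F" by (simp add: filterlim_def)
    then show ?thesis
      by (rule continuous_on_tendsto_compose[OF continuous_on_product_coordinates]) auto
  qed
  ultimately show ?thesis by (rule that)
qed

text \<open>\<open>h\<close> is rounded down to a multiple of \<open>\<epsilon>\<close>; boundedness
  leaves finitely many values.\<close>

lemma uniform_step_approx:
  fixes h :: "'a \<Rightarrow> real"
  assumes h: "h \<in> borel_measurable M" "\<And>x. \<bar>h x\<bar> \<le> B" and \<epsilon>: "\<epsilon> > 0"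
  obtains I :: "int set" and S c where "finite I" "\<And>k. k \<in> I \<Longrightarrow> S k \<in> sets M"
    "\<And>x. x \<in> space M \<Longrightarrow> \<bar>h x - (\<Sum>k\<in>I. c k * indicator (S k) x)\<bar> \<le> \<epsilon>"
proof -
  define I where "I = {\<lfloor>- B / \<epsilon>\<rfloor>..\<lfloor>B / \<epsilon>\<rfloor>}"
  define S where "S k = {x \<in> space M. \<lfloor>h x / \<epsilon>\<rfloor> = k}" for k
  show ?thesis
  proof (rule that[of I S "\<lambda>k. \<epsilon> * k"])
    show "finite I" by (simp add: I_def)
    show "S k \<in> sets M" for k
      unfolding S_def using h(1) by measurable
    fix x assume x: "x \<in> space M"
    have "- B / \<epsilon> \<le> h x / \<epsilon>" "h x / \<epsilon> \<le> B / \<epsilon>"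
      using h(2)[of x] \<epsilon> by (auto intro!: divide_right_mono[of "- B" "h x" \<epsilon>, simplified] divide_right_mono)
    then have k: "\<lfloor>h x / \<epsilon>\<rfloor> \<in> I" by (auto simp: I_def floor_mono)
    have "(\<Sum>k\<in>I. \<epsilon> * k * indicator (S k) x) = (\<Sum>k\<in>I. if k = \<lfloor>h x / \<epsilon>\<rfloor> then \<epsilon> * k else 0)"
      using x by (intro sum.cong) (auto simp: S_def)
    also have "\<dots> = \<epsilon> * \<lfloor>h x / \<epsilon>\<rfloor>"
      using k by (simp add: I_def)
    finally have eq: "(\<Sum>k\<in>I. \<epsilon> * k * indicator (S k) x) = \<epsilon> * \<lfloor>h x / \<epsilon>\<rfloor>" .
    have "\<epsilon> * \<lfloor>h x / \<epsilon>\<rfloor> \<le> \<epsilon> * (h x / \<epsilon>)" "\<epsilon> * (h x / \<epsilon>) \<le> \<epsilon> * (\<lfloor>h x / \<epsilon>\<rfloor> + 1)"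
      using \<epsilon> by (intro mult_left_mono; linarith)+
    then show "\<bar>h x - (\<Sum>k\<in>I. \<epsilon> * k * indicator (S k) x)\<bar> \<le> \<epsilon>"
      unfolding eq using \<epsilon> by (simp add: algebra_simps)
  qed
qed

text \<open>The Dunford-Pettis theorem, with a filter in place of a subsequence.\<close>

lemma (in finite_measure) uniformly_integrable_weak_limit:
  fixes g :: "real \<Rightarrow> 'i \<Rightarrow> 'a \<Rightarrow> real"
  assumes g: "\<And>\<rho> i. \<rho> > 0 \<Longrightarrow> g \<rho> i \<in> borel_measurable M" "\<And>\<rho> i x. g \<rho> i x \<ge> 0"
    and ui: "\<And>\<epsilon>. \<epsilon> > 0 \<Longrightarrow> \<exists>K\<ge>0. \<forall>\<rho>>0. \<forall>i. \<forall>S\<in>sets M. (\<integral>\<^sup>+x. ennreal (g \<rho> i x) * indicator S x \<partial>M) \<le> ennreal \<epsilon> + ennreal K * emeasure M S"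
  obtains F f where "F \<noteq> bot" "F \<le> at_right 0" "\<And>i. f i \<in> borel_measurable M" "\<And>i x. f i x \<ge> 0" "\<And>i. integrable M (f i)"
    "\<And>i h B. h \<in> borel_measurable M \<Longrightarrow> (\<And>x. \<bar>h x\<bar> \<le> B) \<Longrightarrow> ((\<lambda>\<rho>. LINT x|M. h x * g \<rho> i x) \<longlongrightarrow> (LINT x|M. h x * f i x)) F"
proof -
  have ui': "\<exists>K\<ge>0. \<forall>\<rho>>0. \<forall>i. integrable M (g \<rho> i) \<and> (\<forall>S\<in>sets M. (LINT x|M. indicator S x * g \<rho> i x) \<le> \<epsilon> + K * measure M S)"
    if \<epsilon>: "\<epsilon> > 0" for \<epsilon>
  proof -
    obtain K where K: "K \<ge> 0" "\<And>\<rho> i S. \<rho> > 0 \<Longrightarrow> S \<in> sets M \<Longrightarrow> (\<integral>\<^sup>+x. ennreal (g \<rho> i x) * indicator S x \<partial>M) \<le> ennreal \<epsilon> + ennreal K * emeasure M S"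
      using ui[OF \<epsilon>] by blast
    have fin: "ennreal \<epsilon> + ennreal K * emeasure M S = ennreal (\<epsilon> + K * measure M S)" for S
      using K \<epsilon> by (simp add: emeasure_eq_measure ennreal_mult ennreal_plus)
    have int: "integrable M (g \<rho> i)" if \<rho>: "\<rho> > 0" for \<rho> i
    proof (rule integrableI_bounded[OF g(1)[OF \<rho>]])
      have "(\<integral>\<^sup>+x. ennreal (norm (g \<rho> i x)) \<partial>M) = (\<integral>\<^sup>+x. ennreal (g \<rho> i x) * indicator (space M) x \<partial>M)"
        by (intro nn_integral_cong) (simp add: g(2))
      also have "\<dots> \<le> ennreal (\<epsilon> + K * measure M (space M))"
        using K(2)[OF \<rho> sets.top, of i] by (simp only: fin)
      finally show "(\<integral>\<^sup>+x. ennreal (norm (g \<rho> i x)) \<partial>M) < \<infinity>" by (rule le_less_trans) simp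
    qed
    have "(LINT x|M. indicator S x * g \<rho> i x) \<le> \<epsilon> + K * measure M S" if \<rho>: "\<rho> > 0" and S: "S \<in> sets M" for \<rho> i S
    proof -
      have "integrable M (\<lambda>x. indicator S x * g \<rho> i x)"
        using integrable_mult_indicator[OF S int[OF \<rho>]] by simp
      then have "ennreal (LINT x|M. indicator S x * g \<rho> i x) = (\<integral>\<^sup>+x. ennreal (indicator S x * g \<rho> i x) \<partial>M)"
        by (intro nn_integral_eq_integral[symmetric]) (auto simp: g(2))
      also have "\<dots> = (\<integral>\<^sup>+x. ennreal (g \<rho> i x) * indicator S x \<partial>M)"
        by (intro nn_integral_cong) (auto simp: indicator_def)
      also have "\<dots> \<le> ennreal (\<epsilon> + K * measure M S)"
        using K(2)[OF \<rho> S] by (simp only: fin)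
      finally show ?thesis
        using K(1) \<epsilon> by (subst (asm) ennreal_le_iff) auto
    qed
    then show ?thesis using K(1) int by blast
  qed
  \<comment> \<open>The index \<open>i\<close> is part of the coordinate, so that one filter serves
    all \<open>i\<close>.\<close>
  define \<Phi> where "\<Phi> \<rho> = (\<lambda>(i, S). if S \<in> sets M then LINT x|M. indicator S x * g \<rho> i x else 0)" for \<rho>
  obtain K1 where K1: "K1 \<ge> 0" "\<And>\<rho> i. \<rho> > 0 \<Longrightarrow> integrable M (g \<rho> i)"
    "\<And>\<rho> i S. \<rho> > 0 \<Longrightarrow> S \<in> sets M \<Longrightarrow> (LINT x|M. indicator S x * g \<rho> i x) \<le> 1 + K1 * measure M S"
    using ui'[of 1] by auto
  have int: "integrable M (\<lambda>x. indicator S x * g \<rho> i x)" if "\<rho> > 0" "S \<in> sets M" for \<rho> i S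
    using integrable_mult_indicator[OF that(2) K1(2)[OF that(1)]] by simp
  have nn: "0 \<le> (LINT x|M. indicator S x * g \<rho> i x)" for S \<rho> i
    by (intro integral_nonneg_AE) (auto simp: g(2))
  have "eventually (\<lambda>\<rho>. 0 < \<rho>) (at_right (0::real))" by (rule eventually_at_right_less)
  then have ev: "eventually (\<lambda>\<rho>. \<forall>h. \<bar>\<Phi> \<rho> h\<bar> \<le> 1 + K1 * measure M (snd h)) (at_right 0)"
  proof eventually_elim
    case (elim \<rho>)
    show ?case using K1(1) K1(3)[OF elim] nn by (auto simp: \<Phi>_def)
  qed
  obtain F l where F: "F \<noteq> bot" "F \<le> at_right 0" and l: "\<And>h. ((\<lambda>\<rho>. \<Phi> \<rho> h) \<longlongrightarrow> l h) F"
  proof (rule filter_limit[of "at_right (0::real)" \<Phi> "\<lambda>h. 1 + K1 * measure M (snd h)"])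
  qed (use ev in auto)
  have Pos: "eventually (\<lambda>\<rho>. 0 < \<rho>) F"
    using F(2) eventually_at_right_less[of "0::real"] by (auto simp: le_filter_def)
  have lS: "((\<lambda>\<rho>. LINT x|M. indicator S x * g \<rho> i x) \<longlongrightarrow> l (i, S)) F" if "S \<in> sets M" for i S
    using l[of "(i, S)"] that by (simp add: \<Phi>_def)
  have l0: "0 \<le> l (i, S)" if "S \<in> sets M" for i S
    by (rule tendsto_lowerbound[OF lS[OF that] _ F(1)]) (simp add: nn)
  have lK: "\<exists>K\<ge>0. \<forall>i. \<forall>S\<in>sets M. l (i, S) \<le> \<epsilon> + K * measure M S" if \<epsilon>: "\<epsilon> > 0" for \<epsilon>
  proof -
    obtain K where K: "K \<ge> 0" "\<And>\<rho> i S. \<rho> > 0 \<Longrightarrow> S \<in> sets M \<Longrightarrow> (LINT x|M. indicator S x * g \<rho> i x) \<le> \<epsilon> + K * measure M S"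
      using ui'[OF \<epsilon>] by blast
    have "l (i, S) \<le> \<epsilon> + K * measure M S" if S: "S \<in> sets M" for i S
    proof (rule tendsto_upperbound[OF lS[OF S] _ F(1)])
      show "\<forall>\<^sub>F \<rho> in F. (LINT x|M. indicator S x * g \<rho> i x) \<le> \<epsilon> + K * measure M S"
        using Pos by eventually_elim (rule K(2)[OF _ S])
    qed
    then show ?thesis using K(1) by blast
  qed
  have ladd: "l (i, S \<union> T) = l (i, S) + l (i, T)" if "S \<in> sets M" "T \<in> sets M" "S \<inter> T = {}" for i S T
  proof (rule tendsto_unique[OF F(1) lS])
    show "((\<lambda>\<rho>. LINT x|M. indicator (S \<union> T) x * g \<rho> i x) \<longlongrightarrow> l (i, S) + l (i, T)) F"
    proof (rule Lim_transform_eventually[OF tendsto_add[OF lS[OF that(1)] lS[OF that(2)]]])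
      show "\<forall>\<^sub>F \<rho> in F. (LINT x|M. indicator S x * g \<rho> i x) + (LINT x|M. indicator T x * g \<rho> i x) = (LINT x|M. indicator (S \<union> T) x * g \<rho> i x)"
        using Pos
      proof eventually_elim
        case (elim \<rho>)
        have "(LINT x|M. indicator (S \<union> T) x * g \<rho> i x) = (LINT x|M. indicator S x * g \<rho> i x + indicator T x * g \<rho> i x)"
          using that(3) by (intro Bochner_Integration.integral_cong) (auto simp: indicator_def)
        then show ?case using int[OF elim that(1)] int[OF elim that(2)] by simp
      qed
    qed
  qed (use that in auto)
  have lempty: "l (i, {}) = 0" for i
    using ladd[of "{}" "{}" i] by simp
  have lfin: "l (i, \<Union>k<n. S k) = (\<Sum>k<n. l (i, S k))" if "range S \<subseteq> sets M" "disjoint_family S" for i and S :: "nat \<Rightarrow> 'a set" and n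
  proof (induction n)
    case (Suc n)
    have "S n \<inter> S k = {}" if "k < n" for k
      using disjoint_family_onD[OF \<open>disjoint_family S\<close>, of n k] that by simp
    then have "S n \<inter> (\<Union>k<n. S k) = {}" by blast
    moreover have "(\<Union>k<Suc n. S k) = S n \<union> (\<Union>k<n. S k)"
      by (auto simp: lessThan_Suc)
    moreover have "S n \<in> sets M" "(\<Union>k<n. S k) \<in> sets M" using that(1) by auto
    ultimately show ?case using ladd[of "S n" "\<Union>k<n. S k" i] Suc by simp
  qed (simp add: lempty)
  \<comment> \<open>Finite additivity passes to the limit by itself. Countable additivity is where
    uniform integrability enters: it makes the limit small on the tails \<open>T n\<close>, which
    decrease to the empty set.\<close>
  have lsums: "(\<lambda>k. l (i, S k)) sums l (i, \<Union>k. S k)" if S: "range S \<subseteq> sets M" "disjoint_family S" for i and S :: "nat \<Rightarrow> 'a set"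
  proof -
    define T where "T n = (\<Union>k. S k) - (\<Union>k<n. S k)" for n
    have T: "T n \<in> sets M" for n unfolding T_def using S(1) by auto
    have "decseq T" unfolding T_def decseq_def by (auto intro: less_le_trans)
    then have "(\<lambda>n. measure M (T n)) \<longlonglongrightarrow> measure M (\<Inter>n. T n)"
      using T by (intro finite_Lim_measure_decseq) auto
    moreover have "(\<Inter>n. T n) = {}" unfolding T_def by (auto intro: lessI)
    ultimately have T0: "(\<lambda>n. measure M (T n)) \<longlonglongrightarrow> 0" by simp
    have eq: "l (i, \<Union>k. S k) = (\<Sum>k<n. l (i, S k)) + l (i, T n)" for n
    proof -
      have "(\<Union>k. S k) = (\<Union>k<n. S k) \<union> T n" by (auto simp: T_def)
      moreover have "(\<Union>k<n. S k) \<in> sets M" using S(1) by auto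
      moreover have "(\<Union>k<n. S k) \<inter> T n = {}" by (auto simp: T_def)
      ultimately show ?thesis using ladd[of "\<Union>k<n. S k" "T n" i] T lfin[OF S] by simp
    qed
    have "(\<lambda>n. l (i, T n)) \<longlonglongrightarrow> 0"
    proof (rule LIMSEQ_I)
      fix \<epsilon> :: real assume \<epsilon>: "\<epsilon> > 0"
      then obtain K where K: "K \<ge> 0" "\<And>S. S \<in> sets M \<Longrightarrow> l (i, S) \<le> \<epsilon> / 2 + K * measure M S"
        using lK[of "\<epsilon> / 2"] by auto
      have "(\<lambda>n. K * measure M (T n)) \<longlonglongrightarrow> K * 0" by (intro tendsto_intros T0)
      from order_tendstoD(2)[OF this, of "\<epsilon> / 2"] \<epsilon>
      have "eventually (\<lambda>n. K * measure M (T n) < \<epsilon> / 2) sequentially" by simp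
      then have "eventually (\<lambda>n. norm (l (i, T n) - 0) < \<epsilon>) sequentially"
      proof eventually_elim
        case (elim n)
        then show ?case using K(2)[OF T[of n]] l0[OF T[of n], of i] by simp
      qed
      then show "\<exists>no. \<forall>n\<ge>no. norm (l (i, T n) - 0) < \<epsilon>" by (simp add: eventually_sequentially)
    qed
    then have "(\<lambda>n. l (i, \<Union>k. S k) - l (i, T n)) \<longlonglongrightarrow> l (i, \<Union>k. S k) - 0"
      by (intro tendsto_intros)
    moreover have "(\<lambda>n. l (i, \<Union>k. S k) - l (i, T n)) = (\<lambda>n. \<Sum>k<n. l (i, S k))"
    proof
      show "l (i, \<Union>k. S k) - l (i, T n) = (\<Sum>k<n. l (i, S k))" for n
        using eq[of n] by linarith
    qed
    ultimately show ?thesis unfolding sums_def by simp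
  qed
  have "\<exists>f\<in>borel_measurable M. (\<forall>x. f x \<ge> 0) \<and> integrable M f \<and> (\<forall>S\<in>sets M. l (i, S) = (LINT x|M. indicator S x * f x))" for i
  proof -
    define N where "N = measure_of (space M) (sets M) (\<lambda>S. ennreal (l (i, S)))"
    have setsN: "sets N = sets M" "space N = space M" by (simp_all add: N_def)
    have eN: "emeasure N S = ennreal (l (i, S))" if "S \<in> sets M" for S
      unfolding N_def
    proof (rule emeasure_measure_of_sigma)
      show "positive (sets M) (\<lambda>S. ennreal (l (i, S)))" by (simp add: positive_def lempty)
      show "countably_additive (sets M) (\<lambda>S. ennreal (l (i, S)))"
      proof (rule countably_additiveI)
        fix S :: "nat \<Rightarrow> 'a set" assume S: "range S \<subseteq> sets M" "disjoint_family S"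
        have "(\<Sum>k. ennreal (l (i, S k))) = ennreal (\<Sum>k. l (i, S k))"
          using S l0 lsums[OF S, of i] by (intro suminf_ennreal2) (auto simp: sums_iff)
        then show "(\<Sum>k. ennreal (l (i, S k))) = ennreal (l (i, \<Union>k. S k))"
          using lsums[OF S, of i] by (simp add: sums_iff)
      qed
    qed (use that in \<open>auto simp: sets.sigma_algebra_axioms\<close>)
    \<comment> \<open>On a null set the bound \<open>\<epsilon> + K * measure M S\<close> reduces to
      \<open>\<epsilon>\<close>.\<close>
    have "absolutely_continuous M N"
      unfolding absolutely_continuous_def
    proof
      fix S assume "S \<in> null_sets M"
      then have S: "S \<in> sets M" "measure M S = 0" by (auto simp: measure_eq_0_null_sets)
      have "l (i, S) \<le> 0"
      proof (rule field_le_epsilon)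
        fix \<epsilon> :: real assume "\<epsilon> > 0"
        then show "l (i, S) \<le> 0 + \<epsilon>" using lK[of \<epsilon>] S by fastforce
      qed
      then show "S \<in> null_sets N" using S setsN eN[OF S(1)] by (auto simp: null_sets_def ennreal_neg)
    qed
    then obtain f where f: "f \<in> borel_measurable M" "density M f = N"
      using Radon_Nikodym[of N] setsN by blast
    have fS: "(\<integral>\<^sup>+x. f x * indicator S x \<partial>M) = ennreal (l (i, S))" if "S \<in> sets M" for S
      using that eN f by (simp flip: emeasure_density)
    have "(\<integral>\<^sup>+x. f x \<partial>M) = (\<integral>\<^sup>+x. f x * indicator (space M) x \<partial>M)"
      by (intro nn_integral_cong) simp
    then have "(\<integral>\<^sup>+x. f x \<partial>M) \<noteq> \<infinity>" using fS[OF sets.top] by simp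
    then have "AE x in M. f x \<noteq> \<infinity>" using f by (intro nn_integral_PInf_AE) auto
    then have ae: "AE x in M. ennreal (enn2real (f x)) = f x"
      by eventually_elim (simp add: less_top)
    have i: "integrable M (\<lambda>x. indicator S x * enn2real (f x)) \<and> (LINT x|M. indicator S x * enn2real (f x)) = l (i, S)" if S: "S \<in> sets M" for S
    proof -
      have "(\<integral>\<^sup>+x. ennreal (indicator S x * enn2real (f x)) \<partial>M) = (\<integral>\<^sup>+x. f x * indicator S x \<partial>M)"
        by (rule nn_integral_cong_AE) (use ae in \<open>eventually_elim, auto simp: indicator_def\<close>)
      then have e: "(\<integral>\<^sup>+x. ennreal (indicator S x * enn2real (f x)) \<partial>M) = ennreal (l (i, S))" using fS[OF S] by simp
      have [measurable]: "f \<in> borel_measurable M" by (rule f)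
      have "integrable M (\<lambda>x. indicator S x * enn2real (f x))"
        using S e by (intro integrableI_nonneg) auto
      moreover have "(LINT x|M. indicator S x * enn2real (f x)) = l (i, S)"
        using S e l0[OF S, of i] by (subst integral_eq_nn_integral) auto
      ultimately show ?thesis by blast
    qed
    have "integrable M (\<lambda>x. indicator (space M) x * enn2real (f x)) = integrable M (\<lambda>x. enn2real (f x))"
      by (intro Bochner_Integration.integrable_cong) auto
    then show ?thesis
      using i f by (intro bexI[of _ "\<lambda>x. enn2real (f x)"]) auto
  qed
  then obtain f where f: "\<And>i. f i \<in> borel_measurable M" "\<And>i x. f i x \<ge> 0" "\<And>i. integrable M (f i)"
    "\<And>i S. S \<in> sets M \<Longrightarrow> l (i, S) = (LINT x|M. indicator S x * f i x)" by metis
  show ?thesis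
  proof (rule that[OF F f(1-3)])
    fix i and h :: "'a \<Rightarrow> real" and B assume h: "h \<in> borel_measurable M" "\<And>x. \<bar>h x\<bar> \<le> B"
    have B: "B \<ge> 0" using h(2) by (meson abs_ge_zero order_trans)
    define c where "c = 1 + K1 * measure M (space M)"
    have c: "c > 0" using K1 by (auto simp: c_def intro!: add_pos_nonneg)
    have gc: "(LINT x|M. g \<rho> i x) \<le> c" if "\<rho> > 0" for \<rho>
    proof -
      have "(LINT x|M. g \<rho> i x) = (LINT x|M. indicator (space M) x * g \<rho> i x)"
        by (intro Bochner_Integration.integral_cong) auto
      then show ?thesis using K1(3)[OF that sets.top] by (simp add: c_def)
    qed
    define c' where "c' = (LINT x|M. f i x)"
    have c': "c' \<ge> 0" unfolding c'_def by (intro integral_nonneg_AE) (auto simp: f)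
    show "((\<lambda>\<rho>. LINT x|M. h x * g \<rho> i x) \<longlongrightarrow> (LINT x|M. h x * f i x)) F"
    proof (rule tendstoI)
      fix e :: real assume e: "e > 0"
      \<comment> \<open>Replacing \<open>h\<close> by a step function costs at most
        \<open>\<epsilon> * c\<close> for \<open>g \<rho> i\<close> and
        \<open>\<epsilon> * c'\<close> for \<open>f i\<close>, together \<open>e / 2\<close>; the
        other half is left for the convergence on finitely many sets.\<close>
      define \<epsilon> where "\<epsilon> = e / 2 / (c + c')"
      have cc: "c + c' > 0" using c c' by simp
      have \<epsilon>: "\<epsilon> > 0" "\<epsilon> * c + \<epsilon> * c' = e / 2"
      proof -
        show "\<epsilon> > 0" using e cc by (simp add: \<epsilon>_def)
        have "\<epsilon> * c + \<epsilon> * c' = \<epsilon> * (c + c')" by (simp add: distrib_left)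
        also have "\<dots> = e / 2"
          unfolding \<epsilon>_def by (rule nonzero_eq_divide_eq[THEN iffD1]) (use cc in auto)
        finally show "\<epsilon> * c + \<epsilon> * c' = e / 2" .
      qed
      obtain I :: "int set" and S a where S: "finite I" "\<And>k. k \<in> I \<Longrightarrow> S k \<in> sets M"
        and app: "\<And>x. x \<in> space M \<Longrightarrow> \<bar>h x - (\<Sum>k\<in>I. a k * indicator (S k) x)\<bar> \<le> \<epsilon>"
        using uniform_step_approx[OF h \<epsilon>(1)] by metis
      define st where "st x = (\<Sum>k\<in>I. a k * indicator (S k) x)" for x
      have near: "\<bar>(LINT x|M. h x * q x) - (\<Sum>k\<in>I. a k * (LINT x|M. indicator (S k) x * q x))\<bar> \<le> \<epsilon> * (LINT x|M. q x)"
        if q: "integrable M q" "\<And>x. q x \<ge> 0" for q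
      proof -
        have i1: "integrable M (\<lambda>x. h x * q x)"
          by (rule Bochner_Integration.integrable_bound[OF integrable_mult_right[OF q(1), of B]])
             (use h q B in \<open>auto simp: abs_mult intro!: mult_right_mono borel_measurable_integrable\<close>)
        have i2: "integrable M (\<lambda>x. indicator (S k) x * q x)" if "k \<in> I" for k
          using integrable_mult_indicator[OF S(2)[OF that] q(1)] by simp
        have e2: "(\<Sum>k\<in>I. a k * (LINT x|M. indicator (S k) x * q x)) = (LINT x|M. st x * q x)"
          using i2 by (simp add: st_def sum_distrib_right mult.assoc)
        have i3: "integrable M (\<lambda>x. st x * q x)"
          using i2 unfolding st_def sum_distrib_right mult.assoc by (intro Bochner_Integration.integrable_sum integrable_mult_right)
        have "\<bar>(LINT x|M. h x * q x) - (LINT x|M. st x * q x)\<bar> = \<bar>LINT x|M. h x * q x - st x * q x\<bar>"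
          using i1 i3 by simp
        also have "\<dots> \<le> (LINT x|M. \<bar>h x * q x - st x * q x\<bar>)"
          using integral_norm_bound[of M "\<lambda>x. h x * q x - st x * q x"] by simp
        also have "\<dots> \<le> (LINT x|M. \<epsilon> * q x)"
        proof (rule integral_mono)
          show "integrable M (\<lambda>x. \<bar>h x * q x - st x * q x\<bar>)" using i1 i3 by simp
          show "integrable M (\<lambda>x. \<epsilon> * q x)" using q by simp
          fix x assume "x \<in> space M"
          have "\<bar>h x * q x - st x * q x\<bar> = \<bar>h x - st x\<bar> * q x"
            using q(2)[of x] by (simp add: abs_mult flip: left_diff_distrib)
          also have "\<dots> \<le> \<epsilon> * q x"
            using app[OF \<open>x \<in> space M\<close>] q(2)[of x] by (intro mult_right_mono) (auto simp: st_def)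
          finally show "\<bar>h x * q x - st x * q x\<bar> \<le> \<epsilon> * q x" .
        qed
        finally show ?thesis using e2 by simp
      qed
      have "((\<lambda>\<rho>. \<Sum>k\<in>I. a k * (LINT x|M. indicator (S k) x * g \<rho> i x)) \<longlongrightarrow> (\<Sum>k\<in>I. a k * (LINT x|M. indicator (S k) x * f i x))) F"
        by (intro tendsto_intros) (use lS S(2) f(4) in metis)
      from tendstoD[OF this, of "e / 2"] e
      have "\<forall>\<^sub>F \<rho> in F. dist (\<Sum>k\<in>I. a k * (LINT x|M. indicator (S k) x * g \<rho> i x)) (\<Sum>k\<in>I. a k * (LINT x|M. indicator (S k) x * f i x)) < e / 2"
        by simp
      then show "\<forall>\<^sub>F \<rho> in F. dist (LINT x|M. h x * g \<rho> i x) (LINT x|M. h x * f i x) < e"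
        using Pos
      proof eventually_elim
        case (elim \<rho>)
        have "\<epsilon> * (LINT x|M. g \<rho> i x) \<le> \<epsilon> * c" using gc[OF elim(2)] \<epsilon> by simp
        then show ?case
          using near[OF K1(2)[OF elim(2)] g(2), of i] near[OF f(3) f(2), of i] elim(1) \<epsilon>(2)
          unfolding dist_real_def c'_def by linarith
      qed
    qed
  qed
qed

section \<open>Binary digits and Schoenberg's curve\<close>

definition bindig :: "nat \<Rightarrow> real \<Rightarrow> real" where
  "bindig k y = of_int (\<lfloor>2 ^ Suc k * y\<rfloor> mod 2)"

lemma bindig_cases: "bindig k y = 0 \<or> bindig k y = 1"
proof -
  have "\<lfloor>2 ^ Suc k * y\<rfloor> mod 2 = 0 \<or> \<lfloor>2 ^ Suc k * y\<rfloor> mod 2 = 1" by presburger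
  then show ?thesis by (auto simp: bindig_def)
qed

lemma borel_measurable_bindig [measurable]: "bindig k \<in> borel_measurable borel"
  unfolding bindig_def by measurable

text \<open>The partial sums are \<open>\<lfloor>2 ^ n * y\<rfloor> / 2 ^ n\<close>, since
  \<open>\<lfloor>2 ^ Suc n * y\<rfloor>\<close> is twice \<open>\<lfloor>2 ^ n * y\<rfloor>\<close>
  plus the next digit. The bounds on \<open>y\<close> make the empty sum correct.\<close>

lemma bindig_sums:
  assumes y: "0 \<le> y" "y < 1"
  shows "(\<lambda>k. bindig k y / 2 ^ Suc k) sums y"
proof -
  have fin: "(\<Sum>k<n. bindig k y / 2 ^ Suc k) = \<lfloor>2 ^ n * y\<rfloor> / 2 ^ n" for n
  proof (induction n)
    case 0
    have "\<lfloor>y\<rfloor> = 0" using y by (simp add: floor_eq_iff)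
    then show ?case by simp
  next
    case (Suc n)
    have "\<lfloor>2 ^ Suc n * y\<rfloor> div 2 = \<lfloor>2 ^ n * y\<rfloor>"
      using floor_divide_real_eq_div[of 2 "2 ^ Suc n * y"] by simp
    then have "\<lfloor>2 ^ Suc n * y\<rfloor> = 2 * \<lfloor>2 ^ n * y\<rfloor> + \<lfloor>2 ^ Suc n * y\<rfloor> mod 2" by presburger
    then have "real_of_int \<lfloor>2 ^ Suc n * y\<rfloor> = real_of_int (2 * \<lfloor>2 ^ n * y\<rfloor> + \<lfloor>2 ^ Suc n * y\<rfloor> mod 2)" by simp
    then have "real_of_int \<lfloor>2 ^ Suc n * y\<rfloor> = 2 * \<lfloor>2 ^ n * y\<rfloor> + bindig n y"
      by (simp only: bindig_def of_int_add of_int_mult of_int_numeral)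
    then show ?case unfolding sum.lessThan_Suc Suc.IH by (simp add: field_simps)
  qed
  have "(\<lambda>n. \<lfloor>2 ^ n * y\<rfloor> / 2 ^ n) \<longlonglongrightarrow> y"
  proof (rule real_tendsto_sandwich)
    have "(\<lambda>n. (1/2::real) ^ n) \<longlonglongrightarrow> 0" by (rule LIMSEQ_power_zero) simp
    then have "(\<lambda>n. y - (1/2) ^ n) \<longlonglongrightarrow> y - 0" by (intro tendsto_diff tendsto_const)
    then show "(\<lambda>n. y - (1/2) ^ n) \<longlonglongrightarrow> y" by simp
    show "\<forall>\<^sub>F n in sequentially. y - (1/2) ^ n \<le> \<lfloor>2 ^ n * y\<rfloor> / 2 ^ n"
    proof (rule always_eventually, rule allI)
      fix n
      have "2 ^ n * y - 1 \<le> \<lfloor>2 ^ n * y\<rfloor>" by linarith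
      then have "(2 ^ n * y - 1) / 2 ^ n \<le> \<lfloor>2 ^ n * y\<rfloor> / 2 ^ n" by (intro divide_right_mono) auto
      then show "y - (1/2) ^ n \<le> \<lfloor>2 ^ n * y\<rfloor> / 2 ^ n" by (simp add: field_simps power_one_over)
    qed
    show "\<forall>\<^sub>F n in sequentially. \<lfloor>2 ^ n * y\<rfloor> / 2 ^ n \<le> y"
      by (intro always_eventually allI) (simp add: field_simps)
  qed (rule tendsto_const)
  then show ?thesis unfolding sums_def fin .
qed

text \<open>Schoenberg's space-filling curve: \<open>bump\<close> reads off ternary digits, being \<open>0\<close> on \<open>[0,1/3]\<close> and
  \<open>1\<close> on \<open>[2/3,1]\<close> and having period \<open>2\<close>.\<close>

definition bump :: "real \<Rightarrow> real" where
  "bump t = max 0 (min 1 (1 / 2 - cos (pi * t)))"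

lemma bump_bounds: "0 \<le> bump t" "bump t \<le> 1"
  by (auto simp: bump_def)

lemma bump_low: "0 \<le> t \<Longrightarrow> t \<le> 1/3 \<Longrightarrow> bump t = 0"
proof -
  assume t: "0 \<le> t" "t \<le> 1/3"
  have "cos (pi / 3) \<le> cos (pi * t)"
    using t pi_gt_zero by (intro cos_monotone_0_pi_le) (auto simp: field_simps)
  then show ?thesis by (simp add: bump_def cos_60)
qed

lemma bump_high: "2/3 \<le> t \<Longrightarrow> t \<le> 1 \<Longrightarrow> bump t = 1"
proof -
  assume t: "2/3 \<le> t" "t \<le> 1"
  have "cos (pi * t) \<le> cos (pi - pi / 3)"
    using t pi_gt_zero by (intro cos_monotone_0_pi_le) (auto simp: field_simps)
  then have "cos (pi * t) \<le> - (1/2)" by (simp only: cos_pi_minus cos_60)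
  then show ?thesis by (simp add: bump_def)
qed

lemma bump_periodic: "bump (t + 2 * of_int k) = bump t"
proof -
  have "pi * (t + 2 * of_int k) = pi * t + 2 * pi * of_int k" by (simp add: algebra_simps)
  then show ?thesis
    unfolding bump_def by (simp only: cos_add cos_int_2pin sin_int_2pin mult_1_right mult_zero_right diff_0_right)
qed

text \<open>The point of the middle-thirds Cantor set with ternary digits
  \<open>2 * a n\<close>.\<close>

definition cantor :: "(nat \<Rightarrow> real) \<Rightarrow> real" where
  "cantor a = (\<Sum>n. 2 * a n / 3 ^ Suc n)"

context
  fixes a :: "nat \<Rightarrow> real"
  assumes a: "\<And>n. a n = 0 \<or> a n = 1"
begin

lemma cantor_bounds: "summable (\<lambda>n. 2 * a n / 3 ^ Suc n)" "0 \<le> cantor a" "cantor a \<le> 1"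
proof -
  have geo: "(\<lambda>n. (2/3) * (1/3) ^ n :: real) sums ((2/3) * (1 / (1 - 1/3)))"
    by (intro sums_mult geometric_sums) simp
  then have geo: "(\<lambda>n. 2 / 3 ^ Suc n :: real) sums 1"
    by (simp add: power_one_over field_simps)
  have le: "2 * a n / 3 ^ Suc n \<le> 2 / 3 ^ Suc n" "0 \<le> 2 * a n / 3 ^ Suc n" for n
    using a[of n] by auto
  show s: "summable (\<lambda>n. 2 * a n / 3 ^ Suc n)"
    by (rule summable_comparison_test'[OF sums_summable[OF geo], of 0])
       (simp only: real_norm_def abs_of_nonneg[OF le(2)] le(1))
  show "0 \<le> cantor a" unfolding cantor_def by (rule suminf_nonneg[OF s le(2)])
  have "cantor a \<le> (\<Sum>n. 2 / 3 ^ Suc n)"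
    unfolding cantor_def by (rule suminf_le[OF le(1) s sums_summable[OF geo]])
  then show "cantor a \<le> 1" using geo by (simp add: sums_iff)
qed

end

text \<open>Multiplication by \<open>3 ^ n\<close> shifts the ternary digits by \<open>n\<close>
  places. All digits are \<open>0\<close> or \<open>2\<close>, so what moves in front of the point
  is an even integer and is removed by the period of \<open>bump\<close>; the rest lies in the first
  or the last third of the unit interval according to \<open>a n\<close>.\<close>

lemma bump_cantor:
  assumes a: "\<And>n. a n = 0 \<or> a n = 1"
  shows "bump (3 ^ n * cantor a) = a n"
proof -
  have shift: "cantor b = 2 * b 0 / 3 + cantor (\<lambda>n. b (Suc n)) / 3" if b: "\<And>n. b n = 0 \<or> b n = (1::real)" for b
  proof -
    have s: "summable (\<lambda>n. 2 * b (Suc n) / 3 ^ Suc n)" using cantor_bounds(1)[of "\<lambda>n. b (Suc n)"] b by blast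
    have "cantor b = (\<Sum>n. 2 * b (Suc n) / 3 ^ Suc (Suc n)) + 2 * b 0 / 3 ^ Suc 0"
      unfolding cantor_def using suminf_split_head[OF cantor_bounds(1)[of b, OF b]] by simp
    also have "(\<Sum>n. 2 * b (Suc n) / 3 ^ Suc (Suc n)) = (\<Sum>n. (2 * b (Suc n) / 3 ^ Suc n) / 3)"
      by (intro suminf_cong) simp
    also have "\<dots> = cantor (\<lambda>n. b (Suc n)) / 3"
      unfolding cantor_def by (rule suminf_divide[OF s])
    finally show ?thesis by simp
  qed
  have "\<exists>k::int. 3 ^ n * cantor a = 2 * of_int k + cantor (\<lambda>j. a (n + j))"
  proof (induction n)
    case 0 then show ?case by (intro exI[of _ 0]) simp
  next
    case (Suc n)
    then obtain k :: int where k: "3 ^ n * cantor a = 2 * of_int k + cantor (\<lambda>j. a (n + j))" by blast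
    have "cantor (\<lambda>j. a (n + j)) = 2 * a n / 3 + cantor (\<lambda>j. a (Suc n + j)) / 3"
      using shift[of "\<lambda>j. a (n + j)"] a by simp
    then have "3 ^ Suc n * cantor a = 2 * (3 * of_int k + a n) + cantor (\<lambda>j. a (Suc n + j))"
      using k by simp
    moreover obtain a' :: int where "a n = of_int a'" using a[of n] by (metis of_int_0 of_int_1)
    ultimately show ?case by (intro exI[of _ "3 * k + a'"]) simp
  qed
  then obtain k :: int where k: "3 ^ n * cantor a = cantor (\<lambda>j. a (n + j)) + 2 * of_int k"
    by (metis add.commute)
  define c where "c = cantor (\<lambda>j. a (Suc n + j))"
  have c: "0 \<le> c" "c \<le> 1" unfolding c_def using cantor_bounds[of "\<lambda>j. a (Suc n + j)"] a by blast+
  have "cantor (\<lambda>j. a (n + j)) = 2 * a n / 3 + c / 3"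
    using shift[of "\<lambda>j. a (n + j)"] a by (simp add: c_def)
  then have "bump (3 ^ n * cantor a) = bump (2 * a n / 3 + c / 3)"
    unfolding k bump_periodic by simp
  also have "\<dots> = a n"
    using a[of n] bump_low[of "c / 3"] bump_high[of "2 / 3 + c / 3"] c by auto
  finally show ?thesis .
qed

text \<open>Coordinate \<open>i\<close> reads the ternary digits in the positions congruent to
  \<open>i\<close> modulo \<open>d\<close> and takes them as binary digits, so \<open>d\<close>
  coordinates are interleaved in one number.\<close>

definition schoenberg :: "nat \<Rightarrow> nat \<Rightarrow> real \<Rightarrow> real" where
  "schoenberg d i t = (\<Sum>k. bump (3 ^ (k * d + i) * t) / 2 ^ Suc k)"

lemma half_sums: "(\<lambda>k. 1 / 2 ^ Suc k :: real) sums 1"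
  using power_half_series by (simp add: power_one_over)

lemma schoenberg_summable: "summable (\<lambda>k. bump (3 ^ (k * d + i) * t) / 2 ^ Suc k)"
  by (rule summable_comparison_test_ev[OF _ sums_summable[OF half_sums]])
     (auto simp: bump_bounds divide_right_mono)

lemma schoenberg_bounds: "0 \<le> schoenberg d i t" "schoenberg d i t \<le> 1"
proof -
  show "0 \<le> schoenberg d i t" unfolding schoenberg_def
    by (rule suminf_nonneg[OF schoenberg_summable]) (simp add: bump_bounds)
  have "schoenberg d i t \<le> (\<Sum>k. 1 / 2 ^ Suc k)" unfolding schoenberg_def
    by (rule suminf_le[OF _ schoenberg_summable sums_summable[OF half_sums]]) (simp add: bump_bounds divide_right_mono)
  then show "schoenberg d i t \<le> 1" using half_sums by (simp add: sums_iff)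
qed

lemma continuous_on_schoenberg: "continuous_on S (schoenberg d i)"
proof -
  have "uniform_limit S (\<lambda>n t. \<Sum>k<n. bump (3 ^ (k * d + i) * t) / 2 ^ Suc k) (schoenberg d i) sequentially"
    unfolding schoenberg_def[abs_def]
    by (rule Weierstrass_m_test[OF _ sums_summable[OF half_sums]]) (simp add: bump_bounds divide_right_mono)
  then show ?thesis
    by (rule uniform_limit_theorem[rotated])
       (auto intro!: always_eventually continuous_intros simp: bump_def)
qed

text \<open>Position \<open>k * d + i\<close> of the code holds the binary digit \<open>k\<close> of
  \<open>y i\<close>, and \<open>bump_cantor\<close> recovers it.\<close>

lemma schoenberg_cantor:
  assumes y: "\<And>i. i < d \<Longrightarrow> 0 \<le> y i \<and> y i < 1" and i: "i < d"
  shows "schoenberg d i (cantor (\<lambda>n. bindig (n div d) (y (n mod d)))) = y i"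
proof -
  have "bump (3 ^ (k * d + i) * cantor (\<lambda>n. bindig (n div d) (y (n mod d)))) = bindig k (y i)" for k
    using bump_cantor[of "\<lambda>n. bindig (n div d) (y (n mod d))" "k * d + i"] bindig_cases i by simp
  then show ?thesis
    using bindig_sums[of "y i"] y[OF i] by (simp add: schoenberg_def sums_iff)
qed

definition squash :: "real \<Rightarrow> real" where "squash t = 1 / 2 + t / (2 * (1 + \<bar>t\<bar>))"

text \<open>\<open>unsquash 0\<close> inverts \<open>squash\<close>; positive \<open>\<delta>\<close> make it continuous at the endpoints.\<close>

definition unsquash :: "real \<Rightarrow> real \<Rightarrow> real" where
  "unsquash \<delta> y = (2 * y - 1) / max \<delta> (1 - \<bar>2 * y - 1\<bar>)"

lemma squash_bounds: "0 < squash t" "squash t < 1"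
  by (auto simp: squash_def field_simps abs_if)

lemma unsquash_squash: "unsquash 0 (squash t) = t"
proof -
  have 1: "2 * squash t - 1 = t / (1 + \<bar>t\<bar>)" by (simp add: squash_def field_simps)
  have "1 - \<bar>t / (1 + \<bar>t\<bar>)\<bar> = 1 / (1 + \<bar>t\<bar>)" by (simp add: abs_divide field_simps)
  then show ?thesis unfolding unsquash_def 1 by (simp add: max_def)
qed

text \<open>
  Binary digits of the squashed coordinates encode a point as a number in \<open>[0,1]\<close>, which Schoenberg's
  continuous curve decodes. Hence Helly's selection theorem on the line suffices.
\<close>

lemma vague_limit:
  fixes g :: "nat \<Rightarrow> 'a::euclidean_space \<Rightarrow> real"
  assumes g [measurable]: "\<And>k. g k \<in> borel_measurable borel" and g0: "\<And>k x. g k x \<ge> 0"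
    and gC: "\<And>k. (\<integral>\<^sup>+x. ennreal (g k x) \<partial>lborel) \<le> ennreal C"
  obtains r \<nu> where "strict_mono (r :: nat \<Rightarrow> nat)" "finite_measure \<nu>" "sets \<nu> = sets borel"
    "\<And>h. h \<in> Cc \<Longrightarrow> (\<lambda>k. LINT x|lborel. h x * g (r k) x) \<longlonglongrightarrow> (LINT x|\<nu>. h x)"
proof -
  define d where "d = DIM('a)"
  obtain e :: "nat \<Rightarrow> 'a" where e: "bij_betw e {..<d} Basis"
    using ex_bij_betw_nat_finite[OF finite_Basis] by (auto simp: d_def atLeast0LessThan)
  have eB: "e i \<in> Basis" if "i < d" for i using e that by (auto simp: bij_betw_def)
  have d0: "d > 0" by (simp add: d_def)
  define \<Psi> where "\<Psi> x = cantor (\<lambda>n. bindig (n div d) (squash (x \<bullet> e (n mod d))))" for x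
  have [measurable]: "squash \<in> borel_measurable borel" unfolding squash_def by measurable
  have \<Psi>m [measurable]: "\<Psi> \<in> borel_measurable borel"
    unfolding \<Psi>_def[abs_def] cantor_def by measurable
  have \<Psi>01: "0 \<le> \<Psi> x" "\<Psi> x \<le> 1" for x
    unfolding \<Psi>_def by (rule cantor_bounds, rule bindig_cases)+
  have \<Psi>gt: "-1 < \<Psi> x" for x using \<Psi>01[of x] by linarith
  have sc: "schoenberg d i (\<Psi> x) = squash (x \<bullet> e i)" if "i < d" for i x
    unfolding \<Psi>_def using that squash_bounds
    by (intro schoenberg_cantor[where y="\<lambda>i. squash (x \<bullet> e i)"]) (auto intro: less_imp_le)
  define \<Gamma> where "\<Gamma> \<delta> t = (\<Sum>i<d. unsquash \<delta> (schoenberg d i t) *\<^sub>R e i)" for \<delta> t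
  have [measurable]: "schoenberg d i \<in> borel_measurable borel" for i
    by (rule borel_measurable_continuous_onI[OF continuous_on_schoenberg])
  have [measurable]: "\<Gamma> \<delta> \<in> borel_measurable borel" for \<delta>
    unfolding \<Gamma>_def[abs_def] unsquash_def by measurable
  have \<Gamma>e: "\<Gamma> \<delta> t \<bullet> e i = unsquash \<delta> (schoenberg d i t)" if i: "i < d" for \<delta> t i
  proof -
    have "\<Gamma> \<delta> t \<bullet> e i = (\<Sum>j<d. if j = i then unsquash \<delta> (schoenberg d j t) else 0)"
      unfolding \<Gamma>_def inner_sum_left inner_scaleR_left
      using i eB e by (intro sum.cong refl) (auto simp: inner_Basis bij_betw_def inj_on_eq_iff)
    also have "\<dots> = unsquash \<delta> (schoenberg d i t)" using i by simp
    finally show ?thesis .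
  qed
  have \<Gamma>\<Psi>: "\<Gamma> 0 (\<Psi> x) = x" for x
  proof -
    have "\<Gamma> 0 (\<Psi> x) = (\<Sum>i<d. (x \<bullet> e i) *\<^sub>R e i)"
      unfolding \<Gamma>_def by (intro sum.cong) (auto simp: sc unsquash_squash)
    also have "\<dots> = (\<Sum>b\<in>Basis. (x \<bullet> b) *\<^sub>R b)"
      by (rule sum.reindex_bij_betw[OF e])
    finally show ?thesis by (simp add: euclidean_representation)
  qed
  \<comment> \<open>\<open>U\<close> corresponds to the points of the space, and its complement in
    the range of codes to infinity. Mass that escapes to infinity ends up outside \<open>U\<close>
    in the limit and is discarded, as it must be for a vague limit.\<close>
  define U where "U = {t. \<forall>i<d. 0 < schoenberg d i t \<and> schoenberg d i t < 1}"
  have U [measurable]: "U \<in> sets borel" unfolding U_def by measurable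
  have \<Psi>U: "\<Psi> x \<in> U" for x using sc squash_bounds by (simp add: U_def)
  \<comment> \<open>Since \<open>h\<close> has compact support, its composition with the decoding
    map, set to zero outside \<open>U\<close>, is continuous and bounded on the line. Weak
    convergence can be tested with it.\<close>
  have phi: "\<exists>\<phi>. continuous_on UNIV \<phi> \<and> (\<exists>B. \<forall>t. \<bar>\<phi> t\<bar> \<le> B) \<and> (\<forall>t. \<phi> t = indicator U t * h (\<Gamma> 0 t))"
    if h: "h \<in> Cc" for h :: "'a \<Rightarrow> real"
  proof -
    obtain R where R: "\<And>x. h x \<noteq> 0 \<Longrightarrow> norm x \<le> R" "R \<ge> 0" using Cc_support[OF h] by blast
    obtain B where B: "\<And>x. \<bar>h x\<bar> \<le> B" using Cc_bounded[OF h] by blast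
    \<comment> \<open>A coordinate \<open>y\<close> with
      \<open>\<bar>2 * y - 1\<bar> > 1 - \<delta>\<close> is decoded to a number of absolute value
      above \<open>(1 - \<delta>) / \<delta> = R + 1\<close>, hence outside the support of
      \<open>h\<close>, by \<open>\<Gamma> \<delta>\<close> and on \<open>U\<close> also by
      \<open>\<Gamma> 0\<close>. For all other coordinates the two decodings coincide.\<close>
    define \<delta> where "\<delta> = 1 / (R + 2)"
    have \<delta>: "\<delta> > 0" "\<delta> < 1" using R(2) by (auto simp: \<delta>_def)
    have "continuous_on UNIV (\<Gamma> \<delta>)"
      unfolding \<Gamma>_def unsquash_def using \<delta>(1)
      by (intro continuous_intros continuous_on_schoenberg) (auto simp: max_def)
    then have "continuous_on UNIV (\<lambda>t. h (\<Gamma> \<delta> t))"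
      by (intro continuous_on_compose2[OF Cc_continuous[OF h, of UNIV]]) auto
    moreover have "h (\<Gamma> \<delta> t) = indicator U t * h (\<Gamma> 0 t)" for t
    proof (cases "\<forall>i<d. \<bar>2 * schoenberg d i t - 1\<bar> \<le> 1 - \<delta>")
      case True
      then have "t \<in> U" using \<delta> by (fastforce simp: U_def)
      moreover have "\<Gamma> \<delta> t = \<Gamma> 0 t"
        unfolding \<Gamma>_def unsquash_def
      proof (intro sum.cong refl)
        fix i assume "i \<in> {..<d}"
        then have "\<bar>2 * schoenberg d i t - 1\<bar> \<le> 1 - \<delta>" using True by blast
        then have "max \<delta> (1 - \<bar>2 * schoenberg d i t - 1\<bar>) = max 0 (1 - \<bar>2 * schoenberg d i t - 1\<bar>)"
          using \<delta> by linarith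
        then show "((2 * schoenberg d i t - 1) / max \<delta> (1 - \<bar>2 * schoenberg d i t - 1\<bar>)) *\<^sub>R e i =
           ((2 * schoenberg d i t - 1) / max 0 (1 - \<bar>2 * schoenberg d i t - 1\<bar>)) *\<^sub>R e i" by simp
      qed
      ultimately show ?thesis by simp
    next
      case False
      then obtain i where i: "i < d" and big: "1 - \<delta> < \<bar>2 * schoenberg d i t - 1\<bar>" by (auto simp: not_le)
      define w where "w = 2 * schoenberg d i t - 1"
      have w: "1 - \<delta> < \<bar>w\<bar>" "\<bar>w\<bar> \<le> 1" using big schoenberg_bounds[of d i t] unfolding w_def by linarith+
      have "h (\<Gamma> \<delta>' t) = 0" if d': "0 \<le> \<delta>'" "\<delta>' \<le> \<delta>" "0 < max \<delta>' (1 - \<bar>w\<bar>)" for \<delta>'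
      proof (rule ccontr)
        assume "h (\<Gamma> \<delta>' t) \<noteq> 0"
        then have nR: "norm (\<Gamma> \<delta>' t) \<le> R" by (rule R)
        have "\<bar>\<Gamma> \<delta>' t \<bullet> e i\<bar> \<le> norm (\<Gamma> \<delta>' t)" using Basis_le_norm[OF eB[OF i]] by simp
        moreover have "\<bar>\<Gamma> \<delta>' t \<bullet> e i\<bar> = \<bar>w\<bar> / max \<delta>' (1 - \<bar>w\<bar>)"
          using d'(3) by (simp add: \<Gamma>e[OF i] unsquash_def w_def[symmetric] abs_divide)
        moreover have "\<bar>w\<bar> / max \<delta>' (1 - \<bar>w\<bar>) \<ge> \<bar>w\<bar> / \<delta>"
          using d' w by (intro divide_left_mono) auto
        moreover have "\<bar>w\<bar> / \<delta> > (1 - \<delta>) / \<delta>" using w \<delta> by (intro divide_strict_right_mono) auto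
        moreover have "(1 - \<delta>) / \<delta> = R + 1" using R(2) by (simp add: \<delta>_def field_simps)
        ultimately show False using nR by linarith
      qed
      note z = this
      have "h (\<Gamma> \<delta> t) = 0" using z[of \<delta>] \<delta> by simp
      moreover have "h (\<Gamma> 0 t) = 0" if "t \<in> U"
      proof -
        have "0 < schoenberg d i t" "schoenberg d i t < 1" using that i by (auto simp: U_def)
        then have "\<bar>w\<bar> < 1" unfolding w_def by linarith
        then show ?thesis using z[of 0] \<delta> by simp
      qed
      ultimately show ?thesis by (cases "t \<in> U") auto
    qed
    moreover have "\<exists>B. \<forall>t. \<bar>h (\<Gamma> \<delta> t)\<bar> \<le> B" using B by blast
    ultimately show ?thesis by (intro exI[of _ "\<lambda>t. h (\<Gamma> \<delta> t)"]) blast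
  qed
  define c where "c k = (LINT x|lborel. g k x)" for k
  have gi: "integrable lborel (g k)" for k
    using gC[of k] g0 by (intro integrableI_nonneg) (auto intro: le_less_trans)
  have c: "ennreal (c k) = (\<integral>\<^sup>+x. ennreal (g k x) \<partial>lborel)" "0 \<le> c k" for k
    unfolding c_def using gi g0 by (auto simp: nn_integral_eq_integral intro!: integral_nonneg_AE)
  have cC: "c k \<le> max 0 C" for k
    using gC[of k] c(2)[of k] unfolding c(1)[symmetric] by (cases "C \<ge> 0") (auto simp: ennreal_neg)
  \<comment> \<open>The masses vary with \<open>k\<close>. Along a subsequence they converge to
    \<open>c0\<close>, which is kept apart from the normalised measures.\<close>
  obtain c0 and s :: "nat \<Rightarrow> nat" where s: "strict_mono s" "(c \<circ> s) \<longlonglongrightarrow> c0"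
    using seq_compactE[OF compact_imp_seq_compact[OF compact_Icc[of 0 "max 0 C"]], of c] c(2) cC
    by (metis atLeastAtMost_iff)
  have c00: "c0 \<ge> 0" using c(2) by (intro LIMSEQ_le_const[OF s(2)]) auto
  have hg: "integrable lborel (\<lambda>x. h x * g k x)" if "h \<in> Cc" for h k
  proof -
    obtain B where B: "B \<ge> 0" "\<And>x. \<bar>h x\<bar> \<le> B" using Cc_bounded[OF \<open>h \<in> Cc\<close>] by blast
    have [measurable]: "h \<in> borel_measurable borel" by (rule borel_measurable_continuous_onI[OF Cc_continuous[OF that]])
    show ?thesis
      by (rule Bochner_Integration.integrable_bound[OF integrable_mult_right[OF gi[of k], of B]])
         (use B g0 in \<open>auto simp: abs_mult intro!: mult_right_mono\<close>)
  qed
  show ?thesis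
  proof (cases "c0 = 0")
    \<comment> \<open>Masses that tend to zero cannot be normalised in the limit, but then the vague
      limit is the zero measure.\<close>
    case True
    have "(\<lambda>k. LINT x|lborel. h x * g (s k) x) \<longlonglongrightarrow> (LINT x|null_measure borel. h x)" if h: "h \<in> Cc" for h
    proof -
      obtain B where B: "B \<ge> 0" "\<And>x. \<bar>h x\<bar> \<le> B" using Cc_bounded[OF h] by blast
      have bd: "norm (LINT x|lborel. h x * g k x) \<le> B * c k" for k
      proof -
        have "norm (LINT x|lborel. h x * g k x) \<le> (LINT x|lborel. norm (h x * g k x))" by (rule integral_norm_bound)
        also have "\<dots> \<le> (LINT x|lborel. B * g k x)"
          by (intro integral_mono integrable_norm hg[OF h] integrable_mult_right gi)
             (use B g0 in \<open>auto simp: abs_mult intro!: mult_right_mono\<close>)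
        finally show ?thesis by (simp add: c_def)
      qed
      have lim0: "(\<lambda>k. B * c (s k)) \<longlonglongrightarrow> 0"
        using tendsto_mult[OF tendsto_const s(2), of B] True by (simp add: o_def)
      have "(\<lambda>k. LINT x|lborel. h x * g (s k) x) \<longlonglongrightarrow> 0"
        by (rule Lim_null_comparison[OF always_eventually lim0]) (intro allI bd)
      moreover have "(LINT x|null_measure borel. h x) = 0"
        by (rule integral_eq_zero_AE) (auto simp: eventually_ae_filter null_sets_def intro!: bexI[of _ UNIV])
      ultimately show ?thesis by simp
    qed
    then show ?thesis using s(1) by (intro that[of s "null_measure borel"]) (auto intro!: finite_measureI)
  next
    case False
    then have c0: "c0 > 0" using c00 by simp
    from order_tendstoD(1)[OF s(2) c0] obtain N where N: "\<And>k. k \<ge> N \<Longrightarrow> c (s k) > 0"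
      by (auto simp: eventually_sequentially)
    define s' where "s' k = s (k + N)" for k
    have s': "strict_mono s'" using s(1) by (auto simp: s'_def strict_mono_def)
    have cp: "c (s' k) > 0" for k using N by (simp add: s'_def)
    have clim: "(\<lambda>k. c (s' k)) \<longlonglongrightarrow> c0" using LIMSEQ_ignore_initial_segment[OF s(2), of N] by (simp add: s'_def o_def)
    define D0 where "D0 k = density lborel (\<lambda>x. ennreal (g (s' k) x / c (s' k)))" for k
    have D0: "prob_space (D0 k)" for k
    proof (rule prob_spaceI)
      have "emeasure (D0 k) (space (D0 k)) = (\<integral>\<^sup>+x. ennreal (g (s' k) x) / ennreal (c (s' k)) \<partial>lborel)"
        unfolding D0_def using cp g0 by (simp add: emeasure_density divide_ennreal)
      also have "\<dots> = (\<integral>\<^sup>+x. ennreal (g (s' k) x) \<partial>lborel) / ennreal (c (s' k))"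
        by (rule nn_integral_divide) measurable
      also have "\<dots> = ennreal (c (s' k)) / ennreal (c (s' k))"
        by (simp only: c(1)[symmetric])
      also have "\<dots> = 1"
        using cp[of k] by (simp add: divide_ennreal)
      finally show "emeasure (D0 k) (space (D0 k)) = 1" .
    qed
    define D where "D k = distr (D0 k) borel \<Psi>" for k
    have [measurable_cong]: "sets (D0 k) = sets borel" for k by (simp add: D0_def)
    have D: "real_distribution (D k)" for k
      unfolding D_def by (intro prob_space.real_distribution_distr D0) measurable
    have "tight D"
      unfolding tight_def
    proof (intro conjI allI impI D)
      fix \<epsilon> :: real assume \<epsilon>: "\<epsilon> > 0"
      \<comment> \<open>Tightness is free, as all codes lie in \<open>[0,1]\<close>. The left end is
        \<open>-1\<close> because the interval is open on the left while the codes are only known to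
        be nonnegative.\<close>
      have "measure (D k) {-1<..1} = 1" for k
      proof -
        have "\<Psi> -` {-1<..1} \<inter> space (D0 k) = space (D0 k)" using \<Psi>01 \<Psi>gt by auto
        then show ?thesis unfolding D_def using prob_space.prob_space[OF D0] by (simp add: measure_distr)
      qed
      then show "\<exists>a b. a < b \<and> (\<forall>n. 1 - \<epsilon> < measure (D n) {a<..b})" using \<epsilon> by (intro exI[of _ "-1"] exI[of _ 1]) auto
    qed
    from tight_imp_convergent_subsubsequence[OF this strict_mono_id]
    obtain r M where r: "strict_mono r" and M: "real_distribution M" and conv: "weak_conv_m (D \<circ> r) M"
      by (auto simp: o_def)
    interpret M: real_distribution M by (rule M)
    have mM: "f \<in> borel_measurable borel \<Longrightarrow> f \<in> borel_measurable M" for f :: "real \<Rightarrow> 'c::topological_space"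
      by (simp cong: measurable_cong_sets)
    \<comment> \<open>The limit on the line is restricted to \<open>U\<close>, decoded, and given
      back the mass \<open>c0\<close> that the normalisation removed.\<close>
    define \<nu> where "\<nu> = distr (density M (\<lambda>t. ennreal (c0 * indicator U t))) borel (\<Gamma> 0)"
    have "finite_measure \<nu>" unfolding \<nu>_def
    proof (intro finite_measure.finite_measure_distr finite_measureI)
      have "emeasure (density M (\<lambda>t. ennreal (c0 * indicator U t))) (space (density M (\<lambda>t. ennreal (c0 * indicator U t))))
          = (\<integral>\<^sup>+t. ennreal (c0 * indicator U t) \<partial>M)"
        by (subst emeasure_density) (auto intro!: nn_integral_cong)
      also have "\<dots> \<le> (\<integral>\<^sup>+t. ennreal c0 \<partial>M)"
        using c0 by (intro nn_integral_mono ennreal_leI) (auto simp: indicator_def)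
      also have "\<dots> < \<infinity>" using M.emeasure_space_1[unfolded M.space_eq_univ] by simp
      finally show "emeasure (density M (\<lambda>t. ennreal (c0 * indicator U t))) (space (density M (\<lambda>t. ennreal (c0 * indicator U t)))) \<noteq> \<infinity>" by simp
    qed (auto intro!: mM)
    moreover have "(\<lambda>k. LINT x|lborel. h x * g (s' (r k)) x) \<longlonglongrightarrow> (LINT x|\<nu>. h x)" if h: "h \<in> Cc" for h
    proof -
      have [measurable]: "h \<in> borel_measurable borel" by (rule borel_measurable_continuous_onI[OF Cc_continuous[OF h]])
      obtain \<phi> B where \<phi>: "continuous_on UNIV \<phi>" "\<And>t. \<bar>\<phi> t\<bar> \<le> B" "\<And>t. \<phi> t = indicator U t * h (\<Gamma> 0 t)"
        using phi[OF h] by blast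
      have [measurable]: "\<phi> \<in> borel_measurable borel" by (rule borel_measurable_continuous_onI[OF \<phi>(1)])
      have "(\<lambda>n. integral\<^sup>L ((D \<circ> r) n) \<phi>) \<longlonglongrightarrow> integral\<^sup>L M \<phi>"
      proof (rule weak_conv_imp_integral_bdd_continuous_conv[OF _ M conv])
        show "isCont \<phi> x" for x using \<phi>(1) continuous_on_eq_continuous_at[OF open_UNIV] by blast
        show "norm (\<phi> x) \<le> B" for x using \<phi>(2) by simp
      qed (simp add: D)
      then have "(\<lambda>n. c (s' (r n)) * integral\<^sup>L (D (r n)) \<phi>) \<longlonglongrightarrow> c0 * integral\<^sup>L M \<phi>"
        using LIMSEQ_subseq_LIMSEQ[OF clim r] by (intro tendsto_mult) (auto simp: o_def)
      moreover have "c (s' k) * integral\<^sup>L (D k) \<phi> = (LINT x|lborel. h x * g (s' k) x)" for k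
      proof -
        have "integral\<^sup>L (D k) \<phi> = (LINT x|D0 k. \<phi> (\<Psi> x))"
          unfolding D_def by (rule integral_distr) measurable
        also have "\<dots> = (LINT x|D0 k. h x)"
          by (intro Bochner_Integration.integral_cong refl) (simp add: \<phi>(3) \<Psi>U \<Gamma>\<Psi>)
        also have "\<dots> = (LINT x|lborel. (g (s' k) x / c (s' k)) *\<^sub>R h x)"
          unfolding D0_def using g0 c(2) by (intro integral_density) auto
        also have "\<dots> = (LINT x|lborel. h x * g (s' k) x) / c (s' k)"
          by (simp add: mult.commute flip: integral_divide_zero)
        finally show ?thesis using cp[of k] by simp
      qed
      moreover have "(LINT x|\<nu>. h x) = c0 * integral\<^sup>L M \<phi>"
      proof -
        have "(LINT x|\<nu>. h x) = (LINT t|density M (\<lambda>t. ennreal (c0 * indicator U t)). h (\<Gamma> 0 t))"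
          unfolding \<nu>_def by (rule integral_distr) (auto intro!: mM)
        also have "\<dots> = (LINT t|M. (c0 * indicator U t) *\<^sub>R h (\<Gamma> 0 t))"
          using c0 by (intro integral_density mM) auto
        also have "\<dots> = (LINT t|M. c0 * \<phi> t)" by (simp add: \<phi>(3) mult.assoc)
        finally show ?thesis by simp
      qed
      ultimately show ?thesis by simp
    qed
    moreover have "strict_mono (\<lambda>k. s' (r k))" using s' r by (simp add: strict_mono_def)
    moreover have "sets \<nu> = sets borel" by (simp add: \<nu>_def)
    ultimately show ?thesis by (intro that[of "\<lambda>k. s' (r k)" \<nu>])
  qed
qed

section \<open>Convolution with \<open>L\<^sup>p\<close> functions\<close>

text \<open>Convexity: the graph of \<open>t powr p\<close> lies above its tangent at
  \<open>a\<close>, here in the form of Young's inequality. It yields Jensen's inequality and, in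
  \<open>Lp_representation\<close>, lower semicontinuity of the norm under weak limits.\<close>

lemma powr_tangent:
  fixes a x p :: real
  assumes "0 \<le> a" "0 \<le> x" "1 \<le> p"
  shows "p * a powr (p - 1) * x - (p - 1) * a powr p \<le> x powr p"
proof (cases "a = 0 \<or> x = 0")
  case True
  then show ?thesis using assms by auto
next
  case False
  with assms have ax: "0 < a" "0 < x" by auto
  have "(x powr p) powr (1 / p) * (a powr p) powr (1 - 1 / p) \<le> (1 / p) * x powr p + (1 - 1 / p) * a powr p"
    using ax assms by (intro Youngs_inequality_0) auto
  moreover have "(x powr p) powr (1 / p) = x" "(a powr p) powr (1 - 1 / p) = a powr (p - 1)"
    using ax assms by (simp_all add: powr_powr right_diff_distrib)
  ultimately have "p * (x * a powr (p - 1)) \<le> p * ((1 / p) * x powr p + (1 - 1 / p) * a powr p)"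
    using assms by (intro mult_left_mono) auto
  also have "\<dots> = x powr p + (p - 1) * a powr p"
    using assms by (simp add: field_simps)
  finally show ?thesis by (simp add: algebra_simps)
qed

text \<open>A consequence of the superadditivity of \<open>t powr p\<close> on nonnegative numbers.
  It reduces continuity of translations in the mean of order \<open>q\<close> to the case of order
  one.\<close>

lemma powr_diff_le:
  fixes a b p :: real
  assumes "0 \<le> a" "0 \<le> b" "1 \<le> p"
  shows "\<bar>a - b\<bar> powr p \<le> \<bar>a powr p - b powr p\<bar>"
proof -
  have super: "x powr p + y powr p \<le> (x + y) powr p" if "0 \<le> x" "0 \<le> y" for x y :: real
  proof (cases "x + y = 0")
    case False
    then have xy: "x + y > 0" using that by simp
    have le: "t powr p \<le> t * (x + y) powr (p - 1)" if "0 \<le> t" "t \<le> x + y" for t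
    proof (cases "t = 0")
      case False
      then have "t powr p = t * t powr (p - 1)"
        using that powr_add[of t 1 "p - 1"] by simp
      also have "\<dots> \<le> t * (x + y) powr (p - 1)"
        using that assms by (intro mult_left_mono powr_mono2) auto
      finally show ?thesis .
    qed simp
    have "x powr p + y powr p \<le> (x + y) * (x + y) powr (p - 1)"
      using le[of x] le[of y] that by (simp add: distrib_right)
    also have "\<dots> = (x + y) powr p"
      using xy powr_add[of "x + y" 1 "p - 1"] by simp
    finally show ?thesis .
  next
    case True
    then have "x = 0" "y = 0" using that by auto
    then show ?thesis by simp
  qed
  have "(c - d) powr p \<le> c powr p - d powr p" if "0 \<le> d" "d \<le> c" for c d :: real
    using super[of "c - d" d] that by simp
  from this[of a b] this[of b a] assms show ?thesis
    by (cases "a \<le> b") (auto simp: abs_if not_le)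
qed

lemma le_one_plus_powr: "0 \<le> x \<Longrightarrow> 1 \<le> p \<Longrightarrow> x \<le> 1 + x powr p" for x p :: real
proof (cases "x \<le> 1")
  case False
  assume "0 \<le> x" "1 \<le> p"
  then have "x powr 1 \<le> x powr p" using False by (intro powr_mono) auto
  then show ?thesis using False by simp
qed (simp add: add_increasing2)

lemma powr_sum_le:
  fixes f :: "'i \<Rightarrow> real"
  assumes "finite I" "\<And>i. i \<in> I \<Longrightarrow> 0 \<le> f i" "0 \<le> p"
  shows "(\<Sum>i\<in>I. f i) powr p \<le> real (card I) powr p * (\<Sum>i\<in>I. f i powr p)"
proof (cases "I = {}")
  case False
  define M where "M = Max (f ` I)"
  have "M \<in> f ` I" unfolding M_def using assms False by (intro Max_in) auto
  then obtain j where j: "j \<in> I" "M = f j" by auto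
  have "(\<Sum>i\<in>I. f i) \<le> real (card I) * M"
    unfolding M_def using assms(1) by (intro sum_bounded_above) auto
  then have "(\<Sum>i\<in>I. f i) powr p \<le> (real (card I) * M) powr p"
    using assms by (intro powr_mono2 sum_nonneg) auto
  also have "\<dots> = real (card I) powr p * f j powr p"
    using j assms(2) by (simp add: powr_mult)
  also have "\<dots> \<le> real (card I) powr p * (\<Sum>i\<in>I. f i powr p)"
    using j assms by (intro mult_left_mono member_le_sum) auto
  finally show ?thesis .
qed simp

text \<open>Jensen's inequality for \<open>t powr p\<close>, integrating the tangent line at the mean.\<close>

lemma (in finite_measure) norm_integral_powr_le:
  fixes f :: "'a \<Rightarrow> 'b::{banach,second_countable_topology}"
  assumes p: "1 \<le> p" and [measurable]: "f \<in> borel_measurable M" and pos: "measure M (space M) > 0"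
  shows "ennreal (norm (LINT x|M. f x) powr p) \<le>
     ennreal (measure M (space M) powr (p - 1)) * (\<integral>\<^sup>+x. ennreal (norm (f x) powr p) \<partial>M)"
proof (cases "(\<integral>\<^sup>+x. ennreal (norm (f x) powr p) \<partial>M) = \<infinity>")
  case True
  then show ?thesis using pos by (simp add: ennreal_mult_top)
next
  case False
  define m where "m = measure M (space M)"
  have ip: "integrable M (\<lambda>x. norm (f x) powr p)"
    using False by (intro integrableI_nonneg) (auto simp: top.not_eq_extremum)
  have i: "integrable M (\<lambda>x. norm (f x))"
    by (rule Bochner_Integration.integrable_bound[OF Bochner_Integration.integrable_add[OF integrable_const[of 1] ip]])
       (use le_one_plus_powr p in auto)
  define a where "a = (LINT x|M. norm (f x)) / m"
  have a: "0 \<le> a" unfolding a_def m_def by (intro divide_nonneg_nonneg integral_nonneg_AE) auto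
  have am: "(LINT x|M. norm (f x)) = a * m" using pos by (simp add: a_def m_def)
  have "a powr p * m = (LINT x|M. p * a powr (p - 1) * norm (f x) - (p - 1) * a powr p)"
  proof -
    have "(LINT x|M. p * a powr (p - 1) * norm (f x) - (p - 1) * a powr p) = p * a powr (p - 1) * (a * m) - (p - 1) * a powr p * m"
      using i by (simp add: am m_def)
    also have "a powr (p - 1) * a = a powr p"
      using a powr_add[of a "p - 1" 1] by (cases "a = 0") auto
    then have "p * a powr (p - 1) * (a * m) - (p - 1) * a powr p * m = a powr p * m"
      by (simp add: algebra_simps)
    finally show ?thesis by simp
  qed
  also have "\<dots> \<le> (LINT x|M. norm (f x) powr p)"
    using i ip by (intro integral_mono powr_tangent a p) auto
  finally have 1: "a powr p * m \<le> (LINT x|M. norm (f x) powr p)" .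
  have "norm (LINT x|M. f x) powr p \<le> (a * m) powr p"
    using integral_norm_bound[of M f] p by (intro powr_mono2) (auto simp: am)
  also have "\<dots> = m powr (p - 1) * (a powr p * m)"
    using a pos powr_add[of m "p - 1" 1] by (simp add: powr_mult m_def)
  also have "\<dots> \<le> m powr (p - 1) * (LINT x|M. norm (f x) powr p)"
    using 1 by (intro mult_left_mono) auto
  finally have "ennreal (norm (LINT x|M. f x) powr p) \<le> ennreal (m powr (p - 1) * (LINT x|M. norm (f x) powr p))"
    by (rule ennreal_leI)
  also have "\<dots> = ennreal (m powr (p - 1)) * (\<integral>\<^sup>+x. ennreal (norm (f x) powr p) \<partial>M)"
    using ip by (simp add: ennreal_mult nn_integral_eq_integral)
  finally show ?thesis by (simp add: m_def)
qed

text \<open>\<open>f\<close> is truncated in height and support to \<open>c N\<close>, which is an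
  almost everywhere limit of continuous functions; truncating those as well supplies a dominating
  function.\<close>

lemma Cc_dense_L1:
  fixes f :: "'a::euclidean_space \<Rightarrow> real"
  assumes f: "integrable lborel f" and \<epsilon>: "\<epsilon> > 0"
  obtains h where "h \<in> Cc" "(LINT x|lborel. \<bar>f x - h x\<bar>) \<le> \<epsilon>"
proof -
  have [measurable]: "f \<in> borel_measurable borel" using f by auto
  define c where "c N x = cutoff N x * max (- real N) (min (real N) (f x))" for N x
  have [measurable]: "cutoff N \<in> borel_measurable borel" for N
    by (rule borel_measurable_continuous_onI[OF cutoff(5)])
  have [measurable]: "c N \<in> borel_measurable borel" for N
    unfolding c_def by measurable
  have cle: "\<bar>c N x\<bar> \<le> \<bar>f x\<bar>" for N x
  proof -
    have "\<bar>c N x\<bar> = cutoff N x * \<bar>max (- real N) (min (real N) (f x))\<bar>" by (simp add: c_def abs_mult cutoff)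
    also have "\<dots> \<le> 1 * \<bar>f x\<bar>" by (intro mult_mono) (auto simp: cutoff)
    finally show ?thesis by simp
  qed
  have "(\<lambda>N. LINT x|lborel. \<bar>f x - c N x\<bar>) \<longlonglongrightarrow> (LINT x|(lborel :: 'a measure). 0)"
  proof (rule integral_dominated_convergence[where w="\<lambda>x. 2 * \<bar>f x\<bar>"])
    show "AE x in lborel. (\<lambda>N. \<bar>f x - c N x\<bar>) \<longlonglongrightarrow> 0"
    proof (rule AE_I2)
      fix x
      obtain N0 :: nat where N0: "max \<bar>f x\<bar> (norm x) \<le> real N0" using real_arch_simple by blast
      have "\<bar>f x - c N x\<bar> = 0" if "N \<ge> N0" for N
      proof -
        have "norm x \<le> real N" "\<bar>f x\<bar> \<le> real N" using N0 that by auto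
        then have "cutoff N x = 1" "max (- real N) (min (real N) (f x)) = f x" by (auto simp: cutoff abs_le_iff)
        then show ?thesis by (simp add: c_def)
      qed
      then show "(\<lambda>N. \<bar>f x - c N x\<bar>) \<longlonglongrightarrow> 0"
        by (intro tendsto_eventually) (auto simp: eventually_sequentially)
    qed
    show "AE x in lborel. norm \<bar>f x - c N x\<bar> \<le> 2 * \<bar>f x\<bar>" for N
      using cle[of N] by (intro AE_I2) (smt (verit) real_norm_def)
  qed (use f in auto)
  then have "(\<lambda>N. LINT x|lborel. \<bar>f x - c N x\<bar>) \<longlonglongrightarrow> 0" by simp
  from order_tendstoD(2)[OF this, of "\<epsilon> / 2"] \<epsilon> obtain N where N: "(LINT x|lborel. \<bar>f x - c N x\<bar>) < \<epsilon> / 2"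
    by (auto simp: eventually_sequentially)
  have "c N \<in> borel_measurable lebesgue" by (rule measurable_completion) simp
  then have "c N measurable_on UNIV" by (intro lebesgue_measurable_imp_measurable_on) auto
  then obtain Z G where Z: "negligible Z" and G: "\<And>n. continuous_on UNIV (G n)" "\<And>x. x \<notin> Z \<Longrightarrow> (\<lambda>n. G n x) \<longlonglongrightarrow> c N x"
    unfolding measurable_on_def by auto
  define H where "H n x = max (- real N) (min (real N) (G n x)) * cutoff (N + 1) x" for n x
  have H: "H n \<in> Cc" for n
    unfolding H_def[abs_def] by (intro cutoff_Cc continuous_intros G)
  have HN: "\<bar>H n x\<bar> \<le> real N * cutoff (N + 1) x" for n x
    by (auto simp: H_def abs_mult cutoff intro!: mult_right_mono)
  have cN: "\<bar>c N x\<bar> \<le> real N * cutoff (N + 1) x \<and> c N x * cutoff (N + 1) x = c N x" for x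
  proof (cases "cutoff N x = 0")
    case True
    then show ?thesis by (simp add: c_def cutoff)
  next
    case False
    then have 1: "cutoff (N + 1) x = 1"
      using cutoff(4)[of N x] by (intro cutoff(3)) (auto simp: not_less[symmetric])
    have "\<bar>c N x\<bar> = cutoff N x * \<bar>max (- real N) (min (real N) (f x))\<bar>" by (simp add: c_def abs_mult cutoff)
    also have "\<dots> \<le> 1 * real N" by (intro mult_mono) (auto simp: cutoff)
    finally show ?thesis unfolding 1 by simp
  qed
  have [measurable]: "H n \<in> borel_measurable borel" for n
    by (rule borel_measurable_continuous_onI[OF Cc_continuous[OF H]])
  have "(\<lambda>n. LINT x|lborel. \<bar>c N x - H n x\<bar>) \<longlonglongrightarrow> (LINT x|(lborel :: 'a measure). 0)"
  proof (rule integral_dominated_convergence[where w="\<lambda>x. 2 * real N * cutoff (N + 1) x"])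
    have "AE x in lborel. x \<notin> Z"
      using Z by (metis AE_not_in AE_completion_iff negligible_iff_null_sets)
    then show "AE x in lborel. (\<lambda>n. \<bar>c N x - H n x\<bar>) \<longlonglongrightarrow> 0"
    proof eventually_elim
      case (elim x)
      have "(\<lambda>n. \<bar>c N x - H n x\<bar>) \<longlonglongrightarrow> \<bar>c N x - max (- real N) (min (real N) (c N x)) * cutoff (N + 1) x\<bar>"
        unfolding H_def by (intro tendsto_intros G(2) elim)
      moreover have "max (- real N) (min (real N) (c N x)) = c N x"
      proof -
        have "real N * cutoff (N + 1) x \<le> real N * 1" by (intro mult_left_mono) (auto simp: cutoff)
        then have "\<bar>c N x\<bar> \<le> real N" using cN[of x] by linarith
        then show ?thesis by (simp add: max_def min_def abs_le_iff)
      qed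
      ultimately show ?case using cN[of x] by auto
    qed
    show "integrable lborel (\<lambda>x. 2 * real N * cutoff (N + 1) x)"
      using Cc_integrable[OF cutoff_Cc[OF continuous_on_const[of UNIV "1::real"]] continuous_on_const[of UNIV "2 * real N"], of "N + 1"]
      by (simp add: mult.commute)
    show "AE x in lborel. norm \<bar>c N x - H n x\<bar> \<le> 2 * real N * cutoff (N + 1) x" for n
    proof (rule AE_I2)
      fix x
      show "norm \<bar>c N x - H n x\<bar> \<le> 2 * real N * cutoff (N + 1) x"
        using HN[of n x] conjunct1[OF cN[of x]] unfolding real_norm_def by linarith
    qed
  qed auto
  then have "(\<lambda>n. LINT x|lborel. \<bar>c N x - H n x\<bar>) \<longlonglongrightarrow> 0" by simp
  from order_tendstoD(2)[OF this, of "\<epsilon> / 2"] \<epsilon> obtain n where n: "(LINT x|lborel. \<bar>c N x - H n x\<bar>) < \<epsilon> / 2"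
    by (auto simp: eventually_sequentially)
  have Hi: "integrable lborel (H n)"
    using Cc_integrable[OF H continuous_on_const[of UNIV 1]] by simp
  have ci: "integrable lborel (c N)"
    by (rule Bochner_Integration.integrable_bound[OF f]) (use cle in auto)
  have "(LINT x|lborel. \<bar>f x - H n x\<bar>) \<le> (LINT x|lborel. \<bar>f x - c N x\<bar> + \<bar>c N x - H n x\<bar>)"
    using f Hi ci by (intro integral_mono) auto
  also have "\<dots> = (LINT x|lborel. \<bar>f x - c N x\<bar>) + (LINT x|lborel. \<bar>c N x - H n x\<bar>)"
    using f Hi ci by simp
  also have "\<dots> \<le> \<epsilon>" using N n by simp
  finally show ?thesis by (rule that[OF H])
qed

context htype
begin

text \<open>For functions in \<open>Cc\<close> this is uniform continuity on a compact set. The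
  approximation error \<open>f - h\<close> occurs twice, translated and not, with the same size by
  right invariance; whence \<open>\<epsilon> / 4 + \<epsilon> / 2 + \<epsilon> / 4\<close>.\<close>

lemma L1_translation_continuous:
  fixes f :: "'v \<times> 'z \<Rightarrow> real"
  assumes f: "integrable lborel f" and \<epsilon>: "\<epsilon> > 0"
  obtains \<delta> where "\<delta> > 0" "\<And>z. norm z < \<delta> \<Longrightarrow> (\<integral>\<^sup>+x. ennreal \<bar>f (x \<odot> - z) - f x\<bar> \<partial>lborel) \<le> ennreal \<epsilon>"
proof -
  have [measurable]: "f \<in> borel_measurable borel" using f by auto
  have "\<epsilon> / 4 > 0" using \<epsilon> by simp
  then obtain h where h: "h \<in> Cc" "(LINT x|lborel. \<bar>f x - h x\<bar>) \<le> \<epsilon> / 4"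
    using Cc_dense_L1[OF f] by metis
  have hc: "continuous_on UNIV h" by (rule Cc_continuous[OF h(1)])
  have hm [measurable]: "h \<in> borel_measurable borel" by (rule borel_measurable_continuous_onI[OF hc])
  have hi: "integrable lborel h" using Cc_integrable[OF h(1) continuous_on_const[of UNIV 1]] by simp
  have fh: "(\<integral>\<^sup>+x. ennreal \<bar>f x - h x\<bar> \<partial>lborel) \<le> ennreal (\<epsilon> / 4)"
  proof -
    have "(\<integral>\<^sup>+x. ennreal \<bar>f x - h x\<bar> \<partial>lborel) = ennreal (LINT x|lborel. \<bar>f x - h x\<bar>)"
      using f hi by (intro nn_integral_eq_integral) auto
    then show ?thesis using ennreal_leI[OF h(2)] by simp
  qed
  obtain R where R: "\<And>x. h x \<noteq> 0 \<Longrightarrow> norm x \<le> R" "R \<ge> 0" using Cc_support[OF h(1)] by blast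
  \<comment> \<open>By \<open>norm_mult_le\<close>, translates of \<open>h\<close> by elements of
    norm less than \<open>1\<close> vanish outside the ball of this radius.\<close>
  define R' where "R' = R + 1 + R"
  have fin: "emeasure lborel (cball (0::'v \<times> 'z) R') < \<infinity>" by (rule emeasure_bounded_finite) simp
  define c where "c = measure lborel (cball (0::'v \<times> 'z) R')"
  have c0: "c \<ge> 0" by (simp add: c_def)
  have ec: "emeasure lborel (cball (0::'v \<times> 'z) R') = ennreal c"
    using fin by (simp add: c_def emeasure_eq_ennreal_measure)
  have "uniformly_continuous_on (cball 0 R' \<times> cball 0 1) (\<lambda>p. h (fst p \<odot> - snd p))"
    by (intro compact_uniformly_continuous compact_Times compact_cball continuous_on_compose2[OF hc] continuous_intros) auto
  moreover have "\<epsilon> / (2 * (c + 1)) > 0" using \<epsilon> by (auto simp: c_def intro!: divide_pos_pos add_nonneg_pos)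
  ultimately obtain d where d: "d > 0" "\<And>p q. p \<in> cball 0 R' \<times> cball 0 1 \<Longrightarrow> q \<in> cball 0 R' \<times> cball 0 1 \<Longrightarrow> dist q p < d \<Longrightarrow>
      dist (h (fst q \<odot> - snd q)) (h (fst p \<odot> - snd p)) < \<epsilon> / (2 * (c + 1))"
    unfolding uniformly_continuous_on_def by metis
  show ?thesis
  proof (rule that[of "min 1 d"])
    fix z :: "'v \<times> 'z" assume z: "norm z < min 1 d"
    have [measurable]: "(\<lambda>x. x \<odot> - z) \<in> borel_measurable borel"
      by (intro borel_measurable_continuous_onI continuous_intros)
    have hz: "\<bar>h (x \<odot> - z) - h x\<bar> \<le> \<epsilon> / (2 * (c + 1)) * indicator (cball 0 R') x" for x
    proof (cases "norm x \<le> R'")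
      case True
      then show ?thesis using d(2)[of "(x, 0)" "(x, z)"] z by (simp add: dist_Pair_Pair dist_real_def)
    next
      case False
      have "h x = 0" using R(1)[of x] R(2) False by (auto simp: R'_def)
      moreover have "h (x \<odot> - z) = 0"
      proof (rule ccontr)
        assume "h (x \<odot> - z) \<noteq> 0"
        then have n: "norm (x \<odot> - z) \<le> R" by (rule R)
        have "norm x = norm ((x \<odot> - z) \<odot> z)" by simp
        also have "\<dots> \<le> norm (x \<odot> - z) + norm z + norm (x \<odot> - z) * norm z" by (rule norm_mult_le)
        also have "\<dots> \<le> R + 1 + R * 1" using n z R(2) by (intro add_mono mult_mono) auto
        finally show False using False by (simp add: R'_def)
      qed
      ultimately show ?thesis using False by simp
    qed
    have "(\<integral>\<^sup>+x. ennreal \<bar>h (x \<odot> - z) - h x\<bar> \<partial>lborel) \<le> (\<integral>\<^sup>+x. ennreal (\<epsilon> / (2 * (c + 1))) * indicator (cball (0::'v \<times> 'z) R') x \<partial>lborel)"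
    proof (rule nn_integral_mono)
      fix x :: "'v \<times> 'z"
      have "ennreal \<bar>h (x \<odot> - z) - h x\<bar> \<le> ennreal (\<epsilon> / (2 * (c + 1)) * indicator (cball 0 R') x)"
        by (rule ennreal_leI[OF hz])
      also have "\<dots> = ennreal (\<epsilon> / (2 * (c + 1))) * indicator (cball 0 R') x" by (auto simp: indicator_def)
      finally show "ennreal \<bar>h (x \<odot> - z) - h x\<bar> \<le> ennreal (\<epsilon> / (2 * (c + 1))) * indicator (cball 0 R') x" .
    qed
    also have "\<dots> = ennreal (\<epsilon> / (2 * (c + 1))) * emeasure lborel (cball (0::'v \<times> 'z) R')"
      by (rule nn_integral_cmult_indicator) simp
    also have "\<dots> = ennreal (\<epsilon> / (2 * (c + 1)) * c)"
      unfolding ec by (rule ennreal_mult[symmetric]) (use \<epsilon> c0 in auto)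
    also have "\<dots> \<le> ennreal (\<epsilon> / 2)"
      using \<epsilon> c0 by (intro ennreal_leI) (simp add: field_simps)
    finally have 2: "(\<integral>\<^sup>+x. ennreal \<bar>h (x \<odot> - z) - h x\<bar> \<partial>lborel) \<le> ennreal (\<epsilon> / 2)" .
    have "(\<integral>\<^sup>+x. ennreal \<bar>f (x \<odot> - z) - f x\<bar> \<partial>lborel) \<le>
       (\<integral>\<^sup>+x. ennreal \<bar>f (x \<odot> - z) - h (x \<odot> - z)\<bar> + (ennreal \<bar>h (x \<odot> - z) - h x\<bar> + ennreal \<bar>f x - h x\<bar>) \<partial>lborel)"
      by (intro nn_integral_mono) (auto simp flip: ennreal_plus intro!: ennreal_leI)
    also have "\<dots> = (\<integral>\<^sup>+x. ennreal \<bar>f (x \<odot> - z) - h (x \<odot> - z)\<bar> \<partial>lborel) +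
       ((\<integral>\<^sup>+x. ennreal \<bar>h (x \<odot> - z) - h x\<bar> \<partial>lborel) + (\<integral>\<^sup>+x. ennreal \<bar>f x - h x\<bar> \<partial>lborel))"
      by (simp add: nn_integral_add)
    also have "(\<integral>\<^sup>+x. ennreal \<bar>f (x \<odot> - z) - h (x \<odot> - z)\<bar> \<partial>lborel) = (\<integral>\<^sup>+x. ennreal \<bar>f x - h x\<bar> \<partial>lborel)"
      by (rule nn_integral_mult_right) measurable
    also have "(\<integral>\<^sup>+x. ennreal \<bar>f x - h x\<bar> \<partial>lborel) + ((\<integral>\<^sup>+x. ennreal \<bar>h (x \<odot> - z) - h x\<bar> \<partial>lborel) + (\<integral>\<^sup>+x. ennreal \<bar>f x - h x\<bar> \<partial>lborel))
        \<le> ennreal (\<epsilon> / 4) + (ennreal (\<epsilon> / 2) + ennreal (\<epsilon> / 4))"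
      by (intro add_mono fh 2)
    also have "\<dots> = ennreal \<epsilon>" using \<epsilon> by (simp flip: ennreal_plus)
    finally show "(\<integral>\<^sup>+x. ennreal \<bar>f (x \<odot> - z) - f x\<bar> \<partial>lborel) \<le> ennreal \<epsilon>" .
  qed (use d in auto)
qed

end

lemma powr_add_le:
  fixes a b q :: real
  assumes "0 \<le> a" "0 \<le> b" "0 \<le> q"
  shows "(a + b) powr q \<le> 2 powr q * (a powr q + b powr q)"
  using powr_sum_le[of "{True, False}" "\<lambda>i. if i then a else b" q] assms by (simp add: card_insert_if)

lemma tendsto_0_if_ennreal:
  fixes f :: "'a \<Rightarrow> ennreal"
  assumes "\<And>\<epsilon>. \<epsilon> > 0 \<Longrightarrow> eventually (\<lambda>x. f x \<le> ennreal \<epsilon>) F"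
  shows "(f \<longlongrightarrow> 0) F"
proof (rule order_tendstoI)
  fix a :: ennreal assume "0 < a"
  then obtain b where b: "0 < b" "b < a" using dense by blast
  then obtain \<epsilon> where "b = ennreal \<epsilon>" "\<epsilon> > 0" by (cases b) auto
  with assms[of \<epsilon>] show "eventually (\<lambda>x. f x < a) F"
    using b by (auto elim!: eventually_mono)
qed simp

text \<open>Positive and negative parts of the real and the imaginary part, so that
  \<open>powr_diff_le\<close>, which concerns nonnegative numbers, can be used for complex
  functions.\<close>

definition part :: "nat \<Rightarrow> complex \<Rightarrow> real" where
  "part i w = (if i = 0 then max 0 (Re w) else if i = 1 then max 0 (- Re w) else if i = 2 then max 0 (Im w) else max 0 (- Im w))"

lemma part_nonneg: "0 \<le> part i w"
  by (simp add: part_def)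

lemma part_le: "part i w \<le> norm w"
  using abs_Re_le_cmod[of w] abs_Im_le_cmod[of w] by (auto simp: part_def)

lemma borel_measurable_part [measurable]: "part i \<in> borel_measurable borel"
  unfolding part_def[abs_def] by measurable

lemma norm_diff_le_part: "norm (a - b) \<le> (\<Sum>i<4. \<bar>part i a - part i b\<bar>)"
proof -
  have "norm (a - b) \<le> \<bar>Re a - Re b\<bar> + \<bar>Im a - Im b\<bar>"
    using cmod_le[of "a - b"] by simp
  moreover have "\<bar>Re a - Re b\<bar> \<le> \<bar>part 0 a - part 0 b\<bar> + \<bar>part 1 a - part 1 b\<bar>"
    by (simp add: part_def)
  moreover have "\<bar>Im a - Im b\<bar> \<le> \<bar>part 2 a - part 2 b\<bar> + \<bar>part 3 a - part 3 b\<bar>"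
    by (simp add: part_def)
  ultimately show ?thesis
    by (simp add: numeral_eq_Suc)
qed

context htype
begin

section \<open>Poisson integrals of L^q functions\<close>

lemma measurable_pair_KM:
  fixes T :: "('v \<times> 'z) \<times> ('v \<times> 'z) \<Rightarrow> 'v \<times> 'z"
  assumes "continuous_on UNIV T"
  shows "T \<in> borel_measurable (lborel \<Otimes>\<^sub>M KM)" "T \<in> borel_measurable (KM \<Otimes>\<^sub>M lborel)"
proof -
  have "sets ((lborel :: ('v \<times> 'z) measure) \<Otimes>\<^sub>M KM) = sets ((borel :: ('v \<times> 'z) measure) \<Otimes>\<^sub>M (borel :: ('v \<times> 'z) measure))"
    "sets (KM \<Otimes>\<^sub>M (lborel :: ('v \<times> 'z) measure)) = sets ((borel :: ('v \<times> 'z) measure) \<Otimes>\<^sub>M (borel :: ('v \<times> 'z) measure))"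
    by (intro sets_pair_measure_cong sets_KM sets_lborel)+
  then have "sets ((lborel :: ('v \<times> 'z) measure) \<Otimes>\<^sub>M KM) = sets borel" "sets (KM \<Otimes>\<^sub>M (lborel :: ('v \<times> 'z) measure)) = sets borel"
    by (simp_all only: borel_prod)
  then show "T \<in> borel_measurable (lborel \<Otimes>\<^sub>M KM)" "T \<in> borel_measurable (KM \<Otimes>\<^sub>M lborel)"
    using assms measurable_cong_sets borel_measurable_continuous_onI by blast+
qed

lemma measurable_shift_KM [measurable]:
  "(\<lambda>p. fst p \<odot> - dil \<rho> (snd p)) \<in> borel_measurable (lborel \<Otimes>\<^sub>M KM)"
  "(\<lambda>p. snd p \<odot> - dil \<rho> (fst p)) \<in> borel_measurable (KM \<Otimes>\<^sub>M lborel)"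
  by (rule measurable_pair_KM; intro continuous_intros)+

context
  fixes f :: "'v \<times> 'z \<Rightarrow> complex" and q :: real
  assumes f [measurable]: "f \<in> borel_measurable borel" and q: "1 \<le> q"
    and fq: "(\<integral>\<^sup>+x. ennreal (norm (f x) powr q) \<partial>lborel) < \<infinity>"
begin

text \<open>As \<open>t \<le> 1 + t powr q\<close> for \<open>t \<ge> 0\<close> and
  \<open>K \<rho>\<close> is bounded, the integrand is dominated by the kernel plus a multiple of
  \<open>norm (f w) powr q\<close>.\<close>

lemma integrable_shift_KM:
  assumes \<rho>: "\<rho> > 0" shows "integrable KM (\<lambda>y. f (x \<odot> - dil \<rho> y))"
proof -
  define c where "c = \<rho> powr (2 * s) * \<rho> powr (- 4 * kap)"
  have c: "c \<ge> 0" "\<And>x. K \<rho> x \<le> c" using K_le[OF \<rho>] by (auto simp: c_def)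
  have "integrable KM (\<lambda>y. 1::real)" by simp
  then have i1: "integrable lborel (\<lambda>w. K \<rho> (- w \<odot> x))"
    using Pois_eq(2)[OF \<rho>, of "\<lambda>_. 1 :: real" x] by simp
  have i2: "integrable lborel (\<lambda>w. norm (f w) powr q)"
    using fq by (intro integrableI_nonneg) auto
  have "integrable lborel (\<lambda>w. K \<rho> (- w \<odot> x) *\<^sub>R f w)"
  proof (rule Bochner_Integration.integrable_bound[OF Bochner_Integration.integrable_add[OF i1 integrable_mult_right[OF i2, of c]]])
    have [measurable]: "(\<lambda>w. - w \<odot> x) \<in> borel_measurable borel"
      by (intro borel_measurable_continuous_onI continuous_intros)
    show "(\<lambda>w. K \<rho> (- w \<odot> x) *\<^sub>R f w) \<in> borel_measurable lborel" by measurable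
    show "AE w in lborel. norm (K \<rho> (- w \<odot> x) *\<^sub>R f w) \<le> norm (K \<rho> (- w \<odot> x) + c * norm (f w) powr q)"
    proof (rule AE_I2)
      fix w
      have "norm (K \<rho> (- w \<odot> x) *\<^sub>R f w) \<le> K \<rho> (- w \<odot> x) * (1 + norm (f w) powr q)"
        using le_one_plus_powr[of "norm (f w)" q] q by (simp add: mult_left_mono)
      also have "\<dots> \<le> K \<rho> (- w \<odot> x) + c * norm (f w) powr q"
        using c(2)[of "- w \<odot> x"] by (simp add: distrib_left mult_right_mono)
      finally show "norm (K \<rho> (- w \<odot> x) *\<^sub>R f w) \<le> norm (K \<rho> (- w \<odot> x) + c * norm (f w) powr q)"
        by (rule order_trans) simp
    qed
  qed
  then show ?thesis using Pois_eq(2)[OF \<rho> f] by simp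
qed

text \<open>Jensen's inequality for \<open>KM\<close> gives the factor
  \<open>A powr (q - 1)\<close>; after Fubini's theorem, right invariance leaves the total mass
  \<open>A\<close> as the remaining factor.\<close>

lemma Pois_Lp_bound:
  "(\<integral>\<^sup>+x. ennreal (norm (Pois f (x, \<rho>)) powr q) \<partial>lborel) \<le> ennreal (A powr q) * (\<integral>\<^sup>+x. ennreal (norm (f x) powr q) \<partial>lborel)"
proof -
  interpret pair: pair_sigma_finite lborel KM ..
  have AKM: "measure KM (space KM) = A" by (simp add: A_def)
  have "(\<integral>\<^sup>+x. ennreal (norm (Pois f (x, \<rho>)) powr q) \<partial>lborel) \<le>
     (\<integral>\<^sup>+x. ennreal (A powr (q - 1)) * (\<integral>\<^sup>+y. ennreal (norm (f (x \<odot> - dil \<rho> y)) powr q) \<partial>KM) \<partial>lborel)"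
    unfolding Pois_def fst_conv snd_conv
    using KM.norm_integral_powr_le[OF q, of "\<lambda>y. f (_ \<odot> - dil \<rho> y)"] A_pos AKM by (intro nn_integral_mono) simp
  also have "\<dots> = ennreal (A powr (q - 1)) * (\<integral>\<^sup>+x. (\<integral>\<^sup>+y. ennreal (norm (f (x \<odot> - dil \<rho> y)) powr q) \<partial>KM) \<partial>lborel)"
    by (rule nn_integral_cmult) measurable
  also have "(\<integral>\<^sup>+x. (\<integral>\<^sup>+y. ennreal (norm (f (x \<odot> - dil \<rho> y)) powr q) \<partial>KM) \<partial>lborel)
     = (\<integral>\<^sup>+y. (\<integral>\<^sup>+x. ennreal (norm (f (x \<odot> - dil \<rho> y)) powr q) \<partial>lborel) \<partial>KM)"
    by (rule pair.Fubini'[symmetric]) measurable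
  also have "\<dots> = (\<integral>\<^sup>+y. (\<integral>\<^sup>+x. ennreal (norm (f x) powr q) \<partial>lborel) \<partial>KM)"
    using nn_integral_mult_right[of "\<lambda>x. ennreal (norm (f x) powr q)"] by simp
  also have "\<dots> = (\<integral>\<^sup>+x. ennreal (norm (f x) powr q) \<partial>lborel) * ennreal A"
    by (simp add: A_def KM.emeasure_eq_measure)
  also have "ennreal (A powr (q - 1)) * ((\<integral>\<^sup>+x. ennreal (norm (f x) powr q) \<partial>lborel) * ennreal A)
      = ennreal (A powr (q - 1) * A) * (\<integral>\<^sup>+x. ennreal (norm (f x) powr q) \<partial>lborel)"
    using A_pos by (simp add: ennreal_mult mult_ac)
  also have "A powr (q - 1) * A = A powr q"
    using A_pos powr_add[of A "q - 1" 1] by simp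
  finally show ?thesis .
qed

text \<open>The functions \<open>part i (f x) powr q\<close> are integrable, so their translates are
  continuous in \<open>L^1\<close>, and \<open>powr_diff_le\<close> bounds the \<open>q\<close>-th
  power of each difference by the difference of these powers.\<close>

lemma Lp_modulus:
  assumes "\<epsilon> > 0"
  obtains \<delta> where "\<delta> > 0" "\<And>z. norm z < \<delta> \<Longrightarrow> (\<integral>\<^sup>+x. ennreal (norm (f (x \<odot> - z) - f x) powr q) \<partial>lborel) \<le> ennreal \<epsilon>"
proof -
  define F where "F i x = part i (f x) powr q" for i x
  have F: "integrable lborel (F i)" for i
  proof -
    have "(\<integral>\<^sup>+x. ennreal (F i x) \<partial>lborel) \<le> (\<integral>\<^sup>+x. ennreal (norm (f x) powr q) \<partial>lborel)"
      unfolding F_def using q part_nonneg part_le by (intro nn_integral_mono ennreal_leI powr_mono2) auto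
    then show ?thesis using fq unfolding F_def by (intro integrableI_nonneg) (auto intro: le_less_trans)
  qed
  \<comment> \<open>\<open>4 powr q\<close> comes from the \<open>q\<close>-th power of a sum of
    four terms, \<open>4\<close> from adding the four moduli.\<close>
  define e where "e = \<epsilon> / (4 powr q * 4)"
  have e: "e > 0" "4 powr q * (4 * e) = \<epsilon>" using assms by (auto simp: e_def)
  have "\<exists>\<delta>>0. \<forall>z. norm z < \<delta> \<longrightarrow> (\<integral>\<^sup>+x. ennreal \<bar>F i (x \<odot> - z) - F i x\<bar> \<partial>lborel) \<le> ennreal e" for i
    using L1_translation_continuous[OF F[of i] e(1)] by metis
  then obtain d where d: "\<And>i. d i > 0" "\<And>i z. norm z < d i \<Longrightarrow> (\<integral>\<^sup>+x. ennreal \<bar>F i (x \<odot> - z) - F i x\<bar> \<partial>lborel) \<le> ennreal e"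
    by metis
  have [measurable]: "F i \<in> borel_measurable borel" for i unfolding F_def by measurable
  define \<delta> where "\<delta> = Min (d ` {..<4::nat})"
  show ?thesis
  proof (rule that[of \<delta>])
    show "\<delta> > 0" unfolding \<delta>_def using d(1) by (subst Min_gr_iff) (auto simp: lessThan_empty_iff)
    fix z :: "'v \<times> 'z" assume z: "norm z < \<delta>"
    have zi: "norm z < d i" if "i < 4" for i
      using z that unfolding \<delta>_def by (subst (asm) Min_gr_iff) (auto simp: lessThan_empty_iff)
    have "(\<integral>\<^sup>+x. ennreal (norm (f (x \<odot> - z) - f x) powr q) \<partial>lborel) \<le>
       (\<integral>\<^sup>+x. ennreal (4 powr q) * (\<Sum>i<4. ennreal \<bar>F i (x \<odot> - z) - F i x\<bar>) \<partial>lborel)"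
    proof (intro nn_integral_mono)
      fix x
      have "norm (f (x \<odot> - z) - f x) powr q \<le> (\<Sum>i<4. \<bar>part i (f (x \<odot> - z)) - part i (f x)\<bar>) powr q"
        using q norm_diff_le_part by (intro powr_mono2) auto
      also have "\<dots> \<le> 4 powr q * (\<Sum>i<4. \<bar>part i (f (x \<odot> - z)) - part i (f x)\<bar> powr q)"
        using powr_sum_le[of "{..<4::nat}" "\<lambda>i. \<bar>part i (f (x \<odot> - z)) - part i (f x)\<bar>" q] q by simp
      also have "\<dots> \<le> 4 powr q * (\<Sum>i<4. \<bar>F i (x \<odot> - z) - F i x\<bar>)"
        unfolding F_def using q by (intro mult_left_mono sum_mono powr_diff_le part_nonneg) auto
      finally have "ennreal (norm (f (x \<odot> - z) - f x) powr q) \<le> ennreal (4 powr q * (\<Sum>i<4. \<bar>F i (x \<odot> - z) - F i x\<bar>))"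
        by (rule ennreal_leI)
      also have "\<dots> = ennreal (4 powr q) * (\<Sum>i<4. ennreal \<bar>F i (x \<odot> - z) - F i x\<bar>)"
        by (simp add: ennreal_mult sum_nonneg sum_ennreal)
      finally show "ennreal (norm (f (x \<odot> - z) - f x) powr q) \<le> ennreal (4 powr q) * (\<Sum>i<4. ennreal \<bar>F i (x \<odot> - z) - F i x\<bar>)" .
    qed
    also have "\<dots> = ennreal (4 powr q) * (\<Sum>i<4. (\<integral>\<^sup>+x. ennreal \<bar>F i (x \<odot> - z) - F i x\<bar> \<partial>lborel))"
    proof -
      have "(\<integral>\<^sup>+x. ennreal (4 powr q) * (\<Sum>i<4. ennreal \<bar>F i (x \<odot> - z) - F i x\<bar>) \<partial>lborel)
          = ennreal (4 powr q) * (\<integral>\<^sup>+x. (\<Sum>i<4. ennreal \<bar>F i (x \<odot> - z) - F i x\<bar>) \<partial>lborel)"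
        by (rule nn_integral_cmult) measurable
      also have "(\<integral>\<^sup>+x. (\<Sum>i<4. ennreal \<bar>F i (x \<odot> - z) - F i x\<bar>) \<partial>lborel)
          = (\<Sum>i<4. (\<integral>\<^sup>+x. ennreal \<bar>F i (x \<odot> - z) - F i x\<bar> \<partial>lborel))"
        by (rule nn_integral_sum) measurable
      finally show ?thesis .
    qed
    also have "\<dots> \<le> ennreal (4 powr q) * (\<Sum>i<4::nat. ennreal e)"
      using d(2) zi by (intro mult_left_mono sum_mono) auto
    also have "\<dots> = ennreal (4 powr q * (4 * e))"
    proof -
      have "(\<Sum>i<4::nat. ennreal e) = ennreal (4 * e)"
        using e by (subst sum_ennreal) auto
      moreover have "ennreal (4 powr q) * ennreal (4 * e) = ennreal (4 powr q * (4 * e))"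
        using e(1) by (intro ennreal_mult[symmetric]) auto
      ultimately show ?thesis by simp
    qed
    finally show "(\<integral>\<^sup>+x. ennreal (norm (f (x \<odot> - z) - f x) powr q) \<partial>lborel) \<le> ennreal \<epsilon>"
      by (simp only: e(2))
  qed
qed

text \<open>\<open>Pois f - A f\<close> is the \<open>KM\<close>-integral over \<open>y\<close> of
  \<open>f (x \<odot> - dil \<rho> y) - f x\<close>. Jensen's inequality and Fubini's theorem reduce
  the claim to the \<open>KM\<close>-integral of \<open>\<omega> (dil \<rho> y)\<close>;
  \<open>\<omega>\<close> is bounded and small near the identity, and \<open>KM\<close> is finite,
  so dominated convergence applies.\<close>

lemma Pois_Lp_tendsto:
  "((\<lambda>\<rho>. \<integral>\<^sup>+x. ennreal (norm (Pois f (x, \<rho>) - A *\<^sub>R f x) powr q) \<partial>lborel) \<longlongrightarrow> 0) (at_right 0)"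
proof -
  interpret pair: pair_sigma_finite lborel KM ..
  have AKM: "measure KM (space KM) = A" by (simp add: A_def)
  define \<omega> where "\<omega> z = (\<integral>\<^sup>+x. ennreal (norm (f (x \<odot> - z) - f x) powr q) \<partial>lborel)" for z
  define c where "c = ennreal (2 powr q) * (2 * (\<integral>\<^sup>+x. ennreal (norm (f x) powr q) \<partial>lborel))"
  have c: "c < \<infinity>" using fq by (simp add: c_def ennreal_mult_less_top)
  have \<omega>c: "\<omega> z \<le> c" for z
  proof -
    have "\<omega> z \<le> (\<integral>\<^sup>+x. ennreal (2 powr q) * (ennreal (norm (f (x \<odot> - z)) powr q) + ennreal (norm (f x) powr q)) \<partial>lborel)"
      unfolding \<omega>_def
    proof (intro nn_integral_mono)
      fix x
      have "norm (f (x \<odot> - z) - f x) powr q \<le> (norm (f (x \<odot> - z)) + norm (f x)) powr q"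
        using q by (intro powr_mono2 norm_triangle_ineq4) auto
      also have "\<dots> \<le> 2 powr q * (norm (f (x \<odot> - z)) powr q + norm (f x) powr q)"
        using q by (intro powr_add_le) auto
      finally have "ennreal (norm (f (x \<odot> - z) - f x) powr q) \<le> ennreal (2 powr q * (norm (f (x \<odot> - z)) powr q + norm (f x) powr q))"
        by (rule ennreal_leI)
      then show "ennreal (norm (f (x \<odot> - z) - f x) powr q) \<le> ennreal (2 powr q) * (ennreal (norm (f (x \<odot> - z)) powr q) + ennreal (norm (f x) powr q))"
        by (simp add: ennreal_mult)
    qed
    also have "\<dots> = ennreal (2 powr q) * ((\<integral>\<^sup>+x. ennreal (norm (f (x \<odot> - z)) powr q) \<partial>lborel) + (\<integral>\<^sup>+x. ennreal (norm (f x) powr q) \<partial>lborel))"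
      by (subst nn_integral_cmult, measurable) (subst nn_integral_add, measurable)
    also have "\<dots> = c"
      using nn_integral_mult_right[of "\<lambda>x. ennreal (norm (f x) powr q)" "- z"] by (simp add: c_def mult_2)
    finally show ?thesis .
  qed
  have \<omega>0: "((\<lambda>\<rho>. \<omega> (dil \<rho> y)) \<longlongrightarrow> 0) (at_right 0)" for y
  proof (rule tendsto_0_if_ennreal)
    fix \<epsilon> :: real assume "\<epsilon> > 0"
    from Lp_modulus[OF this, folded \<omega>_def]
    obtain \<delta> where \<delta>: "\<delta> > 0" "\<And>z. norm z < \<delta> \<Longrightarrow> \<omega> z \<le> ennreal \<epsilon>"
      by blast
    have "continuous_on UNIV (\<lambda>\<rho>. dil \<rho> y)" by (intro continuous_intros)
    then have "isCont (\<lambda>\<rho>. dil \<rho> y) 0"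
      using continuous_on_eq_continuous_at[OF open_UNIV] by blast
    then have "((\<lambda>\<rho>. dil \<rho> y) \<longlongrightarrow> dil 0 y) (at_right 0)"
      unfolding isCont_def by (rule filterlim_at_split[THEN iffD1, THEN conjunct2])
    then have "((\<lambda>\<rho>. norm (dil \<rho> y)) \<longlongrightarrow> 0) (at_right 0)"
      by (simp add: tendsto_norm_zero)
    from order_tendstoD(2)[OF this \<delta>(1)] show "\<forall>\<^sub>F \<rho> in at_right 0. \<omega> (dil \<rho> y) \<le> ennreal \<epsilon>"
      by eventually_elim (rule \<delta>(2))
  qed
  have \<omega>m [measurable]: "(\<lambda>y. \<omega> (dil \<rho> y)) \<in> borel_measurable KM" for \<rho>
  proof -
    have "(\<lambda>(y, x). ennreal (norm (f (x \<odot> - dil \<rho> y) - f x) powr q)) \<in> borel_measurable (KM \<Otimes>\<^sub>M lborel)"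
      unfolding split_def by measurable
    from lborel.borel_measurable_nn_integral[OF this] show ?thesis unfolding \<omega>_def .
  qed
  have main: "(\<integral>\<^sup>+x. ennreal (norm (Pois f (x, \<rho>) - A *\<^sub>R f x) powr q) \<partial>lborel) \<le> ennreal (A powr (q - 1)) * (\<integral>\<^sup>+y. \<omega> (dil \<rho> y) \<partial>KM)"
    if \<rho>: "\<rho> > 0" for \<rho>
  proof -
    have "(\<integral>\<^sup>+x. ennreal (norm (Pois f (x, \<rho>) - A *\<^sub>R f x) powr q) \<partial>lborel) \<le>
       (\<integral>\<^sup>+x. ennreal (A powr (q - 1)) * (\<integral>\<^sup>+y. ennreal (norm (f (x \<odot> - dil \<rho> y) - f x) powr q) \<partial>KM) \<partial>lborel)"
    proof (intro nn_integral_mono)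
      fix x
      have "Pois f (x, \<rho>) - A *\<^sub>R f x = (LINT y|KM. f (x \<odot> - dil \<rho> y) - f x)"
        unfolding Pois_def fst_conv snd_conv using integrable_shift_KM[OF \<rho>] AKM
        by (subst Bochner_Integration.integral_diff) auto
      then show "ennreal (norm (Pois f (x, \<rho>) - A *\<^sub>R f x) powr q) \<le>
         ennreal (A powr (q - 1)) * (\<integral>\<^sup>+y. ennreal (norm (f (x \<odot> - dil \<rho> y) - f x) powr q) \<partial>KM)"
        using KM.norm_integral_powr_le[OF q, of "\<lambda>y. f (x \<odot> - dil \<rho> y) - f x"] A_pos AKM by simp
    qed
    also have "\<dots> = ennreal (A powr (q - 1)) * (\<integral>\<^sup>+x. (\<integral>\<^sup>+y. ennreal (norm (f (x \<odot> - dil \<rho> y) - f x) powr q) \<partial>KM) \<partial>lborel)"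
      by (rule nn_integral_cmult) measurable
    also have "(\<integral>\<^sup>+x. (\<integral>\<^sup>+y. ennreal (norm (f (x \<odot> - dil \<rho> y) - f x) powr q) \<partial>KM) \<partial>lborel) = (\<integral>\<^sup>+y. \<omega> (dil \<rho> y) \<partial>KM)"
      unfolding \<omega>_def by (rule pair.Fubini'[symmetric]) measurable
    finally show ?thesis .
  qed
  have "((\<lambda>\<rho>. \<integral>\<^sup>+y. \<omega> (dil \<rho> y) \<partial>KM) \<longlongrightarrow> 0) (at_right 0)"
    unfolding tendsto_at_iff_sequentially
  proof (intro allI impI)
    fix X :: "nat \<Rightarrow> real" assume X: "\<forall>i. X i \<in> {0<..} - {0}" "X \<longlonglongrightarrow> 0"
    have "(\<lambda>i. \<integral>\<^sup>+y. \<omega> (dil (X i) y) \<partial>KM) \<longlonglongrightarrow> (\<integral>\<^sup>+y. 0 \<partial>KM)"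
    proof (rule nn_integral_dominated_convergence[where w="\<lambda>_. c"])
      show "(\<integral>\<^sup>+y. c \<partial>KM) < \<infinity>"
        using c by (simp add: KM.emeasure_eq_measure ennreal_mult_less_top)
      show "AE y in KM. (\<lambda>i. \<omega> (dil (X i) y)) \<longlonglongrightarrow> 0"
        using \<omega>0 X unfolding tendsto_at_iff_sequentially by (auto simp: o_def)
    qed (use \<omega>c in auto)
    then show "((\<lambda>\<rho>. \<integral>\<^sup>+y. \<omega> (dil \<rho> y) \<partial>KM) \<circ> X) \<longlonglongrightarrow> 0" by (simp add: o_def)
  qed
  then have "((\<lambda>\<rho>. ennreal (A powr (q - 1)) * (\<integral>\<^sup>+y. \<omega> (dil \<rho> y) \<partial>KM)) \<longlongrightarrow> ennreal (A powr (q - 1)) * 0) (at_right 0)"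
    by (intro ennreal_tendsto_cmult) auto
  then have up: "((\<lambda>\<rho>. ennreal (A powr (q - 1)) * (\<integral>\<^sup>+y. \<omega> (dil \<rho> y) \<partial>KM)) \<longlongrightarrow> 0) (at_right 0)" by simp
  show ?thesis
  proof (rule tendsto_sandwich[OF _ _ tendsto_const up])
    show "\<forall>\<^sub>F \<rho> in at_right 0. (\<integral>\<^sup>+x. ennreal (norm (Pois f (x, \<rho>) - A *\<^sub>R f x) powr q) \<partial>lborel) \<le> ennreal (A powr (q - 1)) * (\<integral>\<^sup>+y. \<omega> (dil \<rho> y) \<partial>KM)"
      using eventually_at_right_less[of "0::real"] by eventually_elim (rule main)
  qed simp
qed

end

text \<open>Written against Lebesgue measure in the argument of \<open>f\<close>, the Poisson
  integral does not see the exceptional null set; the bound then holds at every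
  \<open>x\<close>.\<close>

lemma Pois_ess_bound:
  fixes f :: "'v \<times> 'z \<Rightarrow> complex"
  assumes [measurable]: "f \<in> borel_measurable borel" and C: "AE x in lborel. norm (f x) \<le> C" and \<rho>: "\<rho> > 0"
  shows "norm (Pois f (x, \<rho>)) \<le> A * C"
proof -
  have [measurable]: "(\<lambda>w. - w \<odot> x) \<in> borel_measurable borel"
    by (intro borel_measurable_continuous_onI continuous_intros)
  have "integrable KM (\<lambda>y. C)" by simp
  then have iC: "integrable lborel (\<lambda>w. K \<rho> (- w \<odot> x) * C)"
    using Pois_eq(2)[OF \<rho>, of "\<lambda>_. C" x] by simp
  have ae: "AE w in lborel. norm (K \<rho> (- w \<odot> x) *\<^sub>R f w) \<le> K \<rho> (- w \<odot> x) * C"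
    using C by eventually_elim (simp add: mult_left_mono)
  have i: "integrable lborel (\<lambda>w. K \<rho> (- w \<odot> x) *\<^sub>R f w)"
    by (rule Bochner_Integration.integrable_bound[OF iC]) (measurable, use ae in \<open>eventually_elim, simp\<close>)
  have "norm (Pois f (x, \<rho>)) = norm (LINT w|lborel. K \<rho> (- w \<odot> x) *\<^sub>R f w)"
    using Pois_eq(1)[OF \<rho>, of f x] by simp
  also have "\<dots> \<le> (LINT w|lborel. norm (K \<rho> (- w \<odot> x) *\<^sub>R f w))" by (rule integral_norm_bound)
  also have "\<dots> \<le> (LINT w|lborel. K \<rho> (- w \<odot> x) * C)"
    by (rule integral_mono_AE[OF integrable_norm[OF i] iC ae])
  also have "\<dots> = A * C"
    using Pois_eq(1)[OF \<rho>, of "\<lambda>_. C" x] by (simp add: Pois_def A_def)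
  finally show ?thesis .
qed

end

section \<open>Complex measures\<close>

definition signed :: "('a::topological_space set \<Rightarrow> real) \<Rightarrow> bool" where
  "signed \<nu> \<longleftrightarrow> (\<forall>A :: nat \<Rightarrow> 'a set. range A \<subseteq> sets borel \<longrightarrow> disjoint_family A \<longrightarrow>
     (\<lambda>i. \<nu> (A i)) sums \<nu> (\<Union>i. A i))"

lemma signed_uminus: "signed \<nu> \<Longrightarrow> signed (\<lambda>A. - \<nu> A)"
  by (simp add: signed_def sums_minus)

lemma complex_measure_signed:
  assumes "complex_borel_measure \<mu>"
  shows "signed (\<lambda>A. Re (\<mu> A))" "signed (\<lambda>A. Im (\<mu> A))"
  using assms by (auto simp: signed_def complex_borel_measure_def intro: sums_Re sums_Im)

text \<open>A real supremum in place of the extended one in \<open>positive_part\<close>; it is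
  finite by \<open>signed_bounded\<close>, and \<open>SUP_ennreal_eq_var_pos\<close> identifies the
  two.\<close>

definition var_pos :: "('a::topological_space set \<Rightarrow> real) \<Rightarrow> 'a set \<Rightarrow> real" where
  "var_pos \<nu> A = (SUP B\<in>{B \<in> sets borel. B \<subseteq> A}. \<nu> B)"

context
  fixes \<nu> :: "'a::topological_space set \<Rightarrow> real"
  assumes \<nu>: "signed \<nu>"
begin

lemma signed_sums: "range A \<subseteq> sets borel \<Longrightarrow> disjoint_family (A :: nat \<Rightarrow> _) \<Longrightarrow> (\<lambda>i. \<nu> (A i)) sums \<nu> (\<Union>i. A i)"
  using \<nu> by (simp add: signed_def)

lemma signed_empty: "\<nu> {} = 0"
proof -
  have "(\<lambda>i::nat. \<nu> {}) sums \<nu> (\<Union>i::nat. {})"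
    by (rule signed_sums) (auto simp: disjoint_family_on_def)
  then have "summable (\<lambda>i::nat. \<nu> {})" by (rule sums_summable)
  then show ?thesis by (simp only: summable_const_iff)
qed

lemma signed_Un: "A \<in> sets borel \<Longrightarrow> B \<in> sets borel \<Longrightarrow> A \<inter> B = {} \<Longrightarrow> \<nu> (A \<union> B) = \<nu> A + \<nu> B"
proof -
  assume AB: "A \<in> sets borel" "B \<in> sets borel" "A \<inter> B = {}"
  have "disjoint_family (binaryset A B)"
    using AB(3) by (auto simp: disjoint_family_on_def binaryset_def)
  then have "(\<lambda>i. \<nu> (binaryset A B i)) sums \<nu> (A \<union> B)"
    using signed_sums[of "binaryset A B", unfolded UN_binaryset_eq range_binaryset_eq] AB by simp
  from sums_unique2[OF this binaryset_sums[of \<nu> A B, OF signed_empty]] show ?thesis .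
qed

lemma signed_Diff: "A \<in> sets borel \<Longrightarrow> B \<in> sets borel \<Longrightarrow> B \<subseteq> A \<Longrightarrow> \<nu> (A - B) = \<nu> A - \<nu> B"
  using signed_Un[of B "A - B"] by (auto simp: Un_absorb1)

text \<open>A set on which \<open>\<nu>\<close> is unbounded contains a subset of large measure on which \<open>\<nu>\<close> is unbounded;
  iterating this produces a decreasing sequence along which continuity from above fails.\<close>

lemma signed_bounded: "\<exists>c. \<forall>B\<in>sets borel. \<bar>\<nu> B\<bar> \<le> c"
proof (rule ccontr)
  define unb where "unb A \<longleftrightarrow> (\<forall>c. \<exists>B\<in>sets borel. B \<subseteq> A \<and> c < \<bar>\<nu> B\<bar>)" for A
  assume "\<not> ?thesis"
  then have "unb UNIV" unfolding unb_def not_le[symmetric] by blast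
  have split: "unb E \<or> unb (A - E)" if "unb A" "E \<in> sets borel" "A \<in> sets borel" "E \<subseteq> A" for A E
  proof (rule ccontr)
    assume "\<not> ?thesis"
    then have "\<not> unb E" "\<not> unb (A - E)" by auto
    then obtain c1 c2 where "\<forall>B\<in>sets borel. B \<subseteq> E \<longrightarrow> \<not> c1 < \<bar>\<nu> B\<bar>" "\<forall>B\<in>sets borel. B \<subseteq> A - E \<longrightarrow> \<not> c2 < \<bar>\<nu> B\<bar>"
      unfolding unb_def by meson
    then have c: "\<And>B. B \<in> sets borel \<Longrightarrow> B \<subseteq> E \<Longrightarrow> \<bar>\<nu> B\<bar> \<le> c1"
      "\<And>B. B \<in> sets borel \<Longrightarrow> B \<subseteq> A - E \<Longrightarrow> \<bar>\<nu> B\<bar> \<le> c2" by (simp_all add: not_less)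
    obtain B where B: "B \<in> sets borel" "B \<subseteq> A" "c1 + c2 < \<bar>\<nu> B\<bar>" using \<open>unb A\<close> unfolding unb_def by meson
    have "\<nu> B = \<nu> (B \<inter> E) + \<nu> (B - E)"
      using signed_Un[of "B \<inter> E" "B - E"] B that by (auto simp: Int_Diff_Un)
    moreover have "\<bar>\<nu> (B \<inter> E)\<bar> \<le> c1" using B that by (intro c) auto
    moreover have "\<bar>\<nu> (B - E)\<bar> \<le> c2" using B that by (intro c) auto
    ultimately show False using B by linarith
  qed
  \<comment> \<open>If the value on \<open>E\<close> exceeds \<open>n\<close> plus that on
    \<open>A\<close> in absolute value, then both \<open>E\<close> and \<open>A - E\<close> have
    values of size at least \<open>n\<close>, and whichever of them is unbounded can be
    taken.\<close>
  have step: "\<exists>B. (B \<in> sets borel \<and> unb B) \<and> B \<subseteq> A \<and> real n \<le> \<bar>\<nu> B\<bar>" if A: "A \<in> sets borel \<and> unb A" for A n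
  proof -
    obtain E where E: "E \<in> sets borel" "E \<subseteq> A" "real n + \<bar>\<nu> A\<bar> < \<bar>\<nu> E\<bar>" using A unfolding unb_def by meson
    have "\<nu> (A - E) = \<nu> A - \<nu> E" using A E by (intro signed_Diff) auto
    then have "real n \<le> \<bar>\<nu> (A - E)\<bar>" using E by linarith
    moreover have "real n \<le> \<bar>\<nu> E\<bar>" using E by linarith
    moreover have "A - E \<in> sets borel" "A - E \<subseteq> A" using A E by auto
    ultimately show ?thesis using split[of A E] A E by metis
  qed
  obtain B :: "nat \<Rightarrow> 'a set" where B: "\<And>n. B n \<in> sets borel \<and> unb (B n)" "\<And>n. B (Suc n) \<subseteq> B n \<and> real n \<le> \<bar>\<nu> (B (Suc n))\<bar>"
  proof -
    have "\<exists>B. \<forall>n. (B n \<in> sets borel \<and> unb (B n)) \<and> B (Suc n) \<subseteq> B n \<and> real n \<le> \<bar>\<nu> (B (Suc n))\<bar>"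
    proof (rule dependent_nat_choice[of "\<lambda>_ x. x \<in> sets borel \<and> unb x" "\<lambda>n x y. y \<subseteq> x \<and> real n \<le> \<bar>\<nu> y\<bar>"])
      show "\<exists>x. x \<in> sets borel \<and> unb x" using \<open>unb UNIV\<close> by (intro exI[of _ UNIV]) auto
    qed (rule step)
    then show ?thesis using that by blast
  qed
  define D where "D n = B n - B (Suc n)" for n
  have dec: "B m \<subseteq> B n" if "n \<le> m" for n m
    using that by (induction rule: dec_induct) (use B(2) in blast)+
  have "disjoint_family D"
    unfolding disjoint_family_on_def
  proof (intro ballI impI)
    fix i j :: nat assume "i \<noteq> j"
    then show "D i \<inter> D j = {}"
      using dec[of "Suc i" j] dec[of "Suc j" i] unfolding D_def by (cases "i < j") auto
  qed
  moreover have "range D \<subseteq> sets borel" using B(1) by (auto simp: D_def)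
  ultimately have "(\<lambda>n. \<nu> (D n)) sums \<nu> (\<Union>n. D n)"
    by (intro signed_sums)
  moreover have "\<nu> (D n) = \<nu> (B n) - \<nu> (B (Suc n))" for n
    unfolding D_def using B by (intro signed_Diff) auto
  moreover have "(\<Sum>k<n. \<nu> (B k) - \<nu> (B (Suc k))) = \<nu> (B 0) - \<nu> (B n)" for n
    by (rule sum_lessThan_telescope')
  ultimately have "(\<lambda>n. \<nu> (B 0) - \<nu> (B n)) \<longlonglongrightarrow> \<nu> (\<Union>n. D n)" by (simp add: sums_def)
  then have "(\<lambda>n. \<nu> (B 0) - (\<nu> (B 0) - \<nu> (B n))) \<longlonglongrightarrow> \<nu> (B 0) - \<nu> (\<Union>n. D n)" by (intro tendsto_intros)
  then have "convergent (\<lambda>n. \<nu> (B n))" by (auto simp: convergent_def)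
  then have "Bseq (\<lambda>n. \<nu> (B n))" by (rule convergent_imp_Bseq)
  then obtain c where c: "\<And>n. \<bar>\<nu> (B n)\<bar> \<le> c" by (auto simp: Bseq_def)
  obtain n :: nat where "c < real n" using reals_Archimedean2 by blast
  then show False using B(2)[of n] c[of "Suc n"] by linarith
qed

lemma var_pos_bdd: "bdd_above (\<nu> ` {B \<in> sets borel. B \<subseteq> A})"
proof -
  obtain c where "\<And>B. B \<in> sets borel \<Longrightarrow> \<bar>\<nu> B\<bar> \<le> c" using signed_bounded by blast
  then show ?thesis by (intro bdd_aboveI[of _ c]) (auto simp: abs_le_iff)
qed

lemma var_pos_upper: "B \<in> sets borel \<Longrightarrow> B \<subseteq> A \<Longrightarrow> \<nu> B \<le> var_pos \<nu> A"
  unfolding var_pos_def by (rule cSUP_upper[OF _ var_pos_bdd]) simp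

lemma var_pos_least: "(\<And>B. B \<in> sets borel \<Longrightarrow> B \<subseteq> A \<Longrightarrow> \<nu> B \<le> c) \<Longrightarrow> var_pos \<nu> A \<le> c"
  unfolding var_pos_def by (rule cSUP_least) auto

lemma var_pos_nonneg: "0 \<le> var_pos \<nu> A"
  using var_pos_upper[of "{}" A] signed_empty by simp

lemma var_pos_mono: "A \<subseteq> B \<Longrightarrow> var_pos \<nu> A \<le> var_pos \<nu> B"
  by (rule var_pos_least) (use var_pos_upper in blast)

lemma var_pos_super:
  assumes "A \<inter> B = {}"
  shows "var_pos \<nu> A + var_pos \<nu> B \<le> var_pos \<nu> (A \<union> B)"
proof -
  have "var_pos \<nu> A \<le> var_pos \<nu> (A \<union> B) - var_pos \<nu> B"
  proof (rule var_pos_least)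
    fix C assume C: "C \<in> sets borel" "C \<subseteq> A"
    have "var_pos \<nu> B \<le> var_pos \<nu> (A \<union> B) - \<nu> C"
    proof (rule var_pos_least)
      fix D assume D: "D \<in> sets borel" "D \<subseteq> B"
      have "\<nu> C + \<nu> D = \<nu> (C \<union> D)" using C D assms by (intro signed_Un[symmetric]) auto
      also have "\<dots> \<le> var_pos \<nu> (A \<union> B)" using C D by (intro var_pos_upper) auto
      finally show "\<nu> D \<le> var_pos \<nu> (A \<union> B) - \<nu> C" by simp
    qed
    then show "\<nu> C \<le> var_pos \<nu> (A \<union> B) - var_pos \<nu> B" by simp
  qed
  then show ?thesis by simp
qed

text \<open>Superadditivity on disjoint sets bounds the partial sums. Conversely, a set
  \<open>B\<close> inside the union is split into the pieces \<open>B \<inter> A i\<close>.\<close>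

lemma var_pos_sums:
  assumes A: "range A \<subseteq> sets borel" "disjoint_family (A :: nat \<Rightarrow> _)"
  shows "(\<lambda>i. var_pos \<nu> (A i)) sums var_pos \<nu> (\<Union>i. A i)"
proof -
  have fin: "(\<Sum>i<n. var_pos \<nu> (A i)) \<le> var_pos \<nu> (\<Union>i<n. A i)" for n
  proof (induction n)
    case 0 then show ?case by (simp add: var_pos_nonneg)
  next
    case (Suc n)
    have "A n \<inter> A k = {}" if "k < n" for k
      using disjoint_family_onD[OF A(2), of n k] that by simp
    then have "(\<Union>i<n. A i) \<inter> A n = {}" by blast
    from var_pos_super[OF this] Suc show ?case
      by (simp add: lessThan_Suc Un_commute)
  qed
  have bd: "(\<Sum>i<n. var_pos \<nu> (A i)) \<le> var_pos \<nu> (\<Union>i. A i)" for n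
    by (rule order_trans[OF fin var_pos_mono]) auto
  have s: "summable (\<lambda>i. var_pos \<nu> (A i))"
    by (rule summableI_nonneg_bounded[OF var_pos_nonneg bd])
  have "(\<Sum>i. var_pos \<nu> (A i)) \<le> var_pos \<nu> (\<Union>i. A i)"
    by (rule suminf_le_const[OF s bd])
  moreover have "var_pos \<nu> (\<Union>i. A i) \<le> (\<Sum>i. var_pos \<nu> (A i))"
  proof (rule var_pos_least)
    fix B assume B: "B \<in> sets borel" "B \<subseteq> (\<Union>i. A i)"
    have "(\<lambda>i. \<nu> (B \<inter> A i)) sums \<nu> (\<Union>i. B \<inter> A i)"
      using A B by (intro signed_sums) (auto simp: disjoint_family_on_def)
    moreover have "(\<Union>i. B \<inter> A i) = B" using B by auto
    ultimately have "(\<lambda>i. \<nu> (B \<inter> A i)) sums \<nu> B" by simp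
    then show "\<nu> B \<le> (\<Sum>i. var_pos \<nu> (A i))"
      by (rule sums_le[OF _ _ summable_sums[OF s], rotated]) (use A B in \<open>auto intro!: var_pos_upper\<close>)
  qed
  ultimately show ?thesis using s by (simp add: sums_iff)
qed

text \<open>Truncating negative values to \<open>0\<close> does not change the supremum, since the
  empty set already contributes \<open>0\<close>.\<close>

lemma SUP_ennreal_eq_var_pos: "(SUP B\<in>{B \<in> sets borel. B \<subseteq> A}. ennreal (\<nu> B)) = ennreal (var_pos \<nu> A)"
proof (rule antisym)
  show le: "(SUP B\<in>{B \<in> sets borel. B \<subseteq> A}. ennreal (\<nu> B)) \<le> ennreal (var_pos \<nu> A)"
    by (rule SUP_least) (auto intro!: ennreal_leI var_pos_upper)
  define S where "S = (SUP B\<in>{B \<in> sets borel. B \<subseteq> A}. ennreal (\<nu> B))"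
  have fin: "S < \<top>" using le unfolding S_def by (rule le_less_trans) simp
  have "var_pos \<nu> A \<le> enn2real S"
  proof (rule var_pos_least)
    fix B assume "B \<in> sets borel" "B \<subseteq> A"
    then have "ennreal (\<nu> B) \<le> S" unfolding S_def by (intro SUP_upper) simp
    then have "enn2real (ennreal (\<nu> B)) \<le> enn2real S" by (rule enn2real_mono[OF _ fin])
    then show "\<nu> B \<le> enn2real S" by (cases "0 \<le> \<nu> B") (auto intro: order_trans[OF _ enn2real_nonneg])
  qed
  then have "ennreal (var_pos \<nu> A) \<le> ennreal (enn2real S)" by (rule ennreal_leI)
  then show "ennreal (var_pos \<nu> A) \<le> (SUP B\<in>{B \<in> sets borel. B \<subseteq> A}. ennreal (\<nu> B))"
    unfolding S_def[symmetric] using fin by simp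
qed

lemma sets_positive_part [simp]: "sets (positive_part \<nu>) = sets borel"
  unfolding positive_part_def using sets.sigma_sets_eq[of borel] by (simp add: space_borel)

lemma space_positive_part [simp]: "space (positive_part \<nu>) = UNIV"
  unfolding positive_part_def by (simp add: space_measure_of_conv)

lemma emeasure_positive_part:
  assumes "B \<in> sets borel" shows "emeasure (positive_part \<nu>) B = ennreal (var_pos \<nu> B)"
proof -
  have "emeasure (positive_part \<nu>) B = (SUP C\<in>{C \<in> sets borel. C \<subseteq> B}. ennreal (\<nu> C))"
    unfolding positive_part_def
  proof (rule emeasure_measure_of_sigma)
    show "sigma_algebra UNIV (sets (borel :: 'a measure))"
      using sets.sigma_algebra_axioms[of "borel :: 'a measure"] by simp
    show "positive (sets borel) (\<lambda>A. SUP B\<in>{B \<in> sets borel. B \<subseteq> A}. ennreal (\<nu> B))"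
      unfolding SUP_ennreal_eq_var_pos positive_def
      using antisym[OF var_pos_least[of "{}" 0] var_pos_nonneg] signed_empty by simp
    show "countably_additive (sets borel) (\<lambda>A. SUP B\<in>{B \<in> sets borel. B \<subseteq> A}. ennreal (\<nu> B))"
      unfolding SUP_ennreal_eq_var_pos
    proof (rule countably_additiveI)
      fix A :: "nat \<Rightarrow> 'a set" assume A: "range A \<subseteq> sets borel" "disjoint_family A"
      note s = var_pos_sums[OF A]
      have "(\<Sum>i. ennreal (var_pos \<nu> (A i))) = ennreal (\<Sum>i. var_pos \<nu> (A i))"
        using s by (intro suminf_ennreal2 var_pos_nonneg) (auto simp: sums_iff)
      then show "(\<Sum>i. ennreal (var_pos \<nu> (A i))) = ennreal (var_pos \<nu> (\<Union>i. A i))"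
        using s by (simp add: sums_iff)
    qed
  qed (rule assms)
  then show ?thesis by (simp add: SUP_ennreal_eq_var_pos)
qed

lemma finite_measure_positive_part: "finite_measure (positive_part \<nu>)"
  by (rule finite_measureI) (simp add: emeasure_positive_part)

lemma measure_positive_part: "B \<in> sets borel \<Longrightarrow> measure (positive_part \<nu>) B = var_pos \<nu> B"
  by (simp add: measure_def emeasure_positive_part var_pos_nonneg)

end

text \<open>The Jordan decomposition without a Hahn set: for \<open>B \<subseteq> A\<close>,
  \<open>\<nu> B = \<nu> A - \<nu> (A - B)\<close> is at most \<open>\<nu> A\<close> plus the
  positive part of \<open>- \<nu>\<close> on \<open>A\<close>. The same argument for
  \<open>- \<nu>\<close> gives the reverse inequality.\<close>

lemma positive_part_diff:
  assumes \<nu>: "signed \<nu>" and A: "A \<in> sets borel"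
  shows "measure (positive_part \<nu>) A - measure (positive_part (\<lambda>A. - \<nu> A)) A = \<nu> A"
proof -
  have le: "var_pos \<kappa> A \<le> \<kappa> A + var_pos (\<lambda>A. - \<kappa> A) A" if \<kappa>: "signed \<kappa>" for \<kappa>
  proof (rule var_pos_least[OF \<kappa>])
    fix B assume B: "B \<in> sets borel" "B \<subseteq> A"
    have "\<kappa> (A - B) = \<kappa> A - \<kappa> B" by (rule signed_Diff[OF \<kappa> A B])
    moreover have "- \<kappa> (A - B) \<le> var_pos (\<lambda>A. - \<kappa> A) A"
      using A B by (intro var_pos_upper[OF signed_uminus[OF \<kappa>]]) auto
    ultimately show "\<kappa> B \<le> \<kappa> A + var_pos (\<lambda>A. - \<kappa> A) A" by simp
  qed
  show ?thesis
    using le[OF \<nu>] le[OF signed_uminus[OF \<nu>]] A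
    by (simp add: measure_positive_part[OF \<nu>] measure_positive_part[OF signed_uminus[OF \<nu>]])
qed

text \<open>Agreement on sets extends to step functions and, by uniform approximation, to bounded
  measurable functions. The four measures form one family so that a single error estimate serves
  all.\<close>

lemma integral_diff_cong_measures:
  fixes N :: "nat \<Rightarrow> 'a::topological_space measure" and h :: "'a \<Rightarrow> real"
  assumes fin: "\<And>i. finite_measure (N i)" and sets: "\<And>i. sets (N i) = sets borel"
    and eq: "\<And>B. B \<in> sets borel \<Longrightarrow> measure (N 0) B - measure (N 1) B = measure (N 2) B - measure (N 3) B"
    and h: "h \<in> borel_measurable borel" "\<And>x. \<bar>h x\<bar> \<le> M"
  shows "(LINT x|N 0. h x) - (LINT x|N 1. h x) = (LINT x|N 2. h x) - (LINT x|N 3. h x)"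
proof -
  define c where "c = (\<Sum>i<4. measure (N i) (space (N i)))"
  have c: "c \<ge> 0" by (simp add: c_def sum_nonneg)
  have sp: "space (N i) = space borel" for i by (rule sets_eq_imp_space_eq[OF sets])
  have hm: "h \<in> borel_measurable (N i)" for i using h(1) measurable_cong_sets[OF sets refl] by blast
  have "\<bar>((LINT x|N 0. h x) - (LINT x|N 1. h x)) - ((LINT x|N 2. h x) - (LINT x|N 3. h x))\<bar> \<le> 0"
  proof (rule field_le_epsilon)
    fix e :: real assume e: "e > 0"
    define \<epsilon> where "\<epsilon> = e / (c + 1)"
    have \<epsilon>: "\<epsilon> > 0" "\<epsilon> * c \<le> e" using e c by (auto simp: \<epsilon>_def field_simps)
    obtain I :: "int set" and S a where S: "finite I" "\<And>k. k \<in> I \<Longrightarrow> S k \<in> sets (borel :: 'a measure)"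
      and app: "\<And>x. x \<in> space borel \<Longrightarrow> \<bar>h x - (\<Sum>k\<in>I. a k * indicator (S k) x)\<bar> \<le> \<epsilon>"
      using uniform_step_approx[OF h \<epsilon>(1)] by metis
    have near: "\<bar>(LINT x|N i. h x) - (\<Sum>k\<in>I. a k * measure (N i) (S k))\<bar> \<le> \<epsilon> * measure (N i) (space (N i))" for i
    proof -
      interpret finite_measure "N i" by (rule fin)
      have Sk: "k \<in> I \<Longrightarrow> S k \<in> sets (N i)" for k using S(2) sets by simp
      have i1: "integrable (N i) h" by (rule integrable_const_bound[of _ M]) (use h hm in auto)
      have i2: "integrable (N i) (\<lambda>x. \<Sum>k\<in>I. a k * indicator (S k) x)"
        by (intro Bochner_Integration.integrable_sum integrable_mult_right integrable_real_indicator Sk) (auto simp: emeasure_eq_measure)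
      have "(LINT x|N i. (\<Sum>k\<in>I. a k * indicator (S k) x)) = (\<Sum>k\<in>I. (LINT x|N i. a k * indicator (S k) x))"
        by (intro Bochner_Integration.integral_sum integrable_mult_right integrable_real_indicator Sk) (auto simp: emeasure_eq_measure)
      also have "\<dots> = (\<Sum>k\<in>I. a k * measure (N i) (S k))"
      proof (intro sum.cong refl)
        fix k assume "k \<in> I"
        then have "S k \<inter> space (N i) = S k" using sets.sets_into_space[OF Sk] by blast
        then show "(LINT x|N i. a k * indicator (S k) x) = a k * measure (N i) (S k)"
          by simp
      qed
      finally have e2: "(\<Sum>k\<in>I. a k * measure (N i) (S k)) = (LINT x|N i. (\<Sum>k\<in>I. a k * indicator (S k) x))" by simp
      have "\<bar>(LINT x|N i. h x) - (\<Sum>k\<in>I. a k * measure (N i) (S k))\<bar> = \<bar>LINT x|N i. h x - (\<Sum>k\<in>I. a k * indicator (S k) x)\<bar>"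
        unfolding e2 by (simp only: Bochner_Integration.integral_diff[OF i1 i2])
      also have "\<dots> \<le> (LINT x|N i. \<bar>h x - (\<Sum>k\<in>I. a k * indicator (S k) x)\<bar>)"
        using integral_norm_bound[of "N i" "\<lambda>x. h x - (\<Sum>k\<in>I. a k * indicator (S k) x)"] by simp
      also have "\<dots> \<le> (LINT x|N i. \<epsilon>)"
        by (intro integral_mono integrable_abs Bochner_Integration.integrable_diff i1 i2) (use app sp in auto)
      finally show ?thesis by (simp add: mult.commute)
    qed
    have "(\<Sum>k\<in>I. a k * measure (N 0) (S k)) - (\<Sum>k\<in>I. a k * measure (N 1) (S k)) =
      (\<Sum>k\<in>I. a k * measure (N 2) (S k)) - (\<Sum>k\<in>I. a k * measure (N 3) (S k))"
      unfolding sum_subtractf[symmetric] right_diff_distrib[symmetric]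
      by (intro sum.cong refl arg_cong2[where f="(*)"] eq S(2))
    moreover have "\<epsilon> * c = \<epsilon> * measure (N 0) (space (N 0)) + \<epsilon> * measure (N 1) (space (N 1)) + \<epsilon> * measure (N 2) (space (N 2)) + \<epsilon> * measure (N 3) (space (N 3))"
      by (simp add: c_def numeral_eq_Suc algebra_simps)
    ultimately show "\<bar>((LINT x|N 0. h x) - (LINT x|N 1. h x)) - ((LINT x|N 2. h x) - (LINT x|N 3. h x))\<bar> \<le> 0 + e"
      using near[of 0] near[of 1] near[of 2] near[of 3] \<epsilon>(2) by linarith
  qed
  then show ?thesis by simp
qed

text \<open>Integrals depend on the difference of the measures alone, so the measures produced by
  compactness can stand for the Jordan parts in \<open>cm_integral\<close>.\<close>

lemma integral_positive_part_diff:
  fixes h :: "'a::topological_space \<Rightarrow> real"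
  assumes N: "finite_measure N1" "finite_measure N2" "sets N1 = sets borel" "sets N2 = sets borel"
    and \<nu>: "signed \<nu>" "\<And>B. B \<in> sets borel \<Longrightarrow> \<nu> B = measure N1 B - measure N2 B"
    and h: "h \<in> borel_measurable borel" "\<And>x. \<bar>h x\<bar> \<le> M"
  shows "(LINT x|positive_part \<nu>. h x) - (LINT x|positive_part (\<lambda>A. - \<nu> A). h x) = (LINT x|N1. h x) - (LINT x|N2. h x)"
proof -
  define N where "N i = (if i = 0 then positive_part \<nu> else if i = 1 then positive_part (\<lambda>A. - \<nu> A) else if i = 2 then N1 else N2)" for i :: nat
  have "(LINT x|N 0. h x) - (LINT x|N 1. h x) = (LINT x|N 2. h x) - (LINT x|N 3. h x)"
  proof (rule integral_diff_cong_measures[OF _ _ _ h])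
    show "finite_measure (N i)" for i
      using N \<nu>(1) by (auto simp: N_def finite_measure_positive_part signed_uminus)
    show "sets (N i) = sets borel" for i
      using N \<nu>(1) by (auto simp: N_def sets_positive_part signed_uminus)
    show "measure (N 0) B - measure (N 1) B = measure (N 2) B - measure (N 3) B" if "B \<in> sets borel" for B
      using positive_part_diff[OF \<nu>(1) that] \<nu>(2)[OF that] by (simp add: N_def)
  qed
  then show ?thesis by (simp add: N_def)
qed

lemma signed_measure_diff:
  assumes N: "finite_measure N1" "finite_measure N2" "sets N1 = sets borel" "sets N2 = sets (borel :: 'a::topological_space measure)"
  shows "signed (\<lambda>B. measure N1 B - measure N2 B)"
  unfolding signed_def
proof (intro allI impI)
  fix A :: "nat \<Rightarrow> 'a set" assume A: "range A \<subseteq> sets borel" "disjoint_family A"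
  show "(\<lambda>i. measure N1 (A i) - measure N2 (A i)) sums (measure N1 (\<Union>i. A i) - measure N2 (\<Union>i. A i))"
    using A N by (intro sums_diff finite_measure.finite_measure_UNION) auto
qed

context htype
begin

section \<open>Convolution of finite measures with the kernel\<close>

lemma finite_measure_admissible:
  assumes "finite_measure N" "sets N = sets borel"
  shows "admissible N"
proof -
  interpret finite_measure N by fact
  have "integrable N (K \<rho>)" if "\<rho> > 0" for \<rho>
  proof (rule integrable_const_bound[of _ "\<rho> powr (2 * s) * \<rho> powr (- 4 * kap)"])
    show "K \<rho> \<in> borel_measurable N"
      using borel_measurable_K[of \<rho>] measurable_cong_sets[OF assms(2) refl] by blast
  qed (use K_le[OF that] in auto)
  then show ?thesis
    using assms by (simp add: admissible_def sigma_finite_measure_axioms)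
qed

context
  fixes N :: "('v \<times> 'z) measure"
  assumes N: "finite_measure N" "sets N = sets borel"
begin

definition mconv :: "real \<Rightarrow> 'v \<times> 'z \<Rightarrow> real" where
  "mconv \<rho> x = (LINT y|N. K \<rho> (- y \<odot> x))"

lemma integrable_K_left: "\<rho> > 0 \<Longrightarrow> integrable N (\<lambda>y. K \<rho> (- y \<odot> x))"
proof -
  assume \<rho>: "\<rho> > 0"
  have "K \<rho> (- y \<odot> x) = K \<rho> (- x \<odot> y)" for y
    using K_minus[of \<rho> "- x \<odot> y"] by (simp add: minus_mult)
  then show ?thesis using integrable_K_translate[OF finite_measure_admissible[OF N] \<rho>, of "- x"] by simp
qed

lemma mconv_nonneg: "0 \<le> mconv \<rho> x"
  unfolding mconv_def by (intro integral_nonneg_AE) auto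

lemma borel_measurable_mconv: "\<rho> > 0 \<Longrightarrow> mconv \<rho> \<in> borel_measurable borel"
proof -
  assume \<rho>: "\<rho> > 0"
  have eq: "mconv \<rho> = (\<lambda>x. LINT y|N. K \<rho> (- x \<odot> y))"
  proof
    fix x
    have "K \<rho> (- y \<odot> x) = K \<rho> (- x \<odot> y)" for y
      using K_minus[of \<rho> "- x \<odot> y"] by (simp add: minus_mult)
    then show "mconv \<rho> x = (LINT y|N. K \<rho> (- x \<odot> y))"
      unfolding mconv_def by simp
  qed
  have "continuous_on UNIV (\<lambda>x. LINT y|N. K \<rho> (- x \<odot> y))"
    by (rule continuous_on_compose2[OF continuous_on_K_nu[OF finite_measure_admissible[OF N] \<rho>]]) (auto intro!: continuous_intros)
  then show ?thesis
    unfolding eq by (rule borel_measurable_continuous_onI)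
qed

lemma nn_integral_K_pair:
  assumes \<rho>: "\<rho> > 0"
  shows "(\<integral>\<^sup>+x. (\<integral>\<^sup>+y. ennreal (K \<rho> (- y \<odot> x)) \<partial>N) \<partial>lborel) = ennreal (A * measure N UNIV)"
proof -
  interpret fin: finite_measure N by (rule N)
  interpret pair: pair_sigma_finite lborel N ..
  have "continuous_on UNIV (\<lambda>p :: ('v \<times> 'z) \<times> ('v \<times> 'z). K \<rho> (- snd p \<odot> fst p))"
    using \<rho> by (intro continuous_intros) auto
  from measurable_lborel_nu[OF finite_measure_admissible[OF N] \<rho> this]
  have [measurable]: "(\<lambda>(x, y). ennreal (K \<rho> (- y \<odot> x))) \<in> borel_measurable (lborel \<Otimes>\<^sub>M N)"
    by (simp add: split_def)
  have sp: "space N = UNIV" using sets_eq_imp_space_eq[OF N(2)] by simp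
  have "(\<integral>\<^sup>+x. (\<integral>\<^sup>+y. ennreal (K \<rho> (- y \<odot> x)) \<partial>N) \<partial>lborel) = (\<integral>\<^sup>+y. (\<integral>\<^sup>+x. ennreal (K \<rho> (- y \<odot> x)) \<partial>lborel) \<partial>N)"
    by (rule pair.Fubini'[symmetric]) measurable
  also have "\<dots> = (\<integral>\<^sup>+y. ennreal A \<partial>N)"
    using nn_integral_mult_left[of "\<lambda>x. ennreal (K \<rho> x)"] nn_integral_K_1[OF \<rho>] by simp
  also have "\<dots> = ennreal (A * measure N UNIV)"
    using A_pos by (simp add: sp fin.emeasure_eq_measure ennreal_mult)
  finally show ?thesis .
qed

lemma nn_integral_mconv:
  assumes \<rho>: "\<rho> > 0" shows "(\<integral>\<^sup>+x. ennreal (mconv \<rho> x) \<partial>lborel) = ennreal (A * measure N UNIV)"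
proof -
  have "ennreal (mconv \<rho> x) = (\<integral>\<^sup>+y. ennreal (K \<rho> (- y \<odot> x)) \<partial>N)" for x
    unfolding mconv_def by (intro nn_integral_eq_integral[symmetric] integrable_K_left \<rho>) auto
  then show ?thesis using nn_integral_K_pair[OF \<rho>] by simp
qed

lemma integrable_mult_mconv:
  fixes g :: "'v \<times> 'z \<Rightarrow> complex"
  assumes g: "g \<in> borel_measurable borel" "\<And>x. norm (g x) \<le> M" and \<rho>: "\<rho> > 0"
  shows "integrable lborel (\<lambda>x. g x * complex_of_real (mconv \<rho> x))"
proof -
  have i: "integrable lborel (mconv \<rho>)"
    using nn_integral_mconv[OF \<rho>] mconv_nonneg borel_measurable_mconv[OF \<rho>] by (intro integrableI_nonneg) auto
  show ?thesis
    by (rule Bochner_Integration.integrable_bound[OF integrable_mult_right[OF i, of M]])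
       (use g borel_measurable_mconv[OF \<rho>] mconv_nonneg in
         \<open>auto simp: norm_mult intro!: order_trans[OF mult_right_mono[OF g(2)]] mult_right_mono\<close>)
qed

text \<open>By Fubini's theorem and the substitution \<open>x = y \<odot> dil \<rho> w\<close>, the
  kernel moves onto the test function: the integral is that of \<open>J \<rho>\<close> over
  \<open>N\<close>. \<open>J \<rho>\<close> is bounded and converges pointwise to
  \<open>A *\<^sub>R g\<close> because \<open>g\<close> is bounded and continuous.\<close>

lemma mconv_weak_limit:
  fixes g :: "'v \<times> 'z \<Rightarrow> complex"
  assumes g: "continuous_on UNIV g" "\<And>x. norm (g x) \<le> M"
  shows "((\<lambda>\<rho>. LINT x|lborel. g x * complex_of_real (mconv \<rho> x)) \<longlongrightarrow> A *\<^sub>R (LINT x|N. g x)) (at_right 0)"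
proof -
  interpret fin: finite_measure N by (rule N)
  interpret pair: pair_sigma_finite lborel N ..
  have gm [measurable]: "g \<in> borel_measurable borel" by (rule borel_measurable_continuous_onI[OF g(1)])
  have M: "M \<ge> 0" using g(2) by (meson norm_ge_zero order_trans)
  have gN: "f \<in> borel_measurable N" if "f \<in> borel_measurable borel" for f :: "_ \<Rightarrow> complex"
    using that measurable_cong_sets[OF N(2) refl] by blast
  have shift [measurable]: "(\<lambda>w. y \<odot> dil \<rho> w) \<in> borel_measurable borel" for y \<rho>
    by (intro borel_measurable_continuous_onI continuous_intros)
  define J where "J \<rho> y = (LINT w|KM. g (y \<odot> dil \<rho> w))" for \<rho> y
  have eq: "(LINT x|lborel. g x * complex_of_real (mconv \<rho> x)) = (LINT y|N. J \<rho> y)" and Jm: "J \<rho> \<in> borel_measurable N"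
    if \<rho>: "\<rho> > 0" for \<rho>
  proof -
    have c: "continuous_on UNIV (\<lambda>p :: ('v \<times> 'z) \<times> ('v \<times> 'z). K \<rho> (- snd p \<odot> fst p) *\<^sub>R g (fst p))"
      using \<rho> by (intro continuous_intros continuous_on_compose2[OF g(1)]) auto
    note mf = measurable_lborel_nu[OF finite_measure_admissible[OF N] \<rho> c]
    have c2: "continuous_on UNIV (\<lambda>p :: ('v \<times> 'z) \<times> ('v \<times> 'z). K \<rho> (- snd p \<odot> fst p))"
      using \<rho> by (intro continuous_intros) auto
    from measurable_lborel_nu[OF finite_measure_admissible[OF N] \<rho> c2]
    have mK [measurable]: "(\<lambda>p. ennreal (K \<rho> (- snd p \<odot> fst p))) \<in> borel_measurable (lborel \<Otimes>\<^sub>M N)"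
      by simp
    have i: "integrable (lborel \<Otimes>\<^sub>M N) (\<lambda>p. K \<rho> (- snd p \<odot> fst p) *\<^sub>R g (fst p))"
    proof (rule integrableI_bounded[OF mf])
      have "(\<integral>\<^sup>+p. ennreal (norm (K \<rho> (- snd p \<odot> fst p) *\<^sub>R g (fst p))) \<partial>(lborel \<Otimes>\<^sub>M N)) \<le>
          (\<integral>\<^sup>+p. ennreal M * ennreal (K \<rho> (- snd p \<odot> fst p)) \<partial>(lborel \<Otimes>\<^sub>M N))"
      proof (intro nn_integral_mono)
        fix p :: "('v \<times> 'z) \<times> ('v \<times> 'z)"
        have "norm (K \<rho> (- snd p \<odot> fst p) *\<^sub>R g (fst p)) \<le> M * K \<rho> (- snd p \<odot> fst p)"
          using mult_left_mono[OF g(2)[of "fst p"], of "K \<rho> (- snd p \<odot> fst p)"] by (simp add: mult.commute)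
        then have "ennreal (norm (K \<rho> (- snd p \<odot> fst p) *\<^sub>R g (fst p))) \<le> ennreal (M * K \<rho> (- snd p \<odot> fst p))"
          by (rule ennreal_leI)
        also have "\<dots> = ennreal M * ennreal (K \<rho> (- snd p \<odot> fst p))" by (rule ennreal_mult[OF M K_nonneg])
        finally show "ennreal (norm (K \<rho> (- snd p \<odot> fst p) *\<^sub>R g (fst p))) \<le> ennreal M * ennreal (K \<rho> (- snd p \<odot> fst p))" .
      qed
      also have "\<dots> = ennreal M * (\<integral>\<^sup>+p. ennreal (K \<rho> (- snd p \<odot> fst p)) \<partial>(lborel \<Otimes>\<^sub>M N))"
        by (rule nn_integral_cmult[OF mK])
      also have "(\<integral>\<^sup>+p. ennreal (K \<rho> (- snd p \<odot> fst p)) \<partial>(lborel \<Otimes>\<^sub>M N)) = ennreal (A * measure N UNIV)"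
        using fin.nn_integral_fst[OF mK] nn_integral_K_pair[OF \<rho>] by simp
      finally show "(\<integral>\<^sup>+p. ennreal (norm (K \<rho> (- snd p \<odot> fst p) *\<^sub>R g (fst p))) \<partial>(lborel \<Otimes>\<^sub>M N)) < \<infinity>"
        by (rule le_less_trans) (simp add: ennreal_mult_less_top)
    qed
    then have i': "integrable (lborel \<Otimes>\<^sub>M N) (\<lambda>(x, y). K \<rho> (- y \<odot> x) *\<^sub>R g x)" by (simp add: split_def)
    have inner: "(LINT x|lborel. K \<rho> (- y \<odot> x) *\<^sub>R g x) = J \<rho> y" for y
    proof -
      have [measurable]: "(\<lambda>x. - y \<odot> x) \<in> borel_measurable borel" "(\<lambda>x. y \<odot> x) \<in> borel_measurable borel"
        by (intro borel_measurable_continuous_onI continuous_intros)+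
      have "(LINT x|lborel. K \<rho> (- y \<odot> x) *\<^sub>R g x) = (LINT x|lborel. K \<rho> x *\<^sub>R g (y \<odot> x))"
        by (subst integral_mult_left[of _ y, symmetric]) auto
      also have "\<dots> = J \<rho> y" unfolding J_def by (rule integral_K(1)[OF \<rho>]) measurable
      finally show ?thesis .
    qed
    have "(LINT x|lborel. g x * complex_of_real (mconv \<rho> x)) = (LINT x|lborel. LINT y|N. K \<rho> (- y \<odot> x) *\<^sub>R g x)"
    proof (rule Bochner_Integration.integral_cong[OF refl])
      fix x
      show "g x * complex_of_real (mconv \<rho> x) = (LINT y|N. K \<rho> (- y \<odot> x) *\<^sub>R g x)"
        unfolding mconv_def using integral_scaleR_left[OF integrable_K_left[OF \<rho>, of x], of "g x"]
        by (simp add: scaleR_conv_of_real mult.commute)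
    qed
    also have "\<dots> = (LINT y|N. LINT x|lborel. K \<rho> (- y \<odot> x) *\<^sub>R g x)"
      by (rule pair.Fubini_integral[OF i', symmetric])
    finally show "(LINT x|lborel. g x * complex_of_real (mconv \<rho> x)) = (LINT y|N. J \<rho> y)"
      by (simp only: inner)
    have "integrable N (\<lambda>y. LINT x|lborel. K \<rho> (- y \<odot> x) *\<^sub>R g x)"
      by (rule pair.integrable_snd[OF i'])
    then show "J \<rho> \<in> borel_measurable N" by (simp only: inner) (rule borel_measurable_integrable)
  qed
  have AKM: "measure KM (space KM) = A" by (simp add: A_def)
  have seq: "(\<lambda>i. LINT y|N. J (X i) y) \<longlonglongrightarrow> A *\<^sub>R (LINT x|N. g x)" if X: "\<And>i. X i > 0" "X \<longlonglongrightarrow> 0" for X :: "nat \<Rightarrow> real"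
  proof -
    have J0: "(\<lambda>i. J (X i) y) \<longlonglongrightarrow> A *\<^sub>R g y" for y
    proof -
      have "(\<lambda>i. J (X i) y) \<longlonglongrightarrow> (LINT w|KM. g (y \<odot> dil 0 w))"
        unfolding J_def
      proof (rule integral_dominated_convergence[where w="\<lambda>_. M"])
        show "AE w in KM. (\<lambda>i. g (y \<odot> dil (X i) w)) \<longlonglongrightarrow> g (y \<odot> dil 0 w)"
        proof (rule AE_I2)
          fix w
          have "continuous_on UNIV (\<lambda>\<rho>. g (y \<odot> dil \<rho> w))"
            by (intro continuous_intros continuous_on_compose2[OF g(1)]) auto
          then have "isCont (\<lambda>\<rho>. g (y \<odot> dil \<rho> w)) 0"
            using continuous_on_eq_continuous_at[OF open_UNIV] by blast
          then show "(\<lambda>i. g (y \<odot> dil (X i) w)) \<longlonglongrightarrow> g (y \<odot> dil 0 w)"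
            using X(2) by (rule isCont_tendsto_compose)
        qed
      qed (use g(2) in auto)
      then show ?thesis using AKM by simp
    qed
    have Jb: "norm (J \<rho> y) \<le> A * M" for \<rho> y
    proof -
      have "norm (J \<rho> y) \<le> (LINT w|KM. norm (g (y \<odot> dil \<rho> w)))" unfolding J_def by (rule integral_norm_bound)
      also have "\<dots> \<le> (LINT w|KM. M)"
      proof (rule integral_mono)
        show "integrable KM (\<lambda>w. norm (g (y \<odot> dil \<rho> w)))"
          by (intro integrable_norm KM.integrable_const_bound[of _ M]) (use g(2) in auto)
      qed (use g(2) in auto)
      finally show ?thesis using AKM by simp
    qed
    have "(\<lambda>i. LINT y|N. J (X i) y) \<longlonglongrightarrow> (LINT y|N. A *\<^sub>R g y)"
      by (rule integral_dominated_convergence[where w="\<lambda>_. A * M"])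
         (use J0 Jb Jm[OF X(1)] in \<open>auto intro!: gN\<close>)
    then show ?thesis by simp
  qed
  show ?thesis
    unfolding tendsto_at_iff_sequentially
  proof (intro allI impI)
    fix X :: "nat \<Rightarrow> real" assume X: "\<forall>i. X i \<in> {0<..} - {0}" "X \<longlonglongrightarrow> 0"
    then have "(\<lambda>i. LINT y|N. J (X i) y) \<longlonglongrightarrow> A *\<^sub>R (LINT x|N. g x)" by (intro seq) auto
    moreover have "((\<lambda>\<rho>. LINT x|lborel. g x * complex_of_real (mconv \<rho> x)) \<circ> X) = (\<lambda>i. LINT y|N. J (X i) y)"
      using X(1) eq by (auto simp: fun_eq_iff)
    ultimately show "((\<lambda>\<rho>. LINT x|lborel. g x * complex_of_real (mconv \<rho> x)) \<circ> X) \<longlonglongrightarrow> A *\<^sub>R (LINT x|N. g x)" by simp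
  qed
qed

end

text \<open>The link between classical solutions and \<open>jet\<close>:
  \<open>left_inv_field\<close> differentiates along the lines of \<open>XF\<close> and
  \<open>ZF\<close>, and the operator has real coefficients, so the real and imaginary parts
  separate.\<close>

lemma is_solution_jet:
  assumes u: "is_solution bracket s u"
  shows "continuous_on Om u" "sol (\<lambda>p. Re (u p))" "sol (\<lambda>p. Im (u p))"
proof -
  obtain f' f'' where f': "\<And>p. p \<in> Om \<Longrightarrow> (u has_derivative blinfun_apply (f' p)) (at p)"
    and f'': "\<And>p. p \<in> Om \<Longrightarrow> (f' has_derivative blinfun_apply (f'' p)) (at p)" and c'': "continuous_on Om f''"
  proof -
    have Om: "UNIV \<times> {0<..} = (Om :: (('v \<times> 'z) \<times> real) set)" by (auto simp: Om_def)
    show ?thesis using u that unfolding is_solution_def C2_on_def Om by blast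
  qed
  show cu: "continuous_on Om u"
    using f' by (intro continuous_at_imp_continuous_on ballI has_derivative_continuous) auto
  have c': "continuous_on Om f'"
    using f'' by (intro continuous_at_imp_continuous_on ballI has_derivative_continuous) auto
  define D1 where "D1 E p = f' p (E p)" for E p
  define D2 where "D2 E p = f'' p (E p) (E p)" for E p
  have line: "((\<lambda>t. g (p + t *\<^sub>R e)) has_vector_derivative g' e) (at 0)" if "(g has_derivative g') (at p)"
    for g :: "('v \<times> 'z) \<times> real \<Rightarrow> 'c::real_normed_vector" and g' p e
  proof -
    have "((\<lambda>t. p + t *\<^sub>R e) has_derivative (\<lambda>t. t *\<^sub>R e)) (at 0)" by (auto intro!: derivative_eq_intros)
    moreover have "(g has_derivative g') (at (p + 0 *\<^sub>R e))" using that by simp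
    ultimately have "((\<lambda>t. g (p + t *\<^sub>R e)) has_derivative (\<lambda>t. g' (t *\<^sub>R e))) (at 0)"
      by (rule has_derivative_compose)
    then show ?thesis
      using has_derivative_bounded_linear[OF that]
      by (simp add: has_vector_derivative_def linear_cmul[OF bounded_linear.linear])
  qed
  have d1: "((\<lambda>t. u (p + t *\<^sub>R E p)) has_vector_derivative D1 E p) (at 0)" if "p \<in> Om" for p E
    unfolding D1_def by (rule line[OF f'[OF that]])
  \<comment> \<open>The direction is frozen at \<open>e\<close>. Since a field is constant along its
    own lines, this also computes the second derivative along it.\<close>
  have f'e: "((\<lambda>q. blinfun_apply (f' q) e) has_derivative (\<lambda>h. f'' p h e)) (at p)" if "p \<in> Om" for p e
    by (rule bounded_linear.has_derivative[OF blinfun.bounded_linear_left f''[OF that]])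
  have d2: "((\<lambda>t. D1 E (p + t *\<^sub>R E p)) has_vector_derivative D2 E p) (at 0)" if "p \<in> Om" "E \<in> fields" for p E
    using line[OF f'e[OF that(1), of "E p"], of "E p"] fields_const[OF that(2)] by (simp add: D1_def D2_def)
  have jet: "jet (\<lambda>p. L (u p)) (\<lambda>E p. L (D1 E p)) (\<lambda>E p. L (D2 E p))" if L: "bounded_linear L" for L :: "complex \<Rightarrow> real"
    unfolding jet_def ddir_def
  proof (intro conjI ballI)
    have cL: "continuous_on S L" for S using L by (rule linear_continuous_on)
    show "continuous_on Om (\<lambda>p. L (u p))" by (rule continuous_on_compose2[OF cL[of UNIV] cu]) auto
    fix E :: "('v \<times> 'z) \<times> real \<Rightarrow> ('v \<times> 'z) \<times> real" assume E: "E \<in> fields"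
    show "continuous_on Om (\<lambda>p. L (D1 E p))" "continuous_on Om (\<lambda>p. L (D2 E p))"
      unfolding D1_def D2_def
      by (rule continuous_on_compose2[OF cL[of UNIV]]; auto intro!: blinfun.continuous_on c' c'' fields_continuous[OF E])+
    fix p :: "('v \<times> 'z) \<times> real" assume p: "p \<in> Om"
    show "((\<lambda>t. L (u (p + t *\<^sub>R E p))) has_real_derivative L (D1 E p)) (at 0)"
      unfolding has_real_derivative_iff_has_vector_derivative
      by (rule bounded_linear.has_vector_derivative[OF L d1[OF p]])
    show "((\<lambda>t. L (D1 E (p + t *\<^sub>R E p))) has_real_derivative L (D2 E p)) (at 0)"
      unfolding has_real_derivative_iff_has_vector_derivative
      by (rule bounded_linear.has_vector_derivative[OF L d2[OF p E]])
  qed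
  have pde: "(\<Sum>e\<in>Basis. D2 (XF e) p) + D2 RF p + ((1 - 2 * s) / snd p) *\<^sub>R D1 RF p + ((snd p)\<^sup>2 / 4) *\<^sub>R (\<Sum>e\<in>Basis. D2 (ZF e) p) = 0"
    if "p \<in> Om" for p
  proof -
    obtain x \<rho> where p: "p = (x, \<rho>)" by (cases p)
    have \<rho>: "\<rho> > 0" using that by (simp add: p Om_def)
    have Om': "(y, r) \<in> Om" if "r > 0" for y :: "'v \<times> 'z" and r using that by (simp add: Om_def)
    have F: "e \<in> Basis \<Longrightarrow> XF e \<in> fields" "e' \<in> Basis \<Longrightarrow> ZF e' \<in> fields" "RF \<in> fields" for e e'
      by (auto simp: fields_def)
    have mX: "(y \<odot> t *\<^sub>R (e, 0), \<rho>) = (y, \<rho>) + t *\<^sub>R XF e (y, \<rho>)" for y t and e :: 'v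
      by (simp add: mult_eq XF_def br.scaleR_right prod_eq_iff)
    have mZ: "(y \<odot> t *\<^sub>R (0, e), \<rho>) = (y, \<rho>) + t *\<^sub>R ZF e (y, \<rho>)" for y t and e :: 'z
      by (simp add: mult_eq ZF_def br.zero_right prod_eq_iff)
    have X1: "left_inv_field bracket (e, 0) (\<lambda>y. u (y, \<rho>)) y = D1 (XF e) (y, \<rho>)" for e y
      unfolding left_inv_field_def mX by (rule vector_derivative_at[OF d1[OF Om'[OF \<rho>]]])
    have X2: "left_inv_field bracket (e, 0) (left_inv_field bracket (e, 0) (\<lambda>y. u (y, \<rho>))) x = D2 (XF e) p" if "e \<in> Basis" for e
      unfolding X1[abs_def] left_inv_field_def mX p by (rule vector_derivative_at[OF d2[OF Om'[OF \<rho>] F(1)[OF that]]])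
    have Z1: "left_inv_field bracket (0, e) (\<lambda>y. u (y, \<rho>)) y = D1 (ZF e) (y, \<rho>)" for e y
      unfolding left_inv_field_def mZ by (rule vector_derivative_at[OF d1[OF Om'[OF \<rho>]]])
    have Z2: "left_inv_field bracket (0, e) (left_inv_field bracket (0, e) (\<lambda>y. u (y, \<rho>))) x = D2 (ZF e) p" if "e \<in> Basis" for e
      unfolding Z1[abs_def] left_inv_field_def mZ p by (rule vector_derivative_at[OF d2[OF Om'[OF \<rho>] F(2)[OF that]]])
    have vert: "((\<lambda>r. g (x, r)) has_vector_derivative g' (0, 1)) (at r)" if "(g has_derivative g') (at (x, r))"
      for g :: "('v \<times> 'z) \<times> real \<Rightarrow> complex" and g' r
    proof -
      have "((\<lambda>r. (x, r)) has_derivative (\<lambda>t. (0, t))) (at r)" by (auto intro!: derivative_eq_intros)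
      then have "((\<lambda>r. g (x, r)) has_derivative (\<lambda>t. g' (0, t))) (at r)" using that by (rule has_derivative_compose)
      moreover have "(\<lambda>t. g' (0, t)) = (\<lambda>t. t *\<^sub>R g' (0, 1))"
      proof
        show "g' (0, t) = t *\<^sub>R g' (0, 1)" for t
          using linear_cmul[OF bounded_linear.linear[OF has_derivative_bounded_linear[OF that]], of t "(0, 1)"] by simp
      qed
      ultimately show ?thesis unfolding has_vector_derivative_def by (simp only:)
    qed
    have RF: "RF q = (0, 1)" for q by (simp add: RF_def zero_prod_def)
    have R1: "vector_derivative (\<lambda>q. u (x, q)) (at r) = D1 RF (x, r)" if "r > 0" for r
      unfolding D1_def RF by (rule vector_derivative_at[OF vert[OF f'[OF Om'[OF that]]]])
    have "((\<lambda>r. D1 RF (x, r)) has_vector_derivative D2 RF (x, \<rho>)) (at \<rho>)"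
      unfolding D1_def D2_def RF by (rule vert[OF f'e[OF Om'[OF \<rho>]]])
    \<comment> \<open>\<open>R1\<close> is available for positive \<open>r\<close> only, hence the
      transfer within an open set.\<close>
    then have "((\<lambda>r. vector_derivative (\<lambda>q. u (x, q)) (at r)) has_vector_derivative D2 RF (x, \<rho>)) (at \<rho>)"
      by (rule has_vector_derivative_transform_within_open[of _ _ _ "{0<..}"]) (use \<rho> R1 in auto)
    then have R2: "vector_derivative (\<lambda>r. vector_derivative (\<lambda>q. u (x, q)) (at r)) (at \<rho>) = D2 RF p"
      unfolding p by (rule vector_derivative_at)
    have "- sublaplacian bracket (\<lambda>y. u (y, \<rho>)) x
        + vector_derivative (\<lambda>r. vector_derivative (\<lambda>q. u (x, q)) (at r)) (at \<rho>)
        + ((1 - 2 * s) / \<rho>) *\<^sub>R vector_derivative (\<lambda>r. u (x, r)) (at \<rho>)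
        + (1 / 4 * \<rho>\<^sup>2) *\<^sub>R Delta_z bracket (\<lambda>y. u (y, \<rho>)) x = 0"
      using u \<rho> unfolding is_solution_def by blast
    then show ?thesis
      unfolding sublaplacian_def Delta_z_def R2 R1[OF \<rho>] by (simp add: X2 Z2 p)
  qed
  show "sol (\<lambda>p. Re (u p))" unfolding sol_def
  proof (intro exI conjI ballI)
    show "jet (\<lambda>p. Re (u p)) (\<lambda>E p. Re (D1 E p)) (\<lambda>E p. Re (D2 E p))" by (rule jet[OF bounded_linear_Re])
    fix p :: "('v \<times> 'z) \<times> real" assume "p \<in> Om"
    from arg_cong[OF pde[OF this], of Re] show "Lop (\<lambda>E p. Re (D1 E p)) (\<lambda>E p. Re (D2 E p)) p = 0"
      by (simp add: Lop_def)
  qed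
  show "sol (\<lambda>p. Im (u p))" unfolding sol_def
  proof (intro exI conjI ballI)
    show "jet (\<lambda>p. Im (u p)) (\<lambda>E p. Im (D1 E p)) (\<lambda>E p. Im (D2 E p))" by (rule jet[OF bounded_linear_Im])
    fix p :: "('v \<times> 'z) \<times> real" assume "p \<in> Om"
    from arg_cong[OF pde[OF this], of Im] show "Lop (\<lambda>E p. Im (D1 E p)) (\<lambda>E p. Im (D2 E p)) p = 0"
      by (simp add: Lop_def)
  qed
qed


section \<open>Representation of solutions by their boundary values\<close>

lemma K_le_K_one:
  assumes \<rho>: "\<rho> > 0"
  obtains C where "C > 0" "\<And>x. K \<rho> x \<le> C * K 1 x"
proof -
  \<comment> \<open>Chosen such that \<open>1 + t \<le> d * (\<rho>\<^sup>2 + t)\<close> for all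
    \<open>t \<ge> 0\<close>. The comparison with \<open>K 1\<close> makes integrability against
    \<open>KM\<close> sufficient for the Poisson integral at every \<open>\<rho>\<close>.\<close>
  define d where "d = max 1 (1 / \<rho>\<^sup>2)"
  have d: "d \<ge> 1" "1 \<le> d * \<rho>\<^sup>2" using \<rho> by (auto simp: d_def max_def field_simps)
  have "K \<rho> x \<le> (\<rho> powr (2 * s) * (d\<^sup>2) powr kap) * K 1 x" for x
  proof -
    have "1 + (norm (fst x))\<^sup>2 \<le> d * \<rho>\<^sup>2 + d * (norm (fst x))\<^sup>2"
      using d mult_right_mono[OF d(1), of "(norm (fst x))\<^sup>2"] by simp
    then have "(1 + (norm (fst x))\<^sup>2)\<^sup>2 \<le> (d * (\<rho>\<^sup>2 + (norm (fst x))\<^sup>2))\<^sup>2"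
      by (intro power_mono) (auto simp: distrib_left)
    moreover have "1 * (16 * (norm (snd x))\<^sup>2) \<le> d\<^sup>2 * (16 * (norm (snd x))\<^sup>2)"
      using d(1) by (intro mult_right_mono) (auto simp: one_le_power)
    ultimately have "(1 + (norm (fst x))\<^sup>2)\<^sup>2 + 16 * (norm (snd x))\<^sup>2
        \<le> (d * (\<rho>\<^sup>2 + (norm (fst x))\<^sup>2))\<^sup>2 + d\<^sup>2 * (16 * (norm (snd x))\<^sup>2)" by linarith
    then have "G 1 x \<le> d\<^sup>2 * G \<rho> x"
      unfolding G_def power_mult_distrib[of d] distrib_left[of "d\<^sup>2"] by simp
    then have "(d\<^sup>2 * G \<rho> x) powr (- kap) \<le> G 1 x powr (- kap)"
      using G_pos[of 1 x] kap_pos by (intro powr_mono2') auto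
    then have "(d\<^sup>2) powr kap * ((d\<^sup>2) powr (- kap) * G \<rho> x powr (- kap)) \<le> (d\<^sup>2) powr kap * G 1 x powr (- kap)"
      by (intro mult_left_mono) (simp_all add: powr_mult)
    moreover have "(d\<^sup>2) powr kap * ((d\<^sup>2) powr (- kap) * G \<rho> x powr (- kap)) = G \<rho> x powr (- kap)"
      using d(1) by (simp flip: mult.assoc powr_add)
    ultimately have "G \<rho> x powr (- kap) \<le> (d\<^sup>2) powr kap * G 1 x powr (- kap)" by simp
    then show ?thesis
      unfolding K_def by (simp add: mult.assoc mult_left_mono)
  qed
  moreover have "\<rho> powr (2 * s) * (d\<^sup>2) powr kap > 0" using \<rho> d(1) by simp
  ultimately show ?thesis using that by blast
qed

lemma integral_KM:
  fixes g :: "'v \<times> 'z \<Rightarrow> real"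
  assumes "g \<in> borel_measurable borel"
  shows "(LINT x|KM. g x) = (LINT x|lborel. K 1 x * g x)"
    and "integrable KM g \<longleftrightarrow> integrable lborel (\<lambda>x. K 1 x * g x)"
  unfolding KM_def using assms by (simp_all add: integral_density integrable_density)

lemma density_admissible:
  fixes f :: "'v \<times> 'z \<Rightarrow> real"
  assumes f [measurable]: "f \<in> borel_measurable borel" and f0: "\<And>x. 0 \<le> f x" and i: "integrable KM f" and \<rho>: "\<rho> > 0"
  shows "admissible (density lborel (\<lambda>x. ennreal (f x)))" "integrable lborel (\<lambda>y. K \<rho> (- y \<odot> x) * f y)"
    "(LINT y|density lborel (\<lambda>x. ennreal (f x)). K \<rho> (- y \<odot> x)) = (LINT y|lborel. K \<rho> (- y \<odot> x) * f y)"
proof -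
  have int: "integrable lborel (\<lambda>y. f y * K \<rho> y)" if \<rho>: "\<rho> > 0" for \<rho>
  proof -
    obtain C where C: "C > 0" "\<And>x. K \<rho> x \<le> C * K 1 x" using K_le_K_one[OF \<rho>] by blast
    have "integrable lborel (\<lambda>x. C * (K 1 x * f x))"
      using i integral_KM(2)[OF f] by simp
    then show ?thesis
    proof (rule Bochner_Integration.integrable_bound)
      show "AE y in lborel. norm (f y * K \<rho> y) \<le> norm (C * (K 1 y * f y))"
      proof (rule AE_I2)
        fix y
        have "f y * K \<rho> y \<le> f y * (C * K 1 y)" by (intro mult_left_mono C f0)
        then show "norm (f y * K \<rho> y) \<le> norm (C * (K 1 y * f y))"
          using f0[of y] C(1) by (simp add: mult_ac)
      qed
    qed measurable
  qed
  show adm: "admissible (density lborel (\<lambda>x. ennreal (f x)))"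
    unfolding admissible_def
  proof (intro conjI allI impI)
    show "sigma_finite_measure (density lborel (\<lambda>x. ennreal (f x)))"
      by (subst sigma_finite_measure.sigma_finite_iff_density_finite[OF sigma_finite_lborel]) auto
    show "integrable (density lborel (\<lambda>x. ennreal (f x))) (K \<rho>)" if "\<rho> > 0" for \<rho>
      using int[OF that] f0 by (subst integrable_density) auto
  qed simp
  have [measurable]: "(\<lambda>y. - y \<odot> x) \<in> borel_measurable borel"
    by (intro borel_measurable_continuous_onI continuous_intros)
  have "integrable (density lborel (\<lambda>x. ennreal (f x))) (\<lambda>y. K \<rho> (- x \<odot> y))"
    by (rule integrable_K_translate[OF adm \<rho>])
  moreover have "K \<rho> (- x \<odot> y) = K \<rho> (- y \<odot> x)" for y
    using K_minus[of \<rho> "- y \<odot> x"] by (simp add: minus_mult)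
  ultimately have "integrable (density lborel (\<lambda>x. ennreal (f x))) (\<lambda>y. K \<rho> (- y \<odot> x))" by simp
  then show "integrable lborel (\<lambda>y. K \<rho> (- y \<odot> x) * f y)"
    using f0 by (subst (asm) integrable_density) (auto simp: mult.commute)
  show "(LINT y|density lborel (\<lambda>x. ennreal (f x)). K \<rho> (- y \<odot> x)) = (LINT y|lborel. K \<rho> (- y \<odot> x) * f y)"
    using f0 by (subst integral_density) (auto simp: mult.commute)
qed

text \<open>The Boolean index turns the positive and the negative part of a slice into one family,
  so that both converge weakly along the same filter.\<close>

definition sgn_part :: "(('v \<times> 'z) \<times> real \<Rightarrow> real) \<Rightarrow> real \<Rightarrow> bool \<Rightarrow> 'v \<times> 'z \<Rightarrow> real" where
  "sgn_part w \<rho> i x = max 0 (if i then w (x, \<rho>) else - w (x, \<rho>))"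

lemma sgn_part: "0 \<le> sgn_part w \<rho> i x" "sgn_part w \<rho> i x \<le> \<bar>w (x, \<rho>)\<bar>"
  "sgn_part w \<rho> True x - sgn_part w \<rho> False x = w (x, \<rho>)"
  by (auto simp: sgn_part_def)

lemma continuous_on_sgn_part:
  assumes "sol w" "\<rho> > 0" shows "continuous_on UNIV (sgn_part w \<rho> i)"
proof -
  have "continuous_on UNIV (\<lambda>x. w (x, \<rho>))" by (intro sol_continuous_slice assms continuous_intros)
  then show ?thesis unfolding sgn_part_def[abs_def] by (cases i) (auto intro!: continuous_intros)
qed

text \<open>Weak convergence in \<open>KM\<close> tested with \<open>h / K 1\<close>, which is in
  \<open>Cc\<close> along with \<open>h\<close>, is convergence of Lebesgue integrals against
  \<open>h\<close>; \<open>uniqueness\<close> then applies to the measures with densities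
  \<open>f True\<close> and \<open>f False\<close>. The limit for bounded measurable
  \<open>h\<close> is kept in the conclusion for bounding \<open>f\<close> later.\<close>

lemma weak_representation:
  assumes w: "sol w" "loc_bounded C w"
    and ui: "\<And>\<epsilon>. \<epsilon> > 0 \<Longrightarrow> \<exists>T\<ge>0. \<forall>\<rho>>0. \<forall>i. \<forall>S\<in>sets KM. (\<integral>\<^sup>+x. ennreal (sgn_part w \<rho> i x) * indicator S x \<partial>KM) \<le> ennreal \<epsilon> + ennreal T * emeasure KM S"
  obtains F f where "F \<noteq> bot" "F \<le> at_right 0" "\<And>i. f i \<in> borel_measurable borel" "\<And>i x. f i x \<ge> 0" "\<And>i. integrable KM (f i)"
    "\<And>i h B. h \<in> borel_measurable borel \<Longrightarrow> (\<And>x. \<bar>h x\<bar> \<le> B) \<Longrightarrow> ((\<lambda>\<rho>. LINT x|KM. h x * sgn_part w \<rho> i x) \<longlongrightarrow> (LINT x|KM. h x * f i x)) F"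
    "\<And>\<rho> x. \<rho> > 0 \<Longrightarrow> A * w (x, \<rho>) = (LINT y|lborel. K \<rho> (- y \<odot> x) * (f True y - f False y))"
proof -
  have gm: "sgn_part w \<rho> i \<in> borel_measurable borel" if "\<rho> > 0" for \<rho> i
    by (rule borel_measurable_continuous_onI[OF continuous_on_sgn_part[OF w(1) that]])
  have mKM: "f \<in> borel_measurable KM \<longleftrightarrow> f \<in> borel_measurable borel" for f :: "'v \<times> 'z \<Rightarrow> real"
    using measurable_cong_sets[OF sets_KM refl] by blast
  obtain F f where F: "F \<noteq> bot" "F \<le> at_right 0" and f: "\<And>i. f i \<in> borel_measurable KM" "\<And>i x. f i x \<ge> 0" "\<And>i. integrable KM (f i)"
    and lim: "\<And>i h B. h \<in> borel_measurable KM \<Longrightarrow> (\<And>x. \<bar>h x\<bar> \<le> B) \<Longrightarrow> ((\<lambda>\<rho>. LINT x|KM. h x * sgn_part w \<rho> i x) \<longlongrightarrow> (LINT x|KM. h x * f i x)) F"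
  proof (rule KM.uniformly_integrable_weak_limit[of "sgn_part w", OF _ sgn_part(1) ui])
    show "sgn_part w \<rho> i \<in> borel_measurable KM" if "\<rho> > 0" for \<rho> i using gm[OF that] mKM by blast
  qed auto
  have fb [measurable]: "f i \<in> borel_measurable borel" for i using f(1) mKM by blast
  have Pos: "eventually (\<lambda>\<rho>. 0 < \<rho>) F"
    using F(2) eventually_at_right_less[of "0::real"] by (auto simp: le_filter_def)
  have rep: "A * w (x, \<rho>) = (LINT y|lborel. K \<rho> (- y \<odot> x) * (f True y - f False y))" if \<rho>: "\<rho> > 0" for \<rho> x
  proof -
    have "A * w (x, \<rho>) = (LINT y|density lborel (\<lambda>x. ennreal (f True x)). K \<rho> (- y \<odot> x)) - (LINT y|density lborel (\<lambda>x. ennreal (f False x)). K \<rho> (- y \<odot> x))"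
    proof (rule uniqueness[OF w F _ _ _ \<rho>])
      show "admissible (density lborel (\<lambda>x. ennreal (f True x)))" "admissible (density lborel (\<lambda>x. ennreal (f False x)))"
        by (rule density_admissible(1)[OF fb f(2,3) \<rho>])+
      fix h :: "'v \<times> 'z \<Rightarrow> real" assume h: "h \<in> Cc"
      have hc: "continuous_on UNIV h" by (rule Cc_continuous[OF h])
      have [measurable]: "h \<in> borel_measurable borel" by (rule borel_measurable_continuous_onI[OF hc])
      have K1: "K 1 x \<noteq> 0" for x using K_pos[of 1 x] by simp
      have hK: "(\<lambda>x. h x / K 1 x) \<in> Cc"
        using h K1 by (auto simp: Cc_def intro!: continuous_intros)
      obtain B where B: "\<And>x. \<bar>h x / K 1 x\<bar> \<le> B" using Cc_bounded[OF hK] by blast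
      have tr: "(LINT x|KM. h x / K 1 x * g x) = (LINT x|lborel. h x * g x)" if "g \<in> borel_measurable borel" for g
        using that K1 by (subst integral_KM(1)) (auto simp: mult.assoc)
      have "((\<lambda>\<rho>. LINT x|KM. h x / K 1 x * sgn_part w \<rho> i x) \<longlongrightarrow> (LINT x|KM. h x / K 1 x * f i x)) F" for i
        by (rule lim[OF _ B]) (simp add: mKM)
      then have l: "((\<lambda>\<rho>. LINT x|KM. h x / K 1 x * sgn_part w \<rho> i x) \<longlongrightarrow> (LINT x|lborel. h x * f i x)) F" for i
        by (simp only: tr[OF fb])
      have "((\<lambda>\<rho>. (LINT x|KM. h x / K 1 x * sgn_part w \<rho> True x) - (LINT x|KM. h x / K 1 x * sgn_part w \<rho> False x)) \<longlongrightarrow>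
         (LINT x|lborel. h x * f True x) - (LINT x|lborel. h x * f False x)) F"
        by (intro tendsto_diff l)
      moreover have "\<forall>\<^sub>F \<rho> in F. (LINT x|KM. h x / K 1 x * sgn_part w \<rho> True x) - (LINT x|KM. h x / K 1 x * sgn_part w \<rho> False x) = (LINT x|lborel. h x * w (x, \<rho>))"
        using Pos
      proof eventually_elim
        case (elim \<rho>)
        have "(LINT x|lborel. h x * sgn_part w \<rho> True x) - (LINT x|lborel. h x * sgn_part w \<rho> False x) =
          (LINT x|lborel. h x * sgn_part w \<rho> True x - h x * sgn_part w \<rho> False x)"
          by (intro Bochner_Integration.integral_diff[symmetric] Cc_integrable[OF h] continuous_on_sgn_part w elim)
        also have "\<dots> = (LINT x|lborel. h x * w (x, \<rho>))"
          by (simp only: right_diff_distrib[symmetric] sgn_part(3))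
        finally show ?case by (simp only: tr[OF gm[OF elim]])
      qed
      moreover have "(LINT x|density lborel (\<lambda>x. ennreal (f i x)). h x) = (LINT x|lborel. h x * f i x)" for i
        using f(2) by (subst integral_density) (auto simp: mult.commute)
      ultimately show "((\<lambda>\<rho>. LINT x|lborel. h x * w (x, \<rho>)) \<longlongrightarrow>
         (LINT x|density lborel (\<lambda>x. ennreal (f True x)). h x) - (LINT x|density lborel (\<lambda>x. ennreal (f False x)). h x)) F"
        by (simp add: Lim_transform_eventually)
    qed
    also have "\<dots> = (LINT y|lborel. K \<rho> (- y \<odot> x) * f True y) - (LINT y|lborel. K \<rho> (- y \<odot> x) * f False y)"
      by (simp only: density_admissible(3)[OF fb f(2,3) \<rho>])
    also have "\<dots> = (LINT y|lborel. K \<rho> (- y \<odot> x) * f True y - K \<rho> (- y \<odot> x) * f False y)"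
      by (intro Bochner_Integration.integral_diff[symmetric] density_admissible(2)[OF fb f(2,3) \<rho>])
    finally show ?thesis by (simp only: right_diff_distrib[symmetric])
  qed
  show ?thesis
    by (rule that[OF F fb f(2,3) lim rep]) (auto simp: mKM)
qed

text \<open>In \<open>t \<le> 1 + t powr q\<close>, the \<open>1\<close> is accounted for by the
  measure of \<open>S\<close>.\<close>

lemma loc_bounded_if_Lp:
  assumes w: "sol w" and q: "1 \<le> q" and bd: "\<And>\<rho>. \<rho> > 0 \<Longrightarrow> (\<integral>\<^sup>+x. ennreal (\<bar>w (x, \<rho>)\<bar> powr q) \<partial>lborel) \<le> ennreal C"
  shows "loc_bounded (max 1 C) w"
  unfolding loc_bounded_def
proof (intro conjI allI ballI impI)
  fix \<rho> :: real and S :: "('v \<times> 'z) set" assume \<rho>: "0 < \<rho>" and S: "S \<in> sets borel"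
  have [measurable]: "(\<lambda>x. w (x, \<rho>)) \<in> borel_measurable borel"
    by (intro borel_measurable_continuous_onI sol_continuous_slice w \<rho> continuous_intros)
  have "(\<integral>\<^sup>+x. ennreal \<bar>w (x, \<rho>)\<bar> * indicator S x \<partial>lborel) \<le> (\<integral>\<^sup>+x. indicator S x + ennreal (\<bar>w (x, \<rho>)\<bar> powr q) \<partial>lborel)"
  proof (intro nn_integral_mono)
    fix x
    have "ennreal \<bar>w (x, \<rho>)\<bar> \<le> ennreal (1 + \<bar>w (x, \<rho>)\<bar> powr q)"
      using q by (intro ennreal_leI le_one_plus_powr) auto
    then show "ennreal \<bar>w (x, \<rho>)\<bar> * indicator S x \<le> indicator S x + ennreal (\<bar>w (x, \<rho>)\<bar> powr q)"
      by (auto simp: indicator_def)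
  qed
  also have "\<dots> = emeasure lborel S + (\<integral>\<^sup>+x. ennreal (\<bar>w (x, \<rho>)\<bar> powr q) \<partial>lborel)"
    using S by (subst nn_integral_add) auto
  also have "\<dots> \<le> ennreal (max 1 C) * emeasure lborel S + ennreal (max 1 C)"
  proof (rule add_mono)
    have "1 * emeasure lborel S \<le> ennreal (max 1 C) * emeasure lborel S"
      by (intro mult_right_mono) auto
    then show "emeasure lborel S \<le> ennreal (max 1 C) * emeasure lborel S" by simp
    show "(\<integral>\<^sup>+x. ennreal (\<bar>w (x, \<rho>)\<bar> powr q) \<partial>lborel) \<le> ennreal (max 1 C)"
      by (rule order_trans[OF bd[OF \<rho>]]) (auto intro: ennreal_leI)
  qed
  finally show "(\<integral>\<^sup>+x. ennreal \<bar>w (x, \<rho>)\<bar> * indicator S x \<partial>lborel) \<le> ennreal (max 1 C) * (1 + emeasure lborel S)"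
    by (simp add: distrib_left add.commute)
qed simp

lemma K_one_le: "K 1 x \<le> 1"
  using K_le[of 1 x] by simp

text \<open>\<open>g \<le> T + T powr (1 - q) * g powr q\<close> gives uniform integrability because
  \<open>q > 1\<close>. The weak limit is at first only integrable against \<open>KM\<close>. That
  its \<open>q\<close>-th power is integrable is lower semicontinuity of the norm, obtained by
  testing with the tangent of \<open>t powr q\<close> at truncations of the limit and applying
  Fatou's lemma.\<close>

lemma Lp_representation:
  assumes w: "sol w" and q: "1 < q" and bd: "\<And>\<rho>. \<rho> > 0 \<Longrightarrow> (\<integral>\<^sup>+x. ennreal (\<bar>w (x, \<rho>)\<bar> powr q) \<partial>lborel) \<le> ennreal C"
  obtains f where "f \<in> borel_measurable borel" "(\<integral>\<^sup>+x. ennreal (\<bar>f x\<bar> powr q) \<partial>lborel) < \<infinity>"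
    "\<And>\<rho> x. \<rho> > 0 \<Longrightarrow> A * w (x, \<rho>) = (LINT y|lborel. K \<rho> (- y \<odot> x) * f y)"
proof -
  define C' where "C' = max 0 C"
  have bd': "(\<integral>\<^sup>+x. ennreal (sgn_part w \<rho> i x powr q) \<partial>lborel) \<le> ennreal C'" if "\<rho> > 0" for \<rho> i
  proof -
    have "(\<integral>\<^sup>+x. ennreal (sgn_part w \<rho> i x powr q) \<partial>lborel) \<le> (\<integral>\<^sup>+x. ennreal (\<bar>w (x, \<rho>)\<bar> powr q) \<partial>lborel)"
      using q sgn_part by (intro nn_integral_mono ennreal_leI powr_mono2) auto
    also have "\<dots> \<le> ennreal C'" unfolding C'_def by (rule order_trans[OF bd[OF that]]) (auto intro: ennreal_leI)
    finally show ?thesis .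
  qed
  have lb: "loc_bounded (max 1 C) w"
    by (rule loc_bounded_if_Lp[OF w less_imp_le[OF q] bd])
  have C': "C' \<ge> 0" by (simp add: C'_def)
  have gm: "sgn_part w \<rho> i \<in> borel_measurable borel" if "\<rho> > 0" for \<rho> i
    by (rule borel_measurable_continuous_onI[OF continuous_on_sgn_part[OF w that]])
  have ui: "\<exists>T\<ge>0. \<forall>\<rho>>0. \<forall>i. \<forall>S\<in>sets KM. (\<integral>\<^sup>+x. ennreal (sgn_part w \<rho> i x) * indicator S x \<partial>KM) \<le> ennreal \<epsilon> + ennreal T * emeasure KM S"
    if \<epsilon>: "\<epsilon> > 0" for \<epsilon>
  proof -
    have "((\<lambda>T. T powr (1 - q)) \<longlongrightarrow> 0) at_top"
      using q by (intro tendsto_neg_powr filterlim_ident) auto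
    moreover have "0 < \<epsilon> / (C' + 1)" using \<epsilon> C' by simp
    ultimately have "eventually (\<lambda>T. T powr (1 - q) < \<epsilon> / (C' + 1)) at_top" by (rule order_tendstoD(2))
    then have "eventually (\<lambda>T. T powr (1 - q) < \<epsilon> / (C' + 1) \<and> T \<ge> 1) at_top"
      using eventually_ge_at_top[of 1] by eventually_elim auto
    then obtain T where T: "T powr (1 - q) < \<epsilon> / (C' + 1)" "T \<ge> 1"
      using eventually_happens'[OF trivial_limit_at_top_linorder] by blast
    have Te: "T powr (1 - q) * C' \<le> \<epsilon>"
    proof -
      have "T powr (1 - q) * C' \<le> \<epsilon> / (C' + 1) * C'" using T C' by (intro mult_right_mono) auto
      also have "\<dots> \<le> \<epsilon>" using \<epsilon> C' by (simp add: field_simps)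
      finally show ?thesis .
    qed
    have "(\<integral>\<^sup>+x. ennreal (sgn_part w \<rho> i x) * indicator S x \<partial>KM) \<le> ennreal \<epsilon> + ennreal T * emeasure KM S"
      if \<rho>: "\<rho> > 0" and S: "S \<in> sets KM" for \<rho> i S
    proof -
      note [measurable] = gm[OF \<rho>, of i]
      have pt: "g \<le> T + T powr (1 - q) * g powr q" if "g \<ge> 0" for g
      proof (cases "g \<le> T")
        case True
        then show ?thesis by (simp add: add_increasing2)
      next
        case False
        then have "g = g powr (1 - q) * g powr q" using T by (simp flip: powr_add)
        also have "\<dots> \<le> T powr (1 - q) * g powr q" using False T q by (intro mult_right_mono powr_mono2') auto
        finally show ?thesis using T by simp
      qed
      have "(\<integral>\<^sup>+x. ennreal (sgn_part w \<rho> i x) * indicator S x \<partial>KM) \<le>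
         (\<integral>\<^sup>+x. ennreal T * indicator S x + ennreal (T powr (1 - q)) * ennreal (sgn_part w \<rho> i x powr q) \<partial>KM)"
      proof (intro nn_integral_mono)
        fix x
        have "ennreal (sgn_part w \<rho> i x) \<le> ennreal (T + T powr (1 - q) * sgn_part w \<rho> i x powr q)"
          by (intro ennreal_leI pt sgn_part)
        also have "\<dots> = ennreal T + ennreal (T powr (1 - q)) * ennreal (sgn_part w \<rho> i x powr q)"
          using T by (simp add: ennreal_mult)
        finally show "ennreal (sgn_part w \<rho> i x) * indicator S x \<le> ennreal T * indicator S x + ennreal (T powr (1 - q)) * ennreal (sgn_part w \<rho> i x powr q)"
          by (auto simp: indicator_def)
      qed
      also have "\<dots> = ennreal T * emeasure KM S + ennreal (T powr (1 - q)) * (\<integral>\<^sup>+x. ennreal (sgn_part w \<rho> i x powr q) \<partial>KM)"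
        using S by (subst nn_integral_add) (auto simp: nn_integral_cmult_indicator nn_integral_cmult)
      also have "\<dots> \<le> ennreal T * emeasure KM S + ennreal (T powr (1 - q)) * ennreal C'"
      proof (intro add_left_mono mult_left_mono)
        have "(\<integral>\<^sup>+x. ennreal (sgn_part w \<rho> i x powr q) \<partial>KM) = (\<integral>\<^sup>+x. ennreal (K 1 x) * ennreal (sgn_part w \<rho> i x powr q) \<partial>lborel)"
          unfolding KM_def by (subst nn_integral_density) auto
        also have "\<dots> \<le> (\<integral>\<^sup>+x. 1 * ennreal (sgn_part w \<rho> i x powr q) \<partial>lborel)"
          using K_one_le by (intro nn_integral_mono mult_right_mono) auto
        also have "\<dots> \<le> ennreal C'" using bd'[OF \<rho>, of i] by simp
        finally show "(\<integral>\<^sup>+x. ennreal (sgn_part w \<rho> i x powr q) \<partial>KM) \<le> ennreal C'" .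
      qed simp
      also have "ennreal (T powr (1 - q)) * ennreal C' \<le> ennreal \<epsilon>"
        using Te C' by (simp flip: ennreal_mult add: ennreal_leI)
      finally show ?thesis by (simp add: add.commute)
    qed
    then show ?thesis using T(2) by (intro exI[of _ T]) auto
  qed
  obtain F f where F: "F \<noteq> bot" "F \<le> at_right (0::real)" and f [measurable]: "\<And>i. f i \<in> borel_measurable borel" and f0: "\<And>i x. f i x \<ge> 0"
    and fi: "\<And>i. integrable KM (f i)"
    and lim: "\<And>i h B. h \<in> borel_measurable borel \<Longrightarrow> (\<And>x. \<bar>h x\<bar> \<le> B) \<Longrightarrow> ((\<lambda>\<rho>. LINT x|KM. h x * sgn_part w \<rho> i x) \<longlongrightarrow> (LINT x|KM. h x * f i x)) F"
    and rep: "\<And>\<rho> x. \<rho> > 0 \<Longrightarrow> A * w (x, \<rho>) = (LINT y|lborel. K \<rho> (- y \<odot> x) * (f True y - f False y))"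
  proof (rule weak_representation[OF w lb], goal_cases)
    case (1 \<epsilon>)
    then show ?case by (intro ui)
  next
    case (2 F f)
    show ?case by (rule 2(1)[OF 2(2-8)])
  qed
  have Pos: "eventually (\<lambda>\<rho>. 0 < \<rho>) F"
    using F(2) eventually_at_right_less[of "0::real"] by (auto simp: le_filter_def)
  have fq: "(\<integral>\<^sup>+x. ennreal (f i x powr q) \<partial>lborel) \<le> ennreal C'" for i
  proof -
    \<comment> \<open>Truncation in height and support makes the test function \<open>h\<close>
      below bounded and \<open>I n\<close> finite.\<close>
    define a where "a n x = min (f i x) (real n) * indicator (cball 0 (real n)) x" for n x
    have a0: "0 \<le> a n x" and af: "a n x \<le> f i x" and an: "a n x \<le> real n" and aB: "norm x > real n \<Longrightarrow> a n x = 0" for n x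
      using f0[of i x] by (auto simp: a_def indicator_def)
    have [measurable]: "cball (0 :: 'v \<times> 'z) r \<in> sets borel" for r by simp
    have am [measurable]: "a n \<in> borel_measurable borel" for n unfolding a_def by measurable
    have ai: "integrable lborel (\<lambda>x. a n x powr q)" for n
    proof (rule Bochner_Integration.integrable_bound)
      have "emeasure lborel (cball (0::'v \<times> 'z) (real n)) < \<infinity>" by (rule emeasure_bounded_finite) simp
      then show "integrable lborel (\<lambda>x. real n powr q * indicator (cball (0::'v \<times> 'z) (real n)) x)"
        by (intro integrable_mult_right integrable_real_indicator) auto
      show "AE x in lborel. norm (a n x powr q) \<le> norm (real n powr q * indicator (cball 0 (real n)) x)"
      proof (rule AE_I2)
        fix x
        show "norm (a n x powr q) \<le> norm (real n powr q * indicator (cball 0 (real n)) x)"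
          using aB[of n x] an[of n x] a0[of n x] q by (cases "norm x \<le> real n") (auto intro!: powr_mono2)
      qed
    qed measurable
    define I where "I n = (LINT x|lborel. a n x powr q)" for n
    have "I n \<le> C'" for n
    proof -
      \<comment> \<open>The derivative of \<open>t powr q\<close> at \<open>a n x\<close>, divided
        by the weight so that integrals over \<open>KM\<close> become Lebesgue integrals.\<close>
      define h where "h x = q * a n x powr (q - 1) / K 1 x" for x
      have hm [measurable]: "h \<in> borel_measurable borel" unfolding h_def by measurable
      have K1: "K 1 x \<noteq> 0" for x using K_pos[of 1 x] by simp
      have "continuous_on (cball 0 (real n)) (\<lambda>x. 1 / K 1 x)" by (intro continuous_intros) (auto simp: K1)
      then have "bounded ((\<lambda>x. 1 / K 1 x) ` cball 0 (real n))"
        by (intro compact_imp_bounded compact_continuous_image compact_cball)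
      then obtain b where "\<forall>x\<in>cball 0 (real n). \<bar>1 / K 1 x\<bar> \<le> b" unfolding bounded_iff by auto
      then have b: "norm x \<le> real n \<Longrightarrow> 1 / K 1 x \<le> b" for x using K_pos[of 1 x] by auto
      have hb: "\<bar>h x\<bar> \<le> q * real n powr (q - 1) * b" for x
      proof (cases "norm x \<le> real n")
        case True
        have "\<bar>h x\<bar> = q * a n x powr (q - 1) * (1 / K 1 x)" using q K_pos[of 1 x] by (simp add: h_def abs_mult)
        also have "\<dots> \<le> q * real n powr (q - 1) * b"
          using q b[OF True] an[of n x] a0[of n x] K_pos[of 1 x] by (intro mult_mono mult_left_mono powr_mono2) auto
        finally show ?thesis .
      next
        case False
        have "0 \<le> 1 / K 1 0" by simp
        also have "\<dots> \<le> b" by (rule b) simp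
        finally have "b \<ge> 0" .
        then show ?thesis using False aB[of n x] q by (simp add: h_def)
      qed
      have tr: "(LINT x|KM. h x * g x) = (LINT x|lborel. q * a n x powr (q - 1) * g x)"
        "integrable KM (\<lambda>x. h x * g x) \<longleftrightarrow> integrable lborel (\<lambda>x. q * a n x powr (q - 1) * g x)" if "g \<in> borel_measurable borel" for g
      proof -
        have e: "K 1 x * (h x * g x) = q * a n x powr (q - 1) * g x" for x using K1 by (simp add: h_def)
        show "(LINT x|KM. h x * g x) = (LINT x|lborel. q * a n x powr (q - 1) * g x)"
          "integrable KM (\<lambda>x. h x * g x) \<longleftrightarrow> integrable lborel (\<lambda>x. q * a n x powr (q - 1) * g x)"
          using that integral_KM[of "\<lambda>x. h x * g x"] by (simp_all add: e)
      qed
      have "(LINT x|KM. h x * f i x) \<le> C' + (q - 1) * I n"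
      proof (rule tendsto_upperbound[OF lim[OF hm hb] _ F(1)])
        show "\<forall>\<^sub>F \<rho> in F. (LINT x|KM. h x * sgn_part w \<rho> i x) \<le> C' + (q - 1) * I n"
          using Pos
        proof eventually_elim
          case (elim \<rho>)
          note [measurable] = gm[OF elim, of i]
          have gi: "integrable lborel (\<lambda>x. sgn_part w \<rho> i x powr q)"
            using bd'[OF elim, of i] by (intro integrableI_nonneg) (auto intro: le_less_trans)
          have "(LINT x|KM. h x * sgn_part w \<rho> i x) = (LINT x|lborel. q * a n x powr (q - 1) * sgn_part w \<rho> i x)"
            by (rule tr(1)) measurable
          also have "\<dots> \<le> (LINT x|lborel. sgn_part w \<rho> i x powr q + (q - 1) * a n x powr q)"
          proof (rule integral_mono')
            show "integrable lborel (\<lambda>x. sgn_part w \<rho> i x powr q + (q - 1) * a n x powr q)"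
              using gi ai by simp
            fix x
            show "q * a n x powr (q - 1) * sgn_part w \<rho> i x \<le> sgn_part w \<rho> i x powr q + (q - 1) * a n x powr q"
              using powr_tangent[OF a0 sgn_part(1), of q n x w \<rho> i x] q by simp
            show "0 \<le> sgn_part w \<rho> i x powr q + (q - 1) * a n x powr q" using q by simp
          qed
          also have "\<dots> = (LINT x|lborel. sgn_part w \<rho> i x powr q) + (q - 1) * I n"
            using gi ai by (simp add: I_def)
          also have "(LINT x|lborel. sgn_part w \<rho> i x powr q) \<le> C'"
          proof -
            have "ennreal (LINT x|lborel. sgn_part w \<rho> i x powr q) \<le> ennreal C'"
              using bd'[OF elim, of i] nn_integral_eq_integral[OF gi] by simp
            then show ?thesis using C' by (simp add: ennreal_le_iff)
          qed
          finally show ?case by simp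
        qed
      qed
      moreover have "q * I n \<le> (LINT x|KM. h x * f i x)"
      proof -
        have "integrable KM (\<lambda>x. h x * f i x)"
        proof (rule Bochner_Integration.integrable_bound[OF integrable_mult_right[OF fi[of i], of "q * real n powr (q - 1) * b"]])
          show "AE x in KM. norm (h x * f i x) \<le> norm (q * real n powr (q - 1) * b * f i x)"
          proof (rule AE_I2)
            fix x
            have "\<bar>h x\<bar> * f i x \<le> q * real n powr (q - 1) * b * f i x" by (intro mult_right_mono hb f0)
            then show "norm (h x * f i x) \<le> norm (q * real n powr (q - 1) * b * f i x)"
              unfolding real_norm_def abs_mult[of "h x"] abs_of_nonneg[OF f0] by (rule order_trans[OF _ abs_ge_self])
          qed
        qed measurable
        then have i2: "integrable lborel (\<lambda>x. q * a n x powr (q - 1) * f i x)" using tr(2)[OF f] by simp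
        have "q * I n = (LINT x|lborel. q * a n x powr q)" by (simp add: I_def)
        also have "\<dots> \<le> (LINT x|lborel. q * a n x powr (q - 1) * f i x)"
        proof (rule integral_mono[OF integrable_mult_right[OF ai] i2])
          fix x
          have "a n x powr q = a n x powr (q - 1) * a n x"
            using a0[of n x] powr_add[of "a n x" "q - 1" 1] by (cases "a n x = 0") auto
          also have "\<dots> \<le> a n x powr (q - 1) * f i x" by (intro mult_left_mono af) auto
          finally show "q * a n x powr q \<le> q * a n x powr (q - 1) * f i x" using q by (simp add: mult.assoc)
        qed
        also have "\<dots> = (LINT x|KM. h x * f i x)" by (rule tr(1)[OF f, symmetric])
        finally show ?thesis .
      qed
      \<comment> \<open>Finiteness of \<open>I n\<close> allows \<open>(q - 1) * I n\<close> to be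
        subtracted, which leaves \<open>I n \<le> C'\<close>.\<close>
      ultimately have "q * I n \<le> C' + (q - 1) * I n" by linarith
      then show ?thesis by (simp add: algebra_simps)
    qed
    then have In: "(\<integral>\<^sup>+x. ennreal (a n x powr q) \<partial>lborel) \<le> ennreal C'" for n
      using nn_integral_eq_integral[OF ai[of n]] by (simp add: I_def ennreal_leI)
    have "(\<integral>\<^sup>+x. ennreal (f i x powr q) \<partial>lborel) = (\<integral>\<^sup>+x. liminf (\<lambda>n. ennreal (a n x powr q)) \<partial>lborel)"
    proof (intro nn_integral_cong)
      fix x
      obtain N :: nat where N: "max (f i x) (norm x) \<le> real N" using real_arch_simple by blast
      have "a n x = f i x" if "n \<ge> N" for n
      proof -
        have "real N \<le> real n" using that by simp
        then have "f i x \<le> real n" "norm x \<le> real n" using N by linarith+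
        then show ?thesis by (simp add: a_def)
      qed
      then have "(\<lambda>n. ennreal (a n x powr q)) \<longlonglongrightarrow> ennreal (f i x powr q)"
        by (intro tendsto_eventually eventually_sequentiallyI[of N]) simp
      then show "ennreal (f i x powr q) = liminf (\<lambda>n. ennreal (a n x powr q))"
        by (rule lim_imp_Liminf[OF sequentially_bot, symmetric])
    qed
    also have "\<dots> \<le> liminf (\<lambda>n. \<integral>\<^sup>+x. ennreal (a n x powr q) \<partial>lborel)"
      by (intro nn_integral_liminf) measurable
    also have "\<dots> \<le> liminf (\<lambda>n. ennreal C')"
      by (intro Liminf_mono always_eventually allI In)
    also have "\<dots> = ennreal C'" by (simp add: Liminf_const)
    finally show ?thesis .
  qed
  show ?thesis
  proof (rule that[OF _ _ rep])
    show "(\<lambda>y. f True y - f False y) \<in> borel_measurable borel" by measurable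
    have "(\<integral>\<^sup>+x. ennreal (\<bar>f True x - f False x\<bar> powr q) \<partial>lborel) \<le> (\<integral>\<^sup>+x. ennreal (f True x powr q) + ennreal (f False x powr q) \<partial>lborel)"
    proof (intro nn_integral_mono)
      fix x
      have "\<bar>f True x - f False x\<bar> powr q \<le> f True x powr q + f False x powr q"
      proof (cases "f True x \<le> f False x")
        case True
        then have "\<bar>f True x - f False x\<bar> powr q \<le> f False x powr q"
          using q f0[of True x] by (intro powr_mono2) auto
        then show ?thesis by (simp add: add_increasing)
      next
        case False
        then have "\<bar>f True x - f False x\<bar> powr q \<le> f True x powr q"
          using q f0[of False x] by (intro powr_mono2) auto
        then show ?thesis by (simp add: add_increasing2)
      qed
      then show "ennreal (\<bar>f True x - f False x\<bar> powr q) \<le> ennreal (f True x powr q) + ennreal (f False x powr q)"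
        by (simp flip: ennreal_plus add: ennreal_leI)
    qed
    also have "\<dots> = (\<integral>\<^sup>+x. ennreal (f True x powr q) \<partial>lborel) + (\<integral>\<^sup>+x. ennreal (f False x powr q) \<partial>lborel)"
      by (rule nn_integral_add) measurable
    also have "\<dots> \<le> ennreal C' + ennreal C'" by (intro add_mono fq)
    also have "\<dots> < \<infinity>" by simp
    finally show "(\<integral>\<^sup>+x. ennreal (\<bar>f True x - f False x\<bar> powr q) \<partial>lborel) < \<infinity>" .
  qed
qed

text \<open>A uniform bound is uniform integrability with \<open>T = C\<close>. It passes to the
  weak limit by testing with the indicator of the set where the limit exceeds \<open>C\<close>. Both
  parts lie in \<open>[0, C]\<close> almost everywhere, and so their difference is bounded by
  \<open>C\<close>.\<close>

lemma Linf_representation: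
  assumes w: "sol w" and bd: "\<And>\<rho>. \<rho> > 0 \<Longrightarrow> AE x in lborel. \<bar>w (x, \<rho>)\<bar> \<le> C"
  obtains f where "f \<in> borel_measurable borel" "AE x in lborel. \<bar>f x\<bar> \<le> C"
    "\<And>\<rho> x. \<rho> > 0 \<Longrightarrow> A * w (x, \<rho>) = (LINT y|lborel. K \<rho> (- y \<odot> x) * f y)"
proof -
  have C: "C \<ge> 0"
  proof (rule ccontr)
    assume "\<not> C \<ge> 0"
    have "AE x in lborel. \<bar>w (x, 1)\<bar> \<le> C" by (rule bd) simp
    then have "AE x in (lborel :: ('v \<times> 'z) measure). False"
      by eventually_elim (use \<open>\<not> C \<ge> 0\<close> in linarith)
    then show False by (auto simp: AE_iff_null null_sets_def)
  qed
  have gm: "sgn_part w \<rho> i \<in> borel_measurable borel" if "\<rho> > 0" for \<rho> i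
    by (rule borel_measurable_continuous_onI[OF continuous_on_sgn_part[OF w that]])
  have gC: "AE x in lborel. sgn_part w \<rho> i x \<le> C" if "\<rho> > 0" for \<rho> i
    using bd[OF that] by eventually_elim (use sgn_part(2) order_trans in blast)
  have gCK: "AE x in KM. sgn_part w \<rho> i x \<le> C" if "\<rho> > 0" for \<rho> i
    unfolding KM_def using gC[OF that, of i] by (subst AE_density) (auto elim: eventually_mono)
  have lb: "loc_bounded C w"
    unfolding loc_bounded_def
  proof (intro conjI allI ballI impI C)
    fix \<rho> :: real and S :: "('v \<times> 'z) set" assume \<rho>: "0 < \<rho>" and S: "S \<in> sets borel"
    have "(\<integral>\<^sup>+x. ennreal \<bar>w (x, \<rho>)\<bar> * indicator S x \<partial>lborel) \<le> (\<integral>\<^sup>+x. ennreal C * indicator S x \<partial>lborel)"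
      by (rule nn_integral_mono_AE) (use bd[OF \<rho>] in \<open>eventually_elim, auto intro!: mult_right_mono ennreal_leI\<close>)
    also have "\<dots> = ennreal C * emeasure lborel S" using S by (intro nn_integral_cmult_indicator) simp
    also have "\<dots> \<le> ennreal C * (1 + emeasure lborel S)" by (intro mult_left_mono) auto
    finally show "(\<integral>\<^sup>+x. ennreal \<bar>w (x, \<rho>)\<bar> * indicator S x \<partial>lborel) \<le> ennreal C * (1 + emeasure lborel S)" .
  qed
  have ui: "\<exists>T\<ge>0. \<forall>\<rho>>0. \<forall>i. \<forall>S\<in>sets KM. (\<integral>\<^sup>+x. ennreal (sgn_part w \<rho> i x) * indicator S x \<partial>KM) \<le> ennreal \<epsilon> + ennreal T * emeasure KM S" for \<epsilon>
  proof (intro exI[of _ C] conjI allI impI ballI C)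
    fix \<rho> :: real and i S assume \<rho>: "0 < \<rho>" and S: "S \<in> sets KM"
    have "(\<integral>\<^sup>+x. ennreal (sgn_part w \<rho> i x) * indicator S x \<partial>KM) \<le> (\<integral>\<^sup>+x. ennreal C * indicator S x \<partial>KM)"
      by (rule nn_integral_mono_AE) (use gCK[OF \<rho>, of i] in \<open>eventually_elim, auto intro!: mult_right_mono ennreal_leI\<close>)
    also have "\<dots> = ennreal C * emeasure KM S" using S by (intro nn_integral_cmult_indicator)
    finally show "(\<integral>\<^sup>+x. ennreal (sgn_part w \<rho> i x) * indicator S x \<partial>KM) \<le> ennreal \<epsilon> + ennreal C * emeasure KM S"
      by (simp add: add_increasing)
  qed
  obtain F f where F: "F \<noteq> bot" "F \<le> at_right (0::real)" and f [measurable]: "\<And>i. f i \<in> borel_measurable borel" and f0: "\<And>i x. f i x \<ge> 0"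
    and fi: "\<And>i. integrable KM (f i)"
    and lim: "\<And>i h B. h \<in> borel_measurable borel \<Longrightarrow> (\<And>x. \<bar>h x\<bar> \<le> B) \<Longrightarrow> ((\<lambda>\<rho>. LINT x|KM. h x * sgn_part w \<rho> i x) \<longlongrightarrow> (LINT x|KM. h x * f i x)) F"
    and rep: "\<And>\<rho> x. \<rho> > 0 \<Longrightarrow> A * w (x, \<rho>) = (LINT y|lborel. K \<rho> (- y \<odot> x) * (f True y - f False y))"
  proof (rule weak_representation[OF w lb], goal_cases)
    case (1 \<epsilon>)
    then show ?case by (intro ui)
  next
    case (2 F f)
    show ?case by (rule 2(1)[OF 2(2-8)])
  qed
  have Pos: "eventually (\<lambda>\<rho>. 0 < \<rho>) F"
    using F(2) eventually_at_right_less[of "0::real"] by (auto simp: le_filter_def)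
  have fC: "AE x in lborel. f i x \<le> C" for i
  proof -
    define S where "S = {x. f i x > C}"
    have S [measurable]: "S \<in> sets borel" unfolding S_def by measurable
    have iS: "integrable KM (\<lambda>x. indicator S x * f i x)"
      using integrable_mult_indicator[OF _ fi[of i], of S] S by simp
    have iS2: "integrable KM (\<lambda>x. indicator S x * C)"
      by (rule KM.integrable_const_bound[of _ C]) (auto simp: C split: split_indicator)
    have "(LINT x|KM. indicator S x * f i x) \<le> (LINT x|KM. indicator S x * C)"
    proof (rule tendsto_upperbound[OF lim[of "indicator S" 1] _ F(1)])
      show "\<forall>\<^sub>F \<rho> in F. (LINT x|KM. indicator S x * sgn_part w \<rho> i x) \<le> (LINT x|KM. indicator S x * C)"
        using Pos
      proof eventually_elim
        case (elim \<rho>)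
        note [measurable] = gm[OF elim, of i]
        have ae: "AE x in KM. indicator S x * sgn_part w \<rho> i x \<le> indicator S x * C"
          using gCK[OF elim, of i] by eventually_elim (auto simp: indicator_def)
        have "integrable KM (\<lambda>x. indicator S x * sgn_part w \<rho> i x)"
        proof (rule KM.integrable_const_bound[of _ C])
          show "AE x in KM. norm (indicator S x * sgn_part w \<rho> i x) \<le> C"
            using gCK[OF elim, of i] by eventually_elim (use C sgn_part(1) in \<open>auto simp: indicator_def\<close>)
        qed measurable
        then show ?case by (rule integral_mono_AE[OF _ iS2 ae])
      qed
    qed (auto simp: indicator_def)
    then have "(LINT x|KM. indicator S x * (f i x - C)) \<le> 0"
      using iS iS2 by (simp add: right_diff_distrib)
    moreover have nn: "0 \<le> indicator S x * (f i x - C)" for x by (auto simp: indicator_def S_def)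
    ultimately have "(LINT x|KM. indicator S x * (f i x - C)) = 0"
      by (intro antisym integral_nonneg_AE) auto
    moreover have "integrable KM (\<lambda>x. indicator S x * (f i x - C))"
      using iS iS2 by (simp add: right_diff_distrib)
    ultimately have "AE x in KM. indicator S x * (f i x - C) = 0"
      using integral_nonneg_eq_0_iff_AE nn by blast
    \<comment> \<open>\<open>K 1\<close> is positive everywhere, so null sets of \<open>KM\<close>
      are Lebesgue null.\<close>
    then have "AE x in lborel. 0 < ennreal (K 1 x) \<longrightarrow> indicator S x * (f i x - C) = 0"
      unfolding KM_def by (subst (asm) AE_density) auto
    then show ?thesis
    proof eventually_elim
      case (elim x)
      have "0 < ennreal (K 1 x)" using K_pos[of 1 x] by simp
      with elim have "indicator S x * (f i x - C) = 0" by blast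
      then show ?case by (cases "f i x > C") (auto simp: S_def)
    qed
  qed
  show ?thesis
  proof (rule that[OF _ _ rep])
    show "(\<lambda>y. f True y - f False y) \<in> borel_measurable borel" by measurable
    show "AE x in lborel. \<bar>f True x - f False x\<bar> \<le> C"
      using fC[of True] fC[of False]
    proof eventually_elim
      case (elim x)
      then show ?case using f0[of True x] f0[of False x] by linarith
    qed
  qed
qed

text \<open>Without uniform integrability the limits are measures. The negative parts are treated
  along a subsequence of the one found for the positive parts, and the resulting sequence of heights
  is turned into a filter for \<open>uniqueness\<close>.\<close>

lemma L1_representation:
  assumes w: "sol w" and bd: "\<And>\<rho>. \<rho> > 0 \<Longrightarrow> (\<integral>\<^sup>+x. ennreal \<bar>w (x, \<rho>)\<bar> \<partial>lborel) \<le> ennreal C"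
  obtains \<nu>1 \<nu>2 where "finite_measure \<nu>1" "finite_measure \<nu>2" "sets \<nu>1 = sets borel" "sets \<nu>2 = sets borel"
    "\<And>\<rho> x. \<rho> > 0 \<Longrightarrow> A * w (x, \<rho>) = (LINT y|\<nu>1. K \<rho> (- y \<odot> x)) - (LINT y|\<nu>2. K \<rho> (- y \<odot> x))"
proof -
  have gm: "sgn_part w \<rho> i \<in> borel_measurable borel" if "\<rho> > 0" for \<rho> i
    by (rule borel_measurable_continuous_onI[OF continuous_on_sgn_part[OF w that]])
  have gC: "(\<integral>\<^sup>+x. ennreal (sgn_part w \<rho> i x) \<partial>lborel) \<le> ennreal C" if "\<rho> > 0" for \<rho> i
    by (rule order_trans[OF nn_integral_mono bd[OF that]]) (intro ennreal_leI sgn_part)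
  obtain r1 \<nu>1 where 1: "strict_mono (r1 :: nat \<Rightarrow> nat)" "finite_measure \<nu>1" "sets \<nu>1 = sets borel"
    "\<And>h. h \<in> Cc \<Longrightarrow> (\<lambda>k. LINT x|lborel. h x * sgn_part w (1 / (real (r1 k) + 1)) True x) \<longlonglongrightarrow> (LINT x|\<nu>1. h x)"
    by (rule vague_limit[of "\<lambda>k. sgn_part w (1 / (real k + 1)) True" C]) (auto intro!: gm gC sgn_part)
  obtain r2 \<nu>2 where 2: "strict_mono (r2 :: nat \<Rightarrow> nat)" "finite_measure \<nu>2" "sets \<nu>2 = sets borel"
    "\<And>h. h \<in> Cc \<Longrightarrow> (\<lambda>k. LINT x|lborel. h x * sgn_part w (1 / (real (r1 (r2 k)) + 1)) False x) \<longlonglongrightarrow> (LINT x|\<nu>2. h x)"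
    by (rule vague_limit[of "\<lambda>k. sgn_part w (1 / (real (r1 k) + 1)) False" C]) (auto intro!: gm gC sgn_part)
  define X where "X k = 1 / (real (r1 (r2 k)) + 1)" for k
  have X0: "X k > 0" for k by (simp add: X_def)
  have Xlim: "X \<longlonglongrightarrow> 0"
  proof -
    have "(\<lambda>k. 1 / (real k + 1)) \<longlonglongrightarrow> 0" using LIMSEQ_inverse_real_of_nat by (simp add: inverse_eq_divide add.commute)
    moreover have "strict_mono (\<lambda>k. r1 (r2 k))" using 1(1) 2(1) by (simp add: strict_mono_def)
    ultimately show ?thesis using LIMSEQ_subseq_LIMSEQ[of "\<lambda>k. 1 / (real k + 1)" 0 "\<lambda>k. r1 (r2 k)"] by (simp add: X_def[abs_def] o_def)
  qed
  define F where "F = filtermap X sequentially"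
  have F: "F \<noteq> bot" "F \<le> at_right 0"
  proof -
    show "F \<noteq> bot" by (simp add: F_def filtermap_bot_iff)
    have "filterlim X (at_right 0) sequentially"
      by (rule tendsto_imp_filterlim_at_right[OF Xlim]) (simp add: X0)
    then show "F \<le> at_right 0" by (simp add: F_def filterlim_def)
  qed
  have lb: "loc_bounded (max 1 C) w"
    using loc_bounded_if_Lp[OF w, of 1 C] bd by simp
  have "A * w (x, \<rho>) = (LINT y|\<nu>1. K \<rho> (- y \<odot> x)) - (LINT y|\<nu>2. K \<rho> (- y \<odot> x))" if \<rho>: "\<rho> > 0" for \<rho> x
  proof (rule uniqueness[OF w lb F finite_measure_admissible[OF 1(2,3)] finite_measure_admissible[OF 2(2,3)] _ \<rho>])
    fix h :: "'v \<times> 'z \<Rightarrow> real" assume h: "h \<in> Cc"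
    have "(\<lambda>k. LINT x|lborel. h x * sgn_part w (X k) True x) \<longlonglongrightarrow> (LINT x|\<nu>1. h x)"
      using LIMSEQ_subseq_LIMSEQ[OF 1(4)[OF h] 2(1)] by (simp add: X_def o_def)
    moreover have "(\<lambda>k. LINT x|lborel. h x * sgn_part w (X k) False x) \<longlonglongrightarrow> (LINT x|\<nu>2. h x)"
      using 2(4)[OF h] by (simp add: X_def)
    ultimately have "(\<lambda>k. (LINT x|lborel. h x * sgn_part w (X k) True x) - (LINT x|lborel. h x * sgn_part w (X k) False x)) \<longlonglongrightarrow>
       (LINT x|\<nu>1. h x) - (LINT x|\<nu>2. h x)"
      by (rule tendsto_diff)
    moreover have "(LINT x|lborel. h x * sgn_part w (X k) True x) - (LINT x|lborel. h x * sgn_part w (X k) False x) = (LINT x|lborel. h x * w (x, X k))" for k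
    proof -
      have "(LINT x|lborel. h x * sgn_part w (X k) True x) - (LINT x|lborel. h x * sgn_part w (X k) False x) =
        (LINT x|lborel. h x * sgn_part w (X k) True x - h x * sgn_part w (X k) False x)"
        by (intro Bochner_Integration.integral_diff[symmetric] Cc_integrable[OF h] continuous_on_sgn_part w X0)
      then show ?thesis by (simp only: right_diff_distrib[symmetric] sgn_part(3))
    qed
    ultimately have "(\<lambda>k. LINT x|lborel. h x * w (x, X k)) \<longlonglongrightarrow> (LINT x|\<nu>1. h x) - (LINT x|\<nu>2. h x)" by simp
    then show "((\<lambda>\<rho>. LINT x|lborel. h x * w (x, \<rho>)) \<longlongrightarrow> (LINT x|\<nu>1. h x) - (LINT x|\<nu>2. h x)) F"
      by (simp add: F_def filterlim_filtermap)
  qed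
  then show ?thesis using 1(2,3) 2(2,3) by (intro that)
qed

end

section \<open>The main theorem\<close>

lemma cm_integral_scaleR: "cm_integral \<mu> (\<lambda>x. c *\<^sub>R g x) = c *\<^sub>R cm_integral \<mu> g"
  unfolding cm_integral_def
  by (simp add: algebra_simps)

lemma cm_integral_of_real:
  "cm_integral \<mu> (\<lambda>x. complex_of_real (h x)) =
     Complex ((LINT x|positive_part (\<lambda>A. Re (\<mu> A)). h x) - (LINT x|positive_part (\<lambda>A. - Re (\<mu> A)). h x))
       ((LINT x|positive_part (\<lambda>A. Im (\<mu> A)). h x) - (LINT x|positive_part (\<lambda>A. - Im (\<mu> A)). h x))"
  unfolding cm_integral_def by (simp add: complex_eq_iff)

lemma enn2real_gt_one: "1 < p \<Longrightarrow> p \<noteq> \<infinity> \<Longrightarrow> 1 < enn2real p"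
  by (cases p) (auto simp: one_less_ennreal)

lemma Lp_space_finite:
  assumes "f \<in> Lp_space p" "p \<noteq> \<infinity>"
  shows "(\<integral>\<^sup>+x. ennreal (norm (f x) powr enn2real p) \<partial>lborel) < \<infinity>"
proof -
  obtain C where "Lp_bound p f C" using assms(1) by (auto simp: Lp_space_def)
  then have "(\<integral>\<^sup>+x. ennreal (norm (f x) powr enn2real p) \<partial>lborel) \<le> ennreal C"
    using assms(2) by (simp add: Lp_bound_def)
  then show ?thesis by (rule le_less_trans) simp
qed

lemma complex_borel_measure_diff:
  assumes fin: "finite_measure \<nu>1" "finite_measure \<nu>2" "finite_measure \<nu>3" "finite_measure \<nu>4"
    and sets: "sets \<nu>1 = sets borel" "sets \<nu>2 = sets borel" "sets \<nu>3 = sets borel" "sets \<nu>4 = sets (borel :: 'a::topological_space measure)"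
  defines "\<mu> \<equiv> (\<lambda>B. Complex (measure \<nu>1 B - measure \<nu>2 B) (measure \<nu>3 B - measure \<nu>4 B))"
  shows "complex_borel_measure \<mu>"
    and "\<And>h M. h \<in> borel_measurable borel \<Longrightarrow> (\<And>x. \<bar>h x\<bar> \<le> M) \<Longrightarrow>
      cm_integral \<mu> (\<lambda>x. complex_of_real (h x)) =
      Complex ((LINT x|\<nu>1. h x) - (LINT x|\<nu>2. h x)) ((LINT x|\<nu>3. h x) - (LINT x|\<nu>4. h x))"
proof -
  note sg = signed_measure_diff[OF fin(1,2) sets(1,2)] signed_measure_diff[OF fin(3,4) sets(3,4)]
  show "complex_borel_measure \<mu>"
    using sg unfolding complex_borel_measure_def signed_def \<mu>_def by (simp add: sums_complex_iff)
  fix h :: "'a \<Rightarrow> real" and M assume h: "h \<in> borel_measurable borel" "\<And>x. \<bar>h x\<bar> \<le> M"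
  show "cm_integral \<mu> (\<lambda>x. complex_of_real (h x)) =
      Complex ((LINT x|\<nu>1. h x) - (LINT x|\<nu>2. h x)) ((LINT x|\<nu>3. h x) - (LINT x|\<nu>4. h x))"
    unfolding cm_integral_of_real \<mu>_def complex.sel
    using integral_positive_part_diff[OF fin(1,2) sets(1,2) sg(1) refl h]
      integral_positive_part_diff[OF fin(3,4) sets(3,4) sg(2) refl h] by simp
qed

context htype
begin

section \<open>The parts of the theorem in terms of \<open>gconv\<close> and
  \<open>gconv_measure\<close>\<close>

lemma gconv_phi:
  assumes \<rho>: "\<rho> > 0" and f [measurable]: "f \<in> borel_measurable borel"
  shows "\<rho> powr (2 * s) *\<^sub>R gconv bracket f (phi n m s \<rho>) x = Pois f (x, \<rho>)"
proof -
  have [measurable]: "(\<lambda>y. x \<odot> - y) \<in> borel_measurable borel"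
    by (intro borel_measurable_continuous_onI continuous_intros)
  have "\<rho> powr (2 * s) *\<^sub>R gconv bracket f (phi n m s \<rho>) x =
      (LINT y|lborel. \<rho> powr (2 * s) *\<^sub>R (f (x \<odot> - y) * phi n m s \<rho> y))"
    unfolding gconv_def ginv_def by simp
  also have "\<dots> = (LINT y|lborel. K \<rho> y *\<^sub>R f (x \<odot> - y))"
    by (simp add: phi_eq K_def scaleR_conv_of_real mult_ac)
  also have "\<dots> = Pois f (x, \<rho>)"
    using integral_K(1)[OF \<rho>, of "\<lambda>y. f (x \<odot> - y)"] by (simp add: Pois_def)
  finally show ?thesis .
qed

lemma gconv_measure_phi:
  "\<rho> powr (2 * s) *\<^sub>R gconv_measure bracket \<mu> (phi n m s \<rho>) x = cm_integral \<mu> (\<lambda>y. complex_of_real (K \<rho> (- y \<odot> x)))"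
  unfolding gconv_measure_def ginv_def cm_integral_scaleR[symmetric]
  by (simp add: phi_eq K_def scaleR_conv_of_real)

lemma gconv_measure_phi_eq:
  assumes \<mu>: "complex_borel_measure \<mu>"
  shows "\<rho> powr (2 * s) *\<^sub>R gconv_measure bracket \<mu> (phi n m s \<rho>) x =
     Complex (mconv (positive_part (\<lambda>A. Re (\<mu> A))) \<rho> x - mconv (positive_part (\<lambda>A. - Re (\<mu> A))) \<rho> x)
       (mconv (positive_part (\<lambda>A. Im (\<mu> A))) \<rho> x - mconv (positive_part (\<lambda>A. - Im (\<mu> A))) \<rho> x)"
proof -
  note sg = complex_measure_signed[OF \<mu>]
  note sg' = sg(1) signed_uminus[OF sg(1)] sg(2) signed_uminus[OF sg(2)]
  show ?thesis
    unfolding gconv_measure_phi cm_integral_of_real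
    using sg' by (simp add: mconv_def finite_measure_positive_part)
qed

lemma borel_measurable_Pois:
  fixes f :: "'v \<times> 'z \<Rightarrow> complex"
  assumes f [measurable]: "f \<in> borel_measurable borel"
  shows "(\<lambda>x. Pois f (x, \<rho>)) \<in> borel_measurable borel"
proof -
  have "(\<lambda>p. f (fst p \<odot> - dil \<rho> (snd p))) \<in> borel_measurable (lborel \<Otimes>\<^sub>M KM)"
    by (rule measurable_compose[OF measurable_shift_KM(1) f])
  then show ?thesis
    using KM.borel_measurable_lebesgue_integral[of "\<lambda>x y. f (x \<odot> - dil \<rho> y)" lborel]
    by (simp add: case_prod_beta' Pois_def)
qed

lemma integrable_K_Lp:
  assumes p: "1 < p" and f: "f \<in> Lp_space p" and \<rho>: "\<rho> > 0"
  shows "integrable lborel (\<lambda>y. K \<rho> (- y \<odot> x) *\<^sub>R f y)"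
proof (cases "p = \<infinity>")
  case True
  have [measurable]: "f \<in> borel_measurable borel" using f by (simp add: Lp_space_def)
  obtain C where C: "AE y in lborel. norm (f y) \<le> C" using f True by (auto simp: Lp_space_def Lp_bound_def)
  have [measurable]: "(\<lambda>y. - y \<odot> x) \<in> borel_measurable borel"
    by (intro borel_measurable_continuous_onI continuous_intros)
  have "integrable lborel (\<lambda>y. K \<rho> (- y \<odot> x) *\<^sub>R C)"
    using Pois_eq(2)[OF \<rho>, of "\<lambda>_. C" x] by simp
  then show ?thesis
  proof (rule Bochner_Integration.integrable_bound)
    show "AE y in lborel. norm (K \<rho> (- y \<odot> x) *\<^sub>R f y) \<le> norm (K \<rho> (- y \<odot> x) *\<^sub>R C)"
      using C
    proof eventually_elim
      case (elim y)
      then have "norm (f y) \<le> \<bar>C\<bar>" by linarith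
      then show ?case by (simp add: abs_mult mult_left_mono)
    qed
  qed measurable
next
  case False
  have "f \<in> borel_measurable borel" using f by (simp add: Lp_space_def)
  then show ?thesis
    using integrable_shift_KM[OF _ less_imp_le[OF enn2real_gt_one[OF p False]] Lp_space_finite[OF f False] \<rho>] Pois_eq(2)[OF \<rho>] by blast
qed

text \<open>The real and imaginary parts of a solution are solutions, and each has a real boundary
  function. \<open>A *\<^sub>R u\<close> is the Poisson integral of their complex combination, which
  explains the constant \<open>1 / A\<close>.\<close>

lemma solution_eq_gconv:
  assumes u: "is_solution bracket s u" and p: "1 < p" and bd: "\<And>\<rho>. \<rho> > 0 \<Longrightarrow> Lp_bound p (\<lambda>x. u (x, \<rho>)) C"
  shows "\<exists>f\<in>Lp_space p. \<forall>\<rho>>0. \<forall>x. u (x, \<rho>) = (1 / A * \<rho> powr (2 * s)) *\<^sub>R gconv bracket f (phi n m s \<rho>) x"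
proof -
  have part: "\<exists>g. g \<in> borel_measurable borel
      \<and> (if p = \<infinity> then AE x in lborel. \<bar>g x\<bar> \<le> C else (\<integral>\<^sup>+x. ennreal (\<bar>g x\<bar> powr enn2real p) \<partial>lborel) < \<infinity>)
      \<and> (\<forall>\<rho>>0. \<forall>x. A * w (x, \<rho>) = (LINT y|lborel. K \<rho> (- y \<odot> x) * g y))"
    if w: "sol w" and le: "\<And>q. \<bar>w q\<bar> \<le> norm (u q)" for w
  proof (cases "p = \<infinity>")
    case True
    have b: "AE x in lborel. \<bar>w (x, \<rho>)\<bar> \<le> C" if \<rho>: "\<rho> > 0" for \<rho>
    proof -
      have "AE x in lborel. norm (u (x, \<rho>)) \<le> C" using bd[OF \<rho>] True by (simp add: Lp_bound_def)
      then show ?thesis by eventually_elim (rule order_trans[OF le])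
    qed
    obtain g where "g \<in> borel_measurable borel" "AE x in lborel. \<bar>g x\<bar> \<le> C"
      "\<And>\<rho> x. \<rho> > 0 \<Longrightarrow> A * w (x, \<rho>) = (LINT y|lborel. K \<rho> (- y \<odot> x) * g y)"
      using Linf_representation[OF w b] by blast
    then show ?thesis using True by (intro exI[of _ g]) simp
  next
    case False
    note q = enn2real_gt_one[OF p False]
    have b: "(\<integral>\<^sup>+x. ennreal (\<bar>w (x, \<rho>)\<bar> powr enn2real p) \<partial>lborel) \<le> ennreal C" if \<rho>: "\<rho> > 0" for \<rho>
    proof -
      have "(\<integral>\<^sup>+x. ennreal (\<bar>w (x, \<rho>)\<bar> powr enn2real p) \<partial>lborel) \<le> (\<integral>\<^sup>+x. ennreal (norm (u (x, \<rho>)) powr enn2real p) \<partial>lborel)"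
        using q le by (intro nn_integral_mono ennreal_leI powr_mono2) auto
      also have "\<dots> \<le> ennreal C" using bd[OF \<rho>] False by (simp add: Lp_bound_def)
      finally show ?thesis .
    qed
    obtain g where "g \<in> borel_measurable borel" "(\<integral>\<^sup>+x. ennreal (\<bar>g x\<bar> powr enn2real p) \<partial>lborel) < \<infinity>"
      "\<And>\<rho> x. \<rho> > 0 \<Longrightarrow> A * w (x, \<rho>) = (LINT y|lborel. K \<rho> (- y \<odot> x) * g y)"
      using Lp_representation[OF w q b] by blast
    then show ?thesis using False by (intro exI[of _ g]) simp
  qed
  obtain a where a [measurable]: "a \<in> borel_measurable borel"
    and a2: "if p = \<infinity> then AE x in lborel. \<bar>a x\<bar> \<le> C else (\<integral>\<^sup>+x. ennreal (\<bar>a x\<bar> powr enn2real p) \<partial>lborel) < \<infinity>"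
    and a3: "\<forall>\<rho>>0. \<forall>x. A * Re (u (x, \<rho>)) = (LINT y|lborel. K \<rho> (- y \<odot> x) * a y)"
    using part[OF is_solution_jet(2)[OF u] abs_Re_le_cmod] by blast
  obtain b where b [measurable]: "b \<in> borel_measurable borel"
    and b2: "if p = \<infinity> then AE x in lborel. \<bar>b x\<bar> \<le> C else (\<integral>\<^sup>+x. ennreal (\<bar>b x\<bar> powr enn2real p) \<partial>lborel) < \<infinity>"
    and b3: "\<forall>\<rho>>0. \<forall>x. A * Im (u (x, \<rho>)) = (LINT y|lborel. K \<rho> (- y \<odot> x) * b y)"
    using part[OF is_solution_jet(3)[OF u] abs_Im_le_cmod] by blast
  define f where "f x = complex_of_real (a x) + \<i> * complex_of_real (b x)" for x
  have fm [measurable]: "f \<in> borel_measurable borel" unfolding f_def by measurable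
  have fle: "norm (f x) \<le> \<bar>a x\<bar> + \<bar>b x\<bar>" for x
    using norm_triangle_ineq[of "complex_of_real (a x)" "\<i> * complex_of_real (b x)"] by (simp add: f_def norm_mult)
  have "\<exists>C. Lp_bound p f C"
  proof (cases "p = \<infinity>")
    case True
    then have "AE x in lborel. \<bar>a x\<bar> \<le> C" "AE x in lborel. \<bar>b x\<bar> \<le> C" using a2 b2 by simp_all
    then have "AE x in lborel. norm (f x) \<le> 2 * C"
    proof eventually_elim
      case (elim x)
      then show ?case using fle[of x] by linarith
    qed
    then show ?thesis using True by (auto simp: Lp_bound_def)
  next
    case False
    define q where "q = enn2real p"
    have q: "1 < q" unfolding q_def by (rule enn2real_gt_one[OF p False])
    have "(\<integral>\<^sup>+x. ennreal (norm (f x) powr q) \<partial>lborel)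
        \<le> (\<integral>\<^sup>+x. ennreal (2 powr q) * (ennreal (\<bar>a x\<bar> powr q) + ennreal (\<bar>b x\<bar> powr q)) \<partial>lborel)"
    proof (intro nn_integral_mono)
      fix x
      have "norm (f x) powr q \<le> (\<bar>a x\<bar> + \<bar>b x\<bar>) powr q" using q fle by (intro powr_mono2) auto
      also have "\<dots> \<le> 2 powr q * (\<bar>a x\<bar> powr q + \<bar>b x\<bar> powr q)"
        using powr_sum_le[of "{True, False}" "\<lambda>i. if i then \<bar>a x\<bar> else \<bar>b x\<bar>" q] q by simp
      finally show "ennreal (norm (f x) powr q) \<le> ennreal (2 powr q) * (ennreal (\<bar>a x\<bar> powr q) + ennreal (\<bar>b x\<bar> powr q))"
        by (simp flip: ennreal_plus ennreal_mult add: ennreal_leI)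
    qed
    also have "\<dots> = ennreal (2 powr q) * ((\<integral>\<^sup>+x. ennreal (\<bar>a x\<bar> powr q) \<partial>lborel) + (\<integral>\<^sup>+x. ennreal (\<bar>b x\<bar> powr q) \<partial>lborel))"
      by (simp add: nn_integral_cmult nn_integral_add)
    also have "\<dots> < \<infinity>"
      using a2 b2 False by (simp add: q_def ennreal_mult_less_top)
    finally have "(\<integral>\<^sup>+x. ennreal (norm (f x) powr q) \<partial>lborel) < \<infinity>" .
    then have "(\<integral>\<^sup>+x. ennreal (norm (f x) powr q) \<partial>lborel)
        \<le> ennreal (enn2real (\<integral>\<^sup>+x. ennreal (norm (f x) powr q) \<partial>lborel))" by (simp add: less_top)
    then show ?thesis using False by (auto simp: Lp_bound_def q_def)
  qed
  then have fL: "f \<in> Lp_space p" by (simp add: Lp_space_def fm)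
  have "u (x, \<rho>) = (1 / A * \<rho> powr (2 * s)) *\<^sub>R gconv bracket f (phi n m s \<rho>) x" if \<rho>: "\<rho> > 0" for \<rho> x
  proof -
    note int = integrable_K_Lp[OF p fL \<rho>, of x]
    have P: "Pois f (x, \<rho>) = (LINT y|lborel. K \<rho> (- y \<odot> x) *\<^sub>R f y)"
      by (rule Pois_eq(1)[OF \<rho> fm, symmetric])
    have "Re (Pois f (x, \<rho>)) = A * Re (u (x, \<rho>))" "Im (Pois f (x, \<rho>)) = A * Im (u (x, \<rho>))"
      unfolding P integral_Re[OF int, symmetric] integral_Im[OF int, symmetric] a3[rule_format, OF \<rho>] b3[rule_format, OF \<rho>]
      by (simp_all add: f_def)
    then have "Pois f (x, \<rho>) = A *\<^sub>R u (x, \<rho>)" by (simp add: complex_eq_iff)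
    then show ?thesis
      unfolding scaleR_scaleR[symmetric] gconv_phi[OF \<rho> fm] using A_pos by simp
  qed
  then show ?thesis using fL by blast
qed

lemma gconv_Lp_bound:
  assumes p: "1 < p" and f: "f \<in> Lp_space p"
  shows "\<exists>C. \<forall>\<rho>>0. Lp_bound p (\<lambda>x. (1 / A * \<rho> powr (2 * s)) *\<^sub>R gconv bracket f (phi n m s \<rho>) x) C"
proof -
  have fm [measurable]: "f \<in> borel_measurable borel" using f by (simp add: Lp_space_def)
  obtain C where C: "Lp_bound p f C" using f by (auto simp: Lp_space_def)
  have "Lp_bound p (\<lambda>x. (1 / A * \<rho> powr (2 * s)) *\<^sub>R gconv bracket f (phi n m s \<rho>) x) C" if \<rho>: "\<rho> > 0" for \<rho>
    unfolding scaleR_scaleR[symmetric] gconv_phi[OF \<rho> fm]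
  proof (cases "p = \<infinity>")
    case True
    then have "AE x in lborel. norm (f x) \<le> C" using C by (simp add: Lp_bound_def)
    then have "norm (Pois f (x, \<rho>)) \<le> A * C" for x by (rule Pois_ess_bound[OF fm _ \<rho>])
    then have "norm ((1 / A) *\<^sub>R Pois f (x, \<rho>)) \<le> C" for x using A_pos by (simp add: field_simps)
    then show "Lp_bound p (\<lambda>x. (1 / A) *\<^sub>R Pois f (x, \<rho>)) C" using True by (simp add: Lp_bound_def)
  next
    case False
    define q where "q = enn2real p"
    have q: "1 < q" unfolding q_def by (rule enn2real_gt_one[OF p False])
    have fq: "(\<integral>\<^sup>+x. ennreal (norm (f x) powr q) \<partial>lborel) < \<infinity>"
      unfolding q_def by (rule Lp_space_finite[OF f False])
    have "(\<integral>\<^sup>+x. ennreal (norm ((1 / A) *\<^sub>R Pois f (x, \<rho>)) powr q) \<partial>lborel)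
        = (\<integral>\<^sup>+x. ennreal ((1 / A) powr q) * ennreal (norm (Pois f (x, \<rho>)) powr q) \<partial>lborel)"
      using A_pos by (intro nn_integral_cong) (simp add: powr_mult powr_divide flip: ennreal_mult)
    also have "\<dots> = ennreal ((1 / A) powr q) * (\<integral>\<^sup>+x. ennreal (norm (Pois f (x, \<rho>)) powr q) \<partial>lborel)"
    proof (rule nn_integral_cmult)
      have [measurable]: "(\<lambda>x. Pois f (x, \<rho>)) \<in> borel_measurable borel"
        by (rule borel_measurable_Pois[OF fm])
      show "(\<lambda>x. ennreal (norm (Pois f (x, \<rho>)) powr q)) \<in> borel_measurable lborel" by measurable
    qed
    also have "\<dots> \<le> ennreal ((1 / A) powr q) * (ennreal (A powr q) * (\<integral>\<^sup>+x. ennreal (norm (f x) powr q) \<partial>lborel))"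
      by (intro mult_left_mono Pois_Lp_bound[OF fm less_imp_le[OF q] fq]) simp
    also have "\<dots> = (\<integral>\<^sup>+x. ennreal (norm (f x) powr q) \<partial>lborel)"
    proof -
      have "(1 / A) powr q * A powr q = 1" using A_pos by (simp flip: powr_mult)
      then show ?thesis by (simp add: mult.assoc[symmetric] flip: ennreal_mult)
    qed
    also have "\<dots> \<le> ennreal C" using C False by (simp add: Lp_bound_def q_def)
    finally show "Lp_bound p (\<lambda>x. (1 / A) *\<^sub>R Pois f (x, \<rho>)) C" using False by (simp add: Lp_bound_def q_def)
  qed
  then show ?thesis by blast
qed

lemma gconv_Lp_tendsto:
  assumes p: "1 < p" "p \<noteq> \<infinity>" and f: "f \<in> Lp_space p"
    and u: "\<And>\<rho> x. \<rho> > 0 \<Longrightarrow> u (x, \<rho>) = (1 / A * \<rho> powr (2 * s)) *\<^sub>R gconv bracket f (phi n m s \<rho>) x"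
  shows "((\<lambda>\<rho>. \<integral>\<^sup>+x. ennreal (norm (u (x, \<rho>) - f x) powr enn2real p) \<partial>lborel) \<longlongrightarrow> 0) (at_right 0)"
proof -
  have fm [measurable]: "f \<in> borel_measurable borel" using f by (simp add: Lp_space_def)
  define q where "q = enn2real p"
  have q: "1 < q" unfolding q_def by (rule enn2real_gt_one[OF p])
  have fq: "(\<integral>\<^sup>+x. ennreal (norm (f x) powr q) \<partial>lborel) < \<infinity>"
    unfolding q_def by (rule Lp_space_finite[OF f p(2)])
  have "((\<lambda>\<rho>. ennreal ((1 / A) powr q) * (\<integral>\<^sup>+x. ennreal (norm (Pois f (x, \<rho>) - A *\<^sub>R f x) powr q) \<partial>lborel)) \<longlongrightarrow> ennreal ((1 / A) powr q) * 0) (at_right 0)"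
    by (rule ennreal_tendsto_cmult[OF _ Pois_Lp_tendsto[OF fm less_imp_le[OF q] fq]]) simp
  moreover have "\<forall>\<^sub>F \<rho> in at_right 0. ennreal ((1 / A) powr q) * (\<integral>\<^sup>+x. ennreal (norm (Pois f (x, \<rho>) - A *\<^sub>R f x) powr q) \<partial>lborel)
      = (\<integral>\<^sup>+x. ennreal (norm (u (x, \<rho>) - f x) powr q) \<partial>lborel)"
    using eventually_at_right_less[of "0::real"]
  proof eventually_elim
    case (elim \<rho>)
    have "u (x, \<rho>) - f x = (1 / A) *\<^sub>R (Pois f (x, \<rho>) - A *\<^sub>R f x)" for x
      unfolding u[OF elim] scaleR_scaleR[symmetric] gconv_phi[OF elim fm] using A_pos by (simp add: scaleR_diff_right)
    then have "norm (u (x, \<rho>) - f x) powr q = (1 / A) powr q * norm (Pois f (x, \<rho>) - A *\<^sub>R f x) powr q" for x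
      using A_pos by (simp add: powr_mult powr_divide)
    moreover have [measurable]: "(\<lambda>x. Pois f (x, \<rho>)) \<in> borel_measurable borel"
      by (rule borel_measurable_Pois[OF fm])
    ultimately show ?case by (simp add: nn_integral_cmult ennreal_mult)
  qed
  ultimately show ?thesis unfolding q_def by (simp add: tendsto_cong)
qed

text \<open>The limit measures of the positive and negative parts may overlap, but by
  \<open>complex_borel_measure_diff\<close> integrals against \<open>\<mu>\<close> are computed from
  them.\<close>

lemma solution_eq_gconv_measure:
  assumes u: "is_solution bracket s u" and bd: "\<And>\<rho>. \<rho> > 0 \<Longrightarrow> Lp_bound 1 (\<lambda>x. u (x, \<rho>)) C"
  shows "\<exists>\<mu>. complex_borel_measure \<mu> \<and>
    (\<forall>\<rho>>0. \<forall>x. u (x, \<rho>) = (1 / A * \<rho> powr (2 * s)) *\<^sub>R gconv_measure bracket \<mu> (phi n m s \<rho>) x)"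
proof -
  have b: "(\<integral>\<^sup>+x. ennreal \<bar>w (x, \<rho>)\<bar> \<partial>lborel) \<le> ennreal C" if \<rho>: "\<rho> > 0" and le: "\<And>q. \<bar>w q\<bar> \<le> norm (u q)" for w \<rho>
  proof -
    have "(\<integral>\<^sup>+x. ennreal \<bar>w (x, \<rho>)\<bar> \<partial>lborel) \<le> (\<integral>\<^sup>+x. ennreal (norm (u (x, \<rho>))) \<partial>lborel)"
      by (intro nn_integral_mono ennreal_leI le)
    also have "\<dots> \<le> ennreal C" using bd[OF \<rho>] by (simp add: Lp_bound_def)
    finally show ?thesis .
  qed
  obtain \<nu>1 \<nu>2 where 1: "finite_measure \<nu>1" "finite_measure \<nu>2" "sets \<nu>1 = sets borel" "sets \<nu>2 = sets borel"
    "\<And>\<rho> x. \<rho> > 0 \<Longrightarrow> A * Re (u (x, \<rho>)) = (LINT y|\<nu>1. K \<rho> (- y \<odot> x)) - (LINT y|\<nu>2. K \<rho> (- y \<odot> x))"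
    using L1_representation[OF is_solution_jet(2)[OF u] b[OF _ abs_Re_le_cmod]] by blast
  obtain \<nu>3 \<nu>4 where 2: "finite_measure \<nu>3" "finite_measure \<nu>4" "sets \<nu>3 = sets borel" "sets \<nu>4 = sets borel"
    "\<And>\<rho> x. \<rho> > 0 \<Longrightarrow> A * Im (u (x, \<rho>)) = (LINT y|\<nu>3. K \<rho> (- y \<odot> x)) - (LINT y|\<nu>4. K \<rho> (- y \<odot> x))"
    using L1_representation[OF is_solution_jet(3)[OF u] b[OF _ abs_Im_le_cmod]] by blast
  define \<mu> where "\<mu> = (\<lambda>B. Complex (measure \<nu>1 B - measure \<nu>2 B) (measure \<nu>3 B - measure \<nu>4 B))"
  note md = complex_borel_measure_diff[OF 1(1,2) 2(1,2) 1(3,4) 2(3,4), folded \<mu>_def]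
  have "u (x, \<rho>) = (1 / A * \<rho> powr (2 * s)) *\<^sub>R gconv_measure bracket \<mu> (phi n m s \<rho>) x" if \<rho>: "\<rho> > 0" for \<rho> x
  proof -
    have [measurable]: "(\<lambda>y. - y \<odot> x) \<in> borel_measurable borel"
      by (intro borel_measurable_continuous_onI continuous_intros)
    have "cm_integral \<mu> (\<lambda>y. complex_of_real (K \<rho> (- y \<odot> x))) = A *\<^sub>R u (x, \<rho>)"
      by (subst md(2)[where M = "\<rho> powr (2 * s) * \<rho> powr (- 4 * kap)"])
        (use K_le[OF \<rho>] in \<open>auto simp: 1(5)[OF \<rho>, symmetric] 2(5)[OF \<rho>, symmetric] complex_eq_iff\<close>)
    then show ?thesis
      unfolding scaleR_scaleR[symmetric] gconv_measure_phi using A_pos by simp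
  qed
  then show ?thesis using md(1) by blast
qed

text \<open>Each Jordan part contributes its mass: the integral \<open>A\<close> of the kernel
  cancels against \<open>1 / A\<close>.\<close>

lemma gconv_measure_L1_bound:
  assumes \<mu>: "complex_borel_measure \<mu>"
  shows "\<exists>C. \<forall>\<rho>>0. Lp_bound 1 (\<lambda>x. (1 / A * \<rho> powr (2 * s)) *\<^sub>R gconv_measure bracket \<mu> (phi n m s \<rho>) x) C"
proof -
  note sg = complex_measure_signed[OF \<mu>]
  note fin = finite_measure_positive_part[OF sg(1)] finite_measure_positive_part[OF signed_uminus[OF sg(1)]]
    finite_measure_positive_part[OF sg(2)] finite_measure_positive_part[OF signed_uminus[OF sg(2)]]
  define N where "N = (\<lambda>i::nat. if i = 0 then positive_part (\<lambda>A. Re (\<mu> A)) else if i = 1 then positive_part (\<lambda>A. - Re (\<mu> A))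
      else if i = 2 then positive_part (\<lambda>A. Im (\<mu> A)) else positive_part (\<lambda>A. - Im (\<mu> A)))"
  have eq: "\<rho> powr (2 * s) *\<^sub>R gconv_measure bracket \<mu> (phi n m s \<rho>) x =
      Complex (mconv (N 0) \<rho> x - mconv (N 1) \<rho> x) (mconv (N 2) \<rho> x - mconv (N 3) \<rho> x)" for \<rho> x
    unfolding gconv_measure_phi_eq[OF \<mu>] by (simp add: N_def)
  have N: "finite_measure (N i)" "sets (N i) = sets borel" for i
    using fin sets_positive_part[OF sg(1)] sets_positive_part[OF signed_uminus[OF sg(1)]]
      sets_positive_part[OF sg(2)] sets_positive_part[OF signed_uminus[OF sg(2)]] by (simp_all add: N_def)
  have "Lp_bound 1 (\<lambda>x. (1 / A * \<rho> powr (2 * s)) *\<^sub>R gconv_measure bracket \<mu> (phi n m s \<rho>) x) (\<Sum>i<4. measure (N i) UNIV)"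
    if \<rho>: "\<rho> > 0" for \<rho>
  proof -
    have [measurable]: "mconv (N i) \<rho> \<in> borel_measurable borel" for i by (rule borel_measurable_mconv[OF N \<rho>])
    have "(\<integral>\<^sup>+x. ennreal (norm ((1 / A * \<rho> powr (2 * s)) *\<^sub>R gconv_measure bracket \<mu> (phi n m s \<rho>) x)) \<partial>lborel)
        \<le> (\<integral>\<^sup>+x. (\<Sum>i<4. ennreal (1 / A) * ennreal (mconv (N i) \<rho> x)) \<partial>lborel)"
    proof (intro nn_integral_mono)
      fix x
      let ?m = "\<lambda>i. mconv (N i) \<rho> x"
      have m0: "0 \<le> ?m i" for i by (rule mconv_nonneg[OF N])
      have "norm (Complex (?m 0 - ?m 1) (?m 2 - ?m 3)) \<le> \<bar>?m 0 - ?m 1\<bar> + \<bar>?m 2 - ?m 3\<bar>"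
        using cmod_le[of "Complex (?m 0 - ?m 1) (?m 2 - ?m 3)"] by simp
      also have "\<dots> \<le> ?m 0 + ?m 1 + ?m 2 + ?m 3" using m0[of 0] m0[of 1] m0[of 2] m0[of 3] by linarith
      also have "\<dots> = (\<Sum>i<4. ?m i)" by (simp add: eval_nat_numeral)
      finally have "norm ((1 / A * \<rho> powr (2 * s)) *\<^sub>R gconv_measure bracket \<mu> (phi n m s \<rho>) x) \<le> 1 / A * (\<Sum>i<4. ?m i)"
        unfolding scaleR_scaleR[symmetric] eq using A_pos by (simp add: divide_right_mono)
      also have "\<dots> = (\<Sum>i<4. 1 / A * ?m i)" by (rule sum_distrib_left)
      finally have "ennreal (norm ((1 / A * \<rho> powr (2 * s)) *\<^sub>R gconv_measure bracket \<mu> (phi n m s \<rho>) x)) \<le> ennreal (\<Sum>i<4. 1 / A * ?m i)"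
        by (rule ennreal_leI)
      also have "\<dots> = (\<Sum>i<4. ennreal (1 / A) * ennreal (?m i))"
      proof -
        have "ennreal (1 / A) * ennreal (?m i) = ennreal (1 / A * ?m i)" for i
          using A_pos m0 by (intro ennreal_mult[symmetric]) auto
        moreover have "(\<Sum>i<4. ennreal (1 / A * ?m i)) = ennreal (\<Sum>i<4. 1 / A * ?m i)"
          using A_pos m0 by (intro sum_ennreal mult_nonneg_nonneg) auto
        ultimately show ?thesis by simp
      qed
      finally show "ennreal (norm ((1 / A * \<rho> powr (2 * s)) *\<^sub>R gconv_measure bracket \<mu> (phi n m s \<rho>) x)) \<le> (\<Sum>i<4. ennreal (1 / A) * ennreal (?m i))" .
    qed
    also have "\<dots> = (\<Sum>i<4. ennreal (1 / A) * ennreal (A * measure (N i) UNIV))"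
    proof -
      have "(\<integral>\<^sup>+x. ennreal (1 / A) * ennreal (mconv (N i) \<rho> x) \<partial>lborel) = ennreal (1 / A) * ennreal (A * measure (N i) UNIV)" for i
        unfolding nn_integral_mconv[OF N \<rho>, symmetric] by (rule nn_integral_cmult) measurable
      then show ?thesis by (subst nn_integral_sum) auto
    qed
    also have "\<dots> = (\<Sum>i<4. ennreal (measure (N i) UNIV))"
      using A_pos by (intro sum.cong refl) (simp flip: ennreal_mult)
    also have "\<dots> = ennreal (\<Sum>i<4. measure (N i) UNIV)" by (rule sum_ennreal) simp
    finally show ?thesis by (simp add: Lp_bound_def)
  qed
  then show ?thesis by blast
qed

lemma gconv_measure_weak_tendsto:
  assumes \<mu>: "complex_borel_measure \<mu>" and g: "continuous_on UNIV g" "\<And>x. norm (g x) \<le> M"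
    and u: "\<And>\<rho> x. \<rho> > 0 \<Longrightarrow> u (x, \<rho>) = (1 / A * \<rho> powr (2 * s)) *\<^sub>R gconv_measure bracket \<mu> (phi n m s \<rho>) x"
  shows "((\<lambda>\<rho>. LINT x|lborel. g x * u (x, \<rho>)) \<longlongrightarrow> cm_integral \<mu> g) (at_right 0)"
proof -
  note sg = complex_measure_signed[OF \<mu>]
  note fin = finite_measure_positive_part[OF sg(1)] finite_measure_positive_part[OF signed_uminus[OF sg(1)]]
    finite_measure_positive_part[OF sg(2)] finite_measure_positive_part[OF signed_uminus[OF sg(2)]]
  let ?a = "positive_part (\<lambda>A. Re (\<mu> A))" and ?b = "positive_part (\<lambda>A. - Re (\<mu> A))"
  let ?c = "positive_part (\<lambda>A. Im (\<mu> A))" and ?d = "positive_part (\<lambda>A. - Im (\<mu> A))"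
  let ?I = "\<lambda>N \<rho>. LINT x|lborel. g x * complex_of_real (mconv N \<rho> x)"
  note sp = sets_positive_part[OF sg(1)] sets_positive_part[OF signed_uminus[OF sg(1)]]
    sets_positive_part[OF sg(2)] sets_positive_part[OF signed_uminus[OF sg(2)]]
  note lim = mconv_weak_limit[OF fin(1) sp(1) g] mconv_weak_limit[OF fin(2) sp(2) g]
    mconv_weak_limit[OF fin(3) sp(3) g] mconv_weak_limit[OF fin(4) sp(4) g]
  have gm: "g \<in> borel_measurable borel" using g(1) by (rule borel_measurable_continuous_onI)
  have "((\<lambda>\<rho>. (1 / A) *\<^sub>R (?I ?a \<rho> - ?I ?b \<rho> + \<i> * (?I ?c \<rho> - ?I ?d \<rho>))) \<longlongrightarrow>
      (1 / A) *\<^sub>R (A *\<^sub>R (LINT x|?a. g x) - A *\<^sub>R (LINT x|?b. g x) + \<i> * (A *\<^sub>R (LINT x|?c. g x) - A *\<^sub>R (LINT x|?d. g x)))) (at_right 0)"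
    by (intro tendsto_intros lim)
  also have "(1 / A) *\<^sub>R (A *\<^sub>R (LINT x|?a. g x) - A *\<^sub>R (LINT x|?b. g x) + \<i> * (A *\<^sub>R (LINT x|?c. g x) - A *\<^sub>R (LINT x|?d. g x))) = cm_integral \<mu> g"
    unfolding cm_integral_def using A_pos by (simp add: scaleR_add_right scaleR_diff_right right_diff_distrib)
  finally have l: "((\<lambda>\<rho>. (1 / A) *\<^sub>R (?I ?a \<rho> - ?I ?b \<rho> + \<i> * (?I ?c \<rho> - ?I ?d \<rho>))) \<longlongrightarrow> cm_integral \<mu> g) (at_right 0)" .
  have "\<forall>\<^sub>F \<rho> in at_right 0. (1 / A) *\<^sub>R (?I ?a \<rho> - ?I ?b \<rho> + \<i> * (?I ?c \<rho> - ?I ?d \<rho>)) = (LINT x|lborel. g x * u (x, \<rho>))"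
    using eventually_at_right_less[of "0::real"]
  proof eventually_elim
    case (elim \<rho>)
    have i: "integrable lborel (\<lambda>x. g x * complex_of_real (mconv N \<rho> x))" if "N \<in> {?a, ?b, ?c, ?d}" for N
      using that fin sp by (auto intro!: integrable_mult_mconv[OF _ _ gm g(2) elim])
    have "g x * u (x, \<rho>) = (1 / A) *\<^sub>R (g x * complex_of_real (mconv ?a \<rho> x) - g x * complex_of_real (mconv ?b \<rho> x)
        + \<i> * (g x * complex_of_real (mconv ?c \<rho> x) - g x * complex_of_real (mconv ?d \<rho> x)))" for x
    proof -
      have "u (x, \<rho>) = (1 / A) *\<^sub>R (complex_of_real (mconv ?a \<rho> x) - complex_of_real (mconv ?b \<rho> x)
          + \<i> * (complex_of_real (mconv ?c \<rho> x) - complex_of_real (mconv ?d \<rho> x)))"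
        unfolding u[OF elim] scaleR_scaleR[symmetric] gconv_measure_phi_eq[OF \<mu>] by (simp add: complex_eq_iff)
      then show ?thesis by (simp only: mult_scaleR_right) (simp add: algebra_simps)
    qed
    then show ?case using i by simp
  qed
  then show ?thesis using l by (rule Lim_transform_eventually[rotated])
qed

end

theorem theorem1p1:
  fixes bracket :: "'v::euclidean_space \<Rightarrow> 'v \<Rightarrow> 'z::euclidean_space"
    and n m :: nat and s :: real
  assumes "H_type bracket" and "DIM('v) = 2 * n" and "DIM('z) = m" and "s > 0"
  shows "\<exists>c c' :: real. c \<noteq> 0 \<and> c' \<noteq> 0 \<and>
    (\<forall>(p :: ennreal) (u :: ('v \<times> 'z) \<times> real \<Rightarrow> complex). 1 \<le> p \<longrightarrow> is_solution bracket s u \<longrightarrow>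
      (1 < p \<longrightarrow>
        ((\<exists>C. \<forall>\<rho>>0. Lp_bound p (\<lambda>x. u (x, \<rho>)) C) \<longleftrightarrow>
         (\<exists>f\<in>Lp_space p. \<forall>\<rho>>0. \<forall>x.
            u (x, \<rho>) = (c * \<rho> powr (2 * s)) *\<^sub>R gconv bracket f (phi n m s \<rho>) x))) \<and>
      (p = 1 \<longrightarrow>
        ((\<exists>C. \<forall>\<rho>>0. Lp_bound p (\<lambda>x. u (x, \<rho>)) C) \<longleftrightarrow>
         (\<exists>\<mu>. complex_borel_measure \<mu> \<and> (\<forall>\<rho>>0. \<forall>x.
            u (x, \<rho>) = (c * \<rho> powr (2 * s)) *\<^sub>R gconv_measure bracket \<mu> (phi n m s \<rho>) x)))) \<and>
      (1 < p \<and> p < \<infinity> \<longrightarrow>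
        (\<forall>f\<in>Lp_space p.
          (\<forall>\<rho>>0. \<forall>x.
            u (x, \<rho>) = (c * \<rho> powr (2 * s)) *\<^sub>R gconv bracket f (phi n m s \<rho>) x) \<longrightarrow>
          ((\<lambda>\<rho>. \<integral>\<^sup>+x. ennreal (norm (u (x, \<rho>) - c' *\<^sub>R f x) powr enn2real p) \<partial>lborel)
             \<longlongrightarrow> 0) (at_right 0))) \<and>
      (p = 1 \<longrightarrow>
        (\<forall>\<mu>. complex_borel_measure \<mu> \<longrightarrow>
          (\<forall>\<rho>>0. \<forall>x.
            u (x, \<rho>) = (c * \<rho> powr (2 * s)) *\<^sub>R gconv_measure bracket \<mu> (phi n m s \<rho>) x) \<longrightarrow>
          (\<forall>g :: 'v \<times> 'z \<Rightarrow> complex. continuous_on UNIV g \<longrightarrow> bounded (range g) \<longrightarrow>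
            ((\<lambda>\<rho>. LINT x|lborel. g x * u (x, \<rho>)) \<longlongrightarrow> c' *\<^sub>R cm_integral \<mu> g) (at_right 0)))))"
proof -
  interpret htype bracket n m s by unfold_locales (use assms in auto)
  show ?thesis
  \<comment> \<open>The factor \<open>1 / A\<close> normalises the kernel to integral one; the
    boundary value is then attained with constant \<open>1\<close>.\<close>
  proof (rule exI[of _ "1 / A"], rule exI[of _ "1::real"], intro conjI allI impI iffI ballI)
    show "1 / A \<noteq> 0" using A_pos by simp
  next
    fix p :: ennreal and u :: "('v \<times> 'z) \<times> real \<Rightarrow> complex"
    assume "is_solution bracket s u" "1 < p" "\<exists>C. \<forall>\<rho>>0. Lp_bound p (\<lambda>x. u (x, \<rho>)) C"
    then show "\<exists>f\<in>Lp_space p. \<forall>\<rho>>0. \<forall>x. u (x, \<rho>) = (1 / A * \<rho> powr (2 * s)) *\<^sub>R gconv bracket f (phi n m s \<rho>) x"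
      using solution_eq_gconv by blast
  next
    fix p :: ennreal and u :: "('v \<times> 'z) \<times> real \<Rightarrow> complex"
    assume "1 < p" "\<exists>f\<in>Lp_space p. \<forall>\<rho>>0. \<forall>x. u (x, \<rho>) = (1 / A * \<rho> powr (2 * s)) *\<^sub>R gconv bracket f (phi n m s \<rho>) x"
    then obtain f where f: "f \<in> Lp_space p" "\<And>\<rho> x. \<rho> > 0 \<Longrightarrow> u (x, \<rho>) = (1 / A * \<rho> powr (2 * s)) *\<^sub>R gconv bracket f (phi n m s \<rho>) x"
      by blast
    obtain C where C: "\<And>\<rho>. \<rho> > 0 \<Longrightarrow> Lp_bound p (\<lambda>x. (1 / A * \<rho> powr (2 * s)) *\<^sub>R gconv bracket f (phi n m s \<rho>) x) C"
      using gconv_Lp_bound[OF \<open>1 < p\<close> f(1)] by blast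
    show "\<exists>C. \<forall>\<rho>>0. Lp_bound p (\<lambda>x. u (x, \<rho>)) C"
      by (intro exI[of _ C] allI impI) (simp only: f(2) C)
  next
    fix p :: ennreal and u :: "('v \<times> 'z) \<times> real \<Rightarrow> complex"
    assume "is_solution bracket s u" "p = 1" "\<exists>C. \<forall>\<rho>>0. Lp_bound p (\<lambda>x. u (x, \<rho>)) C"
    then show "\<exists>\<mu>. complex_borel_measure \<mu> \<and>
        (\<forall>\<rho>>0. \<forall>x. u (x, \<rho>) = (1 / A * \<rho> powr (2 * s)) *\<^sub>R gconv_measure bracket \<mu> (phi n m s \<rho>) x)"
      using solution_eq_gconv_measure by blast
  next
    fix p :: ennreal and u :: "('v \<times> 'z) \<times> real \<Rightarrow> complex"
    assume "p = 1" "\<exists>\<mu>. complex_borel_measure \<mu> \<and>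
        (\<forall>\<rho>>0. \<forall>x. u (x, \<rho>) = (1 / A * \<rho> powr (2 * s)) *\<^sub>R gconv_measure bracket \<mu> (phi n m s \<rho>) x)"
    then obtain \<mu> where \<mu>: "complex_borel_measure \<mu>"
      "\<And>\<rho> x. \<rho> > 0 \<Longrightarrow> u (x, \<rho>) = (1 / A * \<rho> powr (2 * s)) *\<^sub>R gconv_measure bracket \<mu> (phi n m s \<rho>) x" by blast
    obtain C where C: "\<And>\<rho>. \<rho> > 0 \<Longrightarrow> Lp_bound 1 (\<lambda>x. (1 / A * \<rho> powr (2 * s)) *\<^sub>R gconv_measure bracket \<mu> (phi n m s \<rho>) x) C"
      using gconv_measure_L1_bound[OF \<mu>(1)] by blast
    show "\<exists>C. \<forall>\<rho>>0. Lp_bound p (\<lambda>x. u (x, \<rho>)) C"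
      by (intro exI[of _ C] allI impI) (simp only: \<mu>(2) C \<open>p = 1\<close>)
  next
    fix p :: ennreal and u :: "('v \<times> 'z) \<times> real \<Rightarrow> complex" and f
    assume "1 < p \<and> p < \<infinity>" "f \<in> Lp_space p"
      "\<forall>\<rho>>0. \<forall>x. u (x, \<rho>) = (1 / A * \<rho> powr (2 * s)) *\<^sub>R gconv bracket f (phi n m s \<rho>) x"
    moreover from this have "p \<noteq> \<infinity>" by auto
    ultimately show "((\<lambda>\<rho>. \<integral>\<^sup>+x. ennreal (norm (u (x, \<rho>) - 1 *\<^sub>R f x) powr enn2real p) \<partial>lborel) \<longlongrightarrow> 0) (at_right 0)"
      using gconv_Lp_tendsto[of p f u] unfolding scaleR_one by blast
  next
    fix p :: ennreal and u :: "('v \<times> 'z) \<times> real \<Rightarrow> complex" and \<mu> and g :: "'v \<times> 'z \<Rightarrow> complex"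
    assume \<mu>: "complex_borel_measure \<mu>"
      "\<forall>\<rho>>0. \<forall>x. u (x, \<rho>) = (1 / A * \<rho> powr (2 * s)) *\<^sub>R gconv_measure bracket \<mu> (phi n m s \<rho>) x"
      and g: "continuous_on UNIV g" "bounded (range g)"
    obtain M where M: "\<And>x. norm (g x) \<le> M" using g(2) by (auto simp: bounded_iff)
    show "((\<lambda>\<rho>. LINT x|lborel. g x * u (x, \<rho>)) \<longlongrightarrow> 1 *\<^sub>R cm_integral \<mu> g) (at_right 0)"
      using gconv_measure_weak_tendsto[OF \<mu>(1) g(1) M, of u] \<mu>(2) unfolding scaleR_one by blast
  qed simp
qed

end
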